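(* Let $n\ge 1$. Let $\Phi(\mathcal S)$ be a characteristic class of the tautological sub-bundle $\mathcal S$ on the Lagrangian Grassmannian $LG(n)$ and let $\Psi(\mathcal S)$ be a characteristic class of the tautological sub-bundle (also denoted $\mathcal S$) on the ordinary Grassmannian $G(n,2n)$. Suppose that both $\Phi(\mathcal S)$ and $\Psi(\mathcal S)$ are represented by the same symmetric polynomial $P(x_1,\ldots,x_n)$ of degree not greater than $\frac{n(n+1)}{2}$ in the Chern roots of the respective tautological sub-bundles. Then $$\int_{LG(n)}\Phi(\mathcal S)=\int_{G(n,2n)}\Psi(\mathcal S)\,\sigma_{\delta_n}.$$
   Context: $LG(n)$ is the Lagrangian Grassmannian of Lagrangian (maximal isotropic, $n$-dimensional) subspaces of a $2n$-dimensional complex symplectic vector space; it is smooth projective of dimension $\frac{n(n+1)}{2}$. $G(n,2n)$ is the Grassmannian of $n$-dimensional subspaces of a $2n$-dimensional complex vector space. On each, the tautological sub-bundle $\mathcal S$ has rank $n$, with fiber over a point the corresponding subspace. Polynomials have coefficients in a field of characteristic zero (e.g. $\mathbb Q$, or $\mathbb C$), and cohomology is with coefficients in $\mathbb C$. A symmetric polynomial in the Chern roots of $\mathcal S$ stands for the class obtained by writing it as a polynomial in the elementary symmetric polynomials $e_i$ and substituting $c_i(\mathcal S)$ for $e_i$. $\int_X$ is evaluation of the top-degree part on the fundamental class of $X$. $\sigma_{\delta_n}$ is the Schubert class on $G(n,2n)$ of the partition $\delta_n=(n-1,n-2,\ldots,1)$; it is represented by the symmetric polynomial $(-1)^{\frac{n(n-1)}{2}}\prod_{i<j}(x_i+x_j)$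 in the Chern roots $x_1,\ldots,x_n$ of $\mathcal S$ on $G(n,2n)$. *)

theory Defs
  imports
    "HOL-Analysis.Analysis"
    "HOL-Library.Poly_Mapping"
    "HOL-Library.Uprod"
    "HOL-Combinatorics.Permutations"
begin

instance uprod :: (finite) finite
proof
  have "(UNIV :: 'a uprod set) \<subseteq> (\<lambda>(x, y). Upair x y) ` UNIV"
  proof
    fix u :: "'a uprod"
    obtain x y where "u = Upair x y"
      by (cases u) auto
    then show "u \<in> (\<lambda>(x, y). Upair x y) ` UNIV"
      by auto
  qed
  then show "finite (UNIV :: 'a uprod set)"
    by (rule finite_subset) simp
qed

section \<open>Multivariate polynomials\<close>

text \<open>
  A polynomial with complex coefficients and variables indexed by \<open>'v\<close> is a finitely supported
  function from exponent vectors to coefficients; \<^theory>\<open>HOL-Library.Poly_Mapping\<close> provides the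
  ring structure (convolution product).
\<close>

type_synonym 'v polynomial = "('v \<Rightarrow>\<^sub>0 nat) \<Rightarrow>\<^sub>0 complex"

definition const :: "complex \<Rightarrow> 'v polynomial" where
  "const c = Poly_Mapping.single 0 c"

definition var :: "'v \<Rightarrow> 'v polynomial" where
  "var i = Poly_Mapping.single (Poly_Mapping.single i 1) 1"

definition degree_le :: "nat \<Rightarrow> 'v polynomial \<Rightarrow> bool" where
  "degree_le d P \<longleftrightarrow>
     (\<forall>m \<in> Poly_Mapping.keys P. (\<Sum>i \<in> Poly_Mapping.keys m. Poly_Mapping.lookup m i) \<le> d)"

definition symmetric_polynomial :: "('v::finite) polynomial \<Rightarrow> bool" where
  "symmetric_polynomial P \<longleftrightarrow>
     (\<forall>\<pi>. bij \<pi> \<longrightarrow>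
        (\<forall>m. Poly_Mapping.lookup P (Poly_Mapping.map_key \<pi> m) = Poly_Mapping.lookup P m))"

definition elementary :: "nat \<Rightarrow> ('v::finite) polynomial" where
  "elementary k = (\<Sum>I | card I = k. \<Prod>i\<in>I. var i)"

definition subst_polynomial :: "nat polynomial \<Rightarrow> (nat \<Rightarrow> 'v polynomial) \<Rightarrow> 'v polynomial" where
  "subst_polynomial Q e =
     (\<Sum>m \<in> Poly_Mapping.keys Q. const (Poly_Mapping.lookup Q m) *
        (\<Prod>k \<in> Poly_Mapping.keys m. e k ^ Poly_Mapping.lookup m k))"


section \<open>Differential forms and de Rham cohomology of submanifolds\<close>

text \<open>For open \<open>S\<close> and finite-dimensional domain this is \<open>C\<^sup>\<infinity>\<close> on \<open>S\<close>.\<close>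

coinductive smooth_on :: "'a::real_normed_vector set \<Rightarrow> ('a \<Rightarrow> 'b::real_normed_vector) \<Rightarrow> bool"
  for S where
  "\<lbrakk>\<And>x. x \<in> S \<Longrightarrow> f differentiable (at x);
    \<And>v. smooth_on S (\<lambda>x. frechet_derivative f (at x) v)\<rbrakk> \<Longrightarrow> smooth_on S f"

text \<open>
  Complex-valued, possibly inhomogeneous differential forms on a real vector space: \<open>\<omega> p vs\<close> is
  the value at the point \<open>p\<close>, on the list of tangent vectors \<open>vs\<close>, of the component of \<open>\<omega>\<close>
  of degree \<open>length vs\<close>.
\<close>

type_synonym 'a form = "'a \<Rightarrow> 'a list \<Rightarrow> complex"

definition smooth_form :: "('a::real_normed_vector) form \<Rightarrow> bool" where
  "smooth_form \<omega> \<longleftrightarrow>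
     (\<forall>vs. smooth_on UNIV (\<lambda>p. \<omega> p vs)) \<and>
     (\<forall>p vs. \<forall>i < length vs. linear (\<lambda>v. \<omega> p (vs[i := v]))) \<and>
     (\<forall>p vs. \<not> distinct vs \<longrightarrow> \<omega> p vs = 0)"

definition form_one :: "'a form" where
  "form_one p vs = (if vs = [] then 1 else 0)"

text \<open>
  The wedge product as a sum over shuffles: \<open>I\<close> is the set of positions of the arguments given
  to the first factor, and the exponent counts the inversions of the shuffle.
\<close>

definition wedge :: "'a form \<Rightarrow> 'a form \<Rightarrow> 'a form" where
  "wedge \<alpha> \<beta> p vs =
     (\<Sum>I \<in> Pow {..<length vs}.
        (-1) ^ card {(i, j). i \<in> I \<and> j \<in> {..<length vs} - I \<and> j < i}
        * \<alpha> p (nths vs I) * \<beta> p (nths vs (- I)))"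

text \<open>Only used for forms of even degree, where the order of the factors is irrelevant.\<close>

definition wedge_prod :: "('i \<Rightarrow> 'a form) \<Rightarrow> 'i set \<Rightarrow> 'a form" where
  "wedge_prod f I = Finite_Set.fold (\<lambda>i. wedge (f i)) form_one I"

definition subst_form :: "nat polynomial \<Rightarrow> (nat \<Rightarrow> 'a form) \<Rightarrow> 'a form" where
  "subst_form Q c p vs =
     (\<Sum>m \<in> Poly_Mapping.keys Q. Poly_Mapping.lookup Q m *
        wedge_prod (\<lambda>k. (wedge (c k) ^^ Poly_Mapping.lookup m k) form_one)
          (Poly_Mapping.keys m) p vs)"

definition ext_deriv :: "('a::real_normed_vector) form \<Rightarrow> 'a form" where
  "ext_deriv \<omega> p vs =
     (\<Sum>i < length vs. (-1) ^ i *
        frechet_derivative (\<lambda>q. \<omega> q (take i vs @ drop (Suc i) vs)) (at p) (vs ! i))"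

definition tangent_space :: "('a::real_normed_vector) set \<Rightarrow> 'a \<Rightarrow> 'a set" where
  "tangent_space X p =
     {v. \<exists>\<gamma> :: real \<Rightarrow> 'a. range \<gamma> \<subseteq> X \<and> \<gamma> 0 = p \<and> (\<gamma> has_vector_derivative v) (at 0)}"

text \<open>
  Every smooth form on a closed submanifold \<open>X\<close> is the restriction of an ambient one. Hence the
  de Rham complex of \<open>X\<close> consists of the ambient forms, compared on vectors tangent to \<open>X\<close> only.
  A cohomology class is the set of all forms representing it.
\<close>

definition closed_on :: "('a::real_normed_vector) set \<Rightarrow> 'a form \<Rightarrow> bool" where
  "closed_on X \<omega> \<longleftrightarrow>
     (\<forall>p\<in>X. \<forall>vs. set vs \<subseteq> tangent_space X p \<longrightarrow> ext_deriv \<omega> p vs = 0)"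

definition cohomologous :: "('a::real_normed_vector) set \<Rightarrow> 'a form \<Rightarrow> 'a form \<Rightarrow> bool" where
  "cohomologous X \<omega> \<omega>' \<longleftrightarrow>
     (\<exists>\<eta>. smooth_form \<eta> \<and>
        (\<forall>p\<in>X. \<forall>vs. set vs \<subseteq> tangent_space X p \<longrightarrow> \<omega>' p vs = \<omega> p vs + ext_deriv \<eta> p vs))"

definition coh_class :: "('a::real_normed_vector) set \<Rightarrow> 'a form \<Rightarrow> 'a form set" where
  "coh_class X \<omega> = {\<omega>'. smooth_form \<omega>' \<and> cohomologous X \<omega> \<omega>'}"

definition cohomology :: "('a::real_normed_vector) set \<Rightarrow> 'a form set set" where
  "cohomology X = {coh_class X \<omega> | \<omega>. smooth_form \<omega> \<and> closed_on X \<omega>}"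

definition cup :: "('a::real_normed_vector) set \<Rightarrow> 'a form set \<Rightarrow> 'a form set \<Rightarrow> 'a form set" where
  "cup X A B = {\<omega>. smooth_form \<omega> \<and> (\<exists>\<alpha>\<in>A. \<exists>\<beta>\<in>B. cohomologous X (wedge \<alpha> \<beta>) \<omega>)}"


section \<open>Grassmannians\<close>

text \<open>
  A complex subspace is encoded by its orthogonal projection. This embeds the Grassmannian as a
  compact real submanifold of the space of square matrices.
\<close>

type_synonym 'N cmatrix = "complex ^ 'N ^ 'N"

definition hermitian :: "'N::finite cmatrix \<Rightarrow> bool" where
  "hermitian p \<longleftrightarrow> (\<forall>i j. p $ i $ j = cnj (p $ j $ i))"

definition projections_onto :: "(complex ^ 'N) set set \<Rightarrow> 'N::finite cmatrix set" where
  "projections_onto \<W> = {p. p ** p = p \<and> hermitian p \<and> range ((*v) p) \<in> \<W>}"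

definition n_subspaces :: "(complex ^ ('n::finite + 'n)) set set" where
  "n_subspaces = {W. vec.subspace W \<and> vec.dim W = CARD('n)}"

definition symplectic :: "complex ^ ('n::finite + 'n) \<Rightarrow> complex ^ ('n + 'n) \<Rightarrow> complex" where
  "symplectic v w = (\<Sum>i\<in>UNIV. v $ Inl i * w $ Inr i - v $ Inr i * w $ Inl i)"

definition lagrangian_subspaces :: "(complex ^ ('n::finite + 'n)) set set" where
  "lagrangian_subspaces = {W \<in> n_subspaces. \<forall>v\<in>W. \<forall>w\<in>W. symplectic v w = 0}"

definition grassmannian :: "('n::finite + 'n) cmatrix set" where
  "grassmannian = projections_onto n_subspaces"

definition lagrangian_grassmannian :: "('n::finite + 'n) cmatrix set" where
  "lagrangian_grassmannian = projections_onto lagrangian_subspaces"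

text \<open>
  The complex structure on the tangent space at \<open>p\<close>: a tangent vector \<open>\<xi>\<close> is determined by the
  homomorphism \<open>(1 - p) \<xi> p\<close> from \<open>W = im p\<close> to its orthogonal complement, which gets multiplied
  by \<open>\<i>\<close>. As \<open>\<xi>\<close> is Hermitian with \<open>\<xi> = p \<xi> + \<xi> p\<close>, the result is \<open>\<i> (\<xi> p - p \<xi>)\<close>.
\<close>

definition cstruct :: "'N::finite cmatrix \<Rightarrow> 'N cmatrix \<Rightarrow> 'N cmatrix" where
  "cstruct p \<xi> = (\<chi> i j. \<i> * (\<xi> ** p - p ** \<xi>) $ i $ j)"


section \<open>Integration over complex submanifolds of a Grassmannian\<close>

definition holomorphic_parametrization ::
    "'N::finite cmatrix set \<Rightarrow> (complex ^ 'd) set \<Rightarrow> (complex ^ 'd \<Rightarrow> 'N cmatrix) \<Rightarrow> bool" where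
  "holomorphic_parametrization X U \<phi> \<longleftrightarrow>
     open U \<and> smooth_on U \<phi> \<and> inj_on \<phi> U \<and> \<phi> ` U \<subseteq> X \<and>
     (\<forall>z\<in>U. inj (frechet_derivative \<phi> (at z)) \<and>
        (\<forall>h. frechet_derivative \<phi> (at z) (\<i> *s h) =
             cstruct (\<phi> z) (frechet_derivative \<phi> (at z) h)))"

text \<open>
  The positively oriented real basis \<open>e\<^sub>1, \<i> e\<^sub>1, e\<^sub>2, \<i> e\<^sub>2, \<dots>\<close>; the orientation does not depend
  on the enumeration of the coordinates.
\<close>

definition real_frame :: "(complex ^ 'd::finite) list" where
  "real_frame =
     concat (map (\<lambda>j. [axis j 1, axis j \<i>]) (SOME js. distinct js \<and> set js = UNIV))"

definition form_density ::
    "('N::finite) cmatrix form \<Rightarrow> (complex ^ 'd::finite \<Rightarrow> 'N cmatrix) \<Rightarrow> complex ^ 'd \<Rightarrow> complex" where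
  "form_density \<omega> \<phi> z = \<omega> (\<phi> z) (map (frechet_derivative \<phi> (at z)) real_frame)"

text \<open>
  The integral, for the complex orientation, of the component of degree \<open>2 CARD('d)\<close> of \<open>\<omega>\<close> over
  a complex manifold \<open>X\<close> of dimension \<open>CARD('d)\<close>: cut \<open>X\<close> into finitely many Borel pieces, each
  lying in a holomorphic coordinate patch, and add up the integrals over the pieces.
\<close>

definition has_form_integral ::
    "('d::finite) itself \<Rightarrow> 'N::finite cmatrix set \<Rightarrow> 'N cmatrix form \<Rightarrow> complex \<Rightarrow> bool" where
  "has_form_integral d X \<omega> I \<longleftrightarrow>
     (\<exists>(m::nat) U (\<phi> :: nat \<Rightarrow> complex ^ 'd \<Rightarrow> 'N cmatrix) A.
        (\<forall>k<m. holomorphic_parametrization X (U k) (\<phi> k) \<and> A k \<in> sets borel \<and> A k \<subseteq> U k \<and>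
               set_integrable lborel (A k) (form_density \<omega> (\<phi> k))) \<and>
        disjoint_family_on (\<lambda>k. \<phi> k ` A k) {..<m} \<and>
        X = (\<Union>k<m. \<phi> k ` A k) \<and>
        I = (\<Sum>k<m. set_lebesgue_integral lborel (A k) (form_density \<omega> (\<phi> k))))"

definition form_integral ::
    "('d::finite) itself \<Rightarrow> 'N::finite cmatrix set \<Rightarrow> 'N cmatrix form \<Rightarrow> complex" where
  "form_integral d X \<omega> = (THE I. has_form_integral d X \<omega> I)"

definition class_integral ::
    "('d::finite) itself \<Rightarrow> 'N::finite cmatrix set \<Rightarrow> 'N cmatrix form set \<Rightarrow> complex" where
  "class_integral d X C = (THE I. \<forall>\<omega>\<in>C. has_form_integral d X \<omega> I)"


section \<open>Characteristic classes of the tautological sub-bundle\<close>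

text \<open>
  The tautological bundle, with fibre \<open>im p\<close> over \<open>p\<close>, carries the connection \<open>p \<circ> d\<close> induced
  from the trivial bundle. Its curvature is \<open>p dp \<and> dp\<close>, with value \<open>p (\<xi> \<eta> - \<eta> \<xi>)\<close> on
  tangent vectors \<open>\<xi>\<close>, \<open>\<eta>\<close>; as a matrix it vanishes on the orthogonal complement of \<open>im p\<close>.
\<close>

definition curvature :: "'N::finite \<Rightarrow> 'N \<Rightarrow> 'N cmatrix form" where
  "curvature i j p vs =
     (case vs of [\<xi>, \<eta>] \<Rightarrow> (p ** (\<xi> ** \<eta> - \<eta> ** \<xi>)) $ i $ j | _ \<Rightarrow> 0)"

text \<open>
  Chern-Weil: the total Chern form is \<open>det (1 + \<i> / (2 \<pi>) \<Omega>)\<close> for the curvature \<open>\<Omega>\<close>. Its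
  component of degree \<open>2 k\<close> is the sum of the principal \<open>k \<times> k\<close> minors of \<open>\<i> / (2 \<pi>) \<Omega>\<close>.
\<close>

definition chern_form :: "nat \<Rightarrow> 'N::finite cmatrix form" where
  "chern_form k p vs =
     (\<i> / (2 * of_real pi)) ^ k *
     (\<Sum>I | card I = k. \<Sum>\<tau> | \<tau> permutes I.
        of_int (sign \<tau>) * wedge_prod (\<lambda>i. curvature i (\<tau> i)) I p vs)"

text \<open>
  \<open>C\<close> is the class on \<open>X\<close> given by the polynomial \<open>P\<close> in the Chern roots of the tautological
  bundle: \<open>P\<close> is written as a polynomial \<open>Q\<close> in the elementary symmetric polynomials, which are
  then replaced by the Chern classes.
\<close>

definition represented_by ::
    "('n::finite + 'n) cmatrix set \<Rightarrow> 'n polynomial \<Rightarrow> ('n + 'n) cmatrix form set \<Rightarrow> bool" where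
  "represented_by X P C \<longleftrightarrow>
     (\<exists>Q :: nat polynomial.
        (\<forall>m \<in> Poly_Mapping.keys Q. Poly_Mapping.keys m \<subseteq> {1..CARD('n)}) \<and>
        P = subst_polynomial Q elementary \<and>
        C = coh_class X (subst_form Q chern_form))"


section \<open>Schubert classes\<close>

definition complete_flag :: "(nat \<Rightarrow> (complex ^ ('n::finite + 'n)) set) \<Rightarrow> bool" where
  "complete_flag F \<longleftrightarrow>
     (\<forall>k \<le> 2 * CARD('n). vec.subspace (F k) \<and> vec.dim (F k) = k) \<and>
     (\<forall>k < 2 * CARD('n). F k \<subseteq> F (Suc k))"

text \<open>
  The Schubert variety of \<open>\<lambda>\<close> is \<open>{W. \<forall>i. dim (W \<inter> F (n + i - \<lambda> i)) \<ge> i}\<close>. The Schubert cell is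
  its dense open stratum, where the dimension of \<open>W \<inter> F k\<close> jumps exactly at \<open>k = n + i - \<lambda> i\<close>; the
  remaining strata have smaller dimension.
\<close>

definition schubert_cell ::
    "(nat \<Rightarrow> (complex ^ ('n::finite + 'n)) set) \<Rightarrow> (nat \<Rightarrow> nat) \<Rightarrow> ('n + 'n) cmatrix set" where
  "schubert_cell F l = projections_onto
     {W \<in> n_subspaces. \<forall>i \<in> {1..CARD('n)}.
        vec.dim (W \<inter> F (CARD('n) + i - l i)) = i \<and>
        vec.dim (W \<inter> F (CARD('n) + i - l i - 1)) = i - 1}"

text \<open>
  The class of the Schubert variety is the Poincare dual of integration over it, that is, over its
  cell. Here \<open>CARD('d)\<close> must be the dimension of the variety, the square of \<open>CARD('n)\<close> minus the
  size of the partition.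
\<close>

definition schubert_class ::
    "('d::finite) itself \<Rightarrow> (nat \<Rightarrow> (complex ^ ('n::finite + 'n)) set) \<Rightarrow> (nat \<Rightarrow> nat) \<Rightarrow>
     ('n + 'n) cmatrix form set \<Rightarrow> bool" where
  "schubert_class d F l \<sigma> \<longleftrightarrow>
     \<sigma> \<in> cohomology grassmannian \<and>
     (\<forall>\<eta>. smooth_form \<eta> \<and> closed_on grassmannian \<eta> \<longrightarrow>
        class_integral TYPE('n \<times> 'n) grassmannian (cup grassmannian (coh_class grassmannian \<eta>) \<sigma>) =
        form_integral d (schubert_cell F l) \<eta>)"

definition staircase :: "nat \<Rightarrow> nat \<Rightarrow> nat" where
  "staircase n i = n - i"

end

theory Submission
 imports Defs "HOL-Complex_Analysis.Complex_Analysis" "HOL-Probability.Distributions"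
begin

text \<open>
  The torus acting on \<open>\<complex>\<^sup>2\<^sup>n\<close> with weights \<open>\<plusminus>\<omega>\<^sub>i\<close> acts on both Grassmannians; its fixed points are the
  coordinate subspaces. Let \<open>V\<close> be the generating vector field, \<open>D = d - \<tau> \<iota>\<^sub>V\<close> and \<open>\<theta> = \<langle>V, -\<rangle>\<close>, so
  that \<open>D \<theta> = \<beta> - \<tau> |V|\<^sup>2\<close> with \<open>\<beta> = d \<theta>\<close>. The Chern forms have \<open>D\<close>-closed equivariant extensions,
  and for \<open>D\<close>-closed \<open>F\<close> the form \<open>F / (1 - s D \<theta>) = \<Sum>\<^sub>j s\<^sup>j F \<beta>\<^sup>j / (1 + s \<tau> |V|\<^sup>2)\<^sup>j\<^sup>+\<^sup>1\<close> differs from \<open>F\<close>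
  by a \<open>D\<close>-exact form and hence has the same integral. As \<open>s \<rightarrow> \<infinity>\<close>, this integral concentrates at
  the fixed points, where it becomes an explicit sum of Gaussian type. In the sum for \<open>G(n, 2n)\<close> the
  factor \<open>\<Prod> -(x\<^sub>i + x\<^sub>j)\<close> vanishes at the coordinate subspaces that are not Lagrangian, and at the
  Lagrangian ones it cancels the weights of the normal space of \<open>LG(n)\<close>. So the equivariant integrals
  agree for all \<open>\<tau> > 0\<close>, and \<open>\<tau> \<rightarrow> 0\<close> gives the claim.
\<close>

section \<open>The algebra of alternating cochains\<close>

text \<open>The deformation needs V to be an infinitesimal isometry, so that D annihilates
  D\<theta>. A rational rather than exponential deformation keeps all coefficients among the
  functions obtained from linear ones by ring operations and inversion, a class closed under
  differentiation. The series may stop at the complex dimension, since later powers of \<beta> have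
  too high a degree. Forms live on the space of all matrices, while the closedness of the Chern
  forms is established only at projections and on vectors tangent there; restriction of the
  arguments is therefore built into D. The frequencies \<omega>_i are distinct and positive, so that
  all weights at the fixed points are nonzero. On the two spaces P may be written through different
  polynomials in the e_i; only the values of P at the Chern roots enter, so this ambiguity is
  harmless. The fixed point sums have \<tau> in denominators, which is why the limit \<tau>
  \<rightarrow> 0 is taken in the integrals and not in the sums.\<close>

definition bar :: "('a list \<Rightarrow> complex) \<Rightarrow> 'a list \<Rightarrow> complex" where
 "bar f vs = (-1) ^ length vs * f vs"

text \<open>The wedge product at a point, defined by contraction being an antiderivation: the first
  vector goes to the left factor, or it passes the left factor at the cost of the degree sign
  \<open>bar\<close> and goes to the right one. Identities of products thus become inductions over
  the list of arguments, without sums over shuffles.\<close>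

fun wdg :: "('a list \<Rightarrow> complex) \<Rightarrow> ('a list \<Rightarrow> complex) \<Rightarrow> 'a list \<Rightarrow> complex" where
 "wdg f g [] = f [] * g []"
| "wdg f g (v # vs) = wdg (\<lambda>us. f (v # us)) g vs + wdg (bar f) (\<lambda>us. g (v # us)) vs"

lemma nths_map_Suc: "nths (v # vs) I = (if (0::nat) \<in> I then [v] else []) @ nths vs {j. Suc j \<in> I}"
 by (simp add: nths_Cons)

text \<open>The subsets of positions are split by the factor that receives the first argument. Given
  to the left factor, it creates no inversion (\<open>s1\<close>); given to the right factor, it is
  inverted with every element of \<open>I\<close> (\<open>s2\<close>), which is the sign in
  \<open>bar\<close>.\<close>

lemma wedge_eq_wdg: "wedge \<alpha> \<beta> p vs = wdg (\<alpha> p) (\<beta> p) vs"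
proof (induction vs arbitrary: \<alpha> \<beta>)
 case Nil
 then show ?case by (simp add: wedge_def)
next
 case (Cons v vs)
 let ?n = "length vs"
 let ?N = "{..<length (v # vs)}"
 define sg where "sg n I = (-1 :: complex) ^ card {(i, j). i \<in> I \<and> j \<in> {..<n} - I \<and> j < i}" for n :: nat and I :: "nat set"
 let ?t = "\<lambda>n vs \<alpha> \<beta> I. sg n I * \<alpha> p (nths vs I) * \<beta> p (nths vs (- I))"
 have w: "wedge \<alpha> \<beta> p vs = (\<Sum>I\<in>Pow {..<length vs}. ?t (length vs) vs \<alpha> \<beta> I)" for \<alpha> \<beta> vs
  unfolding wedge_def sg_def ..
 have Pow: "Pow ?N = (\<lambda>I. Suc ` I) ` Pow {..<?n} \<union> (\<lambda>I. insert 0 (Suc ` I)) ` Pow {..<?n}"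
  by (simp add: lessThan_Suc_eq_insert_0 Pow_insert image_Un image_Pow_surj[symmetric] image_image)
 have inj1: "inj_on (\<lambda>I. Suc ` I) (Pow {..<?n})"
  by (rule inj_onI) (simp add: inj_image_eq_iff)
 have inj2: "inj_on (\<lambda>I. insert 0 (Suc ` I)) (Pow {..<?n})"
 proof (rule inj_onI)
  fix I J assume "insert 0 (Suc ` I) = insert 0 (Suc ` J)"
  then have "Suc ` I = Suc ` J" by (metis Diff_insert_absorb imageE nat.distinct(1))
  then show "I = J" by (simp add: inj_image_eq_iff)
 qed
 have disj: "(\<lambda>I. Suc ` I) ` Pow {..<?n} \<inter> (\<lambda>I. insert 0 (Suc ` I)) ` Pow {..<?n} = {}"
  by auto
 have s1: "sg (Suc ?n) (insert 0 (Suc ` I)) = sg ?n I" if "I \<subseteq> {..<?n}" for I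
 proof -
  have "{(i, j). i \<in> insert 0 (Suc ` I) \<and> j \<in> {..<Suc ?n} - insert 0 (Suc ` I) \<and> j < i} =
     (\<lambda>(i, j). (Suc i, Suc j)) ` {(i, j). i \<in> I \<and> j \<in> {..<?n} - I \<and> j < i}" (is "?L = ?R")
  proof (intro set_eqI iffI)
   fix x assume "x \<in> ?L"
   then obtain i j where x: "x = (i, j)" "i \<in> insert 0 (Suc ` I)" "j < Suc ?n" "j \<noteq> 0" "j \<notin> Suc ` I" "j < i" by auto
   then obtain i' j' where "i = Suc i'" "j = Suc j'" "i' \<in> I" by (auto simp: gr0_conv_Suc)
   with x show "x \<in> ?R" by force
  qed (auto simp: inj_image_mem_iff)
  then show ?thesis
   unfolding sg_def by (simp add: card_image inj_on_def)
 qed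
 have s2: "sg (Suc ?n) (Suc ` I) = (-1) ^ card I * sg ?n I" if "I \<subseteq> {..<?n}" for I
 proof -
  have fin: "finite I" using that finite_subset by blast
  have "{(i, j). i \<in> Suc ` I \<and> j \<in> {..<Suc ?n} - Suc ` I \<and> j < i} =
     (\<lambda>i. (Suc i, 0)) ` I \<union>
     (\<lambda>(i, j). (Suc i, Suc j)) ` {(i, j). i \<in> I \<and> j \<in> {..<?n} - I \<and> j < i}" (is "?L = ?R1 \<union> ?R2")
  proof (intro set_eqI iffI)
   fix x assume "x \<in> ?L"
   then obtain i j where x: "x = (i, j)" "i \<in> Suc ` I" "j < Suc ?n" "j \<notin> Suc ` I" "j < i" by auto
   then obtain i' where i': "i = Suc i'" "i' \<in> I" by auto
   show "x \<in> ?R1 \<union> ?R2"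
   proof (cases j)
    case 0 then show ?thesis using x i' by auto
   next
    case (Suc j') then show ?thesis using x i' by force
   qed
  qed (auto simp: inj_image_mem_iff)
  moreover have "card (?R1 \<union> ?R2) = card ?R1 + card ?R2"
  proof (rule card_Un_disjoint)
   show "finite ?R2"
   proof (rule finite_imageI)
    show "finite {(i, j). i \<in> I \<and> j \<in> {..<?n} - I \<and> j < i}"
     by (rule finite_subset[of _ "I \<times> {..<?n}"]) (use fin in auto)
   qed
  qed (use fin in auto)
  moreover have "card ?R1 = card I" by (simp add: card_image inj_on_def)
  moreover have "card ?R2 = card {(i, j). i \<in> I \<and> j \<in> {..<?n} - I \<and> j < i}"
   by (simp add: card_image inj_on_def)
  ultimately have "card {(i, j). i \<in> Suc ` I \<and> j \<in> {..<Suc ?n} - Suc ` I \<and> j < i} =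
   card I + card {(i, j). i \<in> I \<and> j \<in> {..<?n} - I \<and> j < i}" by argo
  then show ?thesis unfolding sg_def by (simp only: power_add)
 qed
 have "wedge \<alpha> \<beta> p (v # vs) =
   (\<Sum>I\<in>Pow {..<?n}. ?t (Suc ?n) (v # vs) \<alpha> \<beta> (Suc ` I)) +
   (\<Sum>I\<in>Pow {..<?n}. ?t (Suc ?n) (v # vs) \<alpha> \<beta> (insert 0 (Suc ` I)))"
  unfolding w Pow
  by (subst sum.union_disjoint) (use disj in \<open>auto simp: sum.reindex inj1 inj2\<close>)
 also have "(\<Sum>I\<in>Pow {..<?n}. ?t (Suc ?n) (v # vs) \<alpha> \<beta> (Suc ` I)) =
   wedge (\<lambda>p. bar (\<alpha> p)) (\<lambda>p us. \<beta> p (v # us)) p vs"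
  unfolding w
 proof (rule sum.cong[OF refl])
  fix I assume "I \<in> Pow {..<?n}"
  then have I: "I \<subseteq> {..<?n}" by simp
  have "{i. i < length vs \<and> i \<in> I} = I" using I by auto
  then have len: "length (nths vs I) = card I" by (simp add: length_nths)
  show "?t (Suc ?n) (v # vs) \<alpha> \<beta> (Suc ` I) =
    ?t ?n vs (\<lambda>p. bar (\<alpha> p)) (\<lambda>p us. \<beta> p (v # us)) I"
   using I by (simp add: nths_map_Suc s2 bar_def len inj_image_mem_iff Collect_neg_eq)
 qed
 also have "(\<Sum>I\<in>Pow {..<?n}. ?t (Suc ?n) (v # vs) \<alpha> \<beta> (insert 0 (Suc ` I))) =
   wedge (\<lambda>p us. \<alpha> p (v # us)) \<beta> p vs"
  unfolding w
  by (rule sum.cong[OF refl]) (simp add: nths_map_Suc s1 inj_image_mem_iff Collect_neg_eq)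
 finally show ?case by (simp add: Cons.IH)
qed

lemma bar_bar [simp]: "bar (bar f) = f"
 by (rule ext) (simp add: bar_def flip: power_mult_distrib mult.assoc)

lemma bar_Cons: "(\<lambda>us. bar f (v # us)) = (\<lambda>us. - bar (\<lambda>us. f (v # us)) us)"
 by (rule ext) (simp add: bar_def)

lemma bar_Cons': "bar f (v # us) = - bar (\<lambda>us. f (v # us)) us"
 by (simp add: bar_def)

lemma wdg_add_left: "wdg (\<lambda>us. f us + f' us) g vs = wdg f g vs + wdg f' g vs"
 by (induction vs arbitrary: f f' g) (simp_all add: algebra_simps bar_def[abs_def])

lemma wdg_add_right: "wdg f (\<lambda>us. g us + g' us) vs = wdg f g vs + wdg f g' vs"
 by (induction vs arbitrary: f g g') (simp_all add: algebra_simps)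

lemma wdg_scale_left: "wdg (\<lambda>us. c * f us) g vs = c * wdg f g vs"
 by (induction vs arbitrary: f g) (simp_all add: algebra_simps bar_def[abs_def] mult.left_commute[of _ c])

lemma wdg_scale_right: "wdg f (\<lambda>us. c * g us) vs = c * wdg f g vs"
 by (induction vs arbitrary: f g) (simp_all add: algebra_simps)

lemma wdg_zero_left [simp]: "wdg (\<lambda>us. 0) g vs = 0"
 using wdg_scale_left[of 0 "\<lambda>_. 0"] by simp

lemma wdg_zero_right [simp]: "wdg f (\<lambda>us. 0) vs = 0"
 using wdg_scale_right[of f 0 "\<lambda>_. 0"] by simp

lemma wdg_minus_left: "wdg (\<lambda>us. - f us) g vs = - wdg f g vs"
 using wdg_scale_left[of "-1" f] by simp

lemma wdg_minus_right: "wdg f (\<lambda>us. - g us) vs = - wdg f g vs"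
 using wdg_scale_right[of f "-1"] by simp

lemma wdg_diff_left: "wdg (\<lambda>us. f us - f' us) g vs = wdg f g vs - wdg f' g vs"
 using wdg_add_left[of f "\<lambda>us. - f' us"] by (simp add: wdg_minus_left)

lemma wdg_diff_right: "wdg f (\<lambda>us. g us - g' us) vs = wdg f g vs - wdg f g' vs"
 using wdg_add_right[of f g "\<lambda>us. - g' us"] by (simp add: wdg_minus_right)

lemma bar_wdg: "bar (wdg f g) = wdg (bar f) (bar g)"
proof (rule ext)
 show "bar (wdg f g) vs = wdg (bar f) (bar g) vs" for vs
 proof (induction vs arbitrary: f g)
  case Nil
  then show ?case by (simp add: bar_def)
 next
  case (Cons v vs)
  have "bar (wdg f g) (v # vs) = - bar (wdg (\<lambda>us. f (v # us)) g) vs - bar (wdg (bar f) (\<lambda>us. g (v # us))) vs"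
   by (simp add: bar_def algebra_simps)
  then show ?case
   by (simp add: Cons.IH bar_Cons wdg_minus_left wdg_minus_right)
 qed
qed

text \<open>Contraction treats both bracketings alike because \<open>bar\<close> is
  multiplicative.\<close>

lemma wdg_assoc: "wdg (wdg f g) h vs = wdg f (wdg g h) vs"
proof (induction vs arbitrary: f g h)
 case Nil
 then show ?case by simp
next
 case (Cons v vs)
 show ?case
  by (simp add: bar_wdg wdg_add_left wdg_add_right Cons.IH)
qed

section \<open>Parity and graded commutativity\<close>

definition evenc :: "('a list \<Rightarrow> complex) \<Rightarrow> bool" where
 "evenc f \<longleftrightarrow> (\<forall>vs. odd (length vs) \<longrightarrow> f vs = 0)"

definition oddc :: "('a list \<Rightarrow> complex) \<Rightarrow> bool" where
 "oddc f \<longleftrightarrow> (\<forall>vs. even (length vs) \<longrightarrow> f vs = 0)"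

lemma bar_even: "evenc f \<Longrightarrow> bar f = f"
 by (rule ext) (auto simp: bar_def evenc_def uminus_power_if)

lemma bar_odd: "oddc f \<Longrightarrow> bar f = (\<lambda>us. - f us)"
 by (rule ext) (auto simp: bar_def oddc_def uminus_power_if)

lemma evenc_Cons: "evenc f \<Longrightarrow> oddc (\<lambda>us. f (v # us))"
 and oddc_Cons: "oddc f \<Longrightarrow> evenc (\<lambda>us. f (v # us))"
 by (simp_all add: evenc_def oddc_def)

text \<open>Contraction exchanges even and odd cochains, so both cases go through one induction. The
  shuffle product is graded commutative on arbitrary functions of lists.\<close>

lemma wdg_comm_aux:
 "(evenc f \<longrightarrow> wdg f g vs = wdg g f vs) \<and> (oddc f \<longrightarrow> wdg f g vs = wdg (bar g) f vs)"
proof (induction vs arbitrary: f g)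
 case Nil
 then show ?case by (simp add: bar_def)
next
 case (Cons v vs)
 show ?case
 proof (intro conjI impI)
  assume f: "evenc f"
  then show "wdg f g (v # vs) = wdg g f (v # vs)"
   using Cons.IH[of "\<lambda>us. f (v # us)" g] Cons.IH[of f "\<lambda>us. g (v # us)"]
   by (simp add: bar_even evenc_Cons)
 next
  assume f: "oddc f"
  have "wdg (\<lambda>us. f (v # us)) g vs = wdg g (\<lambda>us. f (v # us)) vs"
   using Cons.IH oddc_Cons[OF f] by blast
  moreover have "wdg f (\<lambda>us. g (v # us)) vs = wdg (bar (\<lambda>us. g (v # us))) f vs"
   using Cons.IH f by blast
  ultimately show "wdg f g (v # vs) = wdg (bar g) f (v # vs)"
   using f by (simp add: bar_odd[of f] wdg_minus_left bar_Cons)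
 qed
qed

lemma wdg_comm: "evenc f \<Longrightarrow> wdg f g = wdg g f"
 using wdg_comm_aux by blast

definition unitc :: "'a list \<Rightarrow> complex" where
 "unitc vs = (if vs = [] then 1 else 0)"

lemma evenc_unit: "evenc unitc" by (auto simp: evenc_def unitc_def)

lemma wdg_unit_right [simp]: "wdg f unitc = f"
proof
 show "wdg f unitc vs = f vs" for vs
  by (induction vs arbitrary: f) (simp_all add: unitc_def[abs_def])
qed

lemma wdg_unit_left [simp]: "wdg unitc f = f"
 using wdg_comm[OF evenc_unit] by (metis wdg_unit_right)

definition evp :: "('a list \<Rightarrow> complex) \<Rightarrow> 'a list \<Rightarrow> complex" where
 "evp f vs = (if even (length vs) then f vs else 0)"

definition odp :: "('a list \<Rightarrow> complex) \<Rightarrow> 'a list \<Rightarrow> complex" where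
 "odp f vs = (if odd (length vs) then f vs else 0)"

lemma evenc_evp [simp]: "evenc (evp f)" and oddc_odp [simp]: "oddc (odp f)"
 by (auto simp: evenc_def oddc_def evp_def odp_def)

lemma evp_odp: "f = (\<lambda>us. evp f us + odp f us)"
 by (auto simp: evp_def odp_def)

lemma evenc_alt: "evenc f \<longleftrightarrow> bar f = f"
proof
 assume b: "bar f = f"
 show "evenc f" unfolding evenc_def
 proof (intro allI impI)
  fix vs :: "'a list" assume "odd (length vs)"
  then show "f vs = 0" using fun_cong[OF b, of vs] by (simp add: bar_def)
 qed
qed (rule bar_even)

lemma oddc_alt: "oddc f \<longleftrightarrow> bar f = (\<lambda>us. - f us)"
proof
 assume b: "bar f = (\<lambda>us. - f us)"
 show "oddc f" unfolding oddc_def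
 proof (intro allI impI)
  fix vs :: "'a list" assume "even (length vs)"
  then show "f vs = 0" using fun_cong[OF b, of vs] by (simp add: bar_def)
 qed
qed (rule bar_odd)

lemma evenc_wdg: "evenc f \<Longrightarrow> evenc g \<Longrightarrow> evenc (wdg f g)"
 by (simp add: evenc_alt bar_wdg)

lemma oddc_wdg: "evenc f \<Longrightarrow> oddc g \<Longrightarrow> oddc (wdg f g)"
 by (simp add: oddc_alt evenc_alt bar_wdg) (rule ext, simp add: wdg_minus_right)

lemma evenc_wdg2: "oddc f \<Longrightarrow> oddc g \<Longrightarrow> evenc (wdg f g)"
 by (simp add: oddc_alt evenc_alt bar_wdg) (rule ext, simp add: wdg_minus_right wdg_minus_left)

lemma evp_even: "evenc f \<Longrightarrow> evp f = f" and odp_even: "evenc f \<Longrightarrow> odp f = (\<lambda>_. 0)"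
 and evp_odd: "oddc f \<Longrightarrow> evp f = (\<lambda>_. 0)" and odp_odd: "oddc f \<Longrightarrow> odp f = f"
 by (auto simp: evenc_def oddc_def evp_def odp_def)

text \<open>
 The product of two odd cochains is discarded. This makes the cochains a commutative ring, the
 trivial square-zero extension of the even cochains by the odd ones, in which an odd derivation
 \<open>D\<close> of the even cochains becomes the ring homomorphism \<open>f \<mapsto> f + D f\<close>.
\<close>

typedef 'a cochain = "UNIV :: ('a list \<Rightarrow> complex) set" morphisms cev Coch ..

declare Coch_inverse[OF UNIV_I, simp] cev_inverse [simp]

lemma cochain_eqI: "(\<And>vs. cev f vs = cev g vs) \<Longrightarrow> f = g"
 by (metis cev_inject ext)

instantiation cochain :: (type) comm_ring_1
begin
definition "0 = Coch (\<lambda>_. 0)"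
definition "1 = Coch unitc"
definition "f + g = Coch (\<lambda>vs. cev f vs + cev g vs)"
definition "f - g = Coch (\<lambda>vs. cev f vs - cev g vs)"
definition "- f = Coch (\<lambda>vs. - cev f vs)"
definition "f * g = Coch (\<lambda>vs. wdg (evp (cev f)) (evp (cev g)) vs +
  wdg (evp (cev f)) (odp (cev g)) vs + wdg (odp (cev f)) (evp (cev g)) vs)"

lemma cev_mult: "cev (f * g) = (\<lambda>vs. wdg (evp (cev f)) (evp (cev g)) vs +
  wdg (evp (cev f)) (odp (cev g)) vs + wdg (odp (cev f)) (evp (cev g)) vs)"
 by (simp add: times_cochain_def)

lemma evp_mult: "evp (cev (f * g)) = wdg (evp (cev f)) (evp (cev g))"
 and odp_mult: "odp (cev (f * g)) =
  (\<lambda>vs. wdg (evp (cev f)) (odp (cev g)) vs + wdg (evp (cev g)) (odp (cev f)) vs)"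
proof -
 have 1: "evenc (wdg (evp (cev f)) (evp (cev g)))" by (simp add: evenc_wdg)
 have 2: "oddc (wdg (evp (cev f)) (odp (cev g)))" by (simp add: oddc_wdg)
 have 3: "oddc (wdg (odp (cev f)) (evp (cev g)))"
  by (subst wdg_comm[symmetric]) (simp_all add: oddc_wdg)
 show "evp (cev (f * g)) = wdg (evp (cev f)) (evp (cev g))"
  using 1 2 3 by (auto simp: cev_mult evp_def evenc_def oddc_def fun_eq_iff)
 show "odp (cev (f * g)) =
  (\<lambda>vs. wdg (evp (cev f)) (odp (cev g)) vs + wdg (evp (cev g)) (odp (cev f)) vs)"
  using 1 2 3 wdg_comm[OF evenc_evp, of "cev g" "odp (cev f)"]
  by (auto simp: cev_mult odp_def evenc_def oddc_def fun_eq_iff)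
qed

lemma cochain_eqI2: "evp (cev f) = evp (cev g) \<Longrightarrow> odp (cev f) = odp (cev g) \<Longrightarrow> f = g"
 by (metis evp_odp cochain_eqI)

instance
proof
 fix a b c :: "'a cochain"
 show "a * b * c = a * (b * c)"
 proof (rule cochain_eqI2)
  show "evp (cev (a * b * c)) = evp (cev (a * (b * c)))"
   by (simp add: evp_mult wdg_assoc fun_eq_iff)
  have "wdg (evp (cev c)) (wdg (evp (cev a)) (odp (cev b))) = wdg (evp (cev a)) (wdg (evp (cev c)) (odp (cev b)))"
   by (metis evenc_evp ext wdg_assoc wdg_comm)
  moreover have "wdg (evp (cev c)) (wdg (evp (cev b)) (odp (cev a))) = wdg (wdg (evp (cev b)) (evp (cev c))) (odp (cev a))"
   by (metis evenc_evp ext wdg_assoc wdg_comm)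
  ultimately show "odp (cev (a * b * c)) = odp (cev (a * (b * c)))"
   by (simp add: evp_mult odp_mult wdg_add_right fun_eq_iff wdg_assoc)
 qed
 show "a * b = b * a"
  by (rule cochain_eqI2) (auto simp: evp_mult odp_mult wdg_comm fun_eq_iff)
 have u: "evp unitc = unitc" "odp unitc = (\<lambda>_. 0)" by (simp_all add: evp_even odp_even evenc_unit)
 show "1 * a = a"
  by (rule cochain_eqI2) (simp_all add: evp_mult odp_mult one_cochain_def u)
 have e: "evp (cev (a + b)) = (\<lambda>us. evp (cev a) us + evp (cev b) us)"
  "odp (cev (a + b)) = (\<lambda>us. odp (cev a) us + odp (cev b) us)"
  by (auto simp: plus_cochain_def evp_def odp_def)
 show "(a + b) * c = a * c + b * c"
  by (rule cochain_eqI)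
   (simp only: cev_mult e wdg_add_left, simp add: plus_cochain_def cev_mult)
 have "cev 0 [] \<noteq> cev (1 :: 'a cochain) []"
  by (simp add: zero_cochain_def one_cochain_def unitc_def)
 then show "(0 :: 'a cochain) \<noteq> 1" by metis
qed (auto simp: plus_cochain_def minus_cochain_def uminus_cochain_def zero_cochain_def algebra_simps cochain_eqI)

end

lemma cev_simps [simp]:
 "cev 0 vs = 0" "cev (f + g) vs = cev f vs + cev g vs" "cev (f - g) vs = cev f vs - cev g vs"
 "cev (- f) vs = - cev f vs"
 by (simp_all add: plus_cochain_def minus_cochain_def uminus_cochain_def zero_cochain_def)

lemma cev_one: "cev 1 = unitc"
 by (simp add: one_cochain_def)

lemma cev_sum: "cev (sum f A) vs = (\<Sum>a\<in>A. cev (f a) vs)"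
 by (induction A rule: infinite_finite_induct) simp_all

abbreviation evn :: "'a cochain \<Rightarrow> bool" where "evn f \<equiv> evenc (cev f)"

abbreviation oddn :: "'a cochain \<Rightarrow> bool" where "oddn f \<equiv> oddc (cev f)"

lemma cev_mult_even: "evn f \<Longrightarrow> cev (f * g) = wdg (cev f) (cev g)"
 using wdg_add_right[of "cev f" "evp (cev g)" "odp (cev g)"]
 by (simp add: cev_mult evp_even odp_even fun_eq_iff flip: evp_odp)

lemma cev_mult_even2: "evn g \<Longrightarrow> cev (f * g) = wdg (cev f) (cev g)"
 by (metis cev_mult_even mult.commute wdg_comm)

lemma odd_mult_odd: "oddn f \<Longrightarrow> oddn g \<Longrightarrow> f * g = 0"
 by (rule cochain_eqI) (simp add: cev_mult evp_odd)

lemma evn_0 [simp]: "evn 0" and evn_1 [simp]: "evn 1"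
 and evn_add: "evn f \<Longrightarrow> evn g \<Longrightarrow> evn (f + g)"
 by (auto simp: evenc_def cev_one unitc_def)

lemma evn_mult: "evn f \<Longrightarrow> evn g \<Longrightarrow> evn (f * g)"
 by (simp add: cev_mult_even evenc_wdg)

lemma oddn_mult: "evn f \<Longrightarrow> oddn g \<Longrightarrow> oddn (f * g)"
 by (simp add: cev_mult_even oddc_wdg)

lemma evn_power: "evn f \<Longrightarrow> evn (f ^ n)"
 by (induction n) (auto intro: evn_mult)

definition sc :: "complex \<Rightarrow> 'a cochain" where
 "sc c = Coch (\<lambda>vs. c * unitc vs)"

lemma evn_sc [simp]: "evn (sc c)"
 by (simp add: sc_def evenc_def unitc_def)

lemma cev_sc: "cev (sc c) vs = (if vs = [] then c else 0)"
 by (simp add: sc_def unitc_def)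

lemma cev_sc_mult [simp]: "cev (sc c * f) vs = c * cev f vs"
proof -
 have "cev (sc c * f) vs = wdg (\<lambda>us. c * unitc us) (cev f) vs"
  by (subst cev_mult_even) (simp_all add: sc_def[abs_def] evenc_def unitc_def)
 then show ?thesis by (simp add: wdg_scale_left)
qed

lemma sc_hom: "sc (a + b) = sc a + sc b" "sc (a * b) = sc a * sc b" "sc 1 = 1" "sc 0 = 0" "sc (- a) = - sc a"
proof -
 show "sc (a * b) = sc a * sc b"
  by (rule cochain_eqI) (simp only: cev_sc_mult, simp add: cev_sc)
qed (rule cochain_eqI; simp add: cev_sc cev_one unitc_def)+

lemma sc_power: "sc (a ^ n) = sc a ^ n"
 by (induction n) (simp_all add: sc_hom)

text \<open>Determinants and minors carry permutation signs as \<open>of_int\<close>; reading these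
  as scalars makes the rules for \<open>sc\<close> available for them.\<close>

lemma sc_of_int: "sc (of_int n) = of_int n"
proof -
 have n: "sc (of_nat m) = (of_nat m :: 'a cochain)" for m by (induction m) (simp_all add: sc_hom)
 show ?thesis
 proof (cases n)
  case (nonneg m)
  then show ?thesis by (simp add: n)
 next
  case (neg m)
  have "of_int n = (- of_nat (Suc m) :: complex)" "of_int n = (- of_nat (Suc m) :: 'a cochain)"
   unfolding neg by (simp_all only: of_int_minus of_int_of_nat_eq)
  then show ?thesis by (simp only: sc_hom n)
 qed
qed

lemma cev_mult_Nil [simp]: "cev (f * g) [] = cev f [] * cev g []"
 by (simp add: cev_mult evp_def odp_def)

lemma cev_one_Nil [simp]: "cev 1 [] = 1" by (simp add: cev_one unitc_def)

lemma cev_prod_Nil: "cev (prod f A) [] = (\<Prod>a\<in>A. cev (f a) [])"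
 by (induction A rule: infinite_finite_induct) simp_all

lemma cev_power_Nil: "cev (f ^ n) [] = cev f [] ^ n"
 by (induction n) simp_all

lemma cev_of_int_Nil: "cev (of_int n) [] = of_int n"
 by (simp flip: sc_of_int add: cev_sc)

subsection \<open>Restriction to a set of vectors\<close>

text \<open>The set will be a tangent space. Restriction is a ring endomorphism, so identities that
  hold only on tangent vectors can be handled by computations in the same ring.\<close>

definition res :: "'a set \<Rightarrow> 'a cochain \<Rightarrow> 'a cochain" where
 "res T f = Coch (\<lambda>vs. if set vs \<subseteq> T then cev f vs else 0)"

lemma wdg_cong: "(\<And>us. set us \<subseteq> set vs \<Longrightarrow> length us \<le> length vs \<Longrightarrow> f us = f' us) \<Longrightarrow>
  (\<And>us. set us \<subseteq> set vs \<Longrightarrow> length us \<le> length vs \<Longrightarrow> g us = g' us) \<Longrightarrow> wdg f g vs = wdg f' g' vs"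
proof (induction vs arbitrary: f f' g g')
 case Nil
 then show ?case by simp
next
 case (Cons v vs)
 have "wdg (\<lambda>us. f (v # us)) g vs = wdg (\<lambda>us. f' (v # us)) g' vs"
  by (rule Cons.IH; rule Cons.prems) auto
 moreover have "wdg (bar f) (\<lambda>us. g (v # us)) vs = wdg (bar f') (\<lambda>us. g' (v # us)) vs"
 proof (rule Cons.IH)
  fix us assume "set us \<subseteq> set vs" "length us \<le> length vs"
  then show "bar f us = bar f' us"
   unfolding bar_def using Cons.prems(1)[of us] by auto
 qed (rule Cons.prems; auto)
 ultimately show ?case by simp
qed

lemma wdg_restrict_zero:
 assumes "\<not> set vs \<subseteq> T" "\<And>us. \<not> set us \<subseteq> T \<Longrightarrow> f us = 0" "\<And>us. \<not> set us \<subseteq> T \<Longrightarrow> g us = 0"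
 shows "wdg f g vs = 0"
 using assms
proof (induction vs arbitrary: f g)
 case Nil
 then show ?case by simp
next
 case (Cons v vs)
 show ?case
 proof (cases "v \<in> T")
  case True
  have "wdg (\<lambda>us. f (v # us)) g vs = 0" "wdg (bar f) (\<lambda>us. g (v # us)) vs = 0"
   by (rule Cons.IH; use Cons.prems True in \<open>auto simp: bar_def\<close>)+
  then show ?thesis by simp
 next
  case False
  then have "(\<lambda>us. f (v # us)) = (\<lambda>_. 0)" "(\<lambda>us. g (v # us)) = (\<lambda>_. 0)"
   using Cons.prems by auto
  then show ?thesis by simp
 qed
qed

lemma wdg_res:
 "wdg (\<lambda>us. if set us \<subseteq> T then f us else 0) (\<lambda>us. if set us \<subseteq> T then g us else 0) vs =
  (if set vs \<subseteq> T then wdg f g vs else 0)"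
proof (cases "set vs \<subseteq> T")
 case True
 then show ?thesis by (auto intro!: wdg_cong)
next
 case False
 then show ?thesis by (simp add: wdg_restrict_zero[OF False])
qed

lemma res_hom: "res T (f + g) = res T f + res T g" "res T (f - g) = res T f - res T g"
 "res T (f * g) = res T f * res T g" "res T 1 = 1" "res T 0 = 0" "res T (sc c) = sc c"
proof -
 show "res T (f * g) = res T f * res T g"
 proof (rule cochain_eqI)
  fix vs
  have e: "evp (cev (res T h)) = (\<lambda>us. if set us \<subseteq> T then evp (cev h) us else 0)"
   "odp (cev (res T h)) = (\<lambda>us. if set us \<subseteq> T then odp (cev h) us else 0)" for h
   by (auto simp: res_def evp_def odp_def)
  show "cev (res T (f * g)) vs = cev (res T f * res T g) vs"
   unfolding cev_mult e wdg_res by (simp add: res_def cev_mult)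
 qed
qed (auto intro!: cochain_eqI simp: res_def cev_one unitc_def cev_sc)

lemma cev_res: "cev (res T f) vs = (if set vs \<subseteq> T then cev f vs else 0)"
 by (simp add: res_def)

lemma res_sum: "res T (sum f A) = (\<Sum>a\<in>A. res T (f a))"
 by (induction A rule: infinite_finite_induct) (simp_all add: res_hom)

lemma res_prod: "res T (prod f A) = (\<Prod>a\<in>A. res T (f a))"
 by (induction A rule: infinite_finite_induct) (simp_all add: res_hom)

lemma res_of_int: "res T (of_int n) = of_int n"
 by (simp flip: sc_of_int add: res_hom)

lemma evn_res: "evn f \<Longrightarrow> evn (res T f)" and oddn_res: "oddn f \<Longrightarrow> oddn (res T f)"
 by (auto simp: evenc_def oddc_def res_def)

subsection \<open>Low-degree vanishing\<close>

lemma wdg_low_zero: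
 assumes "length vs < m" "\<And>us. length us < m \<Longrightarrow> g us = 0" shows "wdg f g vs = 0"
proof -
 have "wdg f g vs = wdg f (\<lambda>_. 0) vs" by (rule wdg_cong) (use assms in auto)
 then show ?thesis by simp
qed

lemma cev_mult_low_zero:
 assumes "\<And>us. length us < m \<Longrightarrow> cev g us = 0" "length vs < m"
 shows "cev (f * g) vs = 0"
 using assms by (auto simp: cev_mult wdg_low_zero[where m = m] evp_def odp_def)

text \<open>Orders of vanishing add, since each argument is spent on one of the factors.\<close>

lemma wdg_low_zero2:
 assumes "length vs < m + m'" "\<And>us. length us < m \<Longrightarrow> f us = 0" "\<And>us. length us < m' \<Longrightarrow> g us = 0"
 shows "wdg f g vs = 0"
 using assms
proof (induction vs arbitrary: f g m m')
 case Nil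
 then show ?case by (cases m) auto
next
 case (Cons v vs)
 have "wdg (\<lambda>us. f (v # us)) g vs = 0"
 proof (cases m)
  case 0
  then show ?thesis using Cons.prems by (intro wdg_low_zero[where m = m']) auto
 next
  case (Suc k)
  show ?thesis by (rule Cons.IH[of k m']) (use Cons.prems Suc in auto)
 qed
 moreover have "wdg (bar f) (\<lambda>us. g (v # us)) vs = 0"
 proof (cases m')
  case 0
  then have "wdg (bar f) (\<lambda>us. g (v # us)) vs = wdg (\<lambda>_. 0) (\<lambda>us. g (v # us)) vs"
   using Cons.prems by (intro wdg_cong) (auto simp: bar_def)
  then show ?thesis by simp
 next
  case (Suc k)
  show ?thesis by (rule Cons.IH[of m k]) (use Cons.prems Suc in \<open>auto simp: bar_def\<close>)
 qed
 ultimately show ?case by simp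
qed

lemma cev_power_low_zero:
 assumes "evn f" "cev f [] = 0" "length vs < 2 * k"
 shows "cev (f ^ k) vs = 0"
 using assms(3)
proof (induction k arbitrary: vs)
 case 0
 then show ?case by simp
next
 case (Suc k)
 have f2: "cev f us = 0" if "length us < 2" for us
 proof (cases "us = []")
  case False
  with that have "odd (length us)" by (cases us) auto
  then show ?thesis using assms(1) by (simp add: evenc_def)
 qed (use assms in simp)
 show ?case
  unfolding power_Suc cev_mult_even[OF assms(1)]
  by (rule wdg_low_zero2[of _ 2 "2 * k"]) (use Suc f2 in auto)
qed

subsection \<open>Wedge products of even forms\<close>

text \<open>The fold defining \<open>wedge_prod\<close> is independent of the order only if the
  operators \<open>wedge (f i)\<close> commute on all forms. This is why evenness is asked at all
  points \<open>q\<close> and not only at \<open>p\<close>.\<close>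

lemma wedge_prod_eq:
 assumes "finite I" "\<And>i. i \<in> I \<Longrightarrow> evenc (f i p)"
  and ev: "\<And>i q. i \<in> I \<Longrightarrow> evenc (f i q)"
 shows "wedge_prod f I p = cev (\<Prod>i\<in>I. Coch (f i p))"
proof -
 have comm: "wedge (f j) \<circ> wedge (f i) = wedge (f i) \<circ> wedge (f j)" if "i \<in> I" "j \<in> I" for i j
 proof (intro ext)
  fix \<alpha> q vs
  have w: "wedge a b q = wdg (a q) (b q)" for a b :: "'b form" by (rule ext) (rule wedge_eq_wdg)
  have "wdg (f j q) (wdg (f i q) (\<alpha> q)) vs = wdg (wdg (f j q) (f i q)) (\<alpha> q) vs"
   by (simp add: wdg_assoc)
  also have "\<dots> = wdg (wdg (f i q) (f j q)) (\<alpha> q) vs"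
   using wdg_comm[OF ev[OF that(1), of q], of "f j q"] by simp
  also have "\<dots> = wdg (f i q) (wdg (f j q) (\<alpha> q)) vs" by (simp add: wdg_assoc)
  finally show "(wedge (f j) \<circ> wedge (f i)) \<alpha> q vs = (wedge (f i) \<circ> wedge (f j)) \<alpha> q vs"
   by (simp add: w)
 qed
 interpret comp_fun_commute_on I "\<lambda>i. wedge (f i)"
  by standard (use comm in blast)
 have "wedge_prod f J p = cev (\<Prod>i\<in>J. Coch (f i p))" if "J \<subseteq> I" for J
  using finite_subset[OF that assms(1)] that
 proof (induction J)
  case empty
  show ?case by (auto simp: wedge_prod_def form_one_def cev_one unitc_def)
 next
  case (insert i J)
  have "Finite_Set.fold (\<lambda>i. wedge (f i)) form_one (insert i J) =
    wedge (f i) (Finite_Set.fold (\<lambda>i. wedge (f i)) form_one J)"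
   by (rule fold_insert) (use insert in auto)
  then have "wedge_prod f (insert i J) p = wdg (f i p) (wedge_prod f J p)"
   unfolding wedge_prod_def by (auto simp: wedge_eq_wdg)
  also have "\<dots> = cev (Coch (f i p) * (\<Prod>i\<in>J. Coch (f i p)))"
   by (subst cev_mult_even) (use insert ev in auto)
  finally show ?case using insert by simp
 qed
 then show ?thesis by blast
qed

lemma wedge_power_eq:
 assumes "evenc (f p)"
 shows "(wedge f ^^ n) form_one p = cev (Coch (f p) ^ n)"
proof (induction n)
 case 0
 show ?case by (auto simp: form_one_def cev_one unitc_def)
next
 case (Suc n)
 have "(wedge f ^^ Suc n) form_one p = wdg (f p) (cev (Coch (f p) ^ n))"
  by (auto simp: wedge_eq_wdg Suc)
 then show ?case using assms by (simp add: cev_mult_even)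
qed

lemma subst_form_eq:
 assumes ev: "\<And>k q. evenc (c k q)"
 shows "subst_form Q c p = cev (\<Sum>m\<in>Poly_Mapping.keys Q. sc (Poly_Mapping.lookup Q m) *
   (\<Prod>k\<in>Poly_Mapping.keys m. Coch (c k p) ^ Poly_Mapping.lookup m k))"
proof (rule ext)
 fix vs
 have pw: "evenc ((wedge (c k) ^^ n) form_one q)" for k n q
  using ev by (simp add: wedge_power_eq evn_power)
 show "subst_form Q c p vs = cev (\<Sum>m\<in>Poly_Mapping.keys Q. sc (Poly_Mapping.lookup Q m) *
   (\<Prod>k\<in>Poly_Mapping.keys m. Coch (c k p) ^ Poly_Mapping.lookup m k)) vs"
  by (simp add: subst_form_def cev_sum wedge_prod_eq[OF finite_keys pw pw] wedge_power_eq ev)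
qed

section \<open>Calculus of differential forms\<close>

subsection \<open>The Leibniz rule\<close>

abbreviation fder where "fder f x \<equiv> frechet_derivative f (at x)"

lemma has_frechet: "f differentiable (at p) \<Longrightarrow> (f has_derivative fder f p) (at p)"
 by (simp add: frechet_derivative_works)

lemma frechet_eqI: "(f has_derivative f') (at p) \<Longrightarrow> fder f p v = f' v"
 using frechet_derivative_at by metis

lemma ext_deriv_Nil [simp]: "ext_deriv \<omega> p [] = 0"
 by (simp add: ext_deriv_def)

text \<open>Cartan's formula for the constant vector field \<open>v\<close>, whose Lie derivative is
  the directional derivative of the coefficients. It makes the exterior derivative recursive in the
  argument list, like \<open>wdg\<close>.\<close>

lemma ext_deriv_Cons:
 "ext_deriv \<omega> p (v # vs) =
   fder (\<lambda>q. \<omega> q vs) p v - ext_deriv (\<lambda>q us. \<omega> q (v # us)) p vs"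
 unfolding ext_deriv_def length_Cons sum.lessThan_Suc_shift by (simp add: sum_negf)

definition fdiff :: "('a::real_normed_vector \<Rightarrow> 'a list \<Rightarrow> complex) \<Rightarrow> 'a \<Rightarrow> bool" where
 "fdiff f p \<longleftrightarrow> (\<forall>vs. (\<lambda>q. f q vs) differentiable (at p))"

definition fD :: "('a::real_normed_vector \<Rightarrow> 'a list \<Rightarrow> complex) \<Rightarrow> 'a \<Rightarrow> 'a \<Rightarrow> 'a list \<Rightarrow> complex" where
 "fD f p v vs = fder (\<lambda>q. f q vs) p v"

lemma fdiffD: "fdiff f p \<Longrightarrow> ((\<lambda>q. f q vs) has_derivative (\<lambda>v. fD f p v vs)) (at p)"
 unfolding fdiff_def fD_def by (intro has_frechet) blast

lemma fdiff_Cons: "fdiff f p \<Longrightarrow> fdiff (\<lambda>q us. f q (v # us)) p"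
 by (simp add: fdiff_def)

lemma fdiff_bar: "fdiff f p \<Longrightarrow> fdiff (\<lambda>q. bar (f q)) p"
 by (simp add: fdiff_def bar_def)

lemma fD_bar: "fdiff f p \<Longrightarrow> fD (\<lambda>q. bar (f q)) p v = bar (fD f p v)"
 unfolding fD_def bar_def
 by (rule ext, rule frechet_eqI) (auto intro!: derivative_eq_intros fdiffD simp: fD_def[symmetric])

lemma has_derivative_wdg:
 assumes "fdiff f p" "fdiff g p"
 shows "((\<lambda>q. wdg (f q) (g q) vs) has_derivative
     (\<lambda>v. wdg (fD f p v) (g p) vs + wdg (f p) (fD g p v) vs)) (at p)"
 using assms
proof (induction vs arbitrary: f g)
 case Nil
 show ?case
  by (auto intro!: derivative_eq_intros fdiffD Nil)
next
 case (Cons w vs)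
 note 1 = Cons.IH[OF fdiff_Cons[OF Cons.prems(1)] Cons.prems(2)]
 note 2 = Cons.IH[OF fdiff_bar[OF Cons.prems(1)] fdiff_Cons[OF Cons.prems(2)]]
 have e: "fD (\<lambda>q us. h q (w # us)) p v = (\<lambda>us. fD h p v (w # us))" for h and v
  by (rule ext) (simp add: fD_def)
 show ?case
  by (simp, rule has_derivative_eq_rhs[OF has_derivative_add[OF 1 2]])
   (simp add: e fD_bar Cons.prems fun_eq_iff)
qed

lemma fdiff_wdg: "fdiff f p \<Longrightarrow> fdiff g p \<Longrightarrow> fdiff (\<lambda>q. wdg (f q) (g q)) p"
 using has_derivative_wdg unfolding fdiff_def differentiable_def by blast

lemma fdiff_add: "fdiff f p \<Longrightarrow> fdiff g p \<Longrightarrow> fdiff (\<lambda>q us. f q us + g q us) p"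
 and fdiff_scale: "fdiff f p \<Longrightarrow> fdiff (\<lambda>q us. c * f q us) p"
 by (simp_all add: fdiff_def)

lemma ext_deriv_add:
 assumes "fdiff f p" "fdiff g p"
 shows "ext_deriv (\<lambda>q us. f q us + g q us) p vs = ext_deriv f p vs + ext_deriv g p vs"
 using assms
proof (induction vs arbitrary: f g)
 case (Cons v vs)
 have "fder (\<lambda>q. f q vs + g q vs) p v = fD f p v vs + fD g p v vs"
  by (rule frechet_eqI) (intro has_derivative_add fdiffD Cons.prems)
 then show ?case
  by (simp add: ext_deriv_Cons Cons.IH fdiff_Cons Cons.prems fD_def)
qed simp

lemma ext_deriv_scale:
 assumes "fdiff f p"
 shows "ext_deriv (\<lambda>q us. c * f q us) p vs = c * ext_deriv f p vs"
 using assms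
proof (induction vs arbitrary: f)
 case (Cons v vs)
 have "fder (\<lambda>q. c * f q vs) p v = c * fD f p v vs"
  by (rule frechet_eqI) (intro has_derivative_mult_right fdiffD Cons.prems)
 then show ?case
  by (simp add: ext_deriv_Cons Cons.IH fdiff_Cons Cons.prems fD_def algebra_simps)
qed simp

lemma ext_deriv_minus: "fdiff f p \<Longrightarrow> ext_deriv (\<lambda>q us. - f q us) p vs = - ext_deriv f p vs"
 using ext_deriv_scale[of f p "-1" vs] by simp

lemma fdiff_minus: "fdiff f p \<Longrightarrow> fdiff (\<lambda>q us. - f q us) p"
 using fdiff_scale[of f p "-1"] by simp

lemma ext_deriv_sum:
 assumes "\<And>a. a \<in> A \<Longrightarrow> fdiff (f a) p" "finite A"
 shows "ext_deriv (\<lambda>q us. \<Sum>a\<in>A. f a q us) p vs = (\<Sum>a\<in>A. ext_deriv (f a) p vs)"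
 using assms(2,1)
proof (induction A)
 case empty
 have "ext_deriv (\<lambda>q us. 0) p vs = 0" by (simp add: ext_deriv_def)
 then show ?case by simp
next
 case (insert a A)
 then show ?case
  by (simp add: ext_deriv_add fdiff_def)
qed

text \<open>The exterior derivative raises the degree by one and therefore anticommutes with
  \<open>bar\<close>.\<close>

lemma ext_deriv_bar:
 assumes "fdiff f p" shows "ext_deriv (\<lambda>q. bar (f q)) p = (\<lambda>vs. - bar (ext_deriv f p) vs)"
proof (rule ext)
 show "ext_deriv (\<lambda>q. bar (f q)) p vs = - bar (ext_deriv f p) vs" for vs
  using assms
 proof (induction vs arbitrary: f)
  case Nil
  then show ?case by (simp add: bar_def)
 next
  case (Cons v vs)
  have "ext_deriv (\<lambda>q us. bar (f q) (v # us)) p vs = bar (ext_deriv (\<lambda>q us. f q (v # us)) p) vs"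
   by (simp add: bar_Cons' ext_deriv_minus fdiff_bar fdiff_Cons Cons)
  moreover have "fder (\<lambda>q. bar (f q) vs) p v = bar (fD f p v) vs"
   using fD_bar[OF Cons.prems, of v] by (simp add: fD_def fun_eq_iff)
  ultimately show ?case
   by (simp add: ext_deriv_Cons bar_def fD_def algebra_simps)
 qed
qed

text \<open>After Cartan's formula, the Lie derivative obeys the product rule, and the remaining
  terms are instances of the claim for the two contracted products.\<close>

theorem ext_deriv_wdg:
 assumes "fdiff f p" "fdiff g p"
 shows "ext_deriv (\<lambda>q. wdg (f q) (g q)) p vs =
  wdg (ext_deriv f p) (g p) vs + wdg (bar (f p)) (ext_deriv g p) vs"
 using assms
proof (induction vs arbitrary: f g)
 case Nil
 show ?case by simp
next
 case (Cons v vs)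
 let ?f = "\<lambda>q us. f q (v # us)" and ?g = "\<lambda>q us. g q (v # us)"
 have d: "ext_deriv h p (v # us) = fD h p v us - ext_deriv (\<lambda>q us. h q (v # us)) p us" for h us
  by (simp add: ext_deriv_Cons fD_def)
 have "ext_deriv (\<lambda>q us. wdg (f q) (g q) (v # us)) p vs =
   ext_deriv (\<lambda>q. wdg (?f q) (g q)) p vs + ext_deriv (\<lambda>q. wdg (bar (f q)) (?g q)) p vs"
  by (simp add: ext_deriv_add fdiff_wdg fdiff_Cons fdiff_bar Cons.prems)
 also have "\<dots> = wdg (ext_deriv ?f p) (g p) vs + wdg (bar (?f p)) (ext_deriv g p) vs
   - wdg (bar (ext_deriv f p)) (?g p) vs + wdg (f p) (ext_deriv ?g p) vs"
  by (simp add: Cons.IH fdiff_Cons fdiff_bar Cons.prems ext_deriv_bar wdg_minus_left)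
 finally have 1: "ext_deriv (\<lambda>q us. wdg (f q) (g q) (v # us)) p vs = \<dots>" .
 have 2: "fder (\<lambda>q. wdg (f q) (g q) vs) p v = wdg (fD f p v) (g p) vs + wdg (f p) (fD g p v) vs"
  by (rule frechet_eqI) (intro has_derivative_wdg Cons.prems)
 show ?case
  unfolding ext_deriv_Cons[of "\<lambda>q. wdg (f q) (g q)"] 1 2
  by (simp add: d wdg_diff_left wdg_diff_right bar_Cons wdg_minus_left)
qed

subsection \<open>Multilinear alternating cochains\<close>

definition mlin :: "('a::real_vector list \<Rightarrow> complex) \<Rightarrow> bool" where
 "mlin f \<longleftrightarrow> (\<forall>us ws. linear (\<lambda>v. f (us @ v # ws)))"

text \<open>Adjacent equal arguments are what an induction over a list prefix can check; together
  with linearity they yield vanishing on all repeated arguments.\<close>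

definition altn :: "('a list \<Rightarrow> complex) \<Rightarrow> bool" where
 "altn f \<longleftrightarrow> (\<forall>us v ws. f (us @ v # v # ws) = 0)"

definition tens :: "('a::real_vector list \<Rightarrow> complex) \<Rightarrow> bool" where
 "tens f \<longleftrightarrow> mlin f \<and> altn f"

lemma tensI: "(\<And>us ws. linear (\<lambda>v. f (us @ v # ws))) \<Longrightarrow> (\<And>us v ws. f (us @ v # v # ws) = 0) \<Longrightarrow> tens f"
 by (auto simp: tens_def mlin_def altn_def)

lemma tens_linear: "tens f \<Longrightarrow> linear (\<lambda>v. f (us @ v # ws))"
 and tens_dup: "tens f \<Longrightarrow> f (us @ v # v # ws) = 0"
 by (auto simp: tens_def mlin_def altn_def)

lemma tens_linear0: "tens f \<Longrightarrow> linear (\<lambda>v. f (v # ws))"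
 using tens_linear[of f "[]"] by simp

lemma tens_dup0: "tens f \<Longrightarrow> f (v # v # ws) = 0"
 using tens_dup[of f "[]"] by simp

lemma tens_Cons: "tens f \<Longrightarrow> tens (\<lambda>us. f (v # us))"
 by (auto intro!: tensI tens_linear[of f "v # us" for us, simplified] tens_dup[of f "v # us" for us, simplified])

lemma tens_swap:
 assumes "tens f" shows "f (us @ u # v # ws) = - f (us @ v # u # ws)"
proof -
 have l: "f (us @ (a + b) # ws) = f (us @ a # ws) + f (us @ b # ws)" for a b us ws
  using linear_add[OF tens_linear[OF assms]] by blast
 have "0 = f (us @ (u + v) # (u + v) # ws)" by (simp add: tens_dup assms)
 also have "\<dots> = f ((us @ [u]) @ (u + v) # ws) + f ((us @ [v]) @ (u + v) # ws)"
  using l[of us u v "(u + v) # ws"] by simp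
 also have "\<dots> = f (us @ u # v # ws) + f (us @ v # u # ws)"
  by (simp only: l) (simp add: tens_dup assms)
 finally show ?thesis by (simp add: eq_neg_iff_add_eq_0)
qed

lemma tens_repeat: "tens f \<Longrightarrow> f (us @ v # ws @ v # xs) = 0"
proof (induction ws arbitrary: us)
 case Nil
 then show ?case by (simp add: tens_dup)
next
 case (Cons w ws)
 have "f (us @ v # (w # ws) @ v # xs) = - f ((us @ [w]) @ v # ws @ v # xs)"
  using tens_swap[OF Cons.prems, of us v w "ws @ v # xs"] by simp
 then show ?case using Cons.IH[OF Cons.prems, of "us @ [w]"] by simp
qed

lemma tens_not_distinct: "tens f \<Longrightarrow> \<not> distinct vs \<Longrightarrow> f vs = 0"
 using not_distinct_decomp[of vs] tens_repeat by fastforce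

lemma tens_iff:
 "tens f \<longleftrightarrow> (\<forall>vs. \<forall>i < length vs. linear (\<lambda>v. f (vs[i := v]))) \<and> (\<forall>vs. \<not> distinct vs \<longrightarrow> f vs = 0)"
proof
 assume t: "tens f"
 have "linear (\<lambda>v. f (vs[i := v]))" if "i < length vs" for vs i
  using tens_linear[OF t, of "take i vs" "drop (Suc i) vs"] that by (simp add: upd_conv_take_nth_drop)
 then show "(\<forall>vs. \<forall>i < length vs. linear (\<lambda>v. f (vs[i := v]))) \<and> (\<forall>vs. \<not> distinct vs \<longrightarrow> f vs = 0)"
  using tens_not_distinct[OF t] by blast
next
 assume a: "(\<forall>vs. \<forall>i < length vs. linear (\<lambda>v. f (vs[i := v]))) \<and> (\<forall>vs. \<not> distinct vs \<longrightarrow> f vs = 0)"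
 show "tens f"
 proof (rule tensI)
  fix us ws
  have "linear (\<lambda>v. f ((us @ 0 # ws)[length us := v]))"
   using conjunct1[OF a, rule_format, of "length us" "us @ 0 # ws"] by simp
  then show "linear (\<lambda>v. f (us @ v # ws))" by simp
 next
  fix us v ws
  show "f (us @ v # v # ws) = 0" using a by (metis distinct.simps(2) distinct_append list.set_intros(1))
 qed
qed

lemma smooth_form_iff:
 "smooth_form \<omega> \<longleftrightarrow> (\<forall>vs. smooth_on UNIV (\<lambda>p. \<omega> p vs)) \<and> (\<forall>p. tens (\<omega> p))"
 unfolding smooth_form_def tens_iff by blast

lemma linear_cmult: "linear f \<Longrightarrow> linear (\<lambda>v. (c::complex) * f v)"
 by (simp add: linear_iff algebra_simps)

lemma tens_bar: "tens f \<Longrightarrow> tens (bar f)"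
proof (rule tensI)
 fix us ws :: "'a list" assume f: "tens f"
 have "(\<lambda>v. bar f (us @ v # ws)) = (\<lambda>v. (-1) ^ (length us + Suc (length ws)) * f (us @ v # ws))"
  by (simp add: bar_def)
 then show "linear (\<lambda>v. bar f (us @ v # ws))"
  by (simp only: linear_cmult tens_linear[OF f])
qed (simp add: bar_def tens_dup)

lemma tens_scale: "tens f \<Longrightarrow> tens (\<lambda>us. c * f us)"
 by (rule tensI) (simp_all add: tens_dup linear_cmult tens_linear)

lemma tens_add: "tens f \<Longrightarrow> tens g \<Longrightarrow> tens (\<lambda>us. f us + g us)"
 by (rule tensI) (simp_all add: tens_dup linear_compose_add tens_linear)

lemma tens_zero: "tens (\<lambda>us. 0)"
 by (auto intro!: tensI linear_zero)

lemma tens_unit: "tens unitc"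
 by (auto intro!: tensI linear_zero simp: unitc_def)

lemma mlin_wdg_aux: "tens f \<Longrightarrow> tens g \<Longrightarrow> linear (\<lambda>v. wdg f g (us @ v # ws))"
proof (induction us arbitrary: f g)
 case Nil
 have f: "f ((a + b) # us) = f (a # us) + f (b # us)" "f ((r *\<^sub>R a) # us) = r *\<^sub>R f (a # us)" for a b us r
  using linear_add[OF tens_linear0[OF Nil(1)]] linear_scale[OF tens_linear0[OF Nil(1)]] by blast+
 have g: "g ((a + b) # us) = g (a # us) + g (b # us)" "g ((r *\<^sub>R a) # us) = r *\<^sub>R g (a # us)" for a b us r
  using linear_add[OF tens_linear0[OF Nil(2)]] linear_scale[OF tens_linear0[OF Nil(2)]] by blast+
 show ?case
  by (rule linearI)
   (simp_all add: f g wdg_add_left wdg_add_right wdg_scale_left wdg_scale_right scaleR_conv_of_real algebra_simps)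
next
 case (Cons u us)
 show ?case
  by (simp, intro linear_compose_add Cons.IH tens_Cons Cons.prems tens_bar)
qed

lemma altn_wdg_aux: "tens f \<Longrightarrow> tens g \<Longrightarrow> wdg f g (us @ v # v # ws) = 0"
proof (induction us arbitrary: f g)
 case Nil
 then show ?case
  by (simp add: tens_dup0 bar_Cons wdg_minus_left)
next
 case (Cons u us)
 then show ?case by (simp add: tens_Cons tens_bar)
qed

lemma tens_wdg: "tens f \<Longrightarrow> tens g \<Longrightarrow> tens (wdg f g)"
 by (rule tensI) (simp_all add: mlin_wdg_aux altn_wdg_aux)

lemma tens_evp: "tens f \<Longrightarrow> tens (evp f)" and tens_odp: "tens f \<Longrightarrow> tens (odp f)"
proof -
 assume t: "tens f"
 have e: "evp f = (\<lambda>us. (1/2) * (f us + bar f us))" "odp f = (\<lambda>us. (1/2) * (f us + (-1) * bar f us))"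
  by (auto simp: evp_def odp_def bar_def fun_eq_iff)
 show "tens (evp f)" "tens (odp f)"
  unfolding e by (intro tens_scale tens_add tens_bar t)+
qed

lemma tens_mult: "tens (cev f) \<Longrightarrow> tens (cev g) \<Longrightarrow> tens (cev (f * g))"
 unfolding cev_mult by (intro tens_add tens_wdg tens_evp tens_odp)

lemma tens_sc: "tens (cev (sc c))"
 using tens_scale[OF tens_unit, of c] by (simp add: sc_def)

lemma tens_plus: "tens (cev f) \<Longrightarrow> tens (cev g) \<Longrightarrow> tens (cev (f + g))"
 by (simp add: plus_cochain_def tens_add)

subsection \<open>Smooth functions\<close>

text \<open>Rational functions without poles in real linear coordinates. The coefficients of the
  characteristic and localising forms and the entries of the charts are of this kind. The class is
  closed under differentiation, so one coinduction proves all of it smooth.\<close>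

inductive algf :: "('a::euclidean_space \<Rightarrow> complex) \<Rightarrow> bool" where
 algf_const: "algf (\<lambda>x. c)"
| algf_linear: "linear L \<Longrightarrow> algf L"
| algf_add: "algf f \<Longrightarrow> algf g \<Longrightarrow> algf (\<lambda>x. f x + g x)"
| algf_mult: "algf f \<Longrightarrow> algf g \<Longrightarrow> algf (\<lambda>x. f x * g x)"
| algf_inverse: "algf f \<Longrightarrow> (\<And>x. f x \<noteq> 0) \<Longrightarrow> algf (\<lambda>x. inverse (f x))"

lemma algf_uminus: "algf f \<Longrightarrow> algf (\<lambda>x. - f x)"
 using algf_mult[OF algf_const[of "-1"]] by simp

lemma algf_sum: "(\<And>a. a \<in> A \<Longrightarrow> algf (f a)) \<Longrightarrow> algf (\<lambda>x. \<Sum>a\<in>A. f a x)"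
 by (induction A rule: infinite_finite_induct) (auto intro: algf_const algf_add)

lemma algf_prod: "(\<And>a. a \<in> A \<Longrightarrow> algf (f a)) \<Longrightarrow> algf (\<lambda>x. \<Prod>a\<in>A. f a x)"
 by (induction A rule: infinite_finite_induct) (auto intro: algf_const algf_mult)

lemma algf_deriv:
 "algf f \<Longrightarrow> \<exists>f'. (\<forall>x. (f has_derivative f' x) (at x)) \<and> (\<forall>v. algf (\<lambda>x. f' x v))"
proof (induction rule: algf.induct)
 case (algf_const c)
 then show ?case by (intro exI[of _ "\<lambda>x v. 0"]) (auto intro: algf.algf_const)
next
 case (algf_linear L)
 then show ?case
  by (intro exI[of _ "\<lambda>x v. L v"]) (auto intro: algf.algf_const linear_imp_has_derivative)
next
 case (algf_add f g)
 then obtain f' g' where fg: "\<And>x. (f has_derivative f' x) (at x)" "\<And>v. algf (\<lambda>x. f' x v)"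
  "\<And>x. (g has_derivative g' x) (at x)" "\<And>v. algf (\<lambda>x. g' x v)" by blast
 show ?case
  by (intro exI[of _ "\<lambda>x v. f' x v + g' x v"])
   (auto intro!: fg algf.algf_add has_derivative_add)
next
 case (algf_mult f g)
 then obtain f' g' where fg: "\<And>x. (f has_derivative f' x) (at x)" "\<And>v. algf (\<lambda>x. f' x v)"
  "\<And>x. (g has_derivative g' x) (at x)" "\<And>v. algf (\<lambda>x. g' x v)" by blast
 show ?case
  by (intro exI[of _ "\<lambda>x v. f x * g' x v + f' x v * g x"])
   (auto intro!: fg algf.algf_add algf.algf_mult has_derivative_mult algf_mult)
next
 case (algf_inverse f)
 then obtain f' where f: "\<And>x. (f has_derivative f' x) (at x)" "\<And>v. algf (\<lambda>x. f' x v)" by blast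
 show ?case
  by (intro exI[of _ "\<lambda>x v. - (inverse (f x) * f' x v * inverse (f x))"] conjI allI
    f algf_uminus algf.algf_mult Deriv.has_derivative_inverse algf_inverse algf.algf_inverse)
qed

lemma algf_differentiable: "algf f \<Longrightarrow> f differentiable (at x)"
 and algf_frechet: "algf f \<Longrightarrow> algf (\<lambda>x. fder f x v)"
proof -
 assume "algf f"
 then obtain f' where f': "\<And>x. (f has_derivative f' x) (at x)" "\<And>v. algf (\<lambda>x. f' x v)"
  using algf_deriv by blast
 show "f differentiable (at x)" using f' differentiable_def by blast
 have "(\<lambda>x. fder f x v) = (\<lambda>x. f' x v)"
  using frechet_eqI[OF f'(1)] by blast
 then show "algf (\<lambda>x. fder f x v)" using f' by simp
qed

lemma algf_continuous: "algf f \<Longrightarrow> continuous_on S f"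
 by (meson algf_differentiable continuous_at_imp_continuous_on differentiable_imp_continuous_within)

lemma algf_smooth: "algf f \<Longrightarrow> smooth_on UNIV f"
 by (coinduction arbitrary: f rule: smooth_on.coinduct)
  (auto intro: algf_differentiable algf_frechet)

lemma has_derivative_vec:
 fixes f :: "'a::real_normed_vector \<Rightarrow> ('b::real_normed_vector) ^ 'n::finite"
 assumes "\<And>i. ((\<lambda>x. f x $ i) has_derivative (\<lambda>v. f' v $ i)) F"
 shows "(f has_derivative f') F"
proof -
 have bl: "bounded_linear (axis i :: 'b \<Rightarrow> 'b ^ 'n)" for i
 proof (rule bounded_linear_intro[where K = 1])
  have "norm (axis i x) \<le> (\<Sum>j\<in>UNIV. norm (axis i x $ j))" for x :: 'b
   unfolding norm_vec_def by (rule L2_set_le_sum) simp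
  also have "(\<Sum>j\<in>UNIV. norm (axis i x $ j)) = norm x" for x :: 'b
   by (simp add: axis_def if_distrib[of norm] sum.delta cong: if_cong)
  finally show "norm (axis i x) \<le> norm x * 1" for x :: 'b by simp
 qed (auto simp: axis_def vec_eq_iff)
 have e: "(\<Sum>i\<in>UNIV. axis i (y $ i)) = y" for y :: "'b ^ 'n"
  by (simp add: vec_eq_iff axis_def)
 have "((\<lambda>x. \<Sum>i\<in>UNIV. axis i (f x $ i)) has_derivative (\<lambda>v. \<Sum>i\<in>UNIV. axis i (f' v $ i))) F"
  by (intro has_derivative_sum bounded_linear.has_derivative[OF bl] assms)
 then show ?thesis by (simp add: e)
qed

lemma smooth_on_matrixI:
 fixes f :: "'a::euclidean_space \<Rightarrow> complex ^ 'm::finite ^ 'k::finite"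
 assumes "\<forall>a b. algf (\<lambda>x. f x $ a $ b)"
 shows "smooth_on UNIV f"
 using assms
proof (coinduction arbitrary: f rule: smooth_on.coinduct)
 case (smooth_on f)
 define f' where "f' x v = (\<chi> a b. fder (\<lambda>x. f x $ a $ b) x v)" for x v
 have d: "(f has_derivative f' x) (at x)" for x
  by (intro has_derivative_vec)
   (auto simp: f'_def intro!: has_frechet algf_differentiable smooth_on[rule_format])
 have "(\<lambda>x. fder f x v) = (\<lambda>x. f' x v)" for v
  using frechet_eqI[OF d] by blast
 moreover have "algf (\<lambda>x. f' x v $ a $ b)" for v a b
  unfolding f'_def using algf_frechet smooth_on by fastforce
 moreover have "f differentiable (at x)" for x
  using d differentiable_def by blast
 ultimately show ?case
  by (intro exI[of _ f]) simp
qed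

text \<open>Stokes' theorem needs only continuous first derivatives, and the partition of unity
  built for it is shown to have just these.\<close>

definition c1 :: "('a::real_normed_vector \<Rightarrow> 'b::real_normed_vector) \<Rightarrow> bool" where
 "c1 f \<longleftrightarrow> (\<forall>x. f differentiable (at x)) \<and> (\<forall>v. continuous_on UNIV (\<lambda>x. fder f x v))"

lemma c1I: "(\<And>x. (f has_derivative f' x) (at x)) \<Longrightarrow> (\<And>v. continuous_on UNIV (\<lambda>x. f' x v)) \<Longrightarrow> c1 f"
 using frechet_eqI[of f "f' x" x for x] by (auto simp: c1_def differentiable_def)

lemma c1_has: "c1 f \<Longrightarrow> (f has_derivative fder f x) (at x)"
 by (simp add: c1_def has_frechet)

lemma c1_cont: "c1 f \<Longrightarrow> continuous_on S (\<lambda>x. fder f x v)"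
 unfolding c1_def using continuous_on_subset[OF _ subset_UNIV] by blast

lemma c1_continuous: "c1 f \<Longrightarrow> continuous_on S f"
 unfolding c1_def by (meson continuous_at_imp_continuous_on differentiable_imp_continuous_within)

lemma c1_algf: "algf f \<Longrightarrow> c1 f"
 by (simp add: c1_def algf_differentiable algf_continuous algf_frechet)

lemma smooth_diff: "smooth_on S f \<Longrightarrow> x \<in> S \<Longrightarrow> f differentiable (at x)"
 by (erule smooth_on.cases) simp

lemma smooth_frechet: "smooth_on S f \<Longrightarrow> smooth_on S (\<lambda>x. fder f x v)"
 by (erule smooth_on.cases) simp

lemma smooth_continuous: "smooth_on UNIV f \<Longrightarrow> continuous_on S f"
 by (meson UNIV_I continuous_at_imp_continuous_on differentiable_imp_continuous_within smooth_diff)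

lemma c1_smooth: "smooth_on UNIV f \<Longrightarrow> c1 f"
 unfolding c1_def using smooth_continuous smooth_diff smooth_frechet by blast

lemma c1_add: assumes "c1 f" "c1 g" shows "c1 (\<lambda>x. f x + g x)"
 by (rule c1I[OF has_derivative_add]) (auto intro!: c1_has assms continuous_intros c1_cont)

lemma c1_mult:
 fixes f g :: "'a::real_normed_vector \<Rightarrow> 'b::real_normed_algebra"
 assumes "c1 f" "c1 g" shows "c1 (\<lambda>x. f x * g x)"
 by (rule c1I[OF has_derivative_mult])
  (auto intro!: c1_has[OF assms(1)] c1_has[OF assms(2)] continuous_intros c1_cont[OF assms(1)] c1_cont[OF assms(2)]
   c1_continuous[OF assms(1)] c1_continuous[OF assms(2)])

lemma c1_const: "c1 (\<lambda>x. c)"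
 by (rule c1I[of _ "\<lambda>_ _. 0"]) auto

lemma c1_sum: "(\<And>a. a \<in> A \<Longrightarrow> c1 (f a)) \<Longrightarrow> c1 (\<lambda>x. \<Sum>a\<in>A. f a x)"
 by (induction A rule: infinite_finite_induct) (auto intro: c1_const c1_add)

lemma c1_compose_real:
 assumes g: "c1 g" and h: "\<And>x. (h has_real_derivative h' x) (at x)" and c: "continuous_on UNIV h'"
 shows "c1 (\<lambda>x. h (g x))"
proof (rule c1I)
 show "((\<lambda>x. h (g x)) has_derivative (\<lambda>v. h' (g x) * fder g x v)) (at x)" for x
  using has_derivative_compose[OF c1_has[OF g], of h "(*) (h' (g x))" x] h[of "g x"]
  by (simp add: has_field_derivative_def)
 show "continuous_on UNIV (\<lambda>x. h' (g x) * fder g x v)" for v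
  by (intro continuous_intros c1_cont g continuous_on_compose2[OF c c1_continuous[OF g]]) auto
qed

lemma c1_of_real: assumes g: "c1 g" shows "c1 (\<lambda>x. complex_of_real (g x))"
 by (rule c1I[where f' = "\<lambda>x v. of_real (fder g x v)"])
  (auto intro!: derivative_intros c1_has g continuous_intros c1_cont)

subsection \<open>Continuously differentiable forms\<close>

definition cform :: "('a::real_normed_vector) form \<Rightarrow> bool" where
 "cform \<omega> \<longleftrightarrow> (\<forall>vs. c1 (\<lambda>p. \<omega> p vs)) \<and> (\<forall>p. tens (\<omega> p))"

lemma cform_c1: "cform \<omega> \<Longrightarrow> c1 (\<lambda>p. \<omega> p vs)"
 and cform_tens: "cform \<omega> \<Longrightarrow> tens (\<omega> p)"
 and cform_fdiff: "cform \<omega> \<Longrightarrow> fdiff \<omega> p"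
 by (auto simp: cform_def fdiff_def c1_def)

lemma cform_smooth: "smooth_form \<omega> \<Longrightarrow> cform \<omega>"
 by (simp add: smooth_form_iff cform_def c1_smooth)

lemma cform_Cons: "cform \<omega> \<Longrightarrow> cform (\<lambda>p us. \<omega> p (v # us))"
 by (simp add: cform_def tens_Cons)

lemma c1_wdg:
 assumes "\<And>vs. c1 (\<lambda>p. f p vs)" "\<And>vs. c1 (\<lambda>p. g p vs)"
 shows "c1 (\<lambda>p. wdg (f p) (g p) vs)"
 using assms
proof (induction vs arbitrary: f g)
 case Nil
 show ?case by (simp add: c1_mult Nil)
next
 case (Cons v vs)
 have "c1 (\<lambda>p. bar (f p) us)" for us
  unfolding bar_def by (intro c1_mult c1_const Cons.prems)
 then show ?case by (auto intro!: c1_add Cons)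
qed

lemma cform_wdg: "cform f \<Longrightarrow> cform g \<Longrightarrow> cform (\<lambda>p. wdg (f p) (g p))"
 unfolding cform_def by (auto intro: c1_wdg tens_wdg)

lemma cform_mult: "c1 f \<Longrightarrow> cform \<omega> \<Longrightarrow> cform (\<lambda>p us. f p * \<omega> p us)"
 unfolding cform_def by (auto intro: c1_mult tens_scale)

lemma linear_fD: "f differentiable (at p) \<Longrightarrow> linear (fder f p)"
 by (rule linear_frechet_derivative)

lemma tens_ext_deriv:
 assumes "cform \<omega>" shows "tens (ext_deriv \<omega> p)"
proof (rule tensI)
 fix us ws :: "'a list" and v
 show "ext_deriv \<omega> p (us @ v # v # ws) = 0"
  using assms
 proof (induction us arbitrary: \<omega>)
  case Nil
  then show ?case
   by (simp add: ext_deriv_Cons tens_dup0 cform_tens) (simp add: ext_deriv_def tens_dup0 cform_tens)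
 next
  case (Cons u us)
  then show ?case
   by (simp add: ext_deriv_Cons tens_dup cform_tens cform_Cons)
 qed
 have lin: "linear (\<lambda>v. fder (\<lambda>q. \<omega> q (us @ v # ws)) p w)" if "cform \<omega>" for \<omega> :: "'a form" and w us ws
 proof -
  have d: "(\<lambda>q. \<omega> q vs) differentiable (at p)" for vs using cform_fdiff[OF that] by (simp add: fdiff_def)
  note l = tens_linear[OF cform_tens[OF that]]
  show ?thesis
  proof (rule linearI)
   fix a b :: 'a and r :: real
   have "(\<lambda>q. \<omega> q (us @ (a + b) # ws)) = (\<lambda>q. \<omega> q (us @ a # ws) + \<omega> q (us @ b # ws))"
    using linear_add[OF l] by blast
   then show "fder (\<lambda>q. \<omega> q (us @ (a + b) # ws)) p w =
     fder (\<lambda>q. \<omega> q (us @ a # ws)) p w + fder (\<lambda>q. \<omega> q (us @ b # ws)) p w"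
    by (simp only:) (rule frechet_eqI, intro has_derivative_add has_frechet d)
   have "(\<lambda>q. \<omega> q (us @ (r *\<^sub>R a) # ws)) = (\<lambda>q. r *\<^sub>R \<omega> q (us @ a # ws))"
    using linear_scale[OF l] by blast
   then show "fder (\<lambda>q. \<omega> q (us @ (r *\<^sub>R a) # ws)) p w =
     r *\<^sub>R fder (\<lambda>q. \<omega> q (us @ a # ws)) p w"
    by (simp only:) (rule frechet_eqI, intro has_derivative_scaleR_right has_frechet d)
  qed
 qed
 show "linear (\<lambda>v. ext_deriv \<omega> p (us @ v # ws))"
  using assms
 proof (induction us arbitrary: \<omega>)
  case Nil
  have d: "(\<lambda>q. \<omega> q vs) differentiable (at p)" for vs using cform_fdiff[OF Nil] by (simp add: fdiff_def)
  have "linear (\<lambda>v. ext_deriv (\<lambda>q us. \<omega> q (v # us)) p ws)" using Nil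
  proof (induction ws arbitrary: \<omega>)
   case Nil
   then show ?case by (simp add: linear_zero)
  next
   case (Cons w ws)
   \<comment> \<open>Exchanging \<open>v\<close> and \<open>w\<close> moves the varying argument
     behind the constant \<open>w\<close>, so that the induction hypothesis applies to the
     contraction of \<omega> by \<open>w\<close>.\<close>
   have e: "ext_deriv (\<lambda>q us. \<omega> q (v # us)) p (w # ws) = fder (\<lambda>q. \<omega> q (v # ws)) p w
     + ext_deriv (\<lambda>q us. \<omega> q (w # v # us)) p ws" for v
   proof -
    have "(\<lambda>q us. \<omega> q (v # w # us)) = (\<lambda>q us. - \<omega> q (w # v # us))"
     using tens_swap[OF cform_tens[OF Cons.prems], where us = "[]" and u = v and v = w] by simp
    then show ?thesis
     using cform_fdiff[OF Cons.prems, of p]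
     by (simp add: ext_deriv_Cons[of _ _ w] ext_deriv_minus fdiff_def)
   qed
   show ?case
    unfolding e
    by (intro linear_compose_add lin[where us = "[]", unfolded append_Nil] Cons.prems Cons.IH[of "\<lambda>q us. \<omega> q (w # us)"] cform_Cons)
  qed
  then show ?case
   unfolding append_Nil ext_deriv_Cons by (intro linear_compose_sub linear_fD d)
 next
  case (Cons u us)
  show ?case
   unfolding append_Cons ext_deriv_Cons
   by (intro linear_compose_sub lin Cons.IH cform_Cons Cons.prems)
 qed
qed

subsection \<open>Symmetry of second derivatives\<close>

text \<open>The second difference over a parallelogram is a first difference in direction
  \<open>u\<close> of a first difference in direction \<open>v\<close>; the mean value theorem is
  applied once in each direction.\<close>

lemma mixed_mvt:
 fixes f :: "'a::real_normed_vector \<Rightarrow> real"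
 assumes f: "\<And>x. (f has_derivative f' x) (at x)"
  and fu: "\<And>x. ((\<lambda>y. f' y u) has_derivative fu' x) (at x)" and h: "0 < h"
 shows "\<exists>s t. 0 < s \<and> s < h \<and> 0 < t \<and> t < h \<and>
   f (x + h *\<^sub>R u + h *\<^sub>R v) - f (x + h *\<^sub>R u) - f (x + h *\<^sub>R v) + f x = h * h * fu' (x + s *\<^sub>R u + t *\<^sub>R v) v"
proof -
 define G where "G s = f (x + s *\<^sub>R u + h *\<^sub>R v) - f (x + s *\<^sub>R u)" for s
 have sc: "f' y (r *\<^sub>R u) = r * f' y u" "fu' y (r *\<^sub>R v) = r * fu' y v" for y r
  using linear_scale[OF has_derivative_linear[OF f]] linear_scale[OF has_derivative_linear[OF fu]] by simp_all
 have G: "(G has_real_derivative f' (x + s *\<^sub>R u + h *\<^sub>R v) u - f' (x + s *\<^sub>R u) u) (at s)" for s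
  unfolding G_def has_field_derivative_def
  by (rule has_derivative_eq_rhs, (rule has_derivative_diff has_derivative_compose[OF _ f] derivative_eq_intros refl | simp)+)
   (auto simp: sc algebra_simps)
 obtain s where s: "0 < s" "s < h" "G h - G 0 = (h - 0) * (f' (x + s *\<^sub>R u + h *\<^sub>R v) u - f' (x + s *\<^sub>R u) u)"
  using MVT2[OF h, of G, OF G] by blast
 define H where "H t = f' (x + s *\<^sub>R u + t *\<^sub>R v) u" for t
 have H: "(H has_real_derivative fu' (x + s *\<^sub>R u + t *\<^sub>R v) v) (at t)" for t
  unfolding H_def has_field_derivative_def
  by (rule has_derivative_eq_rhs, (rule has_derivative_compose[OF _ fu] derivative_eq_intros refl | simp)+)
   (auto simp: sc algebra_simps)
 obtain t where t: "0 < t" "t < h" "H h - H 0 = (h - 0) * fu' (x + s *\<^sub>R u + t *\<^sub>R v) v"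
  using MVT2[OF h, of H, OF H] by blast
 have "G h - G 0 = h * h * fu' (x + s *\<^sub>R u + t *\<^sub>R v) v"
  using s(3) t(3) by (simp add: H_def)
 then show ?thesis using s t by (intro exI[of _ s] exI[of _ t]) (simp add: G_def)
qed

text \<open>The second difference is symmetric in \<open>u\<close> and \<open>v\<close>, so the two
  mixed derivatives agree at a pair of points whose distance from \<open>x\<close> is of order
  \<open>h\<close>; continuity at \<open>x\<close> gives equality in the limit.\<close>

lemma schwarz_real:
 fixes f :: "'a::real_normed_vector \<Rightarrow> real"
 assumes f: "\<And>x. (f has_derivative f' x) (at x)"
  and fu: "\<And>x. ((\<lambda>y. f' y u) has_derivative fu' x) (at x)"
  and fv: "\<And>x. ((\<lambda>y. f' y v) has_derivative fv' x) (at x)"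
  and cu: "isCont (\<lambda>y. fu' y v) x" and cv: "isCont (\<lambda>y. fv' y u) x"
 shows "fu' x v = fv' x u"
proof -
 have ex: "\<exists>s t s' t'. (0 < s \<and> s < h \<and> 0 < t \<and> t < h) \<and> (0 < s' \<and> s' < h \<and> 0 < t' \<and> t' < h) \<and>
   fu' (x + s *\<^sub>R u + t *\<^sub>R v) v = fv' (x + s' *\<^sub>R v + t' *\<^sub>R u) u" if h: "0 < h" for h
 proof -
  obtain s t where 1: "0 < s \<and> s < h \<and> 0 < t \<and> t < h" "f (x + h *\<^sub>R u + h *\<^sub>R v) - f (x + h *\<^sub>R u) - f (x + h *\<^sub>R v) + f x
    = h * h * fu' (x + s *\<^sub>R u + t *\<^sub>R v) v"
   using mixed_mvt[where f = f and f' = f' and fu' = fu' and x = x and u = u and v = v, OF f fu h] by blast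
  obtain s' t' where 2: "0 < s' \<and> s' < h \<and> 0 < t' \<and> t' < h" "f (x + h *\<^sub>R v + h *\<^sub>R u) - f (x + h *\<^sub>R v) - f (x + h *\<^sub>R u) + f x
    = h * h * fv' (x + s' *\<^sub>R v + t' *\<^sub>R u) u"
   using mixed_mvt[where f = f and f' = f' and fu' = fv' and x = x and u = v and v = u, OF f fv h] by blast
  have "f (x + h *\<^sub>R u + h *\<^sub>R v) = f (x + h *\<^sub>R v + h *\<^sub>R u)" by (simp add: algebra_simps)
  then have "h * h * fu' (x + s *\<^sub>R u + t *\<^sub>R v) v = h * h * fv' (x + s' *\<^sub>R v + t' *\<^sub>R u) u"
   using 1 2 by linarith
  then show ?thesis using 1 2 h by auto
 qed
 define H where "H n = inverse (real (Suc n))" for n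
 have H: "H n > 0" for n by (simp add: H_def)
 have H0: "H \<longlonglongrightarrow> 0" unfolding H_def by (rule LIMSEQ_inverse_real_of_nat)
 obtain s t s' t' where st: "\<And>n. (0 < s n \<and> s n < H n \<and> 0 < t n \<and> t n < H n) \<and>
   (0 < s' n \<and> s' n < H n \<and> 0 < t' n \<and> t' n < H n)"
   "\<And>n. fu' (x + s n *\<^sub>R u + t n *\<^sub>R v) v = fv' (x + s' n *\<^sub>R v + t' n *\<^sub>R u) u"
  using ex[OF H] by metis
 have z: "g \<longlonglongrightarrow> 0" if "\<And>n. 0 < g n \<and> g n < H n" for g
  by (rule tendsto_sandwich[OF _ _ tendsto_const H0]) (use that less_imp_le in \<open>auto intro!: always_eventually\<close>)
 have "(\<lambda>n. x + s n *\<^sub>R u + t n *\<^sub>R v) \<longlonglongrightarrow> x + 0 *\<^sub>R u + 0 *\<^sub>R v"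
  by (intro tendsto_intros z) (use st in auto)
 then have 1: "(\<lambda>n. fu' (x + s n *\<^sub>R u + t n *\<^sub>R v) v) \<longlonglongrightarrow> fu' x v"
  using isCont_tendsto_compose[OF cu] by simp
 have "(\<lambda>n. x + s' n *\<^sub>R v + t' n *\<^sub>R u) \<longlonglongrightarrow> x + 0 *\<^sub>R v + 0 *\<^sub>R u"
  by (intro tendsto_intros z) (use st in auto)
 then have 2: "(\<lambda>n. fv' (x + s' n *\<^sub>R v + t' n *\<^sub>R u) u) \<longlonglongrightarrow> fv' x u"
  using isCont_tendsto_compose[OF cv] by simp
 show ?thesis using LIMSEQ_unique[OF 1] 2 st(2) by simp
qed

lemma schwarz:
 fixes f :: "'a::real_normed_vector \<Rightarrow> 'b::real_inner"
 assumes "smooth_on UNIV f"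
 shows "fder (\<lambda>y. frechet_derivative f (at y) u) x v =
     fder (\<lambda>y. frechet_derivative f (at y) v) x u"
proof -
 define f' where "f' y = fder f y" for y
 define F where "F w y = fder (\<lambda>y. f' y w) y" for w y
 have f: "(f has_derivative f' y) (at y)" for y
  unfolding f'_def using smooth_diff[OF assms] by (simp add: has_frechet)
 have sm: "smooth_on UNIV (\<lambda>y. f' y w)" for w
  unfolding f'_def by (rule smooth_frechet[OF assms])
 have F: "((\<lambda>y. f' y w) has_derivative F w y) (at y)" for w y
  unfolding F_def using smooth_diff[OF sm] by (simp add: has_frechet)
 have cF: "isCont (\<lambda>y. F w y w') y" for w w' y
  unfolding F_def using smooth_continuous[OF smooth_frechet[OF sm]] continuous_on_eq_continuous_at by blast
 have "b \<bullet> F u x v = b \<bullet> F v x u" for b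
  by (rule schwarz_real[where f = "\<lambda>y. b \<bullet> f y" and f' = "\<lambda>y w. b \<bullet> f' y w" and fu' = "\<lambda>y w. b \<bullet> F u y w" and fv' = "\<lambda>y w. b \<bullet> F v y w"])
   (auto intro!: has_derivative_inner_right f F continuous_intros cF)
 then have "(F u x v - F v x u) \<bullet> (F u x v - F v x u) = 0"
  by (simp add: inner_diff_right)
 then show ?thesis by (simp add: F_def f'_def)
qed

text \<open>Contracting with \<open>v\<close> turns the claim into the commutation of the Lie
  derivative along \<open>v\<close> with the exterior derivative, plus the claim for the contracted
  form. The commutation is the inner induction and rests on the symmetry of second
  derivatives.\<close>

lemma ext_deriv_ext_deriv:
 assumes "smooth_form \<eta>" shows "ext_deriv (ext_deriv \<eta>) p vs = 0"
proof -
 have d: "smooth_on UNIV (\<lambda>p. \<eta> p us)" for us using assms by (simp add: smooth_form_iff)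
 then show ?thesis
 proof (induction vs arbitrary: \<eta>)
  case Nil
  then show ?case by simp
 next
  case (Cons v vs)
  have fd1: "fdiff (\<lambda>q. fD \<eta> q v) p" if "\<And>us. smooth_on UNIV (\<lambda>p. \<eta> p us)"
   for \<eta> :: "'a form" and p
   unfolding fdiff_def fD_def using smooth_diff[OF smooth_frechet[OF that] UNIV_I] by blast
  have fd2: "(\<lambda>q. ext_deriv \<eta> q us) differentiable at p" if "\<And>us. smooth_on UNIV (\<lambda>p. \<eta> p us)"
   for \<eta> :: "'a form" and us p
   using that
  proof (induction us arbitrary: \<eta>)
   case Nil then show ?case by simp
  next
   case (Cons u us)
   show ?case
    unfolding ext_deriv_Cons
    by (intro differentiable_diff Cons.IH smooth_diff[OF smooth_frechet UNIV_I] Cons.prems)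
  qed
  let ?\<eta> = "\<lambda>q us. \<eta> q (v # us)"
  have "ext_deriv (ext_deriv \<eta>) p (v # vs) =
    fder (\<lambda>q. ext_deriv \<eta> q vs) p v
    - ext_deriv (\<lambda>q us. fD \<eta> q v us + - ext_deriv ?\<eta> q us) p vs"
   by (simp add: ext_deriv_Cons[of "ext_deriv \<eta>"]) (simp add: ext_deriv_Cons fD_def)
  also have "ext_deriv (\<lambda>q us. fD \<eta> q v us + - ext_deriv ?\<eta> q us) p vs =
    ext_deriv (\<lambda>q. fD \<eta> q v) p vs - ext_deriv (ext_deriv ?\<eta>) p vs"
  proof -
   have "fdiff (ext_deriv ?\<eta>) p" unfolding fdiff_def by (auto intro!: fd2 Cons.prems)
   then show ?thesis
    by (subst ext_deriv_add) (auto intro!: fd1 Cons.prems fdiff_minus simp: ext_deriv_minus)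
  qed
  also have "ext_deriv (ext_deriv ?\<eta>) p vs = 0"
   by (rule Cons.IH) (rule Cons.prems)
  also have "fder (\<lambda>q. ext_deriv \<eta> q vs) p v = ext_deriv (\<lambda>q. fD \<eta> q v) p vs"
   using Cons.prems
  proof (induction vs arbitrary: \<eta>)
   case Nil
   then show ?case by simp
  next
   case (Cons u us)
   have "fder (\<lambda>q. ext_deriv \<eta> q (u # us)) p v =
     fder (\<lambda>q. frechet_derivative (\<lambda>q. \<eta> q us) (at q) u) p v -
     fder (\<lambda>q. ext_deriv (\<lambda>q us. \<eta> q (u # us)) q us) p v"
    unfolding ext_deriv_Cons
    by (rule frechet_eqI, intro has_derivative_diff has_frechet fd2 smooth_diff[OF smooth_frechet UNIV_I] smooth_diff[OF _ UNIV_I] Cons.prems)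
   also have "\<dots> = fder (\<lambda>q. fD \<eta> q v us) p u
     - ext_deriv (\<lambda>q. fD (\<lambda>q us. \<eta> q (u # us)) q v) p us"
    using schwarz[OF Cons.prems[of us], of u p v] Cons.IH[of "\<lambda>q us. \<eta> q (u # us)"] Cons.prems
    by (simp add: fD_def[abs_def])
   also have "\<dots> = ext_deriv (\<lambda>q. fD \<eta> q v) p (u # us)"
    by (simp add: ext_deriv_Cons fD_def[abs_def])
   finally show ?case .
  qed
  finally show ?case by simp
 qed
qed

subsection \<open>Exterior derivative and pullback\<close>

definition one_form :: "('a \<Rightarrow> complex) \<Rightarrow> 'a list \<Rightarrow> complex" where
 "one_form l us = (case us of [u] \<Rightarrow> l u | _ \<Rightarrow> 0)"

lemma one_form_simps [simp]:
 "one_form l [] = 0" "one_form l [u] = l u" "one_form l (u # v # us) = 0"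
 by (simp_all add: one_form_def)

lemma oddc_one_form: "oddc (one_form l)"
 by (auto simp: oddc_def one_form_def split: list.splits)

lemma wdg_one_form_Cons: "wdg (one_form l) g (v # vs) = l v * g vs - wdg (one_form l) (\<lambda>us. g (v # us)) vs"
proof -
 have "(\<lambda>us. one_form l (v # us)) = (\<lambda>us. l v * unitc us)"
  by (auto simp: one_form_def unitc_def fun_eq_iff split: list.splits)
 moreover have "bar (one_form l) = (\<lambda>us. - one_form l us)" by (rule bar_odd[OF oddc_one_form])
 ultimately show ?thesis by (simp add: wdg_scale_left wdg_minus_left)
qed

lemma wdg_one_form_cong:
 "(\<And>us. Suc (length us) = length vs \<Longrightarrow> g us = g' us) \<Longrightarrow> wdg (one_form l) g vs = wdg (one_form l) g' vs"
proof (induction vs arbitrary: g g')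
 case (Cons v vs)
 have "wdg (one_form l) (\<lambda>us. g (v # us)) vs = wdg (one_form l) (\<lambda>us. g' (v # us)) vs"
  by (rule Cons.IH) (simp add: Cons.prems)
 then show ?case using Cons.prems[of vs] by (simp add: wdg_one_form_Cons del: wdg.simps)
qed simp

lemma tens_expand:
 fixes f :: "'a::euclidean_space list \<Rightarrow> complex"
 assumes "tens f" shows "f (v # us) = (\<Sum>b\<in>Basis. of_real (v \<bullet> b) * f (b # us))"
proof -
 have "f (v # us) = f ((\<Sum>b\<in>Basis. (v \<bullet> b) *\<^sub>R b) # us)" by (simp add: euclidean_representation)
 also have "\<dots> = (\<Sum>b\<in>Basis. (v \<bullet> b) *\<^sub>R f (b # us))"
  using linear_sum[OF tens_linear0[OF assms, of us], of "\<lambda>b. (v \<bullet> b) *\<^sub>R b" Basis]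
   linear_scale[OF tens_linear0[OF assms, of us]] by simp
 finally show ?thesis by (simp add: scaleR_conv_of_real)
qed

text \<open>The number operator: contracting with each basis vector and wedging with the dual
  one-form multiplies by the degree. It expresses a form through forms of lower degree, which drives
  the induction for pullbacks.\<close>

lemma tens_euler:
 fixes f :: "'a::euclidean_space list \<Rightarrow> complex"
 assumes "tens f"
 shows "(\<Sum>b\<in>Basis. wdg (one_form (\<lambda>v. of_real (v \<bullet> b))) (\<lambda>us. f (b # us)) vs) = of_nat (length vs) * f vs"
 using assms
proof (induction vs arbitrary: f)
 case (Cons v vs)
 have sw: "f (b # v # us) = - f (v # b # us)" for b us
  using tens_swap[OF Cons.prems, of "[]" b v us] by simp
 show ?case
  using Cons.IH[OF tens_Cons[OF Cons.prems, of v]] tens_expand[OF Cons.prems, of v vs]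
  by (simp add: wdg_one_form_Cons sum_subtractf sum.distrib sw wdg_minus_right sum_negf algebra_simps del: wdg.simps)
qed simp

lemma wdg_map: "wdg f g (map L vs) = wdg (\<lambda>us. f (map L us)) (\<lambda>us. g (map L us)) vs"
proof (induction vs arbitrary: f g)
 case (Cons v vs)
 have "bar f (map L us) = bar (\<lambda>us. f (map L us)) us" for us by (simp add: bar_def)
 then have "(\<lambda>us. bar f (map L us)) = bar (\<lambda>us. f (map L us))" by blast
 then show ?case by (simp add: Cons)
qed simp

lemma one_form_map: "one_form l (map L us) = one_form (\<lambda>v. l (L v)) us"
 by (auto simp: one_form_def split: list.splits)

lemma ext_deriv_cong:
 assumes "\<And>q us. Suc (length us) = length vs \<Longrightarrow> f q us = g q us"
 shows "ext_deriv f p vs = ext_deriv g p vs"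
proof -
 have "f q (take i vs @ drop (Suc i) vs) = g q (take i vs @ drop (Suc i) vs)" if "i < length vs" for q i
  by (rule assms) (use that in simp)
 then show ?thesis by (simp add: ext_deriv_def)
qed

definition pb :: "('b::real_normed_vector \<Rightarrow> 'a::real_normed_vector) \<Rightarrow> 'a form \<Rightarrow> 'b form" where
 "pb \<phi> \<omega> z vs = \<omega> (\<phi> z) (map (fder \<phi> z) vs)"

lemma pb_id: "pb (\<lambda>x. x) \<omega> = \<omega>"
 by (intro ext) (simp add: pb_def)

lemma pb_Cons:
 fixes \<phi> :: "'b::real_normed_vector \<Rightarrow> 'a::euclidean_space"
 assumes "\<And>p. tens (\<omega> p)"
 shows "pb \<phi> \<omega> z (v # vs) = (\<Sum>b\<in>Basis. of_real (fder \<phi> z v \<bullet> b) * pb \<phi> (\<lambda>p us. \<omega> p (b # us)) z vs)"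
 unfolding pb_def list.map using tens_expand[OF assms] by blast

lemma fdiff_pb:
 fixes \<phi> :: "'b::real_normed_vector \<Rightarrow> 'a::euclidean_space"
 assumes \<phi>: "smooth_on UNIV \<phi>" and "cform \<omega>"
 shows "fdiff (pb \<phi> \<omega>) z"
proof -
 have "(\<lambda>z. pb \<phi> \<omega> z vs) differentiable (at z)" for vs
  using assms(2)
 proof (induction vs arbitrary: \<omega>)
  case Nil
  have "(\<lambda>p. \<omega> p []) differentiable (at (\<phi> z))" using cform_fdiff[OF Nil] by (simp add: fdiff_def)
  from differentiable_compose[OF this smooth_diff[OF \<phi> UNIV_I]] show ?case
   by (simp add: pb_def)
 next
  case (Cons v vs)
  have "(\<lambda>z. fder \<phi> z v) differentiable at z"
   by (rule smooth_diff[OF smooth_frechet[OF \<phi>] UNIV_I])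
  then have "(\<lambda>z. complex_of_real (fder \<phi> z v \<bullet> b)) differentiable at z" for b
   unfolding differentiable_def
   using has_derivative_of_real[OF has_derivative_inner_left] by fast
  then have "(\<lambda>z. of_real (fder \<phi> z v \<bullet> b) * pb \<phi> (\<lambda>p us. \<omega> p (b # us)) z vs) differentiable at z" for b
   using Cons.IH[OF cform_Cons[OF Cons.prems]] by (rule differentiable_mult)
  then show ?case
   unfolding pb_Cons[OF cform_tens[OF Cons.prems]] by (intro differentiable_sum) auto
 qed
 then show ?thesis by (simp add: fdiff_def)
qed

text \<open>By the number operator, \<open>n\<close> times the pullback in degree \<open>n\<close>
  is the sum of the differentials of the coordinates of \<phi> times the pullbacks of the contracted
  forms. These differentials are closed by the symmetry of second derivatives, so only the
  derivative of the lower factor remains.\<close>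

lemma ext_deriv_pb_expand:
 fixes \<phi> :: "'b::euclidean_space \<Rightarrow> 'a::euclidean_space"
 assumes \<phi>: "smooth_on UNIV \<phi>" and \<omega>: "cform \<omega>" and vs: "length vs = Suc n"
 shows "of_nat n * ext_deriv (pb \<phi> \<omega>) z vs =
  - (\<Sum>b\<in>Basis. wdg (one_form (\<lambda>v. of_real (fder \<phi> z v \<bullet> b)))
     (ext_deriv (pb \<phi> (\<lambda>p us. \<omega> p (b # us))) z) vs)"
proof -
 define A where "A b z = one_form (\<lambda>v. complex_of_real (fder \<phi> z v \<bullet> b))" for b z
 have A: "((\<lambda>z. A b z us) has_derivative
   (\<lambda>w. one_form (\<lambda>v. of_real (fder (\<lambda>z. frechet_derivative \<phi> (at z) v) z w \<bullet> b)) us)) (at z)" for b us z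
 proof (cases "\<exists>u. us = [u]")
  case True
  then obtain u where us: "us = [u]" by blast
  show ?thesis unfolding A_def us one_form_simps
   by (intro has_derivative_of_real has_derivative_inner_left has_frechet smooth_diff[OF smooth_frechet[OF \<phi>] UNIV_I])
 next
  case False
  then have "one_form l us = 0" for l by (auto simp: one_form_def split: list.splits)
  then show ?thesis by (simp add: A_def)
 qed
 then have fA: "fdiff (A b) z" for b z unfolding fdiff_def differentiable_def by blast
 have dA: "ext_deriv (A b) z us = 0" for b us
 proof -
  have c: "us = [] \<or> (\<exists>u. us = [u]) \<or> (\<exists>u v. us = [u, v]) \<or> (\<exists>u v w ws. us = u # v # w # ws)"
   by (metis neq_Nil_conv)
  have z: "ext_deriv (\<lambda>q us. 0) z us = 0" for us by (simp add: ext_deriv_def)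
  have A0: "(\<lambda>q. A b q []) = (\<lambda>_. 0)" "\<And>u v us. (\<lambda>q. A b q (u # v # us)) = (\<lambda>_. 0)" by (simp_all add: A_def)
  have "ext_deriv (A b) z [u, v] = 0" for u v
  proof -
   have "ext_deriv (A b) z [u, v] = fder (\<lambda>q. A b q [v]) z u - fder (\<lambda>q. A b q [u]) z v"
    by (simp add: ext_deriv_Cons A0)
   also have "\<dots> = 0"
    using frechet_eqI[OF A, of b "[v]" z u] frechet_eqI[OF A, of b "[u]" z v] schwarz[OF \<phi>, of u z v] by simp
   finally show ?thesis .
  qed
  moreover have "ext_deriv (A b) z [u] = 0" for u by (simp add: ext_deriv_Cons A0)
  moreover have "ext_deriv (A b) z (u # v # w # ws) = 0" for u v w ws
   by (simp add: ext_deriv_Cons A0) (simp add: A_def z)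
  ultimately show ?thesis using c by auto
 qed
 have "of_nat n * ext_deriv (pb \<phi> \<omega>) z vs = ext_deriv (\<lambda>q us. of_nat n * pb \<phi> \<omega> q us) z vs"
  by (rule ext_deriv_scale[symmetric]) (rule fdiff_pb[OF \<phi> \<omega>])
 also have "\<dots> = ext_deriv (\<lambda>q us. \<Sum>b\<in>Basis. wdg (A b q) (pb \<phi> (\<lambda>p us. \<omega> p (b # us)) q) us) z vs"
 proof (rule ext_deriv_cong)
  fix q and us :: "'b list" assume "Suc (length us) = length vs"
  then have "length us = n" using vs by simp
  then show "of_nat n * pb \<phi> \<omega> q us = (\<Sum>b\<in>Basis. wdg (A b q) (pb \<phi> (\<lambda>p us. \<omega> p (b # us)) q) us)"
   using tens_euler[OF cform_tens[OF \<omega>], of "\<phi> q" "map (fder \<phi> q) us"]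
   by (simp add: pb_def[abs_def] wdg_map A_def one_form_map)
 qed
 also have "\<dots> = (\<Sum>b\<in>Basis. ext_deriv (\<lambda>q. wdg (A b q) (pb \<phi> (\<lambda>p us. \<omega> p (b # us)) q)) z vs)"
  by (intro ext_deriv_sum fdiff_wdg fA fdiff_pb \<phi> cform_Cons \<omega> finite_Basis)
 also have "\<dots> = (\<Sum>b\<in>Basis. wdg (bar (A b z)) (ext_deriv (pb \<phi> (\<lambda>p us. \<omega> p (b # us))) z) vs)"
 proof (rule sum.cong[OF refl])
  fix b
  have "ext_deriv (A b) z = (\<lambda>_. 0)" using dA by blast
  then show "ext_deriv (\<lambda>q. wdg (A b q) (pb \<phi> (\<lambda>p us. \<omega> p (b # us)) q)) z vs =
    wdg (bar (A b z)) (ext_deriv (pb \<phi> (\<lambda>p us. \<omega> p (b # us))) z) vs"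
   by (simp add: ext_deriv_wdg fA fdiff_pb \<phi> cform_Cons \<omega>)
 qed
 finally show ?thesis
  by (simp add: wdg_minus_left sum_negf A_def bar_odd[OF oddc_one_form])
qed

lemma smooth_ident: "smooth_on UNIV (\<lambda>x. x)"
proof -
 have c: "smooth_on UNIV (\<lambda>x::'a::real_normed_vector. (v::'b::real_normed_vector))" for v
  by (coinduction arbitrary: v) auto
 show ?thesis by (rule smooth_on.intros) (use c in auto)
qed

text \<open>Induction on the degree. In positive degree the expansion for \<phi> and the one for the
  identity map give the same sum, and the factor \<open>Suc n\<close> cancels; in degree zero the
  claim is the chain rule.\<close>

theorem ext_deriv_pb:
 fixes \<phi> :: "'b::euclidean_space \<Rightarrow> 'a::euclidean_space"
 assumes \<phi>: "smooth_on UNIV \<phi>" and \<omega>: "cform \<omega>"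
 shows "ext_deriv (pb \<phi> \<omega>) z vs = pb \<phi> (ext_deriv \<omega>) z vs"
proof (cases vs)
 case Nil
 then show ?thesis by (simp add: pb_def)
next
 case (Cons v ws)
 then have "length vs = Suc (length ws)" by simp
 then show ?thesis using \<omega>
 proof (induction "length ws" arbitrary: ws \<omega> vs)
  case 0
  then obtain v where vs: "vs = [v]" by (metis length_0_conv length_Suc_conv)
  have "((\<lambda>q. \<omega> (\<phi> q) []) has_derivative (\<lambda>v. fder (\<lambda>p. \<omega> p []) (\<phi> z) (fder \<phi> z v))) (at z)"
   by (rule has_derivative_compose[OF has_frechet has_frechet])
    (use smooth_diff[OF \<phi>] cform_fdiff[OF 0(3)] in \<open>auto simp: fdiff_def\<close>)
  then show ?case
   unfolding vs by (simp add: ext_deriv_Cons pb_def frechet_eqI ext_deriv_def)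
 next
  case (Suc n)
  have len: "length vs = Suc (Suc n)" using Suc by simp
  let ?D = "fder \<phi> z"
  have "of_nat (Suc n) * ext_deriv (pb \<phi> \<omega>) z vs =
   - (\<Sum>b\<in>Basis. wdg (one_form (\<lambda>v. of_real (?D v \<bullet> b))) (ext_deriv (pb \<phi> (\<lambda>p us. \<omega> p (b # us))) z) vs)"
   by (rule ext_deriv_pb_expand[OF \<phi> Suc.prems(2) len])
  also have "\<dots> = - (\<Sum>b\<in>Basis. wdg (one_form (\<lambda>v. of_real (?D v \<bullet> b))) (\<lambda>us. ext_deriv (\<lambda>p us. \<omega> p (b # us)) (\<phi> z) (map ?D us)) vs)"
  proof (intro arg_cong[where f = uminus] sum.cong[OF refl] wdg_one_form_cong)
   fix b :: 'a and us :: "'b list" assume "Suc (length us) = length vs"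
   then have l: "length us = Suc n" using len by simp
   have "ext_deriv (pb \<phi> (\<lambda>p us. \<omega> p (b # us))) z us = pb \<phi> (ext_deriv (\<lambda>p us. \<omega> p (b # us))) z us"
    by (rule Suc.hyps(1)[of "tl us"]) (use l cform_Cons[OF Suc.prems(2)] in auto)
   then show "ext_deriv (pb \<phi> (\<lambda>p us. \<omega> p (b # us))) z us = ext_deriv (\<lambda>p us. \<omega> p (b # us)) (\<phi> z) (map ?D us)"
    by (simp add: pb_def)
  qed
  also have "\<dots> = - (\<Sum>b\<in>Basis. wdg (one_form (\<lambda>v. of_real (v \<bullet> b))) (ext_deriv (\<lambda>p us. \<omega> p (b # us)) (\<phi> z)) (map ?D vs))"
   by (simp add: wdg_map one_form_map)
  also have "\<dots> = of_nat (Suc n) * ext_deriv \<omega> (\<phi> z) (map ?D vs)"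
   using ext_deriv_pb_expand[OF smooth_ident Suc.prems(2), of "map ?D vs" "Suc n" "\<phi> z"] len
   by (simp add: pb_id)
  finally show ?case unfolding pb_def by (simp del: of_nat_Suc)
 qed
qed

lemma tens_map: "tens f \<Longrightarrow> linear L \<Longrightarrow> tens (\<lambda>us. f (map L us))"
proof (rule tensI)
 fix us ws assume f: "tens f" and L: "linear L"
 show "linear (\<lambda>v. f (map L (us @ v # ws)))"
  using linear_compose[OF L tens_linear[OF f, of "map L us" "map L ws"]] by (simp add: o_def)
next
 fix us v ws assume f: "tens f"
 then show "f (map L (us @ v # v # ws)) = 0" by (simp add: tens_dup)
qed

lemma tens_continuous:
 fixes f :: "'x::topological_space \<Rightarrow> 'a::euclidean_space list \<Rightarrow> complex"
 assumes "\<And>x. x \<in> S \<Longrightarrow> tens (f x)" "\<And>vs. continuous_on S (\<lambda>x. f x vs)"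
  and "\<And>w. w \<in> set ws \<Longrightarrow> continuous_on S w"
 shows "continuous_on S (\<lambda>x. f x (map (\<lambda>w. w x) ws))"
 using assms
proof (induction ws arbitrary: f)
 case Nil
 then show ?case by simp
next
 case (Cons w ws)
 have "continuous_on S (\<lambda>x. \<Sum>b\<in>Basis. of_real (w x \<bullet> b) * f x (b # map (\<lambda>w. w x) ws))"
  by (intro continuous_intros Cons.IH[of "\<lambda>x us. f x (b # us)" for b] tens_Cons)
   (use Cons.prems in auto)
 then show ?case
  by (rule continuous_on_eq) (simp add: tens_expand[OF Cons.prems(1)])
qed

subsection \<open>Forms of top degree\<close>

lemma tens_swap_far:
 assumes "tens f" shows "f (us @ u # ws @ v # xs) = - f (us @ v # ws @ u # xs)"
proof -
 have l: "f (us @ (a + b) # ws) = f (us @ a # ws) + f (us @ b # ws)" for a b us ws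
  using linear_add[OF tens_linear[OF assms]] by blast
 have "0 = f (us @ (u + v) # ws @ (u + v) # xs)" by (simp add: tens_repeat assms)
 also have "\<dots> = f ((us @ u # ws) @ (u + v) # xs) + f ((us @ v # ws) @ (u + v) # xs)"
  using l[of us u v "ws @ (u + v) # xs"] by simp
 also have "\<dots> = f (us @ u # ws @ v # xs) + f (us @ v # ws @ u # xs)"
  by (simp only: l) (simp add: tens_repeat assms)
 finally show ?thesis by (simp add: eq_neg_iff_add_eq_0)
qed

lemma tens_transpose:
 assumes f: "tens f" and ys: "distinct ys" "a \<in> set ys" "b \<in> set ys" "a \<noteq> b"
 shows "f (map (e \<circ> Transposition.transpose a b) ys) = - f (map e ys)"
proof -
 have *: "f (map (e \<circ> Transposition.transpose a b) (us @ a # ws @ b # xs)) = - f (map e (us @ a # ws @ b # xs))"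
  if "distinct (us @ a # ws @ b # xs)" for us ws xs and a b :: 'b
 proof -
  have "map (e \<circ> Transposition.transpose a b) zs = map e zs" if "a \<notin> set zs" "b \<notin> set zs" for zs
   using that by (auto simp: Transposition.transpose_def)
  then have m: "map (e \<circ> Transposition.transpose a b) us = map e us"
   "map (e \<circ> Transposition.transpose a b) ws = map e ws" "map (e \<circ> Transposition.transpose a b) xs = map e xs"
   using that by auto
  show ?thesis
   unfolding map_append list.map m by (simp add: tens_swap_far[OF f, of "map e us" "e b"])
 qed
 obtain us r where r: "ys = us @ a # r" using ys(2) by (auto dest: split_list)
 have "b \<in> set us \<or> b \<in> set r" using ys r by auto
 then show ?thesis
 proof
  assume "b \<in> set r"
  then obtain ws xs where "r = ws @ b # xs" by (auto dest: split_list)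
  then show ?thesis using *[of us a ws b xs] ys r by simp
 next
  assume "b \<in> set us"
  then obtain vs ws where "us = vs @ b # ws" by (auto dest: split_list)
  then show ?thesis using *[of vs b ws a r] ys r by (simp add: transpose_commute)
 qed
qed

lemma tens_permute:
 fixes ys :: "'m::finite list"
 assumes f: "tens f" and ys: "distinct ys" "set ys = UNIV" and \<sigma>: "\<sigma> permutes UNIV"
 shows "f (map (e \<circ> \<sigma>) ys) = of_int (sign \<sigma>) * f (map e ys)"
 using \<sigma> finite_class.finite_UNIV
proof (induction rule: permutes_induct)
 case id
 show ?case by simp
next
 case (swap a b p)
 have p: "permutation p"
  unfolding permutation_permutes by (rule exI[of _ UNIV]) (simp add: swap.hyps)
 have bij: "bij p" by (rule permutes_bij[OF swap.hyps(4)])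
 have "f (map (e \<circ> (Transposition.transpose a b \<circ> p)) ys) = f (map (e \<circ> Transposition.transpose a b) (map p ys))"
  by (simp add: o_assoc)
 also have "\<dots> = - f (map e (map p ys))"
 proof (rule tens_transpose[OF f])
  show "distinct (map p ys)" using ys bij by (simp add: distinct_map bij_def inj_on_def)
  show "a \<in> set (map p ys)" "b \<in> set (map p ys)" using ys bij by (simp_all add: bij_is_surj)
 qed (rule swap(3))
 also have "\<dots> = of_int (sign (Transposition.transpose a b \<circ> p)) * f (map e ys)"
 proof -
  have "sign (Transposition.transpose a b \<circ> p) = - sign p"
   using swap(3) by (simp add: sign_compose p sign_swap_id permutation_swap_id)
  moreover have "f (map e (map p ys)) = of_int (sign p) * f (map e ys)" by (rule swap.IH[unfolded map_map[symmetric]])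
  ultimately show ?thesis by simp
 qed
 finally show ?case .
qed

lemma tens_multi_expand:
 fixes A :: "'m::finite \<Rightarrow> 'm \<Rightarrow> real" and e :: "'m \<Rightarrow> 'a::real_vector"
 assumes f: "tens f" and "distinct ys"
 shows "f (us @ map (\<lambda>i. \<Sum>k\<in>UNIV. A i k *\<^sub>R e k) ys) =
  (\<Sum>\<sigma>\<in>Pi\<^sub>E (set ys) (\<lambda>_. UNIV). (\<Prod>i\<in>set ys. A i (\<sigma> i)) *\<^sub>R f (us @ map (\<lambda>i. e (\<sigma> i)) ys))"
 using assms(2)
proof (induction ys arbitrary: us)
 case Nil
 show ?case by simp
next
 case (Cons y ys)
 let ?S = "Pi\<^sub>E (set ys) (\<lambda>_. UNIV :: 'm set)"
 let ?t = "\<lambda>us ys \<sigma>. (\<Prod>i\<in>set ys. A i (\<sigma> i)) *\<^sub>R f (us @ map (\<lambda>i. e (\<sigma> i)) ys)"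
 have y: "y \<notin> set ys" using Cons.prems by simp
 let ?r = "map (\<lambda>i. \<Sum>k\<in>UNIV. A i k *\<^sub>R e k) ys"
 have "f (us @ map (\<lambda>i. \<Sum>k\<in>UNIV. A i k *\<^sub>R e k) (y # ys)) = (\<Sum>k\<in>UNIV. A y k *\<^sub>R f ((us @ [e k]) @ ?r))"
  using linear_sum[OF tens_linear[OF f, of us ?r], of "\<lambda>k. A y k *\<^sub>R e k" UNIV]
   linear_scale[OF tens_linear[OF f, of us ?r]] by simp
 also have "\<dots> = (\<Sum>k\<in>UNIV. \<Sum>\<sigma>\<in>?S. A y k *\<^sub>R ?t (us @ [e k]) ys \<sigma>)"
  using Cons.IH[of "us @ [e k]" for k] Cons.prems by (simp only: distinct.simps scaleR_sum_right)
 also have "\<dots> = (\<Sum>(k, \<sigma>)\<in>UNIV \<times> ?S. ?t us (y # ys) (\<sigma>(y := k)))"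
 proof (subst sum.cartesian_product, rule sum.cong[OF refl], clarify)
  fix k and \<sigma> :: "'m \<Rightarrow> 'm"
  have "(\<Prod>i\<in>set ys. A i ((\<sigma>(y := k)) i)) = (\<Prod>i\<in>set ys. A i (\<sigma> i))"
   by (rule prod.cong) (use y in auto)
  then have p: "(\<Prod>i\<in>set (y # ys). A i ((\<sigma>(y := k)) i)) = A y k * (\<Prod>i\<in>set ys. A i (\<sigma> i))"
   using y by simp
  have m: "map (\<lambda>i. e ((\<sigma>(y := k)) i)) (y # ys) = e k # map (\<lambda>i. e (\<sigma> i)) ys"
   using y by auto
  show "A y k *\<^sub>R ?t (us @ [e k]) ys \<sigma> = ?t us (y # ys) (\<sigma>(y := k))"
   unfolding m p by simp
 qed
 also have "\<dots> = (\<Sum>\<sigma>\<in>(\<lambda>(k, \<sigma>). \<sigma>(y := k)) ` (UNIV \<times> ?S). ?t us (y # ys) \<sigma>)"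
  by (subst sum.reindex[OF inj_combinator[OF y]]) (simp add: case_prod_unfold o_def)
 also have "(\<lambda>(k, \<sigma>). \<sigma>(y := k)) ` (UNIV \<times> ?S) = Pi\<^sub>E (set (y # ys)) (\<lambda>_. UNIV)"
  by (simp add: PiE_insert_eq)
 finally show ?case .
qed

text \<open>Multilinear expansion runs over all index maps \<sigma>. Those that are not injective
  repeat an argument and contribute zero; the permutations produce their signs, which is the Leibniz
  formula for the transposed matrix.\<close>

theorem tens_det:
 fixes T :: "real ^ 'm \<Rightarrow> real ^ 'm::finite" and f :: "(real ^ 'm) list \<Rightarrow> complex"
 assumes f: "tens f" and T: "linear T" and ys: "distinct ys" "set ys = UNIV"
 shows "f (map (\<lambda>i. T (axis i 1)) ys) = of_real (det (matrix T)) * f (map (\<lambda>i. axis i 1) ys)"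
proof -
 let ?e = "\<lambda>i. axis i (1::real) :: real ^ 'm"
 have T: "T (?e i) = (\<Sum>k\<in>UNIV. (matrix T $ k $ i) *\<^sub>R ?e k)" for i
  by (simp add: matrix_def vec_eq_iff axis_def if_distrib cong: if_cong)
 have "f (map (\<lambda>i. T (?e i)) ys) =
   (\<Sum>\<sigma>\<in>UNIV. (\<Prod>i\<in>UNIV. matrix T $ \<sigma> i $ i) *\<^sub>R f (map (?e \<circ> \<sigma>) ys))"
  unfolding T using tens_multi_expand[OF f ys(1), of "[]" "\<lambda>i k. matrix T $ k $ i" ?e]
  by (simp add: ys(2) PiE_UNIV_domain o_def)
 also have "\<dots> = (\<Sum>\<sigma> | \<sigma> permutes UNIV. (\<Prod>i\<in>UNIV. matrix T $ \<sigma> i $ i) *\<^sub>R f (map (?e \<circ> \<sigma>) ys))"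
 proof (rule sum.mono_neutral_right)
  show "\<forall>\<sigma>\<in>UNIV - {\<sigma>. \<sigma> permutes UNIV}. (\<Prod>i\<in>UNIV. matrix T $ \<sigma> i $ i) *\<^sub>R f (map (?e \<circ> \<sigma>) ys) = 0"
  proof
   fix \<sigma> :: "'m \<Rightarrow> 'm" assume "\<sigma> \<in> UNIV - {\<sigma>. \<sigma> permutes UNIV}"
   then have "\<not> bij \<sigma>" by (auto simp: permutes_def bij_iff)
   then have "\<not> inj \<sigma>" by (simp add: bij_def finite_UNIV_inj_surj)
   then have "\<not> distinct (map (?e \<circ> \<sigma>) ys)"
    by (simp add: distinct_map ys inj_on_def axis_eq_axis)
   then show "(\<Prod>i\<in>UNIV. matrix T $ \<sigma> i $ i) *\<^sub>R f (map (?e \<circ> \<sigma>) ys) = 0"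
    by (simp add: tens_not_distinct[OF f])
  qed
 qed auto
 also have "\<dots> = (\<Sum>\<sigma> | \<sigma> permutes UNIV. of_real (of_int (sign \<sigma>) * (\<Prod>i\<in>UNIV. transpose (matrix T) $ i $ \<sigma> i)) * f (map ?e ys))"
  by (rule sum.cong) (auto simp: tens_permute[OF f ys] scaleR_conv_of_real transpose_def)
 also have "\<dots> = of_real (det (transpose (matrix T))) * f (map ?e ys)"
  by (simp add: det_def sum_distrib_right)
 finally show ?thesis by simp
qed

subsection \<open>Real coordinates on a complex vector space\<close>

text \<open>The change of variables theorem of the library requires a well-ordered index type.\<close>

typedef ('d::finite) ridx = "{..<2 * CARD('d)}"
 by (rule exI[of _ 0]) simp

instantiation ridx :: (finite) wellorder
begin
definition "x \<le> y \<longleftrightarrow> Rep_ridx x \<le> Rep_ridx y"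
definition "x < y \<longleftrightarrow> Rep_ridx x < Rep_ridx y"
instance
proof
 fix P and a :: "'a ridx"
 assume *: "\<And>x::'a ridx. (\<And>y. y < x \<Longrightarrow> P y) \<Longrightarrow> P x"
 show "P a"
  by (induction a rule: measure_induct_rule[of Rep_ridx]) (use * less_ridx_def in blast)
qed (auto simp: less_eq_ridx_def less_ridx_def Rep_ridx_inject)
end

instance ridx :: (finite) finite
proof
 show "finite (UNIV :: 'a ridx set)"
  unfolding type_definition.Abs_image[OF type_definition_ridx, symmetric] by simp
qed

lemma real_frame_props: "distinct (real_frame :: (complex ^ 'd::finite) list)" (is ?a)
 "set (real_frame :: (complex ^ 'd::finite) list) = Basis" (is ?b)
 "length (real_frame :: (complex ^ 'd::finite) list) = 2 * CARD('d)" (is ?c)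
proof -
 define js :: "'d list" where "js = (SOME js. distinct js \<and> set js = UNIV)"
 have js: "distinct js \<and> set js = UNIV"
  unfolding js_def by (rule someI_ex) (metis finite_class.finite_UNIV finite_distinct_list)
 have e: "real_frame = concat (map (\<lambda>j::'d. [axis j 1, axis j \<i>]) js)"
  unfolding real_frame_def js_def ..
 have "distinct (concat (map (\<lambda>j::'d. [axis j (1::complex), axis j \<i>]) xs))" if "distinct xs" for xs
  using that by (induction xs) (auto simp: axis_eq_axis)
 then show a: ?a using js e by metis
 show b: ?b
  unfolding e using js by (auto simp: Basis_vec_def Basis_complex_def)
 show ?c
  using distinct_card[OF a] b by simp
qed

definition frv :: "('d::finite) ridx \<Rightarrow> complex ^ 'd" where
 "frv k = real_frame ! Rep_ridx k"

definition of_vec :: "real ^ ('d::finite ridx) \<Rightarrow> complex ^ 'd" where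
 "of_vec x = (\<Sum>k\<in>UNIV. (x $ k) *\<^sub>R frv k)"

definition to_vec :: "complex ^ 'd \<Rightarrow> real ^ ('d::finite ridx)" where
 "to_vec w = (\<chi> k. w \<bullet> frv k)"

lemma bij_betw_frv: "bij_betw frv (UNIV :: ('d::finite) ridx set) Basis"
proof -
 have 1: "bij_betw Rep_ridx (UNIV :: 'd ridx set) {..<2 * CARD('d)}"
  by (metis type_definition.Rep_range type_definition_ridx bij_betw_def inj_on_def Rep_ridx_inject)
 have 2: "bij_betw ((!) (real_frame :: (complex ^ 'd) list)) {..<2 * CARD('d)} Basis"
  using bij_betw_nth[of "real_frame :: (complex ^ 'd) list"] real_frame_props[where 'd = 'd] by simp
 show ?thesis
  using bij_betw_trans[OF 1 2] by (simp add: frv_def[abs_def] o_def)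
qed

lemma frv_Basis [simp]: "frv k \<in> Basis"
 using bij_betw_frv bij_betwE by blast

lemma inner_frv: "frv k \<bullet> frv l = (if k = l then 1 else 0)"
 using inj_eq[OF bij_betw_imp_inj_on[OF bij_betw_frv], of k l] by (simp add: inner_Basis)

lemma sum_frv: "(\<Sum>b\<in>Basis. g b) = (\<Sum>k\<in>UNIV. g (frv k))"
 using sum.reindex_bij_betw[OF bij_betw_frv] by metis

lemma to_of_vec [simp]: "to_vec (of_vec x) = x"
 by (simp add: to_vec_def of_vec_def vec_eq_iff inner_sum_left inner_frv if_distrib cong: if_cong)

lemma of_to_vec [simp]: "of_vec (to_vec w) = w"
 using sum_frv[of "\<lambda>b. (w \<bullet> b) *\<^sub>R b"] by (simp add: to_vec_def of_vec_def euclidean_representation)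

lemma of_vec_axis: "of_vec (axis k 1) = frv k"
 by (simp add: of_vec_def axis_def if_distrib[of "\<lambda>x. x *\<^sub>R _"] cong: if_cong)

lemma linear_of_vec: "linear of_vec"
 by (rule linearI) (simp_all add: of_vec_def algebra_simps sum.distrib scaleR_sum_right)

lemma linear_to_vec: "linear to_vec"
 by (rule linearI) (simp_all add: to_vec_def vec_eq_iff inner_add_left)

definition detR :: "(complex ^ 'd \<Rightarrow> complex ^ ('d::finite)) \<Rightarrow> real" where
 "detR T = det (matrix (\<lambda>x. to_vec (T (of_vec x))))"

lemma tens_real_frame:
 fixes T :: "complex ^ 'd \<Rightarrow> complex ^ ('d::finite)"
 assumes f: "tens f" and T: "linear T"
 shows "f (map T real_frame) = of_real (detR T) * f real_frame"
proof -
 define ys :: "'d ridx list" where "ys = map Abs_ridx [0..<2 * CARD('d)]"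
 have inv: "Rep_ridx (Abs_ridx i :: 'd ridx) = i" if "i < 2 * CARD('d)" for i
  using that by (simp add: Abs_ridx_inverse)
 have ys: "distinct ys" "set ys = UNIV"
 proof -
  show "distinct ys"
   unfolding ys_def distinct_map
  proof (intro conjI inj_onI)
   fix i j assume "i \<in> set [0..<2 * CARD('d)]" "j \<in> set [0..<2 * CARD('d)]"
    "Abs_ridx i = (Abs_ridx j :: 'd ridx)"
   then have "Rep_ridx (Abs_ridx i :: 'd ridx) = Rep_ridx (Abs_ridx j :: 'd ridx)" "i < 2 * CARD('d)" "j < 2 * CARD('d)" by simp_all
   then show "i = j" by (simp only: inv)
  qed simp
  show "set ys = UNIV"
   unfolding ys_def unfolding type_definition.Abs_image[OF type_definition_ridx, symmetric]
   by (simp add: atLeast0LessThan)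
 qed
 have fr: "map (\<lambda>i. of_vec (axis i 1)) ys = (real_frame :: (complex ^ 'd) list)"
  unfolding ys_def of_vec_axis
  by (rule nth_equalityI) (simp_all add: real_frame_props frv_def inv)
 have l: "linear (\<lambda>x. to_vec (T (of_vec x)))"
  using linear_compose[OF linear_compose[OF linear_of_vec T] linear_to_vec] by (simp add: o_def)
 have "f (map T real_frame) = f (map of_vec (map (\<lambda>i. to_vec (T (of_vec (axis i 1)))) ys))"
  unfolding fr[symmetric] by (simp add: o_def)
 also have "\<dots> = of_real (detR T) * f (map of_vec (map (\<lambda>i. axis i 1) ys))"
  unfolding detR_def by (rule tens_det[OF tens_map[OF f linear_of_vec] l ys])
 also have "map of_vec (map (\<lambda>i. axis i 1) ys) = (real_frame :: (complex ^ 'd) list)"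
  unfolding fr[symmetric] by (simp add: o_def)
 finally show ?thesis .
qed

text \<open>
 A complex linear automorphism is joined to the identity inside the complex line through both,
 off the countable set of zeros of the complex determinant.
\<close>

lemma detR_pos:
 fixes T :: "complex ^ 'd \<Rightarrow> complex ^ ('d::finite)"
 assumes T: "linear T" and Ti: "\<And>v. T (\<i> *s v) = \<i> *s T v" and inj: "inj T"
 shows "detR T > 0"
proof -
 have sR: "r *\<^sub>R v = complex_of_real r *s v" for r and v :: "complex ^ 'd"
  by (simp add: vec_eq_iff scaleR_conv_of_real[where 'a = complex])
 have sc: "c *s v = Re c *\<^sub>R v + Im c *\<^sub>R (\<i> *s v)" for c and v :: "complex ^ 'd"
  by (simp add: vec_eq_iff complex_eq_iff)
 have Tc: "T (c *s v) = c *s T v" for c v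
  unfolding sc[of c] by (simp add: linear_add[OF T] linear_scale[OF T] Ti)
 have "Vector_Spaces.linear (*s) (*s) T"
  by unfold_locales (auto simp: linear_add[OF T] Tc vec.scale_right_distrib vec.scale_left_distrib)
 then have Tm: "matrix T *v v = T v" for v by (rule matrix_works)
 define M where "M z = (\<chi> i j. (1 - z) * (if i = j then 1 else 0) + z * matrix T $ i $ j)" for z
 define Z where "Z = {z. det (M z) = 0}"
 have M0: "M 0 = mat 1" and M1: "M 1 = matrix T" by (simp_all add: M_def mat_def vec_eq_iff)
 have hol: "(\<lambda>z. det (M z)) holomorphic_on UNIV"
  unfolding det_def M_def by (auto intro!: holomorphic_intros)
 have "countable Z"
 proof (cases "(\<lambda>z. det (M z)) constant_on UNIV")
  case True
  then obtain c where "\<And>z. det (M z) = c" by (auto simp: constant_on_def)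
  moreover have "det (M 0) = 1" by (simp add: M0)
  ultimately have "Z = {}" by (auto simp: Z_def)
  then show ?thesis by simp
 next
  case False
  have "countable {z \<in> UNIV. det (M z) = 0}"
   by (rule holomorphic_countable_zeros[OF hol]) (use False fsigma_UNIV in auto)
  then show ?thesis by (simp add: Z_def)
 qed
 then have conn: "connected (- Z)"
  by (intro path_connected_imp_connected path_connected_complement_countable) auto
 define P where "P z = detR ((*v) (M z))" for z
 have comp: "(to_vec (M z *v frv l)) $ k = (\<Sum>i\<in>UNIV. (M z *v frv l) $ i \<bullet> (frv k $ i))" for z l and k :: "'d ridx"
  by (simp add: to_vec_def inner_vec_def)
 have "continuous_on (- Z) P"
  unfolding P_def detR_def det_def matrix_def
  by (auto simp: of_vec_axis comp matrix_vector_mult_def M_def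
    intro!: continuous_intros linear_continuous_on_compose[OF _ linear_to_vec])
 then have cP: "connected (P ` (- Z))" using conn by (rule connected_continuous_image)
 have linM: "linear ((*v) (M z))" for z
  by (rule linearI) (simp_all add: matrix_vector_right_distrib sR vector_scalar_commute)
 have nz: "P z \<noteq> 0" if "z \<notin> Z" for z
 proof -
  have "invertible (M z)" using that by (simp add: Z_def invertible_det_nz)
  then have "inj ((*v) (M z))" by (rule inj_matrix_vector_mult)
  then have "inj (\<lambda>x. to_vec (M z *v of_vec x))"
   by (metis (no_types, lifting) injI inj_eq of_to_vec to_of_vec)
  moreover have "linear (\<lambda>x. to_vec (M z *v of_vec x))"
   using linear_compose[OF linear_compose[OF linear_of_vec linM] linear_to_vec] by (simp add: o_def)
  ultimately show ?thesis
   unfolding P_def detR_def using det_nz_iff_inj by blast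
 qed
 have "M 0 *v of_vec x = of_vec x" for x :: "real ^ 'd ridx" by (simp add: M0)
 then have P0: "P 0 = 1"
  unfolding P_def detR_def by (simp add: matrix_id_mat_1[unfolded id_def])
 have P1: "P 1 = detR T" by (simp add: P_def M1 Tm[abs_def])
 have "1 \<notin> Z"
 proof -
  have "inj ((*v) (matrix T))" using inj Tm by (simp add: inj_def)
  then have "invertible (matrix T)"
   by (simp add: invertible_left_inverse matrix_left_invertible_injective inj_def)
  then show ?thesis by (simp add: Z_def M1 invertible_det_nz)
 qed
 have "0 \<notin> Z" by (simp add: Z_def M0)
 show ?thesis
 proof (rule ccontr)
  assume "\<not> detR T > 0"
  then have "P 1 \<le> 0" using P1 by simp
  moreover have "0 \<le> P 0" using P0 by simp
  moreover have "P 1 \<in> P ` (- Z)" "P 0 \<in> P ` (- Z)" using \<open>1 \<notin> Z\<close> \<open>0 \<notin> Z\<close> by auto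
  ultimately have "0 \<in> P ` (- Z)" using connectedD_interval[OF cP] by blast
  then show False using nz by auto
 qed
qed

subsection \<open>Change of variables\<close>

lemma of_vec_borel [measurable]: "of_vec \<in> borel \<rightarrow>\<^sub>M borel"
 by (intro borel_measurable_continuous_onI linear_continuous_on linear_conv_bounded_linear[THEN iffD1] linear_of_vec)

text \<open>\<open>of_vec\<close> carries the standard basis to the real orthonormal basis of the
  complex space, so preimages of boxes are boxes with the same side lengths.\<close>

lemma distr_of_vec: "distr lborel borel of_vec = (lborel :: (complex ^ 'd::finite) measure)"
proof (rule lborel_eqI[symmetric])
 fix l u :: "complex ^ 'd" assume le: "\<And>b. b \<in> Basis \<Longrightarrow> l \<bullet> b \<le> u \<bullet> b"
 have "of_vec -` box l u = box (to_vec l) (to_vec u)"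
 proof -
  have "of_vec x \<in> box l u \<longleftrightarrow> x \<in> box (to_vec l) (to_vec u)" for x
  proof -
   have "of_vec x \<in> box l u \<longleftrightarrow> (\<forall>k. l \<bullet> frv k < of_vec x \<bullet> frv k \<and> of_vec x \<bullet> frv k < u \<bullet> frv k)"
    unfolding mem_box using bij_betw_frv[where 'd = 'd] by (metis bij_betw_imp_surj_on frv_Basis imageE)
   moreover have "of_vec x \<bullet> frv k = x $ k" for k
    using to_of_vec[of x] by (metis to_vec_def vec_lambda_beta)
   ultimately show ?thesis by (simp add: mem_box_cart to_vec_def)
  qed
  then show ?thesis by blast
 qed
 moreover have "(\<Prod>b\<in>Basis. (u - l) \<bullet> b) = (\<Prod>b\<in>Basis. (to_vec u - to_vec l) \<bullet> b)"
 proof -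
  have "(\<Prod>b\<in>Basis. (u - l) \<bullet> b) = (\<Prod>k\<in>UNIV. (u - l) \<bullet> frv k)"
   using prod.reindex_bij_betw[OF bij_betw_frv, of "\<lambda>b. (u - l) \<bullet> b"] by simp
  also have "\<dots> = (\<Prod>k\<in>UNIV. (to_vec u - to_vec l) \<bullet> axis k 1)"
   by (simp add: inner_axis to_vec_def inner_diff_left)
  also have "\<dots> = (\<Prod>b\<in>Basis. (to_vec u - to_vec l) \<bullet> b)"
  proof -
   have "bij_betw (\<lambda>k. axis k (1::real)) UNIV (Basis :: (real ^ 'd ridx) set)"
    by (auto simp: bij_betw_def inj_on_def axis_eq_axis Basis_vec_def)
   then show ?thesis using prod.reindex_bij_betw by blast
  qed
  finally show ?thesis .
 qed
 moreover have "to_vec l \<bullet> b \<le> to_vec u \<bullet> b" if b: "b \<in> Basis" for b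
 proof -
  obtain k where "b = axis k 1" using b by (auto simp: Basis_vec_def)
  then show ?thesis using le[OF frv_Basis[of k]] by (simp add: inner_axis to_vec_def)
 qed
 ultimately show "emeasure (distr lborel borel of_vec) (box l u) = ennreal (\<Prod>b\<in>Basis. (u - l) \<bullet> b)"
  by (simp add: emeasure_distr emeasure_lborel_box)
qed simp

lemma distr_lebesgue_of_vec: "distr lebesgue lebesgue of_vec = (lebesgue :: (complex ^ 'd::finite) measure)"
 and of_vec_lebesgue [measurable]: "of_vec \<in> lebesgue \<rightarrow>\<^sub>M (lebesgue :: (complex ^ 'd::finite) measure)"
proof -
 have m: "of_vec \<in> lebesgue \<rightarrow>\<^sub>M (lborel :: (complex ^ 'd) measure)"
  by (simp add: measurable_completion)
 have d: "distr lebesgue lborel of_vec = (lborel :: (complex ^ 'd) measure)"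
  using distr_of_vec by (simp add: distr_completion cong: distr_cong)
 show "distr lebesgue lebesgue of_vec = (lebesgue :: (complex ^ 'd) measure)"
  using completion.completion_distr_eq[OF m] d by simp
 show "of_vec \<in> lebesgue \<rightarrow>\<^sub>M (lebesgue :: (complex ^ 'd) measure)"
  by (rule completion.measurable_completion2[OF m]) (simp add: d)
qed

lemma change_vars_vec:
 fixes h :: "real ^ 'm::{finite,wellorder} \<Rightarrow> real" and g :: "real ^ 'm::_ \<Rightarrow> real ^ 'm::_"
 assumes S: "S \<in> sets lebesgue"
  and g: "\<And>x. x \<in> S \<Longrightarrow> (g has_derivative g' x) (at x within S)" and inj: "inj_on g S"
  and int: "set_integrable lebesgue S (\<lambda>x. \<bar>det (matrix (g' x))\<bar> * h (g x))"
 shows "set_integrable lebesgue (g ` S) h"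
  "set_lebesgue_integral lebesgue (g ` S) h = (LINT x:S|lebesgue. \<bar>det (matrix (g' x))\<bar> * h (g x))"
proof -
 have 1: "(\<lambda>x. \<bar>det (matrix (g' x))\<bar> *\<^sub>R (vec (h (g x)) :: real ^ 1)) absolutely_integrable_on S"
  using int by (simp add: absolutely_integrable_on_1_iff)
 have 2: "(\<lambda>x. vec (h x) :: real ^ 1) absolutely_integrable_on (g ` S)"
  "integral (g ` S) (\<lambda>x. vec (h x) :: real ^ 1) = integral S (\<lambda>x. \<bar>det (matrix (g' x))\<bar> *\<^sub>R (vec (h (g x)) :: real ^ 1))"
  using has_absolute_integral_change_of_variables[OF S g inj, of "\<lambda>x. vec (h x) :: real ^ 1"] 1 by blast+
 show 3: "set_integrable lebesgue (g ` S) h"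
  using 2(1) by (simp add: absolutely_integrable_on_1_iff)
 show "set_lebesgue_integral lebesgue (g ` S) h = (LINT x:S|lebesgue. \<bar>det (matrix (g' x))\<bar> * h (g x))"
  using 2(2) by (simp add: set_lebesgue_integral_eq_integral(2)[OF 3] set_lebesgue_integral_eq_integral(2)[OF int]
    integral_on_1_eq vec_eq_iff)
qed

lemma set_integral_of_vec:
 fixes h :: "complex ^ 'd::finite \<Rightarrow> 'b::{banach,second_countable_topology}"
 assumes h: "(\<lambda>x. indicator S x *\<^sub>R h x) \<in> borel_measurable lebesgue"
 shows "set_integrable lebesgue S h \<longleftrightarrow> set_integrable lebesgue (of_vec -` S) (\<lambda>x. h (of_vec x))"
  "set_lebesgue_integral lebesgue S h = (LINT x:of_vec -` S|lebesgue. h (of_vec x))"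
proof -
 have i: "indicator (of_vec -` S) x = (indicator S (of_vec x) :: real)" for x
  by (simp add: indicator_def)
 show "set_integrable lebesgue S h \<longleftrightarrow> set_integrable lebesgue (of_vec -` S) (\<lambda>x. h (of_vec x))"
  unfolding set_integrable_def i
  by (subst distr_lebesgue_of_vec[symmetric], subst integrable_distr_eq[OF of_vec_lebesgue h]) simp
 show "set_lebesgue_integral lebesgue S h = (LINT x:of_vec -` S|lebesgue. h (of_vec x))"
  unfolding set_lebesgue_integral_def i
  by (subst distr_lebesgue_of_vec[symmetric], subst integral_distr[OF of_vec_lebesgue h]) simp
qed

text \<open>Preimages under \<open>to_vec\<close> are images under the linear map
  \<open>of_vec\<close> between spaces of equal real dimension, and such images of Lebesgue sets are
  Lebesgue sets.\<close>

lemma to_vec_lebesgue [measurable]: "to_vec \<in> (lebesgue :: (complex ^ 'd::finite) measure) \<rightarrow>\<^sub>M lebesgue"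
proof (rule measurableI)
 fix A :: "(real ^ 'd ridx) set" assume A: "A \<in> sets lebesgue"
 have "card (UNIV :: 'd ridx set) = card (Basis :: (complex ^ 'd) set)"
  by (rule bij_betw_same_card[OF bij_betw_frv])
 then have "DIM(real ^ 'd ridx) \<le> DIM(complex ^ 'd)" by simp
 moreover have "of_vec differentiable_on A"
  by (intro linear_imp_differentiable_on linear_of_vec)
 ultimately have "of_vec ` A \<in> sets lebesgue"
  by (rule differentiable_image_in_sets_lebesgue[OF A])
 moreover have "to_vec -` A = of_vec ` A"
  by (auto simp: image_iff) (metis of_to_vec)
 ultimately show "to_vec -` A \<inter> space lebesgue \<in> sets lebesgue" by simp
qed simp

lemma change_vars_real:
 fixes g :: "complex ^ 'd::finite \<Rightarrow> complex ^ 'd" and h :: "complex ^ 'd \<Rightarrow> real"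
 assumes S: "S \<in> sets lebesgue"
  and g: "\<And>x. x \<in> S \<Longrightarrow> (g has_derivative g' x) (at x within S)" and inj: "inj_on g S"
  and int: "set_integrable lebesgue S (\<lambda>x. \<bar>detR (g' x)\<bar> * h (g x))"
 shows "set_integrable lebesgue (g ` S) h \<and>
  set_lebesgue_integral lebesgue (g ` S) h = (LINT x:S|lebesgue. \<bar>detR (g' x)\<bar> * h (g x))"
proof -
 let ?S = "of_vec -` S" and ?G = "\<lambda>x. to_vec (g (of_vec x))"
 let ?G' = "\<lambda>x v. to_vec (g' (of_vec x) (of_vec v))"
 have S': "?S \<in> sets lebesgue" using measurable_sets[OF of_vec_lebesgue S] by simp
 have G: "(?G has_derivative ?G' x) (at x within ?S)" if "x \<in> ?S" for x
 proof -
  have 1: "(of_vec has_derivative of_vec) (at x within ?S)"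
   by (rule linear_imp_has_derivative[OF linear_of_vec])
  have "(g has_derivative g' (of_vec x)) (at (of_vec x) within of_vec ` ?S)"
   by (rule has_derivative_subset[OF g]) (use that in auto)
  from diff_chain_within[OF 1 this]
  have "((\<lambda>x. g (of_vec x)) has_derivative (\<lambda>v. g' (of_vec x) (of_vec v))) (at x within ?S)"
   by (simp add: o_def)
  from has_derivative_compose[OF this linear_imp_has_derivative[OF linear_to_vec]]
  show ?thesis .
 qed
 have inj': "inj_on ?G ?S"
 proof (rule inj_onI)
  fix x y assume xy: "x \<in> ?S" "y \<in> ?S" "?G x = ?G y"
  then have "g (of_vec x) = g (of_vec y)" by (metis of_to_vec)
  then have "of_vec x = of_vec y" using inj xy by (auto dest: inj_onD)
  then show "x = y" by (metis to_of_vec)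
 qed
 have det: "detR (g' (of_vec x)) = det (matrix (?G' x))" for x by (simp add: detR_def)
 have meas: "(\<lambda>x. indicator S x *\<^sub>R (\<bar>detR (g' x)\<bar> * h (g x))) \<in> borel_measurable lebesgue"
  using int unfolding set_integrable_def by (rule borel_measurable_integrable)
 have int': "set_integrable lebesgue ?S (\<lambda>x. \<bar>det (matrix (?G' x))\<bar> * h (of_vec (?G x)))"
  using set_integral_of_vec(1)[OF meas] int by (simp add: det)
 have im: "?G ` ?S = of_vec -` (g ` S)"
 proof (intro set_eqI iffI)
  fix y assume "y \<in> of_vec -` (g ` S)"
  then obtain x where "x \<in> S" "of_vec y = g x" by auto
  then show "y \<in> ?G ` ?S"
   by (intro image_eqI[of _ _ "to_vec x"]) (auto simp flip: \<open>of_vec y = g x\<close>)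
 qed auto
 have cv1: "set_integrable lebesgue (of_vec -` (g ` S)) (\<lambda>x. h (of_vec x))"
  and cv2: "(LINT x:of_vec -` (g ` S)|lebesgue. h (of_vec x)) = (LINT x:?S|lebesgue. \<bar>det (matrix (?G' x))\<bar> * h (of_vec (?G x)))"
  using change_vars_vec[OF S' G inj' int'] unfolding im by auto
 have "(\<lambda>x. indicator (of_vec -` (g ` S)) x *\<^sub>R h (of_vec x)) \<in> borel_measurable lebesgue"
  using cv1 unfolding set_integrable_def by (rule borel_measurable_integrable)
 from measurable_compose[OF to_vec_lebesgue this]
 have meas2: "(\<lambda>x. indicator (g ` S) x *\<^sub>R h x) \<in> borel_measurable lebesgue"
  by (simp add: indicator_def)
 show ?thesis
  using set_integral_of_vec[OF meas2] set_integral_of_vec(2)[OF meas] cv1 cv2 by (simp add: det)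
qed

lemma set_integrable_complex_iff:
 fixes h :: "'a \<Rightarrow> complex"
 shows "set_integrable M S h \<longleftrightarrow> set_integrable M S (\<lambda>x. Re (h x)) \<and> set_integrable M S (\<lambda>x. Im (h x))"
proof
 assume "set_integrable M S h"
 then show "set_integrable M S (\<lambda>x. Re (h x)) \<and> set_integrable M S (\<lambda>x. Im (h x))"
  unfolding set_integrable_def
  using integrable_bounded_linear[OF bounded_linear_Re, of M "\<lambda>x. indicator S x *\<^sub>R h x"]
   integrable_bounded_linear[OF bounded_linear_Im, of M "\<lambda>x. indicator S x *\<^sub>R h x"] by simp
next
 assume a: "set_integrable M S (\<lambda>x. Re (h x)) \<and> set_integrable M S (\<lambda>x. Im (h x))"
 have "integrable M (\<lambda>x. complex_of_real (indicator S x *\<^sub>R Re (h x)) + \<i> * complex_of_real (indicator S x *\<^sub>R Im (h x)))"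
  using a unfolding set_integrable_def by (intro Bochner_Integration.integrable_add integrable_mult_right integrable_of_real) auto
 moreover have "complex_of_real (indicator S x *\<^sub>R Re (h x)) + \<i> * complex_of_real (indicator S x *\<^sub>R Im (h x)) = indicator S x *\<^sub>R h x" for x
  by (simp add: complex_eq_iff)
 ultimately show "set_integrable M S h" by (simp add: set_integrable_def)
qed

lemma set_integral_complex_eq:
 fixes h :: "'a \<Rightarrow> complex"
 assumes "set_integrable M S h"
 shows "set_lebesgue_integral M S h = Complex (LINT x:S|M. Re (h x)) (LINT x:S|M. Im (h x))"
 using assms unfolding set_integrable_def set_lebesgue_integral_def
 by (simp add: complex_eq_iff integral_bounded_linear[OF bounded_linear_Re, symmetric]
   integral_bounded_linear[OF bounded_linear_Im, symmetric])

text \<open>The completed measure is used because images under \<open>g\<close> are handled as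
  Lebesgue sets. Integrability over the image is part of the conclusion, so pieces of a manifold can
  be moved between charts without prior knowledge about the target integral.\<close>

theorem change_vars:
 fixes g :: "complex ^ 'd::finite \<Rightarrow> complex ^ 'd" and h :: "complex ^ 'd \<Rightarrow> complex"
 assumes S: "S \<in> sets lebesgue"
  and g: "\<And>x. x \<in> S \<Longrightarrow> (g has_derivative g' x) (at x within S)" and inj: "inj_on g S"
  and int: "set_integrable lebesgue S (\<lambda>x. of_real \<bar>detR (g' x)\<bar> * h (g x))"
 shows "set_integrable lebesgue (g ` S) h"
  "set_lebesgue_integral lebesgue (g ` S) h = (LINT x:S|lebesgue. of_real \<bar>detR (g' x)\<bar> * h (g x))"
proof -
 note i = int[unfolded set_integrable_complex_iff]
 note re = change_vars_real[OF S g inj, of "\<lambda>x. Re (h x)"]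
 note im = change_vars_real[OF S g inj, of "\<lambda>x. Im (h x)"]
 show 1: "set_integrable lebesgue (g ` S) h"
  unfolding set_integrable_complex_iff using i re im by simp
 show "set_lebesgue_integral lebesgue (g ` S) h = (LINT x:S|lebesgue. of_real \<bar>detR (g' x)\<bar> * h (g x))"
  using i re im by (simp add: set_integral_complex_eq[OF 1] set_integral_complex_eq[OF int])
qed

lemma set_integral_lebesgue:
 fixes f :: "'a::euclidean_space \<Rightarrow> complex"
 assumes "set_integrable lborel A f"
 shows "set_integrable lebesgue A f" "set_lebesgue_integral lebesgue A f = set_lebesgue_integral lborel A f"
 using assms borel_measurable_integrable[of lborel "\<lambda>x. indicator A x *\<^sub>R f x"]
 unfolding set_integrable_def set_lebesgue_integral_def
 by (auto simp: integrable_completion integral_completion)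

subsection \<open>Stokes' theorem for compactly supported forms on a vector space\<close>

text \<open>Every difference quotient in direction \<open>v\<close> has integral zero by translation
  invariance, and the derivative is their dominated limit. The bound comes from the mean value
  inequality.\<close>

lemma integral_derivative_zero:
 fixes f :: "'a::euclidean_space \<Rightarrow> complex"
 assumes f: "c1 f" and supp: "\<And>x. norm x > R \<Longrightarrow> f x = 0"
 shows "integrable lborel (\<lambda>x. fder f x v)"
  "(LINT x|lborel. fder f x v) = 0"
proof -
 let ?D = "\<lambda>x. fder f x v"
 have supp': "?D x = 0" if "norm x > R" for x
 proof -
  have "open (- cball 0 R :: 'a set)" by (simp add: open_Compl)
  then have "((\<lambda>_. 0) has_derivative fder f x) (at x)"
   by (rule has_derivative_transform_within_open[OF c1_has[OF f]]) (use that supp in auto)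
  then show ?thesis using frechet_eqI[of "\<lambda>_. 0" "\<lambda>_. 0" x v] frechet_eqI by fastforce
 qed
 have cD: "continuous_on UNIV ?D" by (rule c1_cont[OF f])
 have "\<exists>C. \<forall>x. norm (?D x) \<le> C"
 proof -
  have "bounded (?D ` cball 0 R)"
   by (intro compact_imp_bounded compact_continuous_image continuous_on_subset[OF cD]) auto
  then obtain C where C: "\<And>x. x \<in> cball 0 R \<Longrightarrow> norm (?D x) \<le> C" unfolding bounded_iff by blast
  have "norm (?D x) \<le> max C 0" for x
   by (cases "norm x > R") (use supp' C[of x] in auto)
  then show ?thesis by blast
 qed
 then obtain C where C: "\<And>x. norm (?D x) \<le> C" by blast
 \<comment> \<open>All steps are at most as long as \<open>v\<close>, so the quotients vanish
   outside the ball enlarged by \<open>norm v\<close>.\<close>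
 have bd: "integrable lborel (\<lambda>x. C * indicator (cball 0 (R + norm v)) x :: real)"
  using emeasure_bounded_finite[OF bounded_cball, of 0 "R + norm v"]
  by (intro integrable_mult_right integrable_real_indicator) auto
 have f_int: "integrable lborel f"
 proof -
  have "set_integrable lborel (cball 0 R) f"
   unfolding set_integrable_def
   by (rule borel_integrable_compact) (auto intro: c1_continuous[OF f])
  moreover have "indicator (cball 0 R) x *\<^sub>R f x = f x" for x
   using supp[of x] by (auto simp: indicator_def)
  ultimately show ?thesis by (simp add: set_integrable_def)
 qed
 define q where "q n x = of_nat (Suc n) * (f (x + inverse (real (Suc n)) *\<^sub>R v) - f x)" for n x
 have fline: "((\<lambda>s. f (x + s *\<^sub>R v)) has_derivative (\<lambda>r. r *\<^sub>R fder f (x + s *\<^sub>R v) v)) (at s)" for x s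
 proof -
  have "((\<lambda>s. x + s *\<^sub>R v) has_derivative (\<lambda>s. s *\<^sub>R v)) (at s)" by (auto intro!: derivative_eq_intros)
  from has_derivative_compose[OF this c1_has[OF f]] show ?thesis
   by (simp add: linear_scale[OF has_derivative_linear[OF c1_has[OF f]]])
 qed
 have lb: "lborel = distr lborel borel ((+) c)" for c :: 'a by (simp add: lborel_distr_plus)
 have sh: "integrable lborel (\<lambda>x. f (x + c))" "(LINT x|lborel. f (x + c)) = integral\<^sup>L lborel f" for c
 proof -
  have m: "f \<in> borel_measurable borel" using f_int by simp
  show "integrable lborel (\<lambda>x. f (x + c))"
   using f_int by (subst (asm) lb[of c]) (simp add: integrable_distr_eq m add.commute)
  show "(LINT x|lborel. f (x + c)) = integral\<^sup>L lborel f"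
   by (subst (2) lb[of c]) (simp add: integral_distr m add.commute)
 qed
 have q0: "integral\<^sup>L lborel (q n) = 0" for n
  unfolding q_def by (simp add: sh f_int)
 have qm: "q n \<in> borel_measurable lborel" for n
  unfolding q_def using sh(1) f_int by (intro borel_measurable_times borel_measurable_diff) auto
 have qlim: "(\<lambda>n. q n x) \<longlonglongrightarrow> ?D x" for x
 proof -
  have "((\<lambda>s. norm (f (x + s *\<^sub>R v) - f x - s *\<^sub>R ?D x) / norm s) \<longlongrightarrow> 0) (at 0)"
   using fline[of x 0] by (simp add: has_derivative_iff_norm)
  then have "((\<lambda>s. norm ((f (x + s *\<^sub>R v) - f x) /\<^sub>R s - ?D x)) \<longlongrightarrow> 0) (at 0)"
  proof (rule Lim_transform_eventually)
   have "norm (f (x + s *\<^sub>R v) - f x - s *\<^sub>R ?D x) / norm s = norm ((f (x + s *\<^sub>R v) - f x) /\<^sub>R s - ?D x)"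
    if "s \<noteq> 0" for s
   proof -
    have "(f (x + s *\<^sub>R v) - f x) /\<^sub>R s - ?D x = (f (x + s *\<^sub>R v) - f x - s *\<^sub>R ?D x) /\<^sub>R s"
     using that by (simp add: scaleR_diff_right)
    then show ?thesis by (simp add: divide_inverse mult.commute)
   qed
   then show "\<forall>\<^sub>F s in at 0. norm (f (x + s *\<^sub>R v) - f x - s *\<^sub>R ?D x) / norm s = norm ((f (x + s *\<^sub>R v) - f x) /\<^sub>R s - ?D x)"
    by (auto simp: eventually_at_filter)
  qed
  then have "((\<lambda>s. (f (x + s *\<^sub>R v) - f x) /\<^sub>R s) \<longlongrightarrow> ?D x) (at 0)"
   by (subst Lim_null) (rule tendsto_norm_zero_cancel)
  moreover have "filterlim (\<lambda>n. inverse (real (Suc n))) (at 0) sequentially"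
   by (rule filterlim_atI[OF LIMSEQ_inverse_real_of_nat]) auto
  ultimately have "(\<lambda>n. (f (x + inverse (real (Suc n)) *\<^sub>R v) - f x) /\<^sub>R inverse (real (Suc n))) \<longlonglongrightarrow> ?D x"
   by (rule filterlim_compose)
  then show ?thesis by (simp add: q_def scaleR_conv_of_real del: of_nat_Suc)
 qed
 have qb: "norm (q n x) \<le> C * indicator (cball 0 (R + norm v)) x" for n x
 proof (cases "x \<in> cball 0 (R + norm v)")
  case True
  let ?h = "inverse (real (Suc n))"
  have "norm (f (x + ?h *\<^sub>R v) - f (x + 0 *\<^sub>R v)) \<le> C * norm (?h - 0)"
  proof (rule differentiable_bound[of UNIV "\<lambda>s. f (x + s *\<^sub>R v)" "\<lambda>s r. r *\<^sub>R fder f (x + s *\<^sub>R v) v"])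
   show "((\<lambda>s. f (x + s *\<^sub>R v)) has_derivative (\<lambda>r. r *\<^sub>R fder f (x + s *\<^sub>R v) v)) (at s within UNIV)" for s
    by (rule fline)
   show "onorm (\<lambda>r. r *\<^sub>R fder f (x + s *\<^sub>R v) v) \<le> C" for s
    by (rule onorm_le) (use mult_left_mono[OF C[of "x + s *\<^sub>R v"] abs_ge_zero] in \<open>simp add: mult.commute[of C]\<close>)
  qed auto
  then have "norm (f (x + ?h *\<^sub>R v) - f x) \<le> C * ?h" by simp
  then have "real (Suc n) * norm (f (x + ?h *\<^sub>R v) - f x) \<le> real (Suc n) * (C * ?h)"
   by (rule mult_left_mono) simp
  also have "\<dots> = C" by (simp add: field_simps)
  finally show ?thesis using True by (simp add: q_def norm_mult del: of_nat_Suc)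
 next
  case False
  have "norm x - norm (inverse (real (Suc n)) *\<^sub>R v) \<le> norm (x + inverse (real (Suc n)) *\<^sub>R v)"
   by (metis norm_diff_ineq)
  moreover have "norm (inverse (real (Suc n)) *\<^sub>R v) \<le> norm v"
   by (simp add: divide_simps) (simp add: algebra_simps)
  moreover have "norm x > R + norm v" using False by simp
  ultimately have "norm (x + inverse (real (Suc n)) *\<^sub>R v) > R" "norm x > R"
   using norm_ge_zero[of v] by linarith+
  then show ?thesis using False by (simp add: q_def supp)
 qed
 have Dm: "?D \<in> borel_measurable lborel"
  using borel_measurable_continuous_onI[OF cD] by simp
 show "integrable lborel ?D"
  by (rule integrable_dominated_convergence[where s = q, OF Dm qm bd]) (use qlim qb in auto)
 have "(\<lambda>n. integral\<^sup>L lborel (q n)) \<longlonglongrightarrow> integral\<^sup>L lborel ?D"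
  by (rule integral_dominated_convergence[where s = q, OF Dm qm bd]) (use qlim qb in auto)
 then show "(LINT x|lborel. ?D x) = 0"
  unfolding q0 by (simp add: LIMSEQ_const_iff)
qed

lemma integral_ext_deriv_zero:
 fixes a :: "('a::euclidean_space) form"
 assumes a: "\<And>us. c1 (\<lambda>z. a z us)" and supp: "\<And>z us. norm z > R \<Longrightarrow> a z us = 0"
 shows "(LINT z|lborel. ext_deriv a z vs) = 0"
proof -
 have i: "integrable lborel (\<lambda>z. fder (\<lambda>z. a z us) z v)"
  "(LINT z|lborel. fder (\<lambda>z. a z us) z v) = 0" for us v
  by (rule integral_derivative_zero[OF a, of R]; use supp in blast)+
 show ?thesis
  unfolding ext_deriv_def by (simp add: Bochner_Integration.integral_sum i)
qed

section \<open>Integration over a compact manifold with a finite atlas\<close>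

lemma ext_deriv_local:
 assumes "open S" "p \<in> S" "\<And>q us. q \<in> S \<Longrightarrow> f q us = g q us" "fdiff f p"
 shows "ext_deriv f p vs = ext_deriv g p vs"
proof -
 have "fder (\<lambda>q. f q us) p = fder (\<lambda>q. g q us) p" for us
  by (rule frechet_derivative_transform_within_open[OF _ assms(1,2)]) (use assms in \<open>auto simp: fdiff_def\<close>)
 then show ?thesis by (simp add: ext_deriv_def)
qed

lemma continuous_ext_deriv: "cform \<omega> \<Longrightarrow> continuous_on S (\<lambda>p. ext_deriv \<omega> p vs)"
 unfolding ext_deriv_def by (intro continuous_intros c1_cont cform_c1)

text \<open>What suffices for integration. Exterior derivatives of \<open>cform\<close> forms
  satisfy it, although their coefficients need not be differentiable.\<close>

definition admissible :: "('a::real_normed_vector) form \<Rightarrow> bool" where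
 "admissible \<omega> \<longleftrightarrow> (\<forall>p. tens (\<omega> p)) \<and> (\<forall>vs. continuous_on UNIV (\<lambda>p. \<omega> p vs))"

lemma admissible_cform: "cform \<omega> \<Longrightarrow> admissible \<omega>"
 by (simp add: admissible_def cform_tens c1_continuous cform_c1)

lemma admissible_ext_deriv: "cform \<omega> \<Longrightarrow> admissible (ext_deriv \<omega>)"
 by (simp add: admissible_def tens_ext_deriv continuous_ext_deriv)

lemma continuous_wdg:
 assumes "\<And>vs. continuous_on S (\<lambda>p. f p vs)" "\<And>vs. continuous_on S (\<lambda>p. g p vs)"
 shows "continuous_on S (\<lambda>p. wdg (f p) (g p) vs)"
 using assms
proof (induction vs arbitrary: f g)
 case Nil
 then show ?case by (auto intro!: continuous_intros)
next
 case (Cons v vs)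
 have "continuous_on S (\<lambda>p. bar (f p) us)" for us
  unfolding bar_def by (intro continuous_intros Cons.prems)
 then show ?case by (auto intro!: continuous_on_add Cons)
qed

lemma admissible_wdg: "admissible f \<Longrightarrow> admissible g \<Longrightarrow> admissible (\<lambda>p. wdg (f p) (g p))"
 by (simp add: admissible_def tens_wdg continuous_wdg)

lemma admissible_add: "admissible f \<Longrightarrow> admissible g \<Longrightarrow> admissible (\<lambda>p us. f p us + g p us)"
 by (auto simp: admissible_def intro!: tens_add continuous_intros)

section \<open>Finite atlases of holomorphic charts and uniqueness of the integral\<close>

lemma frechet_in_tangent_space:
 assumes "open U" "z \<in> U" "\<phi> ` U \<subseteq> X" "\<phi> differentiable (at z)"
 shows "fder \<phi> z h \<in> tangent_space X (\<phi> z)"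
proof -
 \<comment> \<open>Tangent vectors are velocities of curves that stay in \<open>X\<close> for all
   times. Outside of \<open>U\<close> the curve is parked at the base point, which does not affect
   its velocity at 0.\<close>
 define \<gamma> where "\<gamma> t = (if z + t *\<^sub>R h \<in> U then \<phi> (z + t *\<^sub>R h) else \<phi> z)" for t :: real
 have "((\<lambda>t. z + t *\<^sub>R h) has_derivative (\<lambda>t. t *\<^sub>R h)) (at 0)" by (auto intro!: derivative_eq_intros)
 moreover have "(\<phi> has_derivative fder \<phi> z) (at (z + 0 *\<^sub>R h))"
  using has_frechet[OF assms(4)] by simp
 ultimately have "((\<lambda>t. \<phi> (z + t *\<^sub>R h)) has_derivative (\<lambda>t. fder \<phi> z (t *\<^sub>R h))) (at 0)"
  by (rule has_derivative_compose)
 then have "(\<gamma> has_derivative (\<lambda>t. fder \<phi> z (t *\<^sub>R h))) (at 0)"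
 proof (rule has_derivative_transform_within_open)
  have "continuous_on UNIV (\<lambda>t::real. z + t *\<^sub>R h)" by (intro continuous_intros)
  then show "open ((\<lambda>t::real. z + t *\<^sub>R h) -` U)" by (rule open_vimage[OF assms(1)])
 qed (use assms in \<open>auto simp: \<gamma>_def\<close>)
 then have "(\<gamma> has_vector_derivative fder \<phi> z h) (at 0)"
  by (simp add: has_vector_derivative_def linear_scale[OF linear_frechet_derivative[OF assms(4)]])
 moreover have "range \<gamma> \<subseteq> X" "\<gamma> 0 = \<phi> z" using assms by (auto simp: \<gamma>_def)
 ultimately show ?thesis unfolding tangent_space_def by blast
qed

text \<open>Every chart is defined on the whole coordinate space. Its inverse
  \<open>\<kappa> k\<close> and the function \<open>g k\<close>, which on \<open>X\<close> is
  positive exactly on the image of the chart, are defined for all matrices, so that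
  differentiability and cutoffs can be treated in the ambient space.\<close>

locale hol_atlas =
 fixes X :: "'N::finite cmatrix set" and m :: nat
  and \<phi> :: "nat \<Rightarrow> complex ^ 'd::finite \<Rightarrow> 'N cmatrix"
  and \<kappa> :: "nat \<Rightarrow> 'N cmatrix \<Rightarrow> complex ^ 'd"
  and g :: "nat \<Rightarrow> 'N cmatrix \<Rightarrow> real"
 assumes param: "k < m \<Longrightarrow> holomorphic_parametrization X UNIV (\<phi> k)"
  and left_inv: "k < m \<Longrightarrow> \<kappa> k (\<phi> k z) = z"
  and right_inv: "k < m \<Longrightarrow> p \<in> X \<Longrightarrow> g k p > 0 \<Longrightarrow> \<phi> k (\<kappa> k p) = p"
  and pos: "k < m \<Longrightarrow> g k (\<phi> k z) > 0"
  and \<kappa>_diff: "k < m \<Longrightarrow> g k p > 0 \<Longrightarrow> \<kappa> k differentiable (at p)"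
  and g_c1: "k < m \<Longrightarrow> c1 (g k)"
  and compact_X: "compact X" and cover: "p \<in> X \<Longrightarrow> \<exists>k<m. g k p > 0"
begin

lemma smooth: "k < m \<Longrightarrow> smooth_on UNIV (\<phi> k)"
 and in_X: "k < m \<Longrightarrow> \<phi> k z \<in> X"
 using param unfolding holomorphic_parametrization_def by blast+

lemma D_tangent: "k < m \<Longrightarrow> fder (\<phi> k) z h \<in> tangent_space X (\<phi> k z)"
 by (rule frechet_in_tangent_space[of UNIV]) (use in_X smooth_diff[OF smooth] in auto)

lemma mem_chart: "k < m \<Longrightarrow> p \<in> X \<Longrightarrow> p \<in> \<phi> k ` B \<longleftrightarrow> g k p > 0 \<and> \<kappa> k p \<in> B"
 using left_inv right_inv pos by (metis image_iff)

text \<open>Both parametrisations turn multiplication by \<i> into \<open>cstruct\<close>, and the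
  derivative of the chart is injective; hence the derivative \<open>T\<close> of the coordinate
  change commutes with \<i> and preserves orientation. The absolute value in the change of variables
  can then be dropped.\<close>

lemma transition:
 assumes \<psi>: "holomorphic_parametrization X U \<psi>" and z: "z \<in> U" and k: "k < m" "g k (\<psi> z) > 0"
 obtains T where "((\<lambda>z. \<kappa> k (\<psi> z)) has_derivative T) (at z)" "detR T > 0"
  "\<And>\<omega>. tens (\<omega> (\<psi> z)) \<Longrightarrow> form_density \<omega> \<psi> z = of_real (detR T) * form_density \<omega> (\<phi> k) (\<kappa> k (\<psi> z))"
proof -
 let ?D\<psi> = "fder \<psi> z" and ?D\<phi> = "fder (\<phi> k) (\<kappa> k (\<psi> z))"
 define T where "T h = fder (\<kappa> k) (\<psi> z) (?D\<psi> h)" for h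
 have U: "open U" and sm: "smooth_on U \<psi>" and X: "\<psi> ` U \<subseteq> X" and inj: "inj ?D\<psi>"
  and hol: "\<And>h. ?D\<psi> (\<i> *s h) = cstruct (\<psi> z) (?D\<psi> h)"
  using \<psi> z unfolding holomorphic_parametrization_def by auto
 have d\<psi>: "\<psi> differentiable (at w)" if "w \<in> U" for w using smooth_diff[OF sm that] .
 have d\<psi>': "(\<psi> has_derivative ?D\<psi>) (at z)" by (rule has_frechet[OF d\<psi>[OF z]])
 have T: "((\<lambda>z. \<kappa> k (\<psi> z)) has_derivative T) (at z)"
  unfolding T_def[abs_def] by (rule has_derivative_compose[OF d\<psi>' has_frechet[OF \<kappa>_diff[OF k]]])
 have lT: "linear T" by (rule has_derivative_linear[OF T])
 have p: "\<psi> z \<in> X" "\<phi> k (\<kappa> k (\<psi> z)) = \<psi> z" using X z right_inv[OF k(1) _ k(2)] by auto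
 have "((\<lambda>z. \<phi> k (\<kappa> k (\<psi> z))) has_derivative (\<lambda>h. ?D\<phi> (T h))) (at z)"
  by (rule has_derivative_compose[OF T has_frechet[OF smooth_diff[OF smooth[OF k(1)] UNIV_I]]])
 moreover have "open {w \<in> U. g k (\<psi> w) > 0}"
 proof -
  have "continuous_on U (\<lambda>w. g k (\<psi> w))"
   by (intro continuous_on_compose2[OF c1_continuous[OF g_c1[OF k(1)], of UNIV]]
     continuous_at_imp_continuous_on ballI differentiable_imp_continuous_within d\<psi>) auto
  from continuous_open_preimage[OF this U open_greaterThan, of 0]
  show ?thesis by (simp add: Int_def vimage_def)
 qed
 ultimately have "(\<psi> has_derivative (\<lambda>h. ?D\<phi> (T h))) (at z)"
  by (rule has_derivative_transform_within_open) (use z k X right_inv in auto)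
 then have D: "?D\<psi> h = ?D\<phi> (T h)" for h
  using frechet_eqI d\<psi>' by blast
 have inj\<phi>: "inj ?D\<phi>" and hol\<phi>: "?D\<phi> (\<i> *s h) = cstruct (\<psi> z) (?D\<phi> h)" for h
  using param[OF k(1)] p unfolding holomorphic_parametrization_def by auto
 have "detR T > 0"
 proof (rule detR_pos[OF lT])
  fix v
  have "?D\<phi> (T (\<i> *s v)) = ?D\<phi> (\<i> *s T v)" by (simp only: hol\<phi> hol flip: D)
  then show "T (\<i> *s v) = \<i> *s T v" using inj\<phi> by (simp add: inj_eq)
 next
  show "inj T" using inj D by (metis inj_def)
 qed
 moreover have "form_density \<omega> \<psi> z = of_real (detR T) * form_density \<omega> (\<phi> k) (\<kappa> k (\<psi> z))" if "tens (\<omega> (\<psi> z))" for \<omega>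
 proof -
  have "linear ?D\<phi>" by (rule linear_frechet_derivative[OF smooth_diff[OF smooth[OF k(1)] UNIV_I]])
  from tens_real_frame[OF tens_map[OF that this] lT]
  show ?thesis by (simp add: form_density_def p D[abs_def] o_def)
 qed
 ultimately show thesis using that T by blast
qed

text \<open>\<open>S\<close> and \<open>T\<close> are the same part of \<open>X\<close>, seen in the
  coordinates of \<psi> and of the chart; the coordinate change maps \<open>S\<close> bijectively
  onto \<open>T\<close>.\<close>

lemma piece_transfer:
 fixes \<psi> :: "complex ^ 'd \<Rightarrow> 'N cmatrix"
 assumes \<psi>: "holomorphic_parametrization X U \<psi>" and k: "k < m"
  and A: "A \<in> sets borel" "A \<subseteq> U" and B: "B \<in> sets borel"
  and \<omega>: "\<And>p. tens (\<omega> p)" and int: "set_integrable lborel A (form_density \<omega> \<psi>)"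
 defines "S \<equiv> {z \<in> A. \<psi> z \<in> \<phi> k ` B}" and "T \<equiv> {w \<in> B. \<phi> k w \<in> \<psi> ` A}"
 shows "S \<in> sets borel" "T \<in> sets lebesgue" "set_integrable lebesgue S (form_density \<omega> \<psi>)"
  "set_integrable lebesgue T (form_density \<omega> (\<phi> k))"
  "set_lebesgue_integral lebesgue S (form_density \<omega> \<psi>) = set_lebesgue_integral lebesgue T (form_density \<omega> (\<phi> k))"
proof -
 have U: "open U" and sm: "smooth_on U \<psi>" and X: "\<psi> ` U \<subseteq> X" and inj: "inj_on \<psi> U"
  using \<psi> unfolding holomorphic_parametrization_def by auto
 have c\<psi>: "continuous_on U \<psi>"
  by (intro continuous_at_imp_continuous_on ballI differentiable_imp_continuous_within smooth_diff[OF sm])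
 define W where "W = {z \<in> U. g k (\<psi> z) > 0}"
 define \<tau> where "\<tau> z = \<kappa> k (\<psi> z)" for z
 have oW: "open W"
 proof -
  have "continuous_on U (\<lambda>w. g k (\<psi> w))"
   by (rule continuous_on_compose2[OF c1_continuous[OF g_c1[OF k], of UNIV] c\<psi>]) auto
  from continuous_open_preimage[OF this U open_greaterThan, of 0]
  show ?thesis by (simp add: Int_def vimage_def W_def)
 qed
 have c\<tau>: "continuous_on W \<tau>"
 proof (rule continuous_at_imp_continuous_on, rule ballI)
  fix z assume z: "z \<in> W"
  then obtain D where "(\<tau> has_derivative D) (at z)"
   unfolding \<tau>_def[abs_def] using transition[OF \<psi> _ k] by (metis (no_types, lifting) W_def mem_Collect_eq)
  then show "isCont \<tau> z" by (rule has_derivative_continuous)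
 qed
 have S: "S = A \<inter> {z \<in> W. \<tau> z \<in> B}"
  unfolding S_def W_def \<tau>_def using A(2) X mem_chart[OF k, of _ B] by blast
 show Sb: "S \<in> sets borel"
 proof -
  have "\<tau> \<in> borel_measurable (restrict_space borel W)"
   by (rule borel_measurable_continuous_on_restrict[OF c\<tau>])
  from measurable_sets[OF this B] have "\<tau> -` B \<inter> W \<in> sets (restrict_space borel W)"
   by (simp add: space_restrict_space)
  then have "\<tau> -` B \<inter> W \<in> sets borel"
   using oW by (subst (asm) sets_restrict_space_iff) auto
  moreover have "S = A \<inter> (\<tau> -` B \<inter> W)" unfolding S by blast
  ultimately show ?thesis using A(1) by simp
 qed
 have T: "T = \<tau> ` S"
 proof (intro set_eqI iffI)
  fix w assume "w \<in> T"
  then obtain z where "w \<in> B" "z \<in> A" "\<phi> k w = \<psi> z" by (auto simp: T_def)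
  then show "w \<in> \<tau> ` S"
   by (intro image_eqI[of _ _ z]) (auto simp: \<tau>_def S_def left_inv[OF k] simp flip: \<open>\<phi> k w = \<psi> z\<close>)
 next
  fix w assume "w \<in> \<tau> ` S"
  then obtain z b where "w = \<tau> z" "z \<in> A" "b \<in> B" "\<psi> z = \<phi> k b" by (auto simp: S_def)
  then show "w \<in> T" by (auto simp: T_def \<tau>_def left_inv[OF k]) (metis image_eqI)
 qed
 have "\<exists>T. (\<tau> has_derivative T) (at z) \<and> detR T > 0 \<and> form_density \<omega> \<psi> z = of_real (detR T) * form_density \<omega> (\<phi> k) (\<tau> z)"
  if "z \<in> S" for z
 proof -
  have z: "z \<in> U" "g k (\<psi> z) > 0" using that by (auto simp: S W_def)
  obtain T where "(\<tau> has_derivative T) (at z)" "detR T > 0"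
   "\<And>\<omega>. tens (\<omega> (\<psi> z)) \<Longrightarrow> form_density \<omega> \<psi> z = of_real (detR T) * form_density \<omega> (\<phi> k) (\<tau> z)"
   unfolding \<tau>_def by (rule transition[OF \<psi> z(1) k z(2)]) blast
  then show ?thesis using \<omega> by blast
 qed
 then obtain \<tau>' where \<tau>': "\<And>z. z \<in> S \<Longrightarrow> (\<tau> has_derivative \<tau>' z) (at z)" "\<And>z. z \<in> S \<Longrightarrow> detR (\<tau>' z) > 0"
  "\<And>z. z \<in> S \<Longrightarrow> form_density \<omega> \<psi> z = of_real (detR (\<tau>' z)) * form_density \<omega> (\<phi> k) (\<tau> z)"
  by metis
 have inj\<tau>: "inj_on \<tau> S"
 proof (rule inj_onI)
  fix x y assume xy: "x \<in> S" "y \<in> S" "\<tau> x = \<tau> y"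
  then have "\<psi> x = \<psi> y" using right_inv[OF k] X by (auto simp: S W_def \<tau>_def) (metis image_subset_iff)
  then show "x = y" using inj xy by (auto simp: S W_def dest: inj_onD)
 qed
 have "S \<subseteq> A" by (auto simp: S_def)
 then have int1: "set_integrable lborel S (form_density \<omega> \<psi>)"
  using int Sb by (auto intro: set_integrable_subset)
 from set_integral_lebesgue(1)[OF int1] show int2: "set_integrable lebesgue S (form_density \<omega> \<psi>)" .
 have dens: "of_real \<bar>detR (\<tau>' z)\<bar> * form_density \<omega> (\<phi> k) (\<tau> z) = form_density \<omega> \<psi> z" if "z \<in> S" for z
  using \<tau>'(2,3)[OF that] by simp
 have Sl: "S \<in> sets lebesgue" using Sb by simp
 have int3: "set_integrable lebesgue S (\<lambda>z. of_real \<bar>detR (\<tau>' z)\<bar> * form_density \<omega> (\<phi> k) (\<tau> z))"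
  using int2 by (subst set_integrable_cong[OF refl refl dens]) auto
 note der = has_derivative_at_withinI[OF \<tau>'(1)]
 show "set_integrable lebesgue T (form_density \<omega> (\<phi> k))"
  unfolding T by (rule change_vars(1)[OF Sl der inj\<tau> int3])
 show "set_lebesgue_integral lebesgue S (form_density \<omega> \<psi>) = set_lebesgue_integral lebesgue T (form_density \<omega> (\<phi> k))"
 proof -
  have "set_lebesgue_integral lebesgue (\<tau> ` S) (form_density \<omega> (\<phi> k)) =
   (LINT z:S|lebesgue. of_real \<bar>detR (\<tau>' z)\<bar> * form_density \<omega> (\<phi> k) (\<tau> z))"
   by (rule change_vars(2)[OF Sl der inj\<tau> int3])
  also have "\<dots> = set_lebesgue_integral lebesgue S (form_density \<omega> \<psi>)"
   by (rule set_lebesgue_integral_cong) (use Sl dens in auto)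
  finally show ?thesis unfolding T by simp
 qed
 show "T \<in> sets lebesgue"
  unfolding T by (rule differentiable_image_in_sets_lebesgue[OF Sl order_refl])
   (use der in \<open>auto simp: differentiable_on_def differentiable_def\<close>)
qed

text \<open>The given pieces and the reference pieces are cut along each other, and every common
  part has the same integral in both coordinates.\<close>

lemma integral_unique:
 fixes n :: nat
 assumes \<omega>: "\<And>p. tens (\<omega> p)" and I: "has_form_integral TYPE('d) X \<omega> I"
  and c: "\<And>k. k < n \<Longrightarrow> c k < m" and B: "\<And>k. k < n \<Longrightarrow> B k \<in> sets borel"
  and int: "\<And>k. k < n \<Longrightarrow> set_integrable lborel (B k) (form_density \<omega> (\<phi> (c k)))"
  and disj: "disjoint_family_on (\<lambda>k. \<phi> (c k) ` B k) {..<n}" and X: "X = (\<Union>k<n. \<phi> (c k) ` B k)"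
 shows "I = (\<Sum>k<n. set_lebesgue_integral lborel (B k) (form_density \<omega> (\<phi> (c k))))"
proof -
 obtain M and U and \<psi> :: "nat \<Rightarrow> complex ^ 'd \<Rightarrow> 'N cmatrix" and A where
  A: "\<And>l. l < M \<Longrightarrow> holomorphic_parametrization X (U l) (\<psi> l)" "\<And>l. l < M \<Longrightarrow> A l \<in> sets borel"
   "\<And>l. l < M \<Longrightarrow> A l \<subseteq> U l" "\<And>l. l < M \<Longrightarrow> set_integrable lborel (A l) (form_density \<omega> (\<psi> l))"
  and disjA: "disjoint_family_on (\<lambda>l. \<psi> l ` A l) {..<M}" and XA: "X = (\<Union>l<M. \<psi> l ` A l)"
  and IA: "I = (\<Sum>l<M. set_lebesgue_integral lborel (A l) (form_density \<omega> (\<psi> l)))"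
  using I unfolding has_form_integral_def by blast
 define S where "S l k = {z \<in> A l. \<psi> l z \<in> \<phi> (c k) ` B k}" for l k
 define T where "T l k = {w \<in> B k. \<phi> (c k) w \<in> \<psi> l ` A l}" for l k
 have pt: "S l k \<in> sets borel" "T l k \<in> sets lebesgue" "set_integrable lebesgue (S l k) (form_density \<omega> (\<psi> l))"
  "set_integrable lebesgue (T l k) (form_density \<omega> (\<phi> (c k)))"
  "set_lebesgue_integral lebesgue (S l k) (form_density \<omega> (\<psi> l)) = set_lebesgue_integral lebesgue (T l k) (form_density \<omega> (\<phi> (c k)))"
  if "l < M" "k < n" for l k
  unfolding S_def T_def
  using piece_transfer[OF A(1)[OF that(1)] c[OF that(2)] A(2,3)[OF that(1)] B[OF that(2)] \<omega> A(4)[OF that(1)]]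
  by blast+
 have "I = (\<Sum>l<M. set_lebesgue_integral lebesgue (A l) (form_density \<omega> (\<psi> l)))"
  unfolding IA by (rule sum.cong) (simp_all add: set_integral_lebesgue(2) A)
 also have "\<dots> = (\<Sum>l<M. \<Sum>k<n. set_lebesgue_integral lebesgue (S l k) (form_density \<omega> (\<psi> l)))"
 proof (rule sum.cong[OF refl])
  fix l assume l: "l \<in> {..<M}"
  have "\<psi> l z \<in> (\<Union>k<n. \<phi> (c k) ` B k)" if "z \<in> A l" for z
   unfolding X[symmetric] using XA l that by blast
  then have "A l = (\<Union>k<n. S l k)" unfolding S_def by blast
  moreover have "disjoint_family_on (S l) {..<n}"
   using disj unfolding disjoint_family_on_def S_def by fastforce
  ultimately show "set_lebesgue_integral lebesgue (A l) (form_density \<omega> (\<psi> l)) =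
    (\<Sum>k<n. set_lebesgue_integral lebesgue (S l k) (form_density \<omega> (\<psi> l)))"
   using l pt(1,3) by (simp only:) (rule set_integral_finite_Union; simp)
 qed
 also have "\<dots> = (\<Sum>l<M. \<Sum>k<n. set_lebesgue_integral lebesgue (T l k) (form_density \<omega> (\<phi> (c k))))"
  using pt(5) by simp
 also have "\<dots> = (\<Sum>k<n. \<Sum>l<M. set_lebesgue_integral lebesgue (T l k) (form_density \<omega> (\<phi> (c k))))"
  by (rule sum.swap)
 also have "\<dots> = (\<Sum>k<n. set_lebesgue_integral lebesgue (B k) (form_density \<omega> (\<phi> (c k))))"
 proof (rule sum.cong[OF refl])
  fix k assume k: "k \<in> {..<n}"
  have "\<phi> (c k) w \<in> (\<Union>l<M. \<psi> l ` A l)" if "w \<in> B k" for w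
   unfolding XA[symmetric] using X k that by blast
  then have "B k = (\<Union>l<M. T l k)" unfolding T_def by blast
  moreover have "disjoint_family_on (\<lambda>l. T l k) {..<M}"
   using disjA unfolding disjoint_family_on_def T_def by fastforce
  ultimately show "(\<Sum>l<M. set_lebesgue_integral lebesgue (T l k) (form_density \<omega> (\<phi> (c k)))) =
    set_lebesgue_integral lebesgue (B k) (form_density \<omega> (\<phi> (c k)))"
   using k pt(2,4) by (simp only:) (rule set_integral_finite_Union[symmetric]; simp)
 qed
 also have "\<dots> = (\<Sum>k<n. set_lebesgue_integral lborel (B k) (form_density \<omega> (\<phi> (c k))))"
  by (rule sum.cong) (simp_all add: set_integral_lebesgue(2) int)
 finally show ?thesis .
qed

text \<open>A closed coordinate ball minus the images of the earlier balls. The list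
  \<open>c\<close> of chart numbers may reorder or repeat charts, so a chosen chart can be put
  first, where its piece is the full ball.\<close>

definition piece :: "(nat \<Rightarrow> nat) \<Rightarrow> real \<Rightarrow> nat \<Rightarrow> (complex ^ 'd) set" where
 "piece c R k = {z \<in> cball 0 R. \<forall>l<k. \<phi> (c k) z \<notin> \<phi> (c l) ` cball 0 R}"

lemma compact_chart: "k < m \<Longrightarrow> compact (\<phi> k ` cball 0 R)"
 by (intro compact_continuous_image smooth_continuous[OF smooth]) auto

definition covering :: "(nat \<Rightarrow> nat) \<Rightarrow> nat \<Rightarrow> real \<Rightarrow> bool" where
 "covering c n R \<longleftrightarrow> (\<forall>k<n. c k < m) \<and> (\<forall>p\<in>X. \<exists>k<n. p \<in> \<phi> (c k) ` cball 0 R)"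

lemma piece_props:
 assumes cov: "covering c n R"
 shows "k < n \<Longrightarrow> piece c R k \<in> sets borel"
  "disjoint_family_on (\<lambda>k. \<phi> (c k) ` piece c R k) {..<n}" "X = (\<Union>k<n. \<phi> (c k) ` piece c R k)"
proof -
 have c: "c k < m" if "k < n" for k using cov that by (simp add: covering_def)
 have X: "\<exists>k<n. p \<in> \<phi> (c k) ` cball 0 R" if "p \<in> X" for p using cov that by (simp add: covering_def)
 show "piece c R k \<in> sets borel" if k: "k < n"
 proof -
  have cont: "continuous_on UNIV (\<phi> (c k))" by (rule smooth_continuous[OF smooth[OF c[OF k]]])
  have "piece c R k = cball 0 R - (\<Union>l<k. \<phi> (c k) -` (\<phi> (c l) ` cball 0 R))"
   by (auto simp: piece_def)
  moreover have "closed (\<phi> (c k) -` (\<phi> (c l) ` cball 0 R))" if "l < k" for l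
   by (intro closed_vimage cont compact_imp_closed compact_chart c) (use that k in auto)
  then have "closed (\<Union>l<k. \<phi> (c k) -` (\<phi> (c l) ` cball 0 R))" by (intro closed_UN) auto
  ultimately show ?thesis by (simp add: borel_closed sets.Diff)
 qed
 show "disjoint_family_on (\<lambda>k. \<phi> (c k) ` piece c R k) {..<n}"
 proof -
  have "\<phi> (c k) ` piece c R k \<inter> \<phi> (c l) ` piece c R l = {}" if "l < k" for k l
   using that by (auto simp: piece_def)
  then show ?thesis unfolding disjoint_family_on_def by (metis Int_commute nat_neq_iff)
 qed
 show "X = (\<Union>k<n. \<phi> (c k) ` piece c R k)"
 proof (intro set_eqI iffI)
  fix p assume "p \<in> X"
  define k where "k = (LEAST k. k < n \<and> p \<in> \<phi> (c k) ` cball 0 R)"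
  have k: "k < n \<and> p \<in> \<phi> (c k) ` cball 0 R"
   unfolding k_def by (rule LeastI_ex) (use X[OF \<open>p \<in> X\<close>] in blast)
  have "p \<notin> \<phi> (c l) ` cball 0 R" if "l < k" for l
  proof -
   have "\<not> (l < n \<and> p \<in> \<phi> (c l) ` cball 0 R)" using not_less_Least that unfolding k_def by blast
   then show ?thesis using that k by auto
  qed
  then have "p \<in> \<phi> (c k) ` piece c R k" using k by (auto simp: piece_def)
  then show "p \<in> (\<Union>k<n. \<phi> (c k) ` piece c R k)" using k by blast
 qed (use in_X c in auto)
qed

lemma continuous_density:
 assumes "admissible \<omega>" "k < m"
 shows "continuous_on S (form_density \<omega> (\<phi> k))"
proof -
 have 1: "continuous_on UNIV (\<lambda>z. \<omega> (\<phi> k z) (map (\<lambda>w. w z) (map (\<lambda>h z. fder (\<phi> k) z h) real_frame)))"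
 proof (rule tens_continuous)
  show "tens (\<omega> (\<phi> k z))" for z using assms by (simp add: admissible_def)
  show "continuous_on UNIV (\<lambda>z. \<omega> (\<phi> k z) vs)" for vs
   by (rule continuous_on_compose2[of UNIV "\<lambda>p. \<omega> p vs", OF _ smooth_continuous[OF smooth[OF assms(2)]]])
    (use assms(1) in \<open>simp_all add: admissible_def\<close>)
  show "continuous_on UNIV w" if "w \<in> set (map (\<lambda>h z. fder (\<phi> k) z h) real_frame)" for w
   using that smooth_continuous[OF smooth_frechet[OF smooth[OF assms(2)]]] by auto
 qed
 have "form_density \<omega> (\<phi> k) = (\<lambda>z. \<omega> (\<phi> k z) (map (\<lambda>w. w z) (map (\<lambda>h z. fder (\<phi> k) z h) real_frame)))"
  by (rule ext) (simp add: form_density_def o_def)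
 then show ?thesis using continuous_on_subset[OF 1] by simp
qed

lemma density_integrable:
 fixes f :: "complex ^ 'd \<Rightarrow> complex"
 assumes "continuous_on UNIV f" "B \<in> sets borel" "B \<subseteq> cball 0 R"
 shows "set_integrable lborel B f"
proof -
 have "set_integrable lborel (cball 0 R) f"
  unfolding set_integrable_def by (rule borel_integrable_compact) (auto intro: continuous_on_subset[OF assms(1)])
 then show ?thesis by (rule set_integrable_subset) (use assms in auto)
qed

lemma density_integrable_piece:
 assumes "covering c n R" "k < n" "admissible \<omega>"
 shows "set_integrable lborel (piece c R k) (form_density \<omega> (\<phi> (c k)))"
proof (rule density_integrable[of _ _ R])
 show "continuous_on UNIV (form_density \<omega> (\<phi> (c k)))"
  using assms by (intro continuous_density) (auto simp: covering_def)
 show "piece c R k \<in> sets borel" by (rule piece_props(1)[OF assms(1,2)])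
qed (auto simp: piece_def)

lemma has_integral_pieces:
 assumes \<omega>: "admissible \<omega>" and cov: "covering c n R"
 shows "has_form_integral TYPE('d) X \<omega> (\<Sum>k<n. set_lebesgue_integral lborel (piece c R k) (form_density \<omega> (\<phi> (c k))))"
 unfolding has_form_integral_def
proof (rule exI[of _ n], rule exI[of _ "\<lambda>_. UNIV"], rule exI[of _ "\<lambda>k. \<phi> (c k)"], rule exI[of _ "piece c R"], intro conjI allI impI)
 fix k assume k: "k < n"
 show "holomorphic_parametrization X UNIV (\<phi> (c k))"
  by (rule param) (use cov k in \<open>simp add: covering_def\<close>)
qed (simp_all add: density_integrable_piece[OF cov _ \<omega>] piece_props(1,2)[OF cov] piece_props(3)[OF cov, symmetric])

lemma pieces_unique:
 assumes \<omega>: "admissible \<omega>" and I: "has_form_integral TYPE('d) X \<omega> I" and cov: "covering c n R"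
 shows "I = (\<Sum>k<n. set_lebesgue_integral lborel (piece c R k) (form_density \<omega> (\<phi> (c k))))"
proof (rule integral_unique[OF _ I])
 show "tens (\<omega> p)" for p using \<omega> by (simp add: admissible_def)
 show "c k < m" if "k < n" for k using cov that by (simp add: covering_def)
qed (simp_all add: density_integrable_piece[OF cov _ \<omega>] piece_props(1,2)[OF cov] piece_props(3)[OF cov, symmetric])

text \<open>Compactness gives a uniform lower bound for the largest \<open>g k\<close> and a common
  radius for the corresponding parts of the charts. The gap between \<epsilon> and twice \<epsilon>
  leaves room for cutoffs that vanish below \<epsilon> and whose sum is still bounded below on
  \<open>X\<close>.\<close>

lemma radius:
 obtains \<epsilon> R where "0 < \<epsilon>" "0 < R" "\<And>p. p \<in> X \<Longrightarrow> \<exists>k<m. g k p > 2 * \<epsilon>"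
  "\<And>k p. k < m \<Longrightarrow> p \<in> X \<Longrightarrow> g k p \<ge> \<epsilon> \<Longrightarrow> norm (\<kappa> k p) \<le> R"
  "\<And>k p. k < m \<Longrightarrow> p \<in> X \<Longrightarrow> g k p \<ge> \<epsilon> \<Longrightarrow> p \<in> \<phi> k ` cball 0 R"
  "covering (\<lambda>k. k) m R"
proof -
 have cg: "continuous_on S (g k)" if "k < m" for k S by (rule c1_continuous[OF g_c1[OF that]])
 have "\<exists>\<epsilon>>0. \<forall>p\<in>X. \<exists>k<m. g k p > 2 * \<epsilon>"
 proof -
  define V where "V j = (\<Union>k<m. {p. g k p > 2 * inverse (real (Suc j))})" for j
  have "open {p. g k p > c}" if "k < m" for k c
   using open_vimage[OF open_greaterThan cg[OF that]] by (simp add: vimage_def)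
  then have "open (V j)" for j by (auto simp: V_def)
  moreover have "X \<subseteq> (\<Union>j. V j)"
  proof
   fix p assume "p \<in> X"
   then obtain k where k: "k < m" "g k p > 0" using cover by blast
   obtain j where "inverse (real (Suc j)) < g k p / 2" using reals_Archimedean[of "g k p / 2"] k by auto
   then show "p \<in> (\<Union>j. V j)" using k by (auto simp: V_def field_simps)
  qed
  ultimately obtain J where J: "finite J" "X \<subseteq> (\<Union>j\<in>J. V j)"
   using compactE_image[OF compact_X, of UNIV V] by (metis (no_types, lifting))
  define N where "N = Max (insert 0 J)"
  have "\<exists>k<m. g k p > 2 * inverse (real (Suc N))" if px: "p \<in> X" for p
  proof -
   obtain j where j: "j \<in> J" "p \<in> V j" using J px by blast
   then obtain k where jk: "j \<in> J" "k < m" "g k p > 2 * inverse (real (Suc j))" unfolding V_def by blast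
   then have "j \<le> N" using J by (auto simp: N_def)
   then have "inverse (real (Suc N)) \<le> inverse (real (Suc j))" by (simp add: field_simps)
   then show ?thesis using jk by (intro exI[of _ k]) linarith
  qed
  then show ?thesis by (intro exI[of _ "inverse (real (Suc N))"]) auto
 qed
 then obtain \<epsilon> where e: "\<epsilon> > 0" "\<And>p. p \<in> X \<Longrightarrow> \<exists>k<m. g k p > 2 * \<epsilon>" by blast
 have "\<exists>R. \<forall>p\<in>X. g k p \<ge> \<epsilon> \<longrightarrow> norm (\<kappa> k p) \<le> R" if k: "k < m" for k
 proof -
  have "compact (X \<inter> {p. g k p \<ge> \<epsilon>})"
   using closed_vimage[OF closed_atLeast cg[OF k], of \<epsilon>] by (intro compact_Int_closed compact_X) (simp add: vimage_def)
  moreover have "continuous_on (X \<inter> {p. g k p \<ge> \<epsilon>}) (\<kappa> k)"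
   by (intro continuous_at_imp_continuous_on ballI differentiable_imp_continuous_within \<kappa>_diff[OF k]) (use e in auto)
  ultimately have "bounded (\<kappa> k ` (X \<inter> {p. g k p \<ge> \<epsilon>}))"
   by (intro compact_imp_bounded compact_continuous_image)
  then show ?thesis unfolding bounded_iff by auto
 qed
 then obtain R where R: "\<And>k p. k < m \<Longrightarrow> p \<in> X \<Longrightarrow> g k p \<ge> \<epsilon> \<Longrightarrow> norm (\<kappa> k p) \<le> R k" by metis
 define R' where "R' = 1 + (\<Sum>k<m. \<bar>R k\<bar>)"
 have R'R: "R k \<le> R'" if "k < m" for k
 proof -
  have "\<bar>R k\<bar> \<le> (\<Sum>k<m. \<bar>R k\<bar>)" by (rule member_le_sum) (use that in auto)
  then show ?thesis by (simp add: R'_def)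
 qed
 have R': "R' > 0" unfolding R'_def by (meson add_pos_nonneg sum_nonneg abs_ge_zero zero_less_one)
 have n: "norm (\<kappa> k p) \<le> R'" if "k < m" "p \<in> X" "g k p \<ge> \<epsilon>" for k p
  using R[OF that] R'R[OF that(1)] by linarith
 have im: "p \<in> \<phi> k ` cball 0 R'" if "k < m" "p \<in> X" "g k p \<ge> \<epsilon>" for k p
  using mem_chart[OF that(1,2)] n[OF that] that(3) e(1) by auto
 have "\<exists>k<m. p \<in> \<phi> k ` cball 0 R'" if px: "p \<in> X" for p
 proof -
  obtain k where "k < m" "g k p > 2 * \<epsilon>" using e(2)[OF px] by blast
  then show ?thesis using im[OF _ px, of k] e(1) by (intro exI[of _ k]) auto
 qed
 then have "covering (\<lambda>k. k) m R'" by (simp add: covering_def)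
 then show thesis using that[OF e(1) R' e(2) n im] by blast
qed

lemma integral_ex1:
 assumes "admissible \<omega>" shows "\<exists>!I. has_form_integral TYPE('d) X \<omega> I"
proof -
 obtain R where R: "covering (\<lambda>k. k) m R" using radius by metis
 then show ?thesis using has_integral_pieces[OF assms R] pieces_unique[OF assms _ R] by blast
qed

definition intg :: "'N cmatrix form \<Rightarrow> complex" where
 "intg \<omega> = form_integral TYPE('d) X \<omega>"

lemma has_intg: "admissible \<omega> \<Longrightarrow> has_form_integral TYPE('d) X \<omega> (intg \<omega>)"
 unfolding intg_def form_integral_def by (rule theI'[OF integral_ex1])

lemma intg_unique: "admissible \<omega> \<Longrightarrow> has_form_integral TYPE('d) X \<omega> I \<longleftrightarrow> I = intg \<omega>"
 using has_intg integral_ex1 by blast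

lemma intg_pieces:
 assumes "admissible \<omega>" "covering c n R"
 shows "intg \<omega> = (\<Sum>k<n. set_lebesgue_integral lborel (piece c R k) (form_density \<omega> (\<phi> (c k))))"
 by (rule pieces_unique[OF assms(1) has_intg[OF assms(1)] assms(2)])

text \<open>The relation is required only for densities in the charts, so identities valid just at
  points of \<open>X\<close> and on tangent vectors may be integrated.\<close>

lemma intg_add:
 assumes "admissible \<omega>" "admissible \<omega>'" "admissible \<omega>''"
  and eq: "\<And>k z. k < m \<Longrightarrow> form_density \<omega>'' (\<phi> k) z = form_density \<omega> (\<phi> k) z + a * form_density \<omega>' (\<phi> k) z"
 shows "intg \<omega>'' = intg \<omega> + a * intg \<omega>'"
proof -
 obtain R where R: "covering (\<lambda>k. k) m R" using radius by metis
 note i = density_integrable_piece[OF R]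
 note P = intg_pieces[OF _ R]
 have "set_lebesgue_integral lborel (piece (\<lambda>k. k) R k) (form_density \<omega>'' (\<phi> k)) =
   set_lebesgue_integral lborel (piece (\<lambda>k. k) R k) (form_density \<omega> (\<phi> k)) +
   a * set_lebesgue_integral lborel (piece (\<lambda>k. k) R k) (form_density \<omega>' (\<phi> k))" if "k < m" for k
  using i[OF that assms(1)] i[OF that assms(2)] by (simp add: eq[OF that, abs_def])
 then show ?thesis
  using assms by (simp add: P sum.distrib sum_distrib_left)
qed

lemma intg_cong:
 assumes "admissible \<omega>" "admissible \<omega>'"
  and "\<And>k z. k < m \<Longrightarrow> form_density \<omega> (\<phi> k) z = form_density \<omega>' (\<phi> k) z"
 shows "intg \<omega> = intg \<omega>'"
 using intg_add[of \<omega>' \<omega>' \<omega> 0] assms by simp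

end

section \<open>Partition of unity and Stokes' theorem on the manifold\<close>

lemma c1_compose:
 fixes f :: "'a::euclidean_space \<Rightarrow> complex" and \<phi> :: "'b::real_normed_vector \<Rightarrow> 'a"
 assumes f: "c1 f" and \<phi>: "c1 \<phi>"
 shows "c1 (\<lambda>x. f (\<phi> x))"
proof (rule c1I)
 show "((\<lambda>x. f (\<phi> x)) has_derivative (\<lambda>v. fder f (\<phi> x) (fder \<phi> x v))) (at x)" for x
  by (rule has_derivative_compose[OF c1_has[OF \<phi>] c1_has[OF f]])
 fix v
 have e: "fder f y w = (\<Sum>b\<in>Basis. (w \<bullet> b) *\<^sub>R fder f y b)" for y w
 proof -
  have l: "linear (fder f y)" by (rule has_derivative_linear[OF c1_has[OF f]])
  have "fder f y w = fder f y (\<Sum>b\<in>Basis. (w \<bullet> b) *\<^sub>R b)"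
   by (simp add: euclidean_representation)
  then show ?thesis by (simp add: linear_sum[OF l] linear_scale[OF l])
 qed
 show "continuous_on UNIV (\<lambda>x. fder f (\<phi> x) (fder \<phi> x v))"
  unfolding e[of _ "fder \<phi> _ v"]
  by (intro continuous_intros c1_cont[OF \<phi>] continuous_on_compose2[OF c1_cont[OF f, of UNIV] c1_continuous[OF \<phi>]]) auto
qed

lemma c1_pb:
 fixes \<phi> :: "'b::euclidean_space \<Rightarrow> 'a::euclidean_space"
 assumes \<phi>: "smooth_on UNIV \<phi>" and "cform \<omega>"
 shows "c1 (\<lambda>z. pb \<phi> \<omega> z vs)"
 using assms(2)
proof (induction vs arbitrary: \<omega>)
 case Nil
 show ?case using c1_compose[OF cform_c1[OF Nil] c1_smooth[OF \<phi>], of "[]"] by (simp add: pb_def)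
next
 case (Cons v vs)
 have D: "c1 (\<lambda>z. fder \<phi> z v)" by (rule c1_smooth[OF smooth_frechet[OF \<phi>]])
 have "c1 (\<lambda>z. fder \<phi> z v \<bullet> b)" for b
  by (rule c1I[OF has_derivative_inner_left[OF c1_has[OF D]]]) (intro continuous_intros c1_cont[OF D])
 then have "c1 (\<lambda>z. of_real (fder \<phi> z v \<bullet> b) * pb \<phi> (\<lambda>p us. \<omega> p (b # us)) z vs)" for b
  by (intro c1_mult c1_of_real Cons.IH[OF cform_Cons[OF Cons.prems]])
 then show ?case
  unfolding pb_Cons[OF cform_tens[OF Cons.prems]] by (rule c1_sum)
qed

lemma has_derivative_max_square:
 "((\<lambda>x::real. (max 0 x)\<^sup>2) has_real_derivative 2 * max 0 x) (at x)"
proof (cases x "0::real" rule: linorder_cases)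
 case less
 have "((\<lambda>x::real. 0) has_real_derivative 2 * max 0 x) (at x)" using less by simp
 then show ?thesis
  by (rule has_field_derivative_transform_within_open[of _ _ _ "{..<0}"]) (use less in auto)
next
 case equal
 have "((\<lambda>y::real. (max 0 y)\<^sup>2 / y) \<longlongrightarrow> 0) (at 0)"
 proof (rule Lim_null_comparison)
  show "\<forall>\<^sub>F y in at 0. norm ((max 0 y)\<^sup>2 / y) \<le> \<bar>y::real\<bar>"
   by (rule always_eventually) (auto simp: max_def power2_eq_square)
  show "((\<lambda>y::real. \<bar>y\<bar>) \<longlongrightarrow> 0) (at 0)" by (rule tendsto_rabs_zero[OF tendsto_ident_at])
 qed
 then show ?thesis using equal by (simp add: has_field_derivative_iff)
next
 case greater
 have "((\<lambda>x::real. x\<^sup>2) has_real_derivative 2 * max 0 x) (at x)"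
  using greater by (auto intro!: derivative_eq_intros)
 then show ?thesis
  by (rule has_field_derivative_transform_within_open[of _ _ _ "{0<..}"]) (use greater in auto)
qed

lemma ext_deriv_zero_near:
 assumes "open S" "p \<in> S" "\<And>q us. q \<in> S \<Longrightarrow> f q us = 0"
 shows "ext_deriv f p vs = 0"
proof -
 have "ext_deriv (\<lambda>q us. 0) p vs = ext_deriv f p vs"
  by (rule ext_deriv_local[OF assms(1,2)]) (use assms(3) in \<open>auto simp: fdiff_def\<close>)
 then show ?thesis by (simp add: ext_deriv_def)
qed

lemma admissible_sum:
 "(\<And>k. k \<in> K \<Longrightarrow> admissible (f k)) \<Longrightarrow> admissible (\<lambda>p us. \<Sum>k\<in>K. f k p us)"
proof (induction K rule: infinite_finite_induct)
 case (insert k K)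
 then show ?case using admissible_add[of "f k" "\<lambda>p us. \<Sum>k\<in>K. f k p us"] by simp
qed (simp_all add: admissible_def tens_zero)

context hol_atlas
begin

lemma intg_zero: "intg (\<lambda>p us. 0) = 0"
proof -
 have "admissible (\<lambda>p us. 0 :: complex)" by (simp add: admissible_def tens_zero)
 then show ?thesis using intg_add[of "\<lambda>p us. 0" "\<lambda>p us. 0" "\<lambda>p us. 0" 1] by (simp add: form_density_def)
qed

lemma intg_sum:
 "finite K \<Longrightarrow> (\<And>k. k \<in> K \<Longrightarrow> admissible (f k)) \<Longrightarrow> intg (\<lambda>p us. \<Sum>k\<in>K. f k p us) = (\<Sum>k\<in>K. intg (f k))"
proof (induction K rule: finite_induct)
 case empty
 then show ?case by (simp add: intg_zero)
next
 case (insert k K)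
 have "intg (\<lambda>p us. \<Sum>k\<in>insert k K. f k p us) = intg (f k) + 1 * intg (\<lambda>p us. \<Sum>k\<in>K. f k p us)"
  using insert admissible_add[of "f k" "\<lambda>p us. \<Sum>k\<in>K. f k p us"]
  by (intro intg_add) (auto intro: admissible_sum simp: form_density_def)
 then show ?case using insert by simp
qed

text \<open>A partition of unity splits the form into summands that live in one chart each; there
  the integral is that of an exterior derivative with compact support on the coordinate
  space.\<close>

theorem stokes:
 assumes \<eta>: "cform \<eta>"
 shows "intg (ext_deriv \<eta>) = 0"
proof -
 obtain \<epsilon> R where e: "0 < \<epsilon>" and R: "0 < R" and big: "\<And>p. p \<in> X \<Longrightarrow> \<exists>k<m. g k p > 2 * \<epsilon>"
  and im: "\<And>k p. k < m \<Longrightarrow> p \<in> X \<Longrightarrow> g k p \<ge> \<epsilon> \<Longrightarrow> p \<in> \<phi> k ` cball 0 R"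
  and cov: "covering (\<lambda>k. k) m R" using radius by metis
 \<comment> \<open>The squared positive part is continuously differentiable, and the cutoff vanishes
   wherever \<open>g k\<close> is at most \<epsilon>.\<close>
 define b where "b k p = (max 0 (g k p - \<epsilon>))\<^sup>2" for k p
 have b_c1: "c1 (b k)" if "k < m" for k
  unfolding b_def
  by (rule c1_compose_real[where h = "\<lambda>x. (max 0 (x - \<epsilon>))\<^sup>2" and h' = "\<lambda>x. 2 * max 0 (x - \<epsilon>)", OF g_c1[OF that]])
   (use DERIV_shift[of "\<lambda>x. (max 0 x)\<^sup>2" _ _ "- \<epsilon>"] has_derivative_max_square in \<open>auto intro!: continuous_intros\<close>)
 have b0: "b k p = 0" if "g k p \<le> \<epsilon>" for k p using that by (simp add: b_def)
 define B where "B p = (\<Sum>k<m. b k p)" for p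
 have B_c1: "c1 B" unfolding B_def by (rule c1_sum) (use b_c1 in auto)
 \<comment> \<open>At every point of \<open>X\<close> some cutoff is at least the square of
   \<epsilon>, so the sum \<open>B\<close> exceeds \<open>d\<close> on a neighbourhood of
   \<open>X\<close>.\<close>
 define d where "d = \<epsilon>\<^sup>2 / 2"
 have d: "d > 0" using e by (simp add: d_def)
 \<comment> \<open>Positive everywhere and equal to its argument from \<open>d\<close> on. Thus
   \<open>inverse (F (B p))\<close> is defined for all matrices and normalises the cutoffs near
   \<open>X\<close>.\<close>
 define F where "F x = x + (max 0 (d - x))\<^sup>2 / d" for x
 have F0: "F x > 0" for x
 proof (cases "x < d")
  case True
  have "x * d + (d - x)\<^sup>2 = (x - d / 2)\<^sup>2 + 3 / 4 * d\<^sup>2" by (simp add: power2_eq_square algebra_simps)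
  also have "\<dots> > 0" using d by (intro add_nonneg_pos) auto
  finally show ?thesis using True d by (simp add: F_def field_simps)
 qed (use d in \<open>simp add: F_def\<close>)
 have F': "(F has_real_derivative 1 - 2 * max 0 (d - x) / d) (at x)" for x
 proof -
  have "((\<lambda>x. (max 0 (d - x))\<^sup>2) has_real_derivative 2 * max 0 (d - x) * (- 1)) (at x)"
   by (rule DERIV_chain2[OF has_derivative_max_square]) (auto intro!: derivative_eq_intros)
  from DERIV_add[OF DERIV_ident DERIV_cdivide[OF this, of d]] show ?thesis by (simp add: F_def[abs_def])
 qed
 have iF: "c1 (\<lambda>p. inverse (F (B p)))"
 proof (rule c1_compose_real[OF B_c1])
  show "((\<lambda>x. inverse (F x)) has_real_derivative - (inverse (F x) * (1 - 2 * max 0 (d - x) / d) * inverse (F x))) (at x)" for x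
   by (rule DERIV_inverse'[OF F']) (use F0[of x] in simp)
  have "continuous_on UNIV F" using F' by (meson DERIV_isCont continuous_at_imp_continuous_on)
  then show "continuous_on UNIV (\<lambda>x. - (inverse (F x) * (1 - 2 * max 0 (d - x) / d) * inverse (F x)))"
   by (intro continuous_intros) (use F0 d in \<open>auto simp: less_imp_neq[symmetric] order.strict_implies_not_eq[symmetric]\<close>)
 qed
 define \<rho> where "\<rho> k p = b k p * inverse (F (B p))" for k p
 have \<rho>_c1: "c1 (\<lambda>p. complex_of_real (\<rho> k p))" if "k < m" for k
  unfolding \<rho>_def by (intro c1_of_real c1_mult b_c1[OF that] iF)
 define \<eta>k where "\<eta>k k p us = complex_of_real (\<rho> k p) * \<eta> p us" for k p us
 have \<eta>k: "cform (\<eta>k k)" if "k < m" for k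
  unfolding \<eta>k_def by (intro cform_mult \<rho>_c1[OF that] \<eta>)
 have oB: "open {p. B p > d}"
  using open_vimage[OF open_greaterThan c1_continuous[OF B_c1], of d] by (simp add: vimage_def)
 have XB: "B p > d" if px: "p \<in> X" for p
 proof -
  obtain k where k: "k < m" "g k p > 2 * \<epsilon>" using big[OF px] by blast
  have "\<epsilon>\<^sup>2 \<le> b k p" unfolding b_def using k e by (intro power_mono) auto
  also have "b k p \<le> B p" unfolding B_def by (rule member_le_sum) (use k in \<open>auto simp: b_def\<close>)
  moreover have "d < \<epsilon>\<^sup>2" using e by (simp add: d_def)
  ultimately show ?thesis by linarith
 qed
 have sum1: "(\<Sum>k<m. \<eta>k k p us) = \<eta> p us" if "B p > d" for p us
 proof -
  have "F (B p) = B p" using that by (simp add: F_def)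
  then have "(\<Sum>k<m. \<rho> k p) = 1"
   using that d unfolding \<rho>_def sum_distrib_right[symmetric] B_def[symmetric] by simp
  then show ?thesis unfolding \<eta>k_def sum_distrib_right[symmetric] by (simp flip: of_real_sum)
 qed
 have split: "ext_deriv \<eta> p vs = (\<Sum>k<m. ext_deriv (\<eta>k k) p vs)" if "p \<in> X" for p vs
 proof -
  have "ext_deriv \<eta> p vs = ext_deriv (\<lambda>p us. \<Sum>k<m. \<eta>k k p us) p vs"
   by (rule ext_deriv_local[OF oB]) (use XB[OF that] sum1 cform_fdiff[OF \<eta>] in auto)
  also have "\<dots> = (\<Sum>k<m. ext_deriv (\<eta>k k) p vs)"
   by (rule ext_deriv_sum) (use cform_fdiff[OF \<eta>k] in auto)
  finally show ?thesis .
 qed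
 have zero: "intg (ext_deriv (\<eta>k k)) = 0" if k: "k < m" for k
 proof -
  \<comment> \<open>Chart \<open>k\<close> is placed in front of the full list: its piece is then
    the whole ball, and on all other pieces the summand vanishes.\<close>
  define c where "c j = (case j of 0 \<Rightarrow> k | Suc l \<Rightarrow> l)" for j
  have cov': "covering c (Suc m) R"
   unfolding covering_def
  proof (intro conjI ballI allI impI)
   fix j assume "j < Suc m" then show "c j < m" using k by (cases j) (auto simp: c_def)
  next
   fix p assume "p \<in> X"
   then obtain l where "l < m" "p \<in> \<phi> l ` cball 0 R" using cov by (auto simp: covering_def)
   then show "\<exists>j<Suc m. p \<in> \<phi> (c j) ` cball 0 R" by (intro exI[of _ "Suc l"]) (simp add: c_def)
  qed
  \<comment> \<open>Outside of the ball \<open>g k\<close> is below \<epsilon>, so the summand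
    vanishes identically near such a point, and with it the derivative.\<close>
  have small: "ext_deriv (\<eta>k k) p vs = 0" if "p \<in> X" "p \<notin> \<phi> k ` cball 0 R" for p vs
  proof -
   have "g k p < \<epsilon>" using im[OF k that(1)] that(2) by force
   moreover have "open {q. g k q < \<epsilon>}"
    using open_vimage[OF open_lessThan c1_continuous[OF g_c1[OF k]], of \<epsilon>] by (simp add: vimage_def)
   ultimately show ?thesis
    by (intro ext_deriv_zero_near[of "{q. g k q < \<epsilon>}"]) (auto simp: \<eta>k_def \<rho>_def b0)
  qed
  let ?dn = "\<lambda>j. form_density (ext_deriv (\<eta>k k)) (\<phi> (c j))"
  have "intg (ext_deriv (\<eta>k k)) = (\<Sum>j<Suc m. set_lebesgue_integral lborel (piece c R j) (?dn j))"
   by (rule intg_pieces[OF admissible_ext_deriv[OF \<eta>k[OF k]] cov'])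
  also have "\<dots> = set_lebesgue_integral lborel (piece c R 0) (?dn 0)"
  proof -
   have "set_lebesgue_integral lborel (piece c R (Suc l)) (?dn (Suc l)) = 0" if "l < m" for l
   proof -
    have "?dn (Suc l) z = 0" if "z \<in> piece c R (Suc l)" for z
     unfolding form_density_def
     by (rule small) (use that \<open>l < m\<close> in_X in \<open>auto simp: piece_def c_def\<close>)
    then have "indicator (piece c R (Suc l)) z *\<^sub>R ?dn (Suc l) z = 0" for z
     by (cases "z \<in> piece c R (Suc l)") auto
    then show ?thesis unfolding set_lebesgue_integral_def by (simp only: integral_zero)
   qed
   then show ?thesis by (subst sum.lessThan_Suc_shift) simp
  qed
  also have "\<dots> = (LINT z|lborel. ext_deriv (pb (\<phi> k) (\<eta>k k)) z real_frame)"
  proof -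
   have "indicator (piece c R 0) z *\<^sub>R ?dn 0 z = ext_deriv (pb (\<phi> k) (\<eta>k k)) z real_frame" for z
   proof -
    have "?dn 0 z = ext_deriv (pb (\<phi> k) (\<eta>k k)) z real_frame"
     unfolding ext_deriv_pb[OF smooth[OF k] \<eta>k[OF k]] by (simp add: form_density_def pb_def c_def)
    moreover have "?dn 0 z = 0" if "z \<notin> piece c R 0"
     unfolding form_density_def
    proof (rule small)
     show "\<phi> (c 0) z \<in> X" using in_X k by (simp add: c_def)
     show "\<phi> (c 0) z \<notin> \<phi> k ` cball 0 R"
      using that left_inv[OF k] by (auto simp: piece_def c_def) (metis)
    qed
    ultimately show ?thesis by (cases "z \<in> piece c R 0") auto
   qed
   then show ?thesis by (simp add: set_lebesgue_integral_def)
  qed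
  also have "\<dots> = 0"
  proof (rule integral_ext_deriv_zero[of _ R])
   show "c1 (\<lambda>z. pb (\<phi> k) (\<eta>k k) z us)" for us by (rule c1_pb[OF smooth[OF k] \<eta>k[OF k]])
   fix z :: "complex ^ 'd" and us :: "(complex ^ 'd) list" assume z: "R < norm z"
   have "\<phi> k z \<notin> \<phi> k ` cball 0 R" using z left_inv[OF k] by (metis imageE mem_cball_0 not_le)
   then have "g k (\<phi> k z) \<le> \<epsilon>" using im[OF k in_X[OF k], of z] by force
   then show "pb (\<phi> k) (\<eta>k k) z us = 0" by (simp add: pb_def \<eta>k_def \<rho>_def b0)
  qed
  finally show ?thesis .
 qed
 have "intg (ext_deriv \<eta>) = intg (\<lambda>p us. \<Sum>k<m. ext_deriv (\<eta>k k) p us)"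
  by (rule intg_cong)
   (use \<eta> \<eta>k split in_X in \<open>auto intro!: admissible_ext_deriv admissible_sum simp: form_density_def\<close>)
 also have "\<dots> = (\<Sum>k<m. intg (ext_deriv (\<eta>k k)))"
  by (rule intg_sum) (use \<eta>k in \<open>auto intro!: admissible_ext_deriv\<close>)
 finally show ?thesis using zero by simp
qed

end

section \<open>Equivariant Chern forms\<close>

subsection \<open>Smooth even cochain fields\<close>

definition nicef :: "('b::euclidean_space \<Rightarrow> 'a::real_vector cochain) \<Rightarrow> bool" where
 "nicef F \<longleftrightarrow> (\<forall>p. tens (cev (F p))) \<and> (\<forall>p. evn (F p)) \<and> (\<forall>vs. algf (\<lambda>p. cev (F p) vs))"

lemma algf_wdg:
 assumes "\<And>vs. algf (\<lambda>p. f p vs)" "\<And>vs. algf (\<lambda>p. g p vs)"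
 shows "algf (\<lambda>p. wdg (f p) (g p) vs)"
 using assms
proof (induction vs arbitrary: f g)
 case Nil
 then show ?case by (auto intro: algf_mult)
next
 case (Cons v vs)
 have "algf (\<lambda>p. bar (f p) us)" for us
  unfolding bar_def by (intro algf_mult algf_const Cons.prems)
 then show ?case by (auto intro!: algf_add Cons)
qed

lemma nicef_mult: "nicef F \<Longrightarrow> nicef G \<Longrightarrow> nicef (\<lambda>p. F p * G p)"
 unfolding nicef_def
proof (elim conjE, intro conjI allI)
 fix p vs assume F: "\<forall>p. tens (cev (F p))" "\<forall>p. evn (F p)" "\<forall>vs. algf (\<lambda>p. cev (F p) vs)"
  and G: "\<forall>p. tens (cev (G p))" "\<forall>p. evn (G p)" "\<forall>vs. algf (\<lambda>p. cev (G p) vs)"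
 show "tens (cev (F p * G p))" "evn (F p * G p)" using F G by (auto intro: tens_mult evn_mult)
 have "cev (F p * G p) = wdg (cev (F p)) (cev (G p))" for p using F by (intro cev_mult_even) auto
 then show "algf (\<lambda>p. cev (F p * G p) vs)" using F G by (simp add: algf_wdg)
qed

lemma nicef_add: "nicef F \<Longrightarrow> nicef G \<Longrightarrow> nicef (\<lambda>p. F p + G p)"
 by (simp add: nicef_def tens_plus evn_add algf_add)

lemma nicef_sc: assumes "algf f" shows "nicef (\<lambda>p. sc (f p))"
proof -
 have "algf (\<lambda>p. cev (sc (f p)) vs)" for vs :: "'b list"
  using assms by (cases "vs = []") (simp_all add: cev_sc algf_const)
 then show ?thesis by (simp add: nicef_def tens_sc)
qed

lemma nicef_const: "nicef (\<lambda>p. sc c)"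
 by (intro nicef_sc algf_const)

lemma nicef_0: "nicef (\<lambda>p. 0)" and nicef_1: "nicef (\<lambda>p. 1)"
 using nicef_const[of 0] nicef_const[of 1] by (simp_all add: sc_hom)

lemma nicef_sum: "(\<And>a. a \<in> A \<Longrightarrow> nicef (F a)) \<Longrightarrow> nicef (\<lambda>p. \<Sum>a\<in>A. F a p)"
 by (induction A rule: infinite_finite_induct) (auto intro: nicef_add nicef_0)

lemma nicef_prod: "(\<And>a. a \<in> A \<Longrightarrow> nicef (F a)) \<Longrightarrow> nicef (\<lambda>p. \<Prod>a\<in>A. F a p)"
 by (induction A rule: infinite_finite_induct) (auto intro: nicef_mult nicef_1)

lemma nicef_power: "nicef F \<Longrightarrow> nicef (\<lambda>p. F p ^ n)"
 by (induction n) (auto intro: nicef_mult nicef_1)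

lemma nicef_evn: "nicef F \<Longrightarrow> evn (F p)"
 and nicef_tens: "nicef F \<Longrightarrow> tens (cev (F p))"
 and nicef_algf: "nicef F \<Longrightarrow> algf (\<lambda>p. cev (F p) vs)"
 by (simp_all add: nicef_def)

lemma nicef_smooth_form: "nicef F \<Longrightarrow> smooth_form (\<lambda>p. cev (F p))"
 by (simp add: smooth_form_iff nicef_def algf_smooth)

lemma nicef_cform: "nicef F \<Longrightarrow> cform (\<lambda>p. cev (F p))"
 by (intro cform_smooth nicef_smooth_form)

lemma nicef_fdiff: "nicef F \<Longrightarrow> fdiff (\<lambda>p. cev (F p)) p"
 by (intro cform_fdiff nicef_cform)

subsection \<open>Matrices\<close>

definition msc :: "complex \<Rightarrow> complex ^ 'm ^ 'n \<Rightarrow> complex ^ 'm ^ 'n" where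
 "msc c A = (\<chi> i j. c * A $ i $ j)"

lemma msc_nth [simp]: "msc c A $ i $ j = c * A $ i $ j"
 by (simp add: msc_def)

lemma matrix_diff_ldistrib: "(A :: complex ^ 'm ^ 'n) ** (B - C) = A ** B - A ** C"
 and matrix_diff_rdistrib: "((A' :: complex ^ 'm ^ 'n) - B') ** C' = A' ** C' - B' ** C'"
 by (simp_all add: matrix_matrix_mult_def vec_eq_iff algebra_simps sum_subtractf sum.distrib sum_negf)

lemma msc_simps: "msc c A ** B = msc c (A ** B)" "A ** msc c B = msc c (A ** B)"
 "msc c A + msc c A' = msc c (A + A')" "msc c A - msc c A' = msc c (A - A')" "msc c (msc d A) = msc (c * d) A"
 by (simp_all add: matrix_matrix_mult_def vec_eq_iff algebra_simps sum_distrib_left)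

lemma matrix_zero_l [simp]: "(0 :: complex ^ 'm ^ 'n) ** A = 0" and matrix_zero_r [simp]: "B ** (0 :: complex ^ 'm ^ 'n) = 0"
 by (simp_all add: matrix_matrix_mult_def vec_eq_iff)

text \<open>The linearisation of \<open>p ** p = p\<close>. Tangent vectors of the charts lie in
  this space, and the identities for the equivariant curvature hold on all of it.\<close>

definition tang :: "'N::finite cmatrix \<Rightarrow> 'N cmatrix set" where
 "tang p = {\<xi>. p ** \<xi> + \<xi> ** p = \<xi>}"

definition weight :: "('N \<Rightarrow> real) \<Rightarrow> 'N::finite cmatrix" where
 "weight w = (\<chi> i j. if i = j then of_real (w i) else 0)"

text \<open>The velocity of conjugation by exp(\<i> s \<open>weight w\<close>) at s = 0; at a
  projection it is the vector field V.\<close>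

definition rot :: "('N \<Rightarrow> real) \<Rightarrow> 'N::finite cmatrix \<Rightarrow> 'N cmatrix" where
 "rot w \<xi> = msc \<i> (weight w ** \<xi> - \<xi> ** weight w)"

lemma rot_tang: "p ** p = p \<Longrightarrow> rot w p \<in> tang p"
proof -
 assume p: "p ** p = p"
 have pp: "p ** (p ** x) = p ** x" for x using p by (metis matrix_mul_assoc)
 have "p ** (weight w ** p - p ** weight w) + (weight w ** p - p ** weight w) ** p = weight w ** p - p ** weight w"
  by (simp add: matrix_diff_ldistrib matrix_diff_rdistrib p pp flip: matrix_mul_assoc)
 then show ?thesis by (simp add: tang_def rot_def msc_simps)
qed

lemma rot_linear: "linear (rot w)"
 by (rule linearI)
  (simp_all add: rot_def vec_eq_iff matrix_matrix_mult_def algebra_simps sum.distrib sum_subtractf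
   sum_distrib_left scaleR_conv_of_real[where 'a = complex])

subsection \<open>The equivariant differential\<close>

text \<open>The operator D at the point \<open>p\<close>, kept only on arguments in
  \<open>tang p\<close>: closedness of the equivariant Chern forms is established for these
  vectors.\<close>

definition eqD :: "('N \<Rightarrow> real) \<Rightarrow> complex \<Rightarrow> ('N::finite cmatrix \<Rightarrow> 'N cmatrix cochain) \<Rightarrow> 'N cmatrix \<Rightarrow> 'N cmatrix cochain" where
 "eqD w t F p = res (tang p) (Coch (\<lambda>vs. ext_deriv (\<lambda>q. cev (F q)) p vs - t * cev (F p) (rot w p # vs)))"

lemma cev_eqD: "set vs \<subseteq> tang p \<Longrightarrow>
  cev (eqD w t F p) vs = ext_deriv (\<lambda>q. cev (F q)) p vs - t * cev (F p) (rot w p # vs)"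
 by (simp add: eqD_def cev_res)

lemma oddc_ext_deriv:
 assumes "\<And>q. evenc (f q)" shows "oddc (ext_deriv f p)"
 unfolding oddc_def
proof (intro allI impI)
 fix vs :: "'a list" assume "even (length vs)"
 then have "f q (take i vs @ drop (Suc i) vs) = 0" if "i < length vs" for q i
  using assms[of q] that unfolding evenc_def by auto
 then show "ext_deriv f p vs = 0" by (simp add: ext_deriv_def)
qed

lemma oddn_eqD: "nicef F \<Longrightarrow> oddn (eqD w t F p)"
proof -
 assume F: "nicef F"
 have "oddc (ext_deriv (\<lambda>q. cev (F q)) p)" by (rule oddc_ext_deriv) (rule nicef_evn[OF F])
 moreover have "cev (F p) (rot w p # vs) = 0" if "even (length vs)" for vs
  using nicef_evn[OF F, of p] that by (simp add: evenc_def)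
 ultimately show ?thesis unfolding eqD_def by (intro oddn_res) (simp add: oddc_def)
qed

lemma eqD_mult:
 assumes F: "nicef F" and G: "nicef G"
 shows "eqD w t (\<lambda>q. F q * G q) p = eqD w t F p * res (tang p) (G p) + res (tang p) (F p) * eqD w t G p"
proof -
 let ?f = "\<lambda>q. cev (F q)" and ?g = "\<lambda>q. cev (G q)"
 let ?d = "\<lambda>f vs. ext_deriv f p vs - t * f p (rot w p # vs)"
 have b: "bar (?f q) = ?f q" for q by (rule bar_even[OF nicef_evn[OF F]])
 have "ext_deriv (\<lambda>q. cev (F q * G q)) p vs - t * cev (F p * G p) (rot w p # vs) =
   cev (Coch (?d ?f) * G p + F p * Coch (?d ?g)) vs" for vs
 proof -
  have "ext_deriv (\<lambda>q. cev (F q * G q)) p vs = wdg (ext_deriv ?f p) (?g p) vs + wdg (?f p) (ext_deriv ?g p) vs"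
   using ext_deriv_wdg[OF nicef_fdiff[OF F] nicef_fdiff[OF G], where p = p and vs = vs]
   by (simp add: cev_mult_even nicef_evn[OF F] b)
  moreover have "cev (F p * G p) (rot w p # vs) = wdg (\<lambda>us. ?f p (rot w p # us)) (?g p) vs + wdg (?f p) (\<lambda>us. ?g p (rot w p # us)) vs"
   by (simp add: cev_mult_even nicef_evn[OF F] b)
  moreover have "cev (Coch (?d ?f) * G p) vs = wdg (ext_deriv ?f p) (?g p) vs - t * wdg (\<lambda>us. ?f p (rot w p # us)) (?g p) vs"
   by (simp add: cev_mult_even2[OF nicef_evn[OF G]] wdg_diff_left wdg_scale_left)
  moreover have "cev (F p * Coch (?d ?g)) vs = wdg (?f p) (ext_deriv ?g p) vs - t * wdg (?f p) (\<lambda>us. ?g p (rot w p # us)) vs"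
   by (simp add: cev_mult_even[OF nicef_evn[OF F]] wdg_diff_right wdg_scale_right)
  ultimately show ?thesis by (simp only: cev_simps) (simp add: algebra_simps)
 qed
 then show ?thesis
  unfolding eqD_def res_hom(1,3)[symmetric] by (intro arg_cong[where f = "res (tang p)"]) (rule cochain_eqI; simp)
qed

lemma eqD_add: "nicef F \<Longrightarrow> nicef G \<Longrightarrow> eqD w t (\<lambda>q. F q + G q) p = eqD w t F p + eqD w t G p"
proof -
 assume FG: "nicef F" "nicef G"
 have "(\<lambda>q. cev (F q + G q)) = (\<lambda>q us. cev (F q) us + cev (G q) us)" by (simp add: fun_eq_iff)
 then have "ext_deriv (\<lambda>q. cev (F q + G q)) p vs = ext_deriv (\<lambda>q. cev (F q)) p vs + ext_deriv (\<lambda>q. cev (G q)) p vs" for vs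
  by (simp add: ext_deriv_add nicef_fdiff FG)
 then show ?thesis
  unfolding eqD_def res_hom(1)[symmetric]
  by (intro arg_cong[where f = "res (tang p)"] cochain_eqI) (simp add: algebra_simps)
qed

lemma eqD_const: "eqD w t (\<lambda>q. sc c) p = 0"
proof -
 have "Coch (\<lambda>vs. ext_deriv (\<lambda>q. cev (sc c)) p vs - t * cev (sc c) (rot w p # vs)) = 0"
  by (rule cochain_eqI) (simp add: ext_deriv_def cev_sc)
 then show ?thesis by (simp add: eqD_def res_hom)
qed

text \<open>The ring homomorphism obtained by adding D to the restriction. A field is D-closed at
  \<open>p\<close> exactly if this homomorphism acts on it as plain restriction.\<close>

definition eqPhi :: "('N \<Rightarrow> real) \<Rightarrow> complex \<Rightarrow> ('N::finite cmatrix \<Rightarrow> 'N cmatrix cochain) \<Rightarrow> 'N cmatrix \<Rightarrow> 'N cmatrix cochain" where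
 "eqPhi w t F p = res (tang p) (F p) + eqD w t F p"

lemma eqPhi_mult:
 assumes "nicef F" "nicef G"
 shows "eqPhi w t (\<lambda>q. F q * G q) p = eqPhi w t F p * eqPhi w t G p"
 using odd_mult_odd[OF oddn_eqD[OF assms(1)] oddn_eqD[OF assms(2)], of w t p w t p]
 by (simp add: eqPhi_def eqD_mult assms res_hom algebra_simps)

lemma eqPhi_add: "nicef F \<Longrightarrow> nicef G \<Longrightarrow> eqPhi w t (\<lambda>q. F q + G q) p = eqPhi w t F p + eqPhi w t G p"
 by (simp add: eqPhi_def eqD_add res_hom algebra_simps)

lemma eqPhi_const: "eqPhi w t (\<lambda>q. sc c) p = sc c"
 by (simp add: eqPhi_def eqD_const res_hom)

lemma eqPhi_sum:
 "(\<And>a. a \<in> A \<Longrightarrow> nicef (F a)) \<Longrightarrow> eqPhi w t (\<lambda>q. \<Sum>a\<in>A. F a q) p = (\<Sum>a\<in>A. eqPhi w t (F a) p)"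
 using eqPhi_const[of w t 0 p]
 by (induction A rule: infinite_finite_induct) (auto simp: eqPhi_add nicef_sum sc_hom)

lemma eqPhi_prod:
 "(\<And>a. a \<in> A \<Longrightarrow> nicef (F a)) \<Longrightarrow> eqPhi w t (\<lambda>q. \<Prod>a\<in>A. F a q) p = (\<Prod>a\<in>A. eqPhi w t (F a) p)"
 using eqPhi_const[of w t 1 p]
 by (induction A rule: infinite_finite_induct) (auto simp: eqPhi_mult nicef_prod sc_hom)

definition eqclosed :: "('N \<Rightarrow> real) \<Rightarrow> complex \<Rightarrow> ('N::finite cmatrix \<Rightarrow> 'N cmatrix cochain) \<Rightarrow> bool" where
 "eqclosed w t F \<longleftrightarrow> nicef F \<and> (\<forall>p. p ** p = p \<longrightarrow> eqD w t F p = 0)"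

lemma eqclosed_mult: "eqclosed w t F \<Longrightarrow> eqclosed w t G \<Longrightarrow> eqclosed w t (\<lambda>p. F p * G p)"
 and eqclosed_add: "eqclosed w t F \<Longrightarrow> eqclosed w t G \<Longrightarrow> eqclosed w t (\<lambda>p. F p + G p)"
 and eqclosed_const: "eqclosed w t (\<lambda>p. sc c)"
 by (simp_all add: eqclosed_def nicef_mult nicef_add nicef_const eqD_mult eqD_add eqD_const)

lemma eqclosed_sum: "(\<And>a. a \<in> A \<Longrightarrow> eqclosed w t (F a)) \<Longrightarrow> eqclosed w t (\<lambda>p. \<Sum>a\<in>A. F a p)"
 using eqclosed_const[of w t 0]
 by (induction A rule: infinite_finite_induct) (auto simp: sc_hom intro: eqclosed_add)

lemma eqclosed_prod: "(\<And>a. a \<in> A \<Longrightarrow> eqclosed w t (F a)) \<Longrightarrow> eqclosed w t (\<lambda>p. \<Prod>a\<in>A. F a p)"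
 using eqclosed_const[of w t 1]
 by (induction A rule: infinite_finite_induct) (auto simp: sc_hom intro: eqclosed_mult)

lemma eqclosed_power: "eqclosed w t F \<Longrightarrow> eqclosed w t (\<lambda>p. F p ^ n)"
 using eqclosed_prod[of "{..<n}" w t "\<lambda>_. F"] by simp

subsection \<open>Equivariant curvature\<close>

text \<open>Matrix entries of the equivariant curvature: the curvature of the tautological
  connection plus the moment part - \<i> t p W p with W the diagonal matrix \<open>weight w\<close>.
  The scalar is dictated by the Bianchi identity \<open>eqD_entry\<close>.\<close>

definition entry :: "('N \<Rightarrow> real) \<Rightarrow> complex \<Rightarrow> 'N::finite \<Rightarrow> 'N \<Rightarrow> 'N cmatrix \<Rightarrow> 'N cmatrix cochain" where
 "entry w t i j p = Coch (curvature i j p) + sc (- \<i> * t * (p ** (weight w ** p)) $ i $ j)"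

lemma curvature_simps [simp]:
 "curvature i j p [] = 0" "curvature i j p [u] = 0"
 "curvature i j p [\<xi>, \<eta>] = (p ** (\<xi> ** \<eta> - \<eta> ** \<xi>)) $ i $ j" "curvature i j p (a # b # c # vs) = 0"
 by (simp_all add: curvature_def)

lemma one_form_long: "length us \<noteq> 1 \<Longrightarrow> one_form l us = 0"
 by (auto simp: one_form_def split: list.splits)

lemma tens_one_form:
 assumes "linear l" shows "tens (one_form l)"
proof (rule tensI)
 fix us ws
 show "linear (\<lambda>v. one_form l (us @ v # ws))"
  by (cases "us = [] \<and> ws = []") (auto simp: one_form_long linear_zero assms)
qed (simp add: one_form_long)

text \<open>Written through products of coordinate one-forms, the curvature inherits alternation,
  evenness and rational coefficients.\<close>

lemma curvature_wdg:
 "curvature i j p vs = (\<Sum>l\<in>UNIV. \<Sum>m\<in>UNIV. p $ i $ l * wdg (one_form (\<lambda>\<xi>. \<xi> $ l $ m)) (one_form (\<lambda>\<xi>. \<xi> $ m $ j)) vs)"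
proof -
 have c: "vs = [] \<or> (\<exists>u. vs = [u]) \<or> (\<exists>u v. vs = [u, v]) \<or> (\<exists>u v w us. vs = u # v # w # us)"
  by (metis neq_Nil_conv)
 have 3: "wdg (one_form a) (one_form b) (u # v # w # us) = 0" for a b and u v w :: "'a cmatrix" and us
  by (simp add: wdg_one_form_Cons del: wdg.simps)
 have 2: "wdg (one_form a) (one_form b) [u, v] = a u * b v - a v * b u" for a b and u v :: "'a cmatrix"
  by (simp add: wdg_one_form_Cons del: wdg.simps(2))
 have 1: "wdg (one_form a) (one_form b) [u] = 0" for a b and u :: "'a cmatrix"
  by (simp add: wdg_one_form_Cons del: wdg.simps(2))
 show ?thesis
  using c by (elim disjE exE)
   (simp_all add: 1 2 3 matrix_matrix_mult_def sum_distrib_left sum_subtractf algebra_simps del: wdg.simps(2))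
qed

lemma algf_nth_compose: "linear P \<Longrightarrow> algf (\<lambda>x. P x $ i $ j :: complex)"
 by (rule algf_linear) (simp add: linear_iff)

lemma nicef_curvature:
 fixes P :: "'b::euclidean_space \<Rightarrow> 'a::finite cmatrix"
 assumes "linear P" shows "nicef (\<lambda>x. Coch (curvature i j (P x)))"
proof -
 have "Coch (curvature i j p) = (\<Sum>l\<in>UNIV. \<Sum>m\<in>UNIV. sc (p $ i $ l) *
   Coch (wdg (one_form (\<lambda>\<xi>. \<xi> $ l $ m)) (one_form (\<lambda>\<xi>. \<xi> $ m $ j))))"
  for p :: "'a cmatrix"
  by (rule cochain_eqI) (simp add: curvature_wdg cev_sum)
 moreover have "nicef (\<lambda>x::'b. Coch (wdg (one_form (\<lambda>\<xi>::'a cmatrix. \<xi> $ l $ m)) (one_form (\<lambda>\<xi>. \<xi> $ m $ j))))" for l m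
  by (auto simp: nicef_def algf_const evenc_wdg2 oddc_one_form intro!: tens_wdg tens_one_form linearI)
 ultimately show ?thesis
  by (auto intro!: nicef_sum nicef_mult nicef_sc algf_nth_compose assms)
qed

text \<open>The parameter may be a function of the point. In the limit \<tau> \<rightarrow> 0 it
  becomes one more coordinate, which yields joint continuity in \<tau> and the matrix.\<close>

lemma nicef_entry_param:
 assumes t: "algf t" and P: "linear P"
 shows "nicef (\<lambda>x. entry w (t x) i j (P x))"
 unfolding entry_def[abs_def]
proof (intro nicef_add nicef_sc algf_mult algf_const t)
 show "nicef (\<lambda>x. Coch (curvature i j (P x)))" by (rule nicef_curvature[OF P])
 show "algf (\<lambda>x. (P x ** (weight w ** P x)) $ i $ j)"
  by (simp add: matrix_matrix_mult_def algf_sum algf_mult algf_nth_compose[OF P] algf_const)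
qed

lemma linear_ident': "linear (\<lambda>x. x)" by (rule linearI) simp_all

lemma nicef_entry: "nicef (entry w t i j)"
 using nicef_entry_param[OF algf_const linear_ident'] .

text \<open>The matrix [dp, p] of one-forms, whose bracket with the curvature appears in the Bianchi
  identity.\<close>

definition connection :: "'N::finite cmatrix \<Rightarrow> 'N \<Rightarrow> 'N \<Rightarrow> 'N cmatrix cochain" where
 "connection p i j = res (tang p) (Coch (one_form (\<lambda>\<xi>. (\<xi> ** p - p ** \<xi>) $ i $ j)))"

lemma oddn_connection: "oddn (connection p i j)"
 unfolding connection_def by (intro oddn_res) (simp add: oddc_one_form)

text \<open>The equivariant Bianchi identity: D of the curvature is its bracket with the connection.
  By degree only one and three arguments matter. With three it is the ordinary Bianchi identity;
  with one it relates the derivative of the moment part to the contraction of the curvature with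
  V.\<close>

theorem eqD_entry:
 assumes p: "p ** p = p"
 shows "eqD w t (entry w t i j) p =
  (\<Sum>l\<in>UNIV. connection p i l * res (tang p) (entry w t l j p) - res (tang p) (entry w t i l p) * connection p l j)"
  (is "?L = ?R")
proof (rule cochain_eqI)
 fix vs
 let ?W = "weight w"
 let ?th = "\<lambda>i j. one_form (\<lambda>\<xi>. (\<xi> ** p - p ** \<xi>) $ i $ j)"
 let ?E = "\<lambda>i j. cev (entry w t i j p)"
 define R where "R = (\<lambda>vs. \<Sum>l\<in>UNIV. wdg (?th i l) (?E l j) vs - wdg (?th l j) (?E i l) vs)"
 have ev: "evn (entry w t i j p)" for i j by (rule nicef_evn[OF nicef_entry])
 have Rr: "cev ?R vs = (if set vs \<subseteq> tang p then R vs else 0)"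
 proof -
  have "?R = res (tang p) (\<Sum>l\<in>UNIV. Coch (?th i l) * entry w t l j p - entry w t i l p * Coch (?th l j))"
   by (simp add: res_sum res_hom connection_def)
  then show ?thesis
   by (simp add: cev_res cev_sum R_def cev_mult_even[OF ev] cev_mult_even2[OF ev] wdg_comm[OF ev])
 qed
 show "cev ?L vs = cev ?R vs"
 proof (cases "set vs \<subseteq> tang p")
  case False
  then show ?thesis unfolding Rr by (simp add: eqD_def cev_res)
 next
  case True
  have E0: "?E i j [] = - \<i> * t * (p ** (?W ** p)) $ i $ j" for i j
   by (simp add: entry_def cev_sc)
  have E2: "?E i j [\<xi>, \<eta>] = (p ** (\<xi> ** \<eta> - \<eta> ** \<xi>)) $ i $ j" for i j \<xi> \<eta>
   by (simp add: entry_def cev_sc)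
  have E1: "?E i j [\<xi>] = 0" and E3: "?E i j (a # b # c # us) = 0" for i j \<xi> a b c us
   by (simp_all add: entry_def cev_sc)
  have pp: "p ** (p ** x) = p ** x" for x using p by (metis matrix_mul_assoc)
  \<comment> \<open>For tangent vectors these rules move every \<open>p\<close> to the left, which
    brings both sides of the matrix identities below to the same normal form.\<close>
  have tg: "\<xi> ** p = \<xi> - p ** \<xi>" if "\<xi> \<in> tang p" for \<xi>
   using that by (simp add: tang_def algebra_simps)
  have tg': "\<xi> ** (p ** x) = \<xi> ** x - p ** (\<xi> ** x)" if "\<xi> \<in> tang p" for \<xi> x
   using tg[OF that] by (simp add: matrix_mul_assoc matrix_diff_rdistrib)
  have c: "vs = [] \<or> (\<exists>\<xi>. vs = [\<xi>]) \<or> (\<exists>u v. vs = [u, v]) \<or> (\<exists>\<xi> \<eta> \<zeta>. vs = [\<xi>, \<eta>, \<zeta>]) \<or> (\<exists>a b c d us. vs = a # b # c # d # us)"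
   by (metis neq_Nil_conv)
  have "ext_deriv (\<lambda>q. cev (entry w t i j q)) p vs - t * ?E i j (rot w p # vs) = R vs"
  proof -
   consider "even (length vs)" | \<xi> where "vs = [\<xi>]" | \<xi> \<eta> \<zeta> where "vs = [\<xi>, \<eta>, \<zeta>]"
    | a b c d us where "vs = a # b # c # d # us" "odd (length vs)"
    using c by (metis even_Suc_Suc_iff list.size(3) list.size(4) even_zero One_nat_def add.right_neutral add_Suc_right)
   then show ?thesis
   proof cases
    case 1
    have "cev ?L vs = 0" using oddn_eqD[OF nicef_entry, of w t w t i j p] 1 by (simp add: oddc_def)
    moreover have "R vs = 0"
    proof -
     have "wdg (?th a b) (?E c d) vs = 0" for a b c d
      using oddc_wdg[OF ev oddc_one_form, of c d] 1 by (simp add: wdg_comm[OF ev, symmetric] oddc_def)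
     then show ?thesis by (simp add: R_def)
    qed
    ultimately show ?thesis using cev_eqD[OF True] by metis
   next
    case (2 \<xi>)
    have T: "\<xi> \<in> tang p" using True 2 by simp
    have "((\<lambda>q. - \<i> * t * (q ** (?W ** q)) $ i $ j) has_derivative (\<lambda>\<xi>. - \<i> * t * (p ** (?W ** \<xi>) + \<xi> ** (?W ** p)) $ i $ j)) (at p)"
    proof -
     have "((\<lambda>q. q $ a $ b) has_derivative (\<lambda>\<xi>. \<xi> $ a $ b)) (at p)" for a b :: 'a
      by (rule linear_imp_has_derivative) (rule linearI; simp)
     then show ?thesis
      unfolding matrix_matrix_mult_def
      by (auto intro!: derivative_eq_intros simp: sum.distrib sum_distrib_left sum_negf sum_subtractf algebra_simps)
    qed
    then have d: "fder (\<lambda>q. cev (entry w t i j q) []) p \<xi> = - \<i> * t * (p ** (?W ** \<xi>) + \<xi> ** (?W ** p)) $ i $ j"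
     by (intro frechet_eqI) (simp add: entry_def cev_sc)
    have m: "msc (- \<i> * t) (p ** (?W ** \<xi>) + \<xi> ** (?W ** p)) - msc t (p ** (rot w p ** \<xi> - \<xi> ** rot w p)) =
     msc (- \<i> * t) ((\<xi> ** p - p ** \<xi>) ** (p ** (?W ** p)) - (p ** (?W ** p)) ** (\<xi> ** p - p ** \<xi>))"
    proof -
     have "msc t (p ** (rot w p ** \<xi> - \<xi> ** rot w p)) = msc (- \<i> * t) (p ** (\<xi> ** (?W ** p - p ** ?W) - (?W ** p - p ** ?W) ** \<xi>))"
      by (simp add: rot_def msc_simps matrix_diff_ldistrib) (simp add: vec_eq_iff algebra_simps)
     moreover have "p ** (?W ** \<xi>) + \<xi> ** (?W ** p) - p ** (\<xi> ** (?W ** p - p ** ?W) - (?W ** p - p ** ?W) ** \<xi>) =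
       (\<xi> ** p - p ** \<xi>) ** (p ** (?W ** p)) - (p ** (?W ** p)) ** (\<xi> ** p - p ** \<xi>)"
      by (simp only: matrix_diff_ldistrib matrix_diff_rdistrib p pp tg[OF T] tg'[OF T] matrix_mul_assoc[symmetric])
       (simp add: algebra_simps)
     ultimately show ?thesis by (simp only: msc_simps(4))
    qed
    have "R [\<xi>] = (\<Sum>l\<in>UNIV. (\<xi> ** p - p ** \<xi>) $ i $ l * (- \<i> * t * (p ** (?W ** p)) $ l $ j) - (\<xi> ** p - p ** \<xi>) $ l $ j * (- \<i> * t * (p ** (?W ** p)) $ i $ l))"
     unfolding R_def by (simp add: wdg_one_form_Cons E0 del: wdg.simps(2))
    also have "\<dots> = msc (- \<i> * t) ((\<xi> ** p - p ** \<xi>) ** (p ** (?W ** p)) - (p ** (?W ** p)) ** (\<xi> ** p - p ** \<xi>)) $ i $ j"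
     by (simp add: matrix_matrix_mult_def[of "\<xi> ** p - p ** \<xi>"] matrix_matrix_mult_def[of "p ** (?W ** p)"]
       sum_subtractf sum.distrib sum_negf sum_distrib_left algebra_simps)
    finally show ?thesis
     unfolding 2 m[symmetric] by (simp add: ext_deriv_Cons d E2 algebra_simps)
   next
    case (3 \<xi> \<eta> \<zeta>)
    have T: "\<xi> \<in> tang p" "\<eta> \<in> tang p" "\<zeta> \<in> tang p" using True 3 by simp_all
    have d: "fder (\<lambda>q. cev (entry w t i j q) [a, b]) p c = (c ** (a ** b - b ** a)) $ i $ j" for a b c
    proof (rule frechet_eqI)
     have "((\<lambda>q. (q ** A) $ i $ j) has_derivative (\<lambda>c. (c ** A) $ i $ j)) (at p)" for A
      by (rule linear_imp_has_derivative)
       (rule linearI; simp add: matrix_matrix_mult_def algebra_simps sum.distrib scaleR_sum_right)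
     then show "((\<lambda>q. cev (entry w t i j q) [a, b]) has_derivative (\<lambda>c. (c ** (a ** b - b ** a)) $ i $ j)) (at p)"
      by (simp add: entry_def cev_sc)
    qed
    let ?C = "\<lambda>a b. a ** b - b ** a" and ?T = "\<lambda>a. a ** p - p ** a"
    have m: "\<xi> ** ?C \<eta> \<zeta> - \<eta> ** ?C \<xi> \<zeta> + \<zeta> ** ?C \<xi> \<eta> =
      (?T \<xi> ** (p ** ?C \<eta> \<zeta>) - ?T \<eta> ** (p ** ?C \<xi> \<zeta>) + ?T \<zeta> ** (p ** ?C \<xi> \<eta>)) -
      (p ** ?C \<eta> \<zeta> ** ?T \<xi> - p ** ?C \<xi> \<zeta> ** ?T \<eta> + p ** ?C \<xi> \<eta> ** ?T \<zeta>)"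
     by (simp only: matrix_diff_ldistrib matrix_diff_rdistrib p pp tg[OF T(1)] tg'[OF T(1)] tg[OF T(2)] tg'[OF T(2)]
       tg[OF T(3)] tg'[OF T(3)] matrix_mul_assoc[symmetric]) (simp add: algebra_simps)
    have w3: "wdg (one_form l) (?E a b) [\<xi>, \<eta>, \<zeta>] = l \<xi> * (p ** ?C \<eta> \<zeta>) $ a $ b - l \<eta> * (p ** ?C \<xi> \<zeta>) $ a $ b + l \<zeta> * (p ** ?C \<xi> \<eta>) $ a $ b" for l a b
     by (simp add: wdg_one_form_Cons E2 E3 del: wdg.simps(2))
    have mm: "(A ** B) $ i $ j = (\<Sum>l\<in>UNIV. A $ i $ l * B $ l $ j)" for A B :: "'a cmatrix"
     by (simp add: matrix_matrix_mult_def)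
    have "R [\<xi>, \<eta>, \<zeta>] = ((?T \<xi> ** (p ** ?C \<eta> \<zeta>) - ?T \<eta> ** (p ** ?C \<xi> \<zeta>) + ?T \<zeta> ** (p ** ?C \<xi> \<eta>)) -
      (p ** ?C \<eta> \<zeta> ** ?T \<xi> - p ** ?C \<xi> \<zeta> ** ?T \<eta> + p ** ?C \<xi> \<eta> ** ?T \<zeta>)) $ i $ j"
     unfolding R_def w3 vector_minus_component vector_add_component mm[of "?T _"] mm[of "p ** ?C _ _"]
     by (simp add: sum.distrib sum_subtractf algebra_simps)
    then show ?thesis
     unfolding 3 m[symmetric] by (simp add: ext_deriv_Cons d E1 E3)
   next
    case (4 a b c d us)
    have z: "(\<lambda>q. cev (entry w t i j q) (x # y # z # xs)) = (\<lambda>_. 0)" for x y z xs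
     by (simp add: entry_def cev_sc)
    have "cev (entry w t i j q) xs = 0" if "3 \<le> length xs" for q xs
     using that by (cases xs rule: remdups_adj.cases; cases "tl (tl xs)") (auto simp: entry_def cev_sc)
    then have "ext_deriv (\<lambda>q. cev (entry w t i j q)) p vs = ext_deriv (\<lambda>q us. 0) p vs"
     by (intro ext_deriv_cong) (use 4 in auto)
    moreover have "wdg (one_form l) (?E x y) vs = wdg (one_form l) (\<lambda>_. 0) vs" for l x y
    proof (rule wdg_one_form_cong)
     fix xs :: "'a cmatrix list" assume "Suc (length xs) = length vs"
     then have "3 \<le> length xs" using 4 by simp
     then show "?E x y xs = 0"
      by (cases xs rule: remdups_adj.cases; cases "tl (tl xs)") (auto simp: entry_def cev_sc)
    qed
    ultimately show ?thesis
     using 4 by (simp add: R_def E3 ext_deriv_def)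
   qed
  qed
  then show ?thesis unfolding Rr by (simp add: cev_eqD[OF True] True)
 qed
qed

subsection \<open>Principal minors\<close>

definition minors :: "('a::comm_ring_1) ^ 'n ^ 'n \<Rightarrow> nat \<Rightarrow> 'a" where
 "minors A k = (\<Sum>I | card I = k. \<Sum>\<sigma> | \<sigma> permutes I. of_int (sign \<sigma>) * (\<Prod>i\<in>I. A $ i $ \<sigma> i))"

text \<open>Every factor of the Leibniz formula is expanded into its two summands. If
  \<open>I\<close> is the set of rows where the entry of \<open>A\<close> is chosen, the unit matrix
  forces the permutation to fix the complement of \<open>I\<close>.\<close>

lemma det_one_plus:
 fixes A :: "'a::comm_ring_1 ^ 'n ^ 'n"
 shows "det (mat 1 + (\<chi> i j. s * A $ i $ j)) = (\<Sum>k\<le>CARD('n). s ^ k * minors A k)"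
proof -
 have "det (mat 1 + (\<chi> i j. s * A $ i $ j)) =
  (\<Sum>\<sigma> | \<sigma> permutes UNIV. of_int (sign \<sigma>) * (\<Sum>I\<in>Pow UNIV. (\<Prod>i\<in>I. s * A $ i $ \<sigma> i) * (\<Prod>i\<in>UNIV - I. if \<sigma> i = i then 1 else 0)))"
  unfolding det_def
  by (rule sum.cong[OF refl]) (subst prod_add[symmetric], simp_all add: mat_def add.commute eq_commute)
 also have "\<dots> = (\<Sum>I\<in>UNIV. \<Sum>\<sigma> | \<sigma> permutes UNIV. of_int (sign \<sigma>) * ((\<Prod>i\<in>I. s * A $ i $ \<sigma> i) * (\<Prod>i\<in>UNIV - I. if \<sigma> i = i then 1 else 0)))"
  unfolding sum_distrib_left by (subst sum.swap) simp
 also have "\<dots> = (\<Sum>I\<in>UNIV. s ^ card I * (\<Sum>\<sigma> | \<sigma> permutes I. of_int (sign \<sigma>) * (\<Prod>i\<in>I. A $ i $ \<sigma> i)))"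
 proof (rule sum.cong[OF refl])
  fix I :: "'n set"
  have p: "(\<Prod>i\<in>UNIV - I. if \<sigma> i = i then 1 else (0::'a)) = (if \<sigma> permutes I then 1 else 0)"
   if "\<sigma> permutes UNIV" for \<sigma>
  proof (cases "\<sigma> permutes I")
   case True
   then show ?thesis by (auto simp: permutes_not_in intro!: prod.neutral)
  next
   case False
   have "bij \<sigma>" using that by (rule permutes_bij)
   then have "\<exists>i. i \<notin> I \<and> \<sigma> i \<noteq> i" using False unfolding permutes_def bij_iff by blast
   then obtain i where "i \<in> UNIV - I" "\<sigma> i \<noteq> i" by blast
   then have "(\<Prod>i\<in>UNIV - I. if \<sigma> i = i then 1 else (0::'a)) = 0" by (intro prod_zero) auto
   then show ?thesis using False by simp
  qed
  have "(\<Sum>\<sigma> | \<sigma> permutes UNIV. of_int (sign \<sigma>) * ((\<Prod>i\<in>I. s * A $ i $ \<sigma> i) * (\<Prod>i\<in>UNIV - I. if \<sigma> i = i then 1 else 0)))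
   = (\<Sum>\<sigma> | \<sigma> permutes UNIV. if \<sigma> permutes I then s ^ card I * (of_int (sign \<sigma>) * (\<Prod>i\<in>I. A $ i $ \<sigma> i)) else 0)"
   by (rule sum.cong) (auto simp: p prod.distrib algebra_simps)
  also have "\<dots> = (\<Sum>\<sigma> | \<sigma> permutes I. s ^ card I * (of_int (sign \<sigma>) * (\<Prod>i\<in>I. A $ i $ \<sigma> i)))"
   by (rule sum.mono_neutral_cong_right) (auto intro: permutes_subset)
  finally show "(\<Sum>\<sigma> | \<sigma> permutes UNIV. of_int (sign \<sigma>) * ((\<Prod>i\<in>I. s * A $ i $ \<sigma> i) * (\<Prod>i\<in>UNIV - I. if \<sigma> i = i then 1 else 0)))
   = s ^ card I * (\<Sum>\<sigma> | \<sigma> permutes I. of_int (sign \<sigma>) * (\<Prod>i\<in>I. A $ i $ \<sigma> i))"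
   by (simp add: sum_distrib_left)
 qed
 also have "\<dots> = (\<Sum>k\<le>CARD('n). \<Sum>I | I \<in> UNIV \<and> card I = k. s ^ card I * (\<Sum>\<sigma> | \<sigma> permutes I. of_int (sign \<sigma>) * (\<Prod>i\<in>I. A $ i $ \<sigma> i)))"
  by (rule sum.group[symmetric]) (auto simp: card_mono)
 also have "\<dots> = (\<Sum>k\<le>CARD('n). s ^ k * minors A k)"
  unfolding minors_def sum_distrib_left[of "_ ^ _"] by (intro sum.cong) auto
 finally show ?thesis .
qed

text \<open>
 The coefficient ring has square-zero odd elements, so \<open>1 + \<Theta>\<close> is invertible with inverse
 \<open>1 - \<Theta>\<close>, and \<open>M + [\<Theta>, M]\<close> is conjugate to \<open>M\<close>.
\<close>

lemma minors_bracket: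
 fixes M \<Theta> :: "'a cochain ^ 'n ^ 'n"
 assumes M: "\<And>i j. evn (M $ i $ j)" and \<Theta>: "\<And>i j. oddn (\<Theta> $ i $ j)"
 shows "minors (M + (\<Theta> ** M - M ** \<Theta>)) k = minors M k"
proof -
 let ?N = "M + (\<Theta> ** M - M ** \<Theta>)"
 have d: "A ** (B - C) = A ** B - A ** C" "(A - B) ** C = A ** C - B ** C" "(A + B) ** C = A ** C + B ** C"
  for A B C :: "'a cochain ^ 'n ^ 'n"
  by (simp_all add: matrix_matrix_mult_def vec_eq_iff algebra_simps sum_subtractf sum.distrib)
 have tt: "\<Theta> ** \<Theta> = 0"
  by (simp add: matrix_matrix_mult_def vec_eq_iff odd_mult_odd[OF \<Theta> \<Theta>])
 have tmt: "\<Theta> ** M ** \<Theta> = 0"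
 proof -
  have "oddn ((M ** \<Theta>) $ i $ j)" for i j
  proof -
   have "oddn (sum f A)" if "\<And>a. oddn (f a)" for f :: "'n \<Rightarrow> 'a cochain" and A
    using that by (auto simp: oddc_def cev_sum)
   then show ?thesis by (simp add: matrix_matrix_mult_def oddn_mult M \<Theta>)
  qed
  then have "\<Theta> ** (M ** \<Theta>) = 0"
   unfolding matrix_matrix_mult_def[of \<Theta>] by (simp add: vec_eq_iff odd_mult_odd[OF \<Theta>])
  then show ?thesis by (simp add: matrix_mul_assoc)
 qed
 have det: "det (mat 1 + (\<chi> i j. s * ?N $ i $ j)) = det (mat 1 + (\<chi> i j. s * M $ i $ j))" for s
 proof -
  let ?S = "\<lambda>A. (\<chi> i j. s * A $ i $ j) :: 'a cochain ^ 'n ^ 'n"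
  have S: "?S A ** B = ?S (A ** B)" "A ** ?S B = ?S (A ** B)" "?S (A + B) = ?S A + ?S B" "?S (A - B) = ?S A - ?S B" "?S 0 = 0"
   for A B :: "'a cochain ^ 'n ^ 'n"
   by (simp_all add: matrix_matrix_mult_def vec_eq_iff algebra_simps sum_distrib_left)
  have "(mat 1 + \<Theta>) ** (mat 1 + ?S M) ** (mat 1 - \<Theta>) = mat 1 + ?S ?N"
   by (simp only: d matrix_add_ldistrib matrix_mul_lid matrix_mul_rid S tt tmt) (simp add: algebra_simps)
  then have "det (mat 1 + ?S ?N) = det (mat 1 + \<Theta>) * det (mat 1 + ?S M) * det (mat 1 - \<Theta>)"
   by (metis det_mul)
  also have "\<dots> = det ((mat 1 + \<Theta>) ** (mat 1 - \<Theta>)) * det (mat 1 + ?S M)"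
   by (simp add: det_mul mult.commute mult.left_commute)
  also have "(mat 1 + \<Theta>) ** (mat 1 - \<Theta>) = mat 1"
   by (simp only: d matrix_mul_lid matrix_mul_rid tt) simp
  finally show ?thesis by simp
 qed
 have "minors ?N k - minors M k = 0"
 proof (cases "k \<le> CARD('n)")
  case True
  show ?thesis
  proof (rule cochain_eqI)
   fix vs
   \<comment> \<open>Equality of the determinants for all scalars \<open>z\<close> is an identity of
     polynomials in \<open>z\<close>, so their coefficients agree.\<close>
   have "(\<Sum>k\<le>CARD('n). cev (minors ?N k - minors M k) vs * z ^ k) = 0" for z
   proof -
    have "(\<Sum>k\<le>CARD('n). sc z ^ k * minors ?N k) = (\<Sum>k\<le>CARD('n). sc z ^ k * minors M k)"
     using det[of "sc z"] by (simp only: det_one_plus)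
    then have "cev (\<Sum>k\<le>CARD('n). sc (z ^ k) * minors ?N k) vs = cev (\<Sum>k\<le>CARD('n). sc (z ^ k) * minors M k) vs"
     by (simp add: sc_power)
    then have "(\<Sum>k\<le>CARD('n). z ^ k * cev (minors ?N k) vs) = (\<Sum>k\<le>CARD('n). z ^ k * cev (minors M k) vs)"
     by (simp only: cev_sum cev_sc_mult)
    then show ?thesis by (simp add: sum_subtractf right_diff_distrib mult.commute[of _ "z ^ _"])
   qed
   from zero_polynom_imp_zero_coeffs[OF this True] show "cev (minors ?N k - minors M k) vs = cev 0 vs" by simp
  qed
 next
  case False
  then have "{I :: 'n set. card I = k} = {}"
   by (metis (mono_tags, lifting) card_mono empty_Collect_eq finite_class.finite_UNIV subset_UNIV)
  then show ?thesis by (simp add: minors_def)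
 qed
 then show ?thesis by simp
qed

subsection \<open>Equivariant characteristic forms\<close>

definition eqchern :: "('N \<Rightarrow> real) \<Rightarrow> complex \<Rightarrow> nat \<Rightarrow> 'N::finite cmatrix \<Rightarrow> 'N cmatrix cochain" where
 "eqchern w t k p = sc ((\<i> / (2 * of_real pi)) ^ k) * minors (\<chi> i j. entry w t i j p) k"

definition eqsubst :: "('N \<Rightarrow> real) \<Rightarrow> complex \<Rightarrow> nat polynomial \<Rightarrow> 'N::finite cmatrix \<Rightarrow> 'N cmatrix cochain" where
 "eqsubst w t Q p = (\<Sum>m\<in>Poly_Mapping.keys Q. sc (Poly_Mapping.lookup Q m) *
   (\<Prod>k\<in>Poly_Mapping.keys m. eqchern w t k p ^ Poly_Mapping.lookup m k))"

lemma nicef_eqchern_param: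
 assumes "algf t" "linear P" shows "nicef (\<lambda>x. eqchern w (t x) k (P x))"
 unfolding eqchern_def[abs_def] minors_def
 by (intro nicef_mult nicef_const nicef_sum; simp flip: sc_of_int add: nicef_const nicef_prod nicef_entry_param assms)

lemma nicef_eqsubst_param:
 assumes "algf t" "linear P" shows "nicef (\<lambda>x. eqsubst w (t x) Q (P x))"
 unfolding eqsubst_def[abs_def]
 by (intro nicef_sum nicef_mult nicef_const nicef_prod nicef_power nicef_eqchern_param assms)

lemma nicef_eqchern: "nicef (eqchern w t k)"
 using nicef_eqchern_param[OF algf_const linear_ident'] .

text \<open>By the Bianchi identity \<open>eqPhi\<close> maps the matrix of entries to M +
  [\<Theta>, M], and principal minors do not see the bracket. So \<open>eqPhi\<close> acts on the
  Chern form as restriction, which means that D of it vanishes.\<close>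

lemma eqclosed_eqchern: "eqclosed w t (eqchern w t k)"
 unfolding eqclosed_def
proof (intro conjI allI impI nicef_eqchern)
 fix p :: "'a cmatrix" assume p: "p ** p = p"
 define M where "M = (\<chi> i j. res (tang p) (entry w t i j p))"
 define \<Theta> where "\<Theta> = (\<chi> i j. connection p i j)"
 define c where "c = (\<i> / (2 * complex_of_real pi)) ^ k"
 have ent: "eqPhi w t (entry w t i j) p = (M + (\<Theta> ** M - M ** \<Theta>)) $ i $ j" for i j
  by (simp add: eqPhi_def eqD_entry[OF p] M_def \<Theta>_def matrix_matrix_mult_def sum_subtractf)
 have nI: "nicef (\<lambda>p. \<Sum>\<sigma> | \<sigma> permutes I. of_int (sign \<sigma>) * (\<Prod>i\<in>I. entry w t i (\<sigma> i) p))" for I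
  by (intro nicef_sum) (simp flip: sc_of_int add: nicef_mult nicef_const nicef_prod nicef_entry)
 have n: "nicef (\<lambda>p. of_int (sign \<sigma>) * (\<Prod>i\<in>I. entry w t i (\<sigma> i) p))" for I \<sigma>
  by (simp flip: sc_of_int add: nicef_mult nicef_const nicef_prod nicef_entry)
 have "eqPhi w t (eqchern w t k) p = sc c * minors (M + (\<Theta> ** M - M ** \<Theta>)) k"
 proof -
  have "eqPhi w t (\<lambda>p. of_int (sign \<sigma>) * (\<Prod>i\<in>I. entry w t i (\<sigma> i) p)) p = of_int (sign \<sigma>) * (\<Prod>i\<in>I. (M + (\<Theta> ** M - M ** \<Theta>)) $ i $ \<sigma> i)" for \<sigma> I
   unfolding sc_of_int[symmetric]
   by (subst eqPhi_mult) (simp_all add: nicef_const nicef_prod nicef_entry eqPhi_const eqPhi_prod ent del: vector_add_component)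
  then have "eqPhi w t (\<lambda>p. minors (\<chi> i j. entry w t i j p) k) p = minors (M + (\<Theta> ** M - M ** \<Theta>)) k"
   unfolding minors_def by (simp add: eqPhi_sum nI n del: vector_add_component)
  moreover have "nicef (\<lambda>p. minors (\<chi> i j. entry w t i j p) k)"
   unfolding minors_def by (intro nicef_sum) (simp add: n)
  ultimately show ?thesis
   unfolding eqchern_def[abs_def] by (subst eqPhi_mult) (simp_all add: nicef_const eqPhi_const c_def)
 qed
 also have "minors (M + (\<Theta> ** M - M ** \<Theta>)) k = minors M k"
  by (rule minors_bracket) (simp_all add: M_def \<Theta>_def oddn_connection evn_res nicef_evn[OF nicef_entry])
 also have "sc c * minors M k = res (tang p) (eqchern w t k p)"
  by (simp add: eqchern_def minors_def M_def c_def res_hom res_sum res_prod res_of_int)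
 finally show "eqD w t (eqchern w t k) p = 0" by (simp add: eqPhi_def)
qed

lemma eqclosed_eqsubst: "eqclosed w t (eqsubst w t Q)"
 unfolding eqsubst_def[abs_def]
 by (intro eqclosed_sum eqclosed_mult eqclosed_const eqclosed_prod eqclosed_power eqclosed_eqchern)

lemma nicef_eqsubst: "nicef (eqsubst w t Q)"
 using eqclosed_eqsubst eqclosed_def by blast

text \<open>At parameter zero the moment part disappears.\<close>

lemma cev_eqchern_0: "chern_form k p = cev (eqchern w 0 k p)"
proof (rule ext)
 fix vs
 have "wedge_prod (\<lambda>i. curvature i (\<sigma> i)) I p = cev (\<Prod>i\<in>I. entry w 0 i (\<sigma> i) p)" for I \<sigma>
 proof -
  have "evenc (curvature i j q)" for i j and q :: "'a cmatrix"
   using nicef_evn[OF nicef_curvature[OF linear_ident'], of i j q] by simp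
  then show ?thesis
   by (subst wedge_prod_eq) (simp_all add: entry_def sc_hom)
 qed
 then show "chern_form k p vs = cev (eqchern w 0 k p) vs"
  by (simp add: chern_form_def eqchern_def minors_def cev_sum flip: sc_of_int)
qed

lemma subst_form_chern: "subst_form Q chern_form p = cev (eqsubst w 0 Q p)"
proof -
 have "evenc (chern_form k q)" for k and q :: "'a cmatrix"
  unfolding cev_eqchern_0[where w = w] by (rule nicef_evn[OF nicef_eqchern])
 then show ?thesis
  by (simp add: subst_form_eq eqsubst_def cev_eqchern_0[where w = w])
qed

section \<open>Localisation at the fixed points\<close>

subsection \<open>A Gaussian integral\<close>

lemma nn_integral_gauss:
 assumes a: "0 < a"
 shows "(\<integral>\<^sup>+y. ennreal (exp (- (a * y\<^sup>2))) \<partial>lborel) = ennreal (sqrt (pi / a))"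
proof -
 define \<sigma> where "\<sigma> = 1 / sqrt (2 * a)"
 have \<sigma>: "\<sigma> > 0" using a by (simp add: \<sigma>_def)
 have s2: "\<sigma>\<^sup>2 = 1 / (2 * a)" using a by (simp add: \<sigma>_def power_divide)
 have "(\<integral>\<^sup>+y. ennreal (normal_density 0 \<sigma> y) \<partial>lborel) = 1"
  using prob_space.emeasure_space_1[OF prob_space_normal_density[OF \<sigma>, of 0]]
  by (simp add: emeasure_density)
 moreover have "exp (- (a * y\<^sup>2)) = sqrt (pi / a) * normal_density 0 \<sigma> y" for y
  using a by (simp add: normal_density_def s2 real_sqrt_divide)
 ultimately show ?thesis
  using a by (simp add: ennreal_mult nn_integral_cmult)
qed

text \<open>With q the quadratic form, the integrand is the Gamma integral over x > 0 of x^N exp(-(1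
  + q) x) / N!. Exchanging the integrals leaves a Gaussian in \<open>u\<close>, whose value carries
  x^(-N) because the real dimension is \<open>2 * N\<close>; the powers of x cancel.\<close>

theorem nn_integral_rational:
 fixes K :: "'a::euclidean_space \<Rightarrow> real"
 assumes K: "\<And>b. b \<in> Basis \<Longrightarrow> K b > 0" and N: "DIM('a) = 2 * N"
 shows "(\<integral>\<^sup>+u. ennreal (1 / (1 + (\<Sum>b\<in>Basis. K b * (u \<bullet> b)\<^sup>2)) ^ (N + 1)) \<partial>lborel) =
  ennreal (pi ^ N / (fact N * (\<Prod>b\<in>Basis. sqrt (K b))))"
proof -
 define q where "q u = (\<Sum>b\<in>Basis. K b * (u \<bullet> b)\<^sup>2)" for u :: 'a
 have q: "q u \<ge> 0" for u unfolding q_def by (intro sum_nonneg mult_nonneg_nonneg less_imp_le[OF K]) auto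
 have qm [measurable]: "q \<in> borel_measurable borel" unfolding q_def[abs_def] by measurable
 define f where "f x u = indicator {0<..} x * (x ^ N * exp (- (1 + q u) * x) / fact N)" for x :: real and u
 have f_int: "(\<integral>\<^sup>+x. ennreal (f x u) \<partial>lborel) = ennreal (1 / (1 + q u) ^ (N + 1))" for u
 proof -
  have l: "0 < 1 + q u" using q[of u] by simp
  have "AE x in lborel. ennreal (f x u) = ennreal (1 / (1 + q u) ^ (N + 1)) * ennreal (erlang_density N (1 + q u) x)"
  proof (rule AE_mp[OF AE_lborel_singleton[of 0]], rule AE_I2, rule impI)
   fix x :: real assume "x \<noteq> 0"
   then show "ennreal (f x u) = ennreal (1 / (1 + q u) ^ (N + 1)) * ennreal (erlang_density N (1 + q u) x)"
    using l by (auto simp: f_def erlang_density_def indicator_def ennreal_mult[symmetric])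
  qed
  then have "(\<integral>\<^sup>+x. ennreal (f x u) \<partial>lborel) = (\<integral>\<^sup>+x. ennreal (1 / (1 + q u) ^ (N + 1)) * ennreal (erlang_density N (1 + q u) x) \<partial>lborel)"
   by (rule nn_integral_cong_AE)
  also have "\<dots> = ennreal (1 / (1 + q u) ^ (N + 1)) * (\<integral>\<^sup>+x. ennreal (erlang_density N (1 + q u) x) \<partial>lborel)"
   by (rule nn_integral_cmult) simp
  also have "(\<integral>\<^sup>+x. ennreal (erlang_density N (1 + q u) x) \<partial>lborel) = 1"
   using prob_space.emeasure_space_1[OF prob_space_erlang_density[OF l, of N]]
   by (simp add: emeasure_density)
  finally show ?thesis by simp
 qed
 define c where "c = pi ^ N / (fact N * (\<Prod>b\<in>Basis. sqrt (K b)))"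
 have g_int: "(\<integral>\<^sup>+u. ennreal (f x u) \<partial>lborel) = ennreal c * ennreal (indicator {0<..} x * exp (- x))" for x
 proof (cases "x > 0")
  case True
  have "ennreal (f x u) = ennreal (x ^ N * exp (- x) / fact N) * (\<Prod>b\<in>Basis. ennreal (exp (- (x * K b * (u \<bullet> b)\<^sup>2))))" for u
  proof -
   have "exp (- (1 + q u) * x) = exp (- x) * (\<Prod>b\<in>Basis. exp (- (x * K b * (u \<bullet> b)\<^sup>2)))"
    unfolding exp_sum[OF finite_Basis, symmetric] exp_add[symmetric]
    by (simp add: q_def sum_negf sum_distrib_left sum_distrib_right algebra_simps)
   then show ?thesis
    using True by (simp add: f_def prod_ennreal ennreal_mult[symmetric] prod_nonneg)
  qed
  then have "(\<integral>\<^sup>+u. ennreal (f x u) \<partial>lborel) =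
    ennreal (x ^ N * exp (- x) / fact N) * (\<integral>\<^sup>+u. (\<Prod>b\<in>Basis. ennreal (exp (- (x * K b * (u \<bullet> b)\<^sup>2)))) \<partial>lborel)"
   by (simp add: nn_integral_cmult)
  also have "(\<integral>\<^sup>+u. (\<Prod>b\<in>Basis. ennreal (exp (- (x * K b * (u \<bullet> b)\<^sup>2)))) \<partial>(lborel :: 'a measure)) =
    (\<Prod>b\<in>(Basis::'a set). \<integral>\<^sup>+y. ennreal (exp (- (x * K b * y\<^sup>2))) \<partial>lborel)"
   by (rule nn_integral_lborel_prod[of "\<lambda>b y. ennreal (exp (- (x * K b * y\<^sup>2)))"]) auto
  also have "\<dots> = (\<Prod>b\<in>(Basis::'a set). ennreal (sqrt (pi / (x * K b))))"
   using True K by (intro prod.cong nn_integral_gauss) auto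
  also have "\<dots> = ennreal (\<Prod>b\<in>(Basis::'a set). sqrt (pi / (x * K b)))"
   using True K by (intro prod_ennreal) (auto intro: less_imp_le)
  also have "(\<Prod>b\<in>(Basis::'a set). sqrt (pi / (x * K b))) = (pi / x) ^ N / (\<Prod>b\<in>Basis. sqrt (K b))"
  proof -
   have "(\<Prod>b\<in>(Basis::'a set). sqrt (pi / (x * K b))) = (\<Prod>b\<in>(Basis::'a set). sqrt (pi / x) / sqrt (K b))"
    by (simp add: real_sqrt_divide real_sqrt_mult)
   also have "\<dots> = sqrt (pi / x) ^ (2 * N) / (\<Prod>b\<in>Basis. sqrt (K b))"
    by (simp add: prod_dividef N)
   also have "sqrt (pi / x) ^ (2 * N) = (pi / x) ^ N"
    using True by (simp add: power_mult)
   finally show ?thesis .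
  qed
  finally show ?thesis
   using True K by (simp add: c_def ennreal_mult[symmetric] prod_nonneg less_imp_le power_divide)
 next
  case False
  then show ?thesis by (simp add: f_def)
 qed
 have fm: "(\<lambda>(u, x). ennreal (f x u)) \<in> borel_measurable (lborel \<Otimes>\<^sub>M lborel)"
  unfolding f_def[abs_def] by measurable
 have "(\<integral>\<^sup>+u. ennreal (1 / (1 + q u) ^ (N + 1)) \<partial>lborel) = (\<integral>\<^sup>+u. \<integral>\<^sup>+x. ennreal (f x u) \<partial>lborel \<partial>lborel)"
  by (simp add: f_int)
 also have "\<dots> = (\<integral>\<^sup>+x. \<integral>\<^sup>+u. ennreal (f x u) \<partial>lborel \<partial>lborel)"
  using lborel_pair.Fubini'[OF fm] by simp
 also have "\<dots> = (\<integral>\<^sup>+x. ennreal c * ennreal (indicator {0<..} x * exp (- x)) \<partial>lborel)"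
  by (simp add: g_int)
 also have "\<dots> = ennreal c * (\<integral>\<^sup>+x. ennreal (indicator {0<..} x * exp (- x)) \<partial>lborel)"
  by (rule nn_integral_cmult) simp
 also have "(\<integral>\<^sup>+x. ennreal (indicator {0<..} x * exp (- x)) \<partial>lborel) = (\<integral>\<^sup>+x. ennreal (erlang_density 0 1 x) \<partial>lborel)"
 proof (rule nn_integral_cong_AE, rule AE_mp[OF AE_lborel_singleton[of 0]], rule AE_I2, rule impI)
  fix x :: real assume "x \<noteq> 0"
  then show "ennreal (indicator {0<..} x * exp (- x)) = ennreal (erlang_density 0 1 x)"
   by (auto simp: erlang_density_def indicator_def)
 qed
 also have "\<dots> = 1"
  using prob_space.emeasure_space_1[OF prob_space_erlang_density[of 1 0]]
  by (simp add: emeasure_density)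
 finally show ?thesis by (simp add: c_def q_def)
qed

lemma integral_rational:
 fixes K :: "'a::euclidean_space \<Rightarrow> real"
 assumes K: "\<And>b. b \<in> Basis \<Longrightarrow> K b > 0" and N: "DIM('a) = 2 * N"
 shows "integrable lborel (\<lambda>u. 1 / (1 + (\<Sum>b\<in>Basis. K b * (u \<bullet> b)\<^sup>2)) ^ (N + 1))"
  "(LINT u|lborel. 1 / (1 + (\<Sum>b\<in>Basis. K b * (u \<bullet> b)\<^sup>2)) ^ (N + 1)) = pi ^ N / (fact N * (\<Prod>b\<in>Basis. sqrt (K b)))"
proof -
 have nn: "0 \<le> 1 / (1 + (\<Sum>b\<in>Basis. K b * (u \<bullet> b)\<^sup>2)) ^ (N + 1)" for u :: 'a
 proof -
  have "0 \<le> (\<Sum>b\<in>Basis. K b * (u \<bullet> b)\<^sup>2)" by (intro sum_nonneg mult_nonneg_nonneg less_imp_le[OF K]) auto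
  then show ?thesis by simp
 qed
 have c: "0 \<le> pi ^ N / (fact N * (\<Prod>b\<in>(Basis::'a set). sqrt (K b)))"
  using K by (intro divide_nonneg_nonneg mult_nonneg_nonneg prod_nonneg) (auto intro: less_imp_le)
 have "has_bochner_integral lborel (\<lambda>u. 1 / (1 + (\<Sum>b\<in>Basis. K b * (u \<bullet> b)\<^sup>2)) ^ (N + 1)) (pi ^ N / (fact N * (\<Prod>b\<in>(Basis::'a set). sqrt (K b))))"
  by (rule has_bochner_integral_nn_integral[OF _ _ c nn_integral_rational[OF K N]]) (use nn in auto)
 then show "integrable lborel (\<lambda>u. 1 / (1 + (\<Sum>b\<in>Basis. K b * (u \<bullet> b)\<^sup>2)) ^ (N + 1))"
  "(LINT u|lborel. 1 / (1 + (\<Sum>b\<in>Basis. K b * (u \<bullet> b)\<^sup>2)) ^ (N + 1)) = pi ^ N / (fact N * (\<Prod>b\<in>Basis. sqrt (K b)))"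
  by (simp_all add: has_bochner_integral_iff)
qed

subsection \<open>Laplace's method\<close>

text \<open>Put s = (n + 1)^2. Substituting u / (n + 1) for z turns s Q(z) into a quantity with
  limit Q2(u) and leaves the factor (1/s)^(N - j). Hence only \<open>j = N\<close> contributes in
  the limit.\<close>

lemma laplace:
 fixes a :: "'a::euclidean_space \<Rightarrow> complex" and Q Q2 :: "'a \<Rightarrow> real"
 assumes N: "DIM('a) = 2 * N" and j: "j \<le> N"
  and A: "A \<in> sets borel" "A \<subseteq> cball 0 R" and \<delta>: "0 < \<delta>" "ball 0 \<delta> \<subseteq> A"
  and a: "continuous_on UNIV a" and Qc: "continuous_on UNIV Q"
  and c: "0 < c" "\<And>z. z \<in> cball 0 R \<Longrightarrow> c * (norm z)\<^sup>2 \<le> Q z"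
  and Q2: "\<And>u. (\<lambda>n. (real (Suc n))\<^sup>2 * Q (u /\<^sub>R real (Suc n))) \<longlonglongrightarrow> Q2 u"
 shows "(\<lambda>n. LINT z:A|lborel. of_real ((real (Suc n))\<^sup>2 ^ j / (1 + (real (Suc n))\<^sup>2 * Q z) ^ (j + 1)) * a z)
  \<longlonglongrightarrow> (if j = N then a 0 * of_real (LINT u|lborel. 1 / (1 + Q2 u) ^ (N + 1)) else 0)"
proof -
 define r where "r n = real (Suc n)" for n
 have r1: "r n \<ge> 1" and r0: "r n > 0" for n by (simp_all add: r_def)
 define F where "F n z = indicator A z *\<^sub>R (of_real ((r n)\<^sup>2 ^ j / (1 + (r n)\<^sup>2 * Q z) ^ (j + 1)) * a z)" for n z
 define G where "G n u = of_real (1 / r n ^ (2 * N)) * F n (u /\<^sub>R r n)" for n u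
 have FG: "(LINT z|lborel. F n z) = (LINT u|lborel. G n u)" for n
 proof -
  have "(LINT z|lborel. F n z) = (LINT z|density (distr lborel borel (\<lambda>x. 0 + (1 / r n) *\<^sub>R x)) (\<lambda>_. ennreal (\<bar>1 / r n\<bar> ^ DIM('a))). F n z)"
   by (subst lborel_affine[of "1 / r n" "0::'a"]) (use r0[of n] in auto)
  also have "\<dots> = (LINT z|distr lborel borel (\<lambda>x. 0 + (1 / r n) *\<^sub>R x). (\<bar>1 / r n\<bar> ^ DIM('a)) *\<^sub>R F n z)"
  proof (rule integral_density)
   have "continuous_on UNIV (\<lambda>z. (1 + (r n)\<^sup>2 * Q z) ^ (j + 1))" by (intro continuous_intros Qc)
   then show "F n \<in> borel_measurable (distr lborel borel (\<lambda>x. 0 + (1 / r n) *\<^sub>R x))"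
    unfolding F_def using A(1) borel_measurable_continuous_onI[OF a] borel_measurable_continuous_onI[OF Qc]
    by measurable
  qed auto
  also have "\<dots> = (LINT u|lborel. (\<bar>1 / r n\<bar> ^ DIM('a)) *\<^sub>R F n (0 + (1 / r n) *\<^sub>R u))"
  proof (rule integral_distr)
   show "(\<lambda>z. (\<bar>1 / r n\<bar> ^ DIM('a)) *\<^sub>R F n z) \<in> borel_measurable borel"
    unfolding F_def using A(1) borel_measurable_continuous_onI[OF a] borel_measurable_continuous_onI[OF Qc]
    by measurable
  qed simp
  also have "\<dots> = (LINT u|lborel. G n u)"
   using r0[of n] by (simp add: G_def N power_divide divide_inverse scaleR_conv_of_real[where 'a = complex] power_inverse)
  finally show ?thesis .
 qed
 have "\<exists>M. \<forall>z\<in>cball 0 R. norm (a z) \<le> M"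
  using compact_imp_bounded[OF compact_continuous_image[OF continuous_on_subset[OF a subset_UNIV] compact_cball, of 0 R]]
  unfolding bounded_iff by blast
 then obtain M where M: "\<And>z. z \<in> cball 0 R \<Longrightarrow> norm (a z) \<le> M" by blast
 define c' where "c' = min 1 c"
 have c': "0 < c'" "c' \<le> 1" "c' \<le> c" using c by (auto simp: c'_def)
 define W where "W u = 1 / (1 + (\<Sum>b\<in>Basis. 1 * (u \<bullet> b)\<^sup>2)) ^ (N + 1)" for u :: 'a
 have nsq: "(\<Sum>b\<in>Basis. 1 * (u \<bullet> b)\<^sup>2) = (norm u)\<^sup>2" for u :: 'a
  unfolding power2_norm_eq_inner by (subst euclidean_inner) (simp add: power2_eq_square)
 have W: "W u = 1 / (1 + (norm u)\<^sup>2) ^ (N + 1)" for u unfolding W_def nsq ..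
 \<comment> \<open>On the support 1/s is at most (1 + R^2) / (1 + |u|^2). This trades the N - j
   surplus powers of 1/s for decay, so that the majorant is a multiple of (1 + |u|^2)^(-(N+1)),
   which is integrable in 2 N real dimensions.\<close>
 define B where "B = \<bar>M\<bar> * (1 + R\<^sup>2) ^ (N - j) / c' ^ (j + 1)"
 have Wint: "integrable lborel (\<lambda>u. B * W u)"
  unfolding W_def by (intro integrable_mult_right integral_rational(1)) (simp_all add: N)
 have bound: "norm (G n u) \<le> B * W u" for n u
 proof (cases "u /\<^sub>R r n \<in> A")
  case False
  then show ?thesis using c' by (simp add: G_def F_def W B_def)
 next
  case True
  let ?z = "u /\<^sub>R r n" and ?s = "(r n)\<^sup>2" and ?v = "(norm u)\<^sup>2"
  have z: "?z \<in> cball 0 R" using True A by auto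
  have nz: "?s * (norm ?z)\<^sup>2 = ?v" using r0[of n] by (simp add: power_mult_distrib field_simps)
  have s1: "?s \<ge> 1" using r1[of n] by simp
  have "c * ?v \<le> ?s * Q ?z"
   using mult_left_mono[OF c(2)[OF z], of ?s] nz by (simp add: mult.left_commute)
  moreover have "c' * ?v \<le> c * ?v" using c' by (intro mult_right_mono) auto
  ultimately have den: "c' * (1 + ?v) \<le> 1 + ?s * Q ?z" using c' by (simp add: algebra_simps)
  have pos: "0 < c' * (1 + ?v)" using c' by (intro mult_pos_pos add_pos_nonneg) auto
  have "(norm ?z)\<^sup>2 \<le> R\<^sup>2" using z by (intro power_mono) auto
  then have "?s * (norm ?z)\<^sup>2 \<le> ?s * R\<^sup>2" by (intro mult_left_mono) auto
  then have num: "1 + ?v \<le> (1 + R\<^sup>2) * ?s" unfolding nz distrib_right using s1 by (simp only: mult.commute[of "R\<^sup>2"] mult_1)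
  have v1: "1 + ?v > 0" by (intro add_pos_nonneg) auto
  have inv: "1 / ?s \<le> (1 + R\<^sup>2) / (1 + ?v)" using num s1 v1 by (subst pos_divide_le_eq, linarith, subst times_divide_eq_left, subst pos_le_divide_eq, linarith) (simp only: mult_1)
  have "norm (G n u) = 1 / r n ^ (2 * N) * (?s ^ j / (1 + ?s * Q ?z) ^ (j + 1)) * norm (a ?z)"
   proof -
   have "0 < 1 + ?s * Q ?z" using pos den by linarith
   then have "0 \<le> ?s ^ j / (1 + ?s * Q ?z) ^ (j + 1)" "0 \<le> 1 / r n ^ (2 * N)" using r0[of n] by auto
   then show ?thesis
    using True by (simp only: G_def F_def norm_mult norm_of_real indicator_simps scaleR_one abs_of_nonneg mult.assoc)
  qed
  also have "1 / r n ^ (2 * N) * (?s ^ j / (1 + ?s * Q ?z) ^ (j + 1)) = (1 / ?s) ^ (N - j) * (1 / (1 + ?s * Q ?z)) ^ (j + 1)"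
  proof -
   have "r n ^ (2 * N) = ?s ^ (N - j) * ?s ^ j" using j by (simp add: power_mult power_add[symmetric])
   then show ?thesis using r0[of n] by (simp add: power_divide divide_simps)
  qed
  also have "\<dots> * norm (a ?z) \<le> ((1 + R\<^sup>2) / (1 + ?v)) ^ (N - j) * (1 / (c' * (1 + ?v))) ^ (j + 1) * \<bar>M\<bar>"
  proof (intro mult_mono power_mono)
   show "1 / (1 + ?s * Q ?z) \<le> 1 / (c' * (1 + ?v))" by (rule divide_left_mono[OF den]) (use pos den in \<open>simp_all only: mult_pos_pos less_le_trans zero_le_one\<close>)
   show "norm (a ?z) \<le> \<bar>M\<bar>" using M[OF z] by linarith
  qed (use inv den pos v1 s1 in auto)
  also have "\<dots> = B * W u"
  proof -
   have "(1 + ?v) ^ (N + 1) = (1 + ?v) ^ (N - j) * (1 + ?v) ^ (j + 1)" using j by (simp flip: power_add)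
   then show ?thesis
    by (simp only: B_def W power_divide power_mult_distrib power_one divide_inverse inverse_mult_distrib power_inverse mult_1_left mult_ac)
  qed
  finally show ?thesis .
 qed
 have gm: "G n \<in> borel_measurable lborel" for n
  unfolding G_def F_def using A(1) borel_measurable_continuous_onI[OF a] borel_measurable_continuous_onI[OF Qc]
  by measurable
 define L where "L u = (if j = N then a 0 * of_real (1 / (1 + Q2 u) ^ (N + 1)) else 0)" for u
 have Q2n: "c * (norm u)\<^sup>2 \<le> Q2 u" for u
 proof (rule LIMSEQ_le_const[OF Q2])
  have "(\<lambda>n. u /\<^sub>R real (Suc n)) \<longlonglongrightarrow> 0"
   using tendsto_scaleR[OF LIMSEQ_inverse_real_of_nat tendsto_const[of u]] by simp
  then have "\<forall>\<^sub>F n in sequentially. u /\<^sub>R real (Suc n) \<in> ball 0 \<delta>"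
   using \<delta> by (intro topological_tendstoD) auto
  then obtain n0 where n0: "\<And>n. n \<ge> n0 \<Longrightarrow> u /\<^sub>R real (Suc n) \<in> ball 0 \<delta>"
   by (auto simp: eventually_sequentially)
  have "c * (norm u)\<^sup>2 \<le> (real (Suc n))\<^sup>2 * Q (u /\<^sub>R real (Suc n))" if "n \<ge> n0" for n
  proof -
   have "c * (norm (u /\<^sub>R real (Suc n)))\<^sup>2 \<le> Q (u /\<^sub>R real (Suc n))"
    by (rule c(2)) (use n0[OF that] \<delta> A in blast)
   from mult_left_mono[OF this, of "(real (Suc n))\<^sup>2"] show ?thesis
    by (simp add: power_mult_distrib field_simps)
  qed
  then show "\<exists>n0. \<forall>n\<ge>n0. c * (norm u)\<^sup>2 \<le> (real (Suc n))\<^sup>2 * Q (u /\<^sub>R real (Suc n))" by blast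
 qed
 have Q2nn: "Q2 u \<ge> 0" for u
  using Q2n[of u] c(1) by (meson mult_nonneg_nonneg order_trans less_imp_le zero_le_power2)
 have lim: "(\<lambda>n. G n u) \<longlonglongrightarrow> L u" for u
 proof -
  have z0: "(\<lambda>n. u /\<^sub>R r n) \<longlonglongrightarrow> 0"
   using tendsto_scaleR[OF LIMSEQ_inverse_real_of_nat tendsto_const[of u]] by (simp add: r_def)
  have az: "(\<lambda>n. a (u /\<^sub>R r n)) \<longlonglongrightarrow> a 0"
   using continuous_on_tendsto_compose[OF a z0] by simp
  have ev: "\<forall>\<^sub>F n in sequentially. u /\<^sub>R r n \<in> A"
   by (rule eventually_mono[OF topological_tendstoD[OF z0, of "ball 0 \<delta>"]]) (use \<delta> in auto)
  have sr: "(\<lambda>n. (1 / (r n)\<^sup>2) ^ (N - j)) \<longlonglongrightarrow> (if j = N then 1 else 0)"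
  proof (cases "j = N")
   case False
   have "(\<lambda>n. 1 / (r n)\<^sup>2) \<longlonglongrightarrow> 0\<^sup>2"
    using tendsto_power[OF LIMSEQ_inverse_real_of_nat, of 2] by (simp add: r_def power_inverse divide_inverse)
   from tendsto_power[OF this, of "N - j"] show ?thesis using False j by (simp add: power_0_left)
  qed simp
  have "(\<lambda>n. 1 + (r n)\<^sup>2 * Q (u /\<^sub>R r n)) \<longlonglongrightarrow> 1 + Q2 u"
   using Q2[of u] by (intro tendsto_intros) (simp add: r_def)
  then have "(\<lambda>n. (1 / (1 + (r n)\<^sup>2 * Q (u /\<^sub>R r n))) ^ (j + 1)) \<longlonglongrightarrow> (1 / (1 + Q2 u)) ^ (j + 1)"
   using Q2nn[of u] by (intro tendsto_power tendsto_divide tendsto_const) auto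
  from tendsto_mult[OF tendsto_of_real[OF tendsto_mult[OF sr this]] az]
  have "(\<lambda>n. of_real ((1 / (r n)\<^sup>2) ^ (N - j) * (1 / (1 + (r n)\<^sup>2 * Q (u /\<^sub>R r n))) ^ (j + 1)) * a (u /\<^sub>R r n)) \<longlonglongrightarrow> L u"
   by (simp add: L_def power_divide mult.commute split: if_splits)
  then show ?thesis
  proof (rule Lim_transform_eventually)
   show "\<forall>\<^sub>F n in sequentially. of_real ((1 / (r n)\<^sup>2) ^ (N - j) * (1 / (1 + (r n)\<^sup>2 * Q (u /\<^sub>R r n))) ^ (j + 1)) * a (u /\<^sub>R r n) = G n u"
    using ev
   proof (rule eventually_mono)
    fix n assume "u /\<^sub>R r n \<in> A"
    moreover have "r n ^ (2 * N) = (r n)\<^sup>2 ^ (N - j) * (r n)\<^sup>2 ^ j" using j by (simp add: power_mult power_add[symmetric])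
    then have "1 / r n ^ (2 * N) * ((r n)\<^sup>2 ^ j / X) = (1 / (r n)\<^sup>2) ^ (N - j) * (1 / X)" for X
     using r0[of n] by (simp add: power_divide)
    ultimately show "of_real ((1 / (r n)\<^sup>2) ^ (N - j) * (1 / (1 + (r n)\<^sup>2 * Q (u /\<^sub>R r n))) ^ (j + 1)) * a (u /\<^sub>R r n) = G n u"
     unfolding G_def F_def by (simp only: power_one_over[of "1 + _"] mult.assoc[symmetric] of_real_mult[symmetric] indicator_simps scaleR_one) 
   qed
  qed
 qed
 have Lm: "L \<in> borel_measurable lborel" by (rule borel_measurable_LIMSEQ_metric[OF gm lim])
 have "(\<lambda>n. LINT u|lborel. G n u) \<longlonglongrightarrow> (LINT u|lborel. L u)"
  by (rule integral_dominated_convergence[where s = G and w = "\<lambda>u. B * W u", OF Lm gm Wint]) (use lim bound in auto)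
 moreover have "(LINT u|lborel. L u) = (if j = N then a 0 * of_real (LINT u|lborel. 1 / (1 + Q2 u) ^ (N + 1)) else 0)"
  unfolding L_def by (cases "j = N") (simp_all only: if_True if_False refl integral_mult_right_zero integral_complex_of_real Bochner_Integration.integral_zero)
 moreover have "(LINT z:A|lborel. of_real ((real (Suc n))\<^sup>2 ^ j / (1 + (real (Suc n))\<^sup>2 * Q z) ^ (j + 1)) * a z) = (LINT u|lborel. G n u)" for n
  unfolding FG[symmetric] set_lebesgue_integral_def F_def r_def ..
 ultimately show ?thesis by simp
qed

subsection \<open>The localising form\<close>

lemma rot_nth: "rot w \<xi> $ i $ j = \<i> * (of_real (w i) - of_real (w j)) * \<xi> $ i $ j"
 by (simp add: rot_def weight_def matrix_matrix_mult_def if_distrib[of "\<lambda>x. x * _"] if_distrib[of "\<lambda>x. _ * x"]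
   algebra_simps cong: if_cong)

text \<open>Conjugation by unitary matrices preserves the real inner product, so its infinitesimal
  version is skew. This is the isometry property of V.\<close>

lemma rot_skew: "rot w \<xi> \<bullet> \<eta> = - (\<xi> \<bullet> rot w \<eta>)"
 by (simp add: inner_vec_def rot_nth inner_complex_def algebra_simps flip: sum_negf)

definition theta :: "('N \<Rightarrow> real) \<Rightarrow> 'N::finite cmatrix \<Rightarrow> 'N cmatrix list \<Rightarrow> complex" where
 "theta w p = one_form (\<lambda>\<xi>. of_real (rot w p \<bullet> \<xi>))"

text \<open>The exterior derivative of \<open>theta\<close>. It has constant coefficients since V is
  linear in the matrix; skewness of \<open>rot w\<close> makes the two terms of the derivative
  equal, whence the factor 2.\<close>

definition beta :: "('N \<Rightarrow> real) \<Rightarrow> 'N::finite cmatrix cochain" where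
 "beta w = Coch (\<lambda>vs. case vs of [\<xi>, \<eta>] \<Rightarrow> of_real (2 * (rot w \<xi> \<bullet> \<eta>)) | _ \<Rightarrow> 0)"

lemma cev_beta: "cev (beta w) [\<xi>, \<eta>] = of_real (2 * (rot w \<xi> \<bullet> \<eta>))" "length vs \<noteq> 2 \<Longrightarrow> cev (beta w) vs = 0"
 by (auto simp: beta_def split: list.splits)

lemma linear_theta: "linear (\<lambda>p. complex_of_real (rot w p \<bullet> \<xi>))" "linear (\<lambda>\<xi>. complex_of_real (rot w p \<bullet> \<xi>))"
 by (auto simp: linear_iff inner_add_left inner_add_right linear_add[OF rot_linear] linear_scale[OF rot_linear]
   scaleR_conv_of_real[where 'a = complex])

lemma theta_algf: "algf (\<lambda>p. theta w p vs)"
proof (cases "length vs = 1")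
 case True
 then obtain v where "vs = [v]" by (metis One_nat_def length_0_conv length_Suc_conv)
 then show ?thesis by (simp add: theta_def algf_linear linear_theta)
qed (simp add: theta_def one_form_long algf_const)

lemma cform_theta: "cform (theta w)"
 by (simp add: cform_def c1_algf theta_algf) (simp add: theta_def tens_one_form linear_theta)

lemma linear_frechet: "linear L \<Longrightarrow> fder L p v = L v" for L :: "'a::euclidean_space \<Rightarrow> 'b::real_normed_vector"
 by (rule frechet_eqI, rule linear_imp_has_derivative)

lemma ext_deriv_theta: "ext_deriv (theta w) p vs = cev (beta w) vs"
proof -
 have "vs = [] \<or> (\<exists>u. vs = [u]) \<or> (\<exists>u v. vs = [u, v]) \<or> (\<exists>u v x us. vs = u # v # x # us)"
  by (metis neq_Nil_conv)
 then show ?thesis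
 proof (elim disjE exE)
  fix u v assume "vs = [u, v]"
  moreover have "(\<lambda>q. theta w q [u]) = (\<lambda>q. of_real (rot w q \<bullet> u))" for u by (simp add: theta_def)
  moreover have "rot w v \<bullet> u = - (rot w u \<bullet> v)" using rot_skew[of w v u] by (simp add: inner_commute)
  ultimately show ?thesis
   by (simp add: ext_deriv_Cons linear_frechet linear_theta cev_beta)
 next
  fix u v x us assume vs: "vs = u # v # x # us"
  have "ext_deriv (theta w) p vs = ext_deriv (\<lambda>_ _. 0) p vs"
   by (rule ext_deriv_cong) (use vs in \<open>simp add: theta_def one_form_long\<close>)
  then show ?thesis by (simp add: vs cev_beta ext_deriv_def)
 qed (simp_all add: ext_deriv_Cons theta_def cev_beta)
qed

lemma nicef_beta: "nicef (\<lambda>x::'b::euclidean_space. beta w)"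
proof -
 have "ext_deriv (theta w) 0 = cev (beta w)" by (rule ext) (rule ext_deriv_theta)
 then have "tens (cev (beta w))" using tens_ext_deriv[OF cform_theta, of w 0] by simp
 moreover have "evn (beta w)" unfolding evenc_def by (metis cev_beta(2) even_numeral)
 ultimately show ?thesis by (simp add: nicef_def algf_const)
qed

lemma algf_norm_rot: "algf (\<lambda>p. of_real ((norm (rot w p))\<^sup>2))"
proof -
 have "complex_of_real ((norm (rot w p))\<^sup>2) = (\<Sum>b\<in>Basis. of_real (rot w p \<bullet> b) * of_real (rot w p \<bullet> b))" for p
  unfolding power2_norm_eq_inner by (subst euclidean_inner) simp
 then show ?thesis by (simp only:) (intro algf_sum algf_mult algf_linear linear_theta)
qed

lemma frechet_norm_rot:
 "fder (\<lambda>p. complex_of_real ((norm (rot w p))\<^sup>2)) p v = of_real (2 * (rot w p \<bullet> rot w v))"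
proof (rule frechet_eqI)
 have "(rot w has_derivative rot w) (at p)" by (rule linear_imp_has_derivative[OF rot_linear])
 from has_derivative_of_real[OF has_derivative_inner[OF this this]]
 show "((\<lambda>p. complex_of_real ((norm (rot w p))\<^sup>2)) has_derivative (\<lambda>v. complex_of_real (2 * (rot w p \<bullet> rot w v)))) (at p)"
  unfolding power2_norm_eq_inner by (simp add: inner_commute)
qed

text \<open>Only the value on a single argument is in question: there the derivative of |V|^2 and
  the contraction of \<beta> with V cancel by skewness of \<open>rot w\<close>.\<close>

lemma eqclosed_localiser: "eqclosed w t (\<lambda>p. beta w - sc (t * of_real ((norm (rot w p))\<^sup>2)))"
 unfolding eqclosed_def
proof (intro conjI allI impI)
 let ?y = "\<lambda>p. beta w - sc (t * of_real ((norm (rot w p))\<^sup>2))"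
 have "nicef (\<lambda>p. beta w + sc (- t * of_real ((norm (rot w p))\<^sup>2)))"
  by (intro nicef_add nicef_beta nicef_sc algf_mult algf_const algf_norm_rot)
 then show n: "nicef ?y" by (simp add: sc_hom)
 fix p :: "'a cmatrix"
 have "ext_deriv (\<lambda>q. cev (?y q)) p vs - t * cev (?y p) (rot w p # vs) = 0" for vs
 proof -
  have c: "(\<lambda>q. cev (?y q) us) = (\<lambda>_. cev (beta w) us)" if "us \<noteq> []" for us
   using that by (simp add: cev_sc)
  have "vs = [] \<or> (\<exists>u. vs = [u]) \<or> (\<exists>u v us. vs = u # v # us)" by (metis neq_Nil_conv)
  then show ?thesis
  proof (elim disjE exE)
   fix u assume vs: "vs = [u]"
   have "fder (\<lambda>q. - (t * complex_of_real ((norm (rot w q))\<^sup>2))) p u = - (t * of_real (2 * (rot w p \<bullet> rot w u)))"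
    by (rule frechet_eqI, intro has_derivative_minus has_derivative_mult_right)
     (use has_frechet[OF algf_differentiable[OF algf_norm_rot]] in \<open>simp add: frechet_norm_rot[abs_def] del: of_real_power\<close>)
   then have "ext_deriv (\<lambda>q. cev (?y q)) p vs = - (t * of_real (2 * (rot w p \<bullet> rot w u)))"
    by (simp add: vs ext_deriv_Cons cev_sc cev_beta del: of_real_power)
   then show ?thesis
    by (simp add: vs cev_sc cev_beta rot_skew[of w "rot w p"])
  next
   fix u v us assume vs: "vs = u # v # us"
   have "ext_deriv (\<lambda>q. cev (?y q)) p vs = ext_deriv (\<lambda>q. cev (beta w)) p vs"
    by (rule ext_deriv_cong) (use vs in \<open>auto simp: cev_sc\<close>)
   then show ?thesis by (simp add: vs cev_sc cev_beta ext_deriv_def)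
  qed (simp add: cev_sc cev_beta)
 qed
 then have "Coch (\<lambda>vs. ext_deriv (\<lambda>q. cev (?y q)) p vs - t * cev (?y p) (rot w p # vs)) = 0"
  by (intro cochain_eqI) (simp del: of_real_power)
 then show "eqD w t ?y p = 0" unfolding eqD_def by (simp only: res_hom)
qed

text \<open>The inverse of 1 - s D\<theta> as a geometric series around its scalar part, cut off at
  \<open>j = N\<close>; the omitted powers of \<beta> have degree above
  \<open>2 * N\<close>.\<close>

definition expand :: "('N \<Rightarrow> real) \<Rightarrow> nat \<Rightarrow> real \<Rightarrow> real \<Rightarrow> 'N::finite cmatrix \<Rightarrow> 'N cmatrix cochain" where
 "expand w N \<tau> s p = (\<Sum>j\<le>N. sc (of_real (s ^ j / (1 + s * (\<tau> * (norm (rot w p))\<^sup>2)) ^ (j + 1))) * beta w ^ j)"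

section \<open>The truncated inverse of 1 - s D\<theta>\<close>

context
 fixes w :: "'N::finite \<Rightarrow> real" and N :: nat and \<tau> s :: real
 assumes \<tau>: "0 < \<tau>" and s: "0 \<le> s"
begin

text \<open>Here \<open>y\<close> is 1 - s D\<theta>, \<open>den\<close> is its scalar part, and
  \<open>u\<close> is the two-form with y = den (1 - u).\<close>

private definition y :: "'N cmatrix \<Rightarrow> 'N cmatrix cochain" where
 "y p = 1 - sc (of_real s) * (beta w - sc (of_real \<tau> * of_real ((norm (rot w p))\<^sup>2)))"

private definition den :: "'N cmatrix \<Rightarrow> real" where
 "den p = 1 + s * (\<tau> * (norm (rot w p))\<^sup>2)"

private definition u :: "'N cmatrix \<Rightarrow> 'N cmatrix cochain" where
 "u p = sc (of_real (s / den p)) * beta w"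

private lemma den: "den p > 0"
 using \<tau> s by (simp add: den_def add_pos_nonneg)

private lemma algf_den: "algf (\<lambda>p. inverse (of_real (den p)))"
proof (rule algf_inverse)
 show "algf (\<lambda>p. complex_of_real (den p))"
  unfolding den_def of_real_add of_real_mult by (intro algf_add algf_mult algf_const algf_norm_rot)
 show "complex_of_real (den p) \<noteq> 0" for p using den[of p] by simp
qed

private lemma nicef_u: "nicef u"
proof -
 have "nicef (\<lambda>p. sc (of_real s * inverse (of_real (den p))) * beta w)"
  by (intro nicef_mult nicef_sc algf_mult algf_const algf_den nicef_beta)
 then show ?thesis by (simp add: u_def[abs_def] divide_inverse)
qed

private lemma y_alt: "y p = sc (of_real (den p)) * (1 - u p)"
proof -
 have "sc (of_real (den p)) * sc (of_real (s / den p)) = (sc (of_real s) :: 'N cmatrix cochain)"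
  unfolding sc_hom(2)[symmetric] using den[of p] by simp
 then have "sc (of_real (den p)) * (1 - u p) = sc (of_real (den p)) - sc (of_real s) * beta w"
  by (simp only: u_def right_diff_distrib mult_1_right mult.assoc[symmetric])
 moreover have "sc (of_real (den p)) = 1 + sc (of_real s) * (sc (of_real \<tau> * of_real ((norm (rot w p))\<^sup>2)) :: 'N cmatrix cochain)"
  by (simp only: den_def of_real_add of_real_mult sc_hom of_real_1)
 ultimately show ?thesis by (simp only: y_def right_diff_distrib) simp
qed

private lemma expand_alt: "expand w N \<tau> s p = sc (inverse (of_real (den p))) * (\<Sum>j\<le>N. u p ^ j)"
 unfolding expand_def sum_distrib_left
proof (rule sum.cong[OF refl])
 fix j
 have "inverse (complex_of_real (den p)) * of_real (s / den p) ^ j = of_real (s ^ j / den p ^ (j + 1))"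
  by (simp add: divide_inverse power_mult_distrib power_inverse mult_ac)
 then show "sc (of_real (s ^ j / (1 + s * (\<tau> * (norm (rot w p))\<^sup>2)) ^ (j + 1))) * beta w ^ j = sc (inverse (of_real (den p))) * u p ^ j"
  unfolding den_def[symmetric] by (simp only: u_def power_mult_distrib mult.assoc[symmetric] sc_power[symmetric] sc_hom(2)[symmetric])
qed

lemma nicef_expand: "nicef (expand w N \<tau> s)"
 unfolding expand_alt[abs_def] by (intro nicef_mult nicef_sc algf_den nicef_sum nicef_power nicef_u)

private lemma y_expand: "y p * expand w N \<tau> s p = 1 - u p ^ (N + 1)"
proof -
 have "y p * expand w N \<tau> s p = sc (of_real (den p)) * sc (inverse (of_real (den p))) * ((1 - u p) * (\<Sum>j\<le>N. u p ^ j))"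
  by (simp add: y_alt expand_alt mult_ac)
 also have "(1 - u p) * (\<Sum>j\<le>N. u p ^ j) = 1 - u p ^ (N + 1)"
  using one_diff_power_eq[of "u p" "N + 1"] by (simp add: lessThan_Suc_atMost)
 also have "sc (of_real (den p)) * sc (inverse (of_real (den p))) = (1 :: 'N cmatrix cochain)"
  using den[of p] by (simp flip: sc_hom(2) add: sc_hom(3))
 finally show ?thesis by simp
qed

private lemma u_low: "length vs < 2 * k \<Longrightarrow> cev (u p ^ k) vs = 0"
 by (rule cev_power_low_zero[OF nicef_evn[OF nicef_u]]) (simp_all add: u_def cev_beta)

private lemma eqclosed_y: "eqclosed w (of_real \<tau>) y"
proof -
 have "eqclosed w (of_real \<tau>) (\<lambda>p. sc 1 + sc (- of_real s) * (beta w - sc (of_real \<tau> * of_real ((norm (rot w p))\<^sup>2))))"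
  by (intro eqclosed_add eqclosed_mult eqclosed_const eqclosed_localiser)
 then show ?thesis by (simp add: y_def[abs_def] sc_hom algebra_simps)
qed

text \<open>Let h be the truncated inverse. Applying D to y h = 1 - u^(N+1) and using D y = 0 gives
  y D h = D(1 - u^(N+1)), which vanishes in low degrees. Multiplying by h recovers D h up to another
  term with the factor u^(N+1).\<close>

lemma eqD_expand_low:
 assumes F: "eqclosed w (of_real \<tau>) F" and p: "p ** p = p" and l: "length vs < 2 * N + 1"
 shows "cev (eqD w (of_real \<tau>) (\<lambda>q. F q * expand w N \<tau> s q) p) vs = 0"
proof -
 let ?D = "\<lambda>F. eqD w (of_real \<tau>) F p" and ?h = "expand w N \<tau> s"
 have ny: "nicef y" and y0: "?D y = 0" and nF: "nicef F" and F0: "?D F = 0"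
  using eqclosed_y F p by (auto simp: eqclosed_def)
 have nz: "nicef (\<lambda>q. 1 - u q ^ (N + 1))"
  using nicef_mult[OF ny nicef_expand] by (simp add: y_expand)
 have low: "cev (?D (\<lambda>q. 1 - u q ^ (N + 1))) vs = 0" if "length vs < 2 * N + 1" for vs
 proof -
  have "ext_deriv (\<lambda>q. cev (1 - u q ^ (N + 1))) p vs = ext_deriv (\<lambda>q. unitc) p vs"
   by (rule ext_deriv_cong) (use that u_low[of _ "N + 1"] in \<open>simp add: cev_one\<close>)
  moreover have "cev (1 - u p ^ (N + 1)) (rot w p # vs) = 0"
   using that u_low[of "rot w p # vs" "N + 1" p] by (simp add: cev_one unitc_def del: power_Suc)
  ultimately show ?thesis
   by (simp add: eqD_def cev_res ext_deriv_def del: power_Suc)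
 qed
 have "?D (\<lambda>q. 1 - u q ^ (N + 1)) = res (tang p) (y p) * ?D ?h"
  using eqD_mult[OF ny nicef_expand, of w "of_real \<tau>" p] by (simp add: y_expand y0)
 moreover have "res (tang p) (?h p) * (res (tang p) (y p) * ?D ?h) = ?D ?h - res (tang p) (u p ^ (N + 1)) * ?D ?h"
 proof -
  have "res (tang p) (?h p) * res (tang p) (y p) = 1 - res (tang p) (u p ^ (N + 1))"
   unfolding res_hom(3)[symmetric] mult.commute[of "?h p"] y_expand by (simp only: res_hom)
  then show ?thesis by (simp only: mult.assoc[symmetric]) (simp add: algebra_simps)
 qed
 ultimately have e: "?D ?h = res (tang p) (?h p) * ?D (\<lambda>q. 1 - u q ^ (N + 1)) + ?D ?h * res (tang p) (u p ^ (N + 1))"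
  by (simp add: algebra_simps)
 have Dh: "cev (?D ?h) vs = 0" if "length vs < 2 * N + 1" for vs
 proof -
  have "cev (res (tang p) (?h p) * ?D (\<lambda>q. 1 - u q ^ (N + 1))) vs = 0"
   by (rule cev_mult_low_zero[where m = "2 * N + 1"]) (use low that in blast)+
  moreover have "cev (?D ?h * res (tang p) (u p ^ (N + 1))) vs = 0"
   by (rule cev_mult_low_zero[where m = "2 * (N + 1)"]) (use that u_low[of _ "N + 1"] in \<open>auto simp: cev_res simp del: power_Suc\<close>)
  ultimately show ?thesis by (subst e) simp
 qed
 have "?D (\<lambda>q. F q * ?h q) = res (tang p) (F p) * ?D ?h"
  using eqD_mult[OF nF nicef_expand, of w "of_real \<tau>" p] by (simp add: F0)
 then show ?thesis using cev_mult_low_zero[OF Dh l] by simp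
qed

text \<open>With G the product of F and the truncated inverse, d G is \<tau> times the contraction
  of G with V in the relevant degrees. So d(\<theta> G) is \<beta> G - \<tau> |V|^2 G up to \<tau>
  times the contraction of \<theta> G with V. The assumption \<open>top\<close> removes this last
  term; it stands for the fact that 2 N + 1 tangent vectors are dependent. Finally s D\<theta> = 1 -
  y, and y G agrees with F in degree \<open>2 * N\<close>.\<close>

lemma expand_homotopy:
 assumes F: "eqclosed w (of_real \<tau>) F" and p: "p ** p = p" and vs: "set vs \<subseteq> tang p" "length vs = 2 * N"
  and top: "wdg (theta w p) (cev (F p * expand w N \<tau> s p)) (rot w p # vs) = 0"
 shows "of_real s * ext_deriv (\<lambda>q. wdg (theta w q) (cev (F q * expand w N \<tau> s q))) p vs =
  cev (F p * expand w N \<tau> s p) vs - cev (F p) vs"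
proof -
 let ?G = "\<lambda>q. F q * expand w N \<tau> s q"
 have nF: "nicef F" using F by (simp add: eqclosed_def)
 have nG: "nicef ?G" by (intro nicef_mult nF nicef_expand)
 have th: "oddc (theta w q)" for q unfolding theta_def by (rule oddc_one_form)
 have dG: "ext_deriv (\<lambda>q. cev (?G q)) p us = of_real \<tau> * cev (?G p) (rot w p # us)"
  if "set us \<subseteq> set vs" "length us \<le> 2 * N" for us
  proof -
  have t: "set us \<subseteq> tang p" and l: "length us < 2 * N + 1" using that vs by auto
  from eqD_expand_low[OF F p l] show ?thesis unfolding cev_eqD[OF t] by simp
 qed
 have qp: "(\<lambda>us. theta w p (rot w p # us)) = (\<lambda>us. of_real ((norm (rot w p))\<^sup>2) * unitc us)"
  by (auto simp: theta_def unitc_def fun_eq_iff one_form_def power2_norm_eq_inner split: list.splits)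
 have "ext_deriv (\<lambda>q. wdg (theta w q) (cev (?G q))) p vs =
   wdg (cev (beta w)) (cev (?G p)) vs - wdg (theta w p) (ext_deriv (\<lambda>q. cev (?G q)) p) vs"
  using ext_deriv_wdg[OF cform_fdiff[OF cform_theta] nicef_fdiff[OF nG], where vs = vs]
  by (simp add: bar_odd[OF th] wdg_minus_left ext_deriv_theta[abs_def])
 also have "wdg (theta w p) (ext_deriv (\<lambda>q. cev (?G q)) p) vs = of_real \<tau> * wdg (theta w p) (\<lambda>us. cev (?G p) (rot w p # us)) vs"
  unfolding wdg_scale_right[symmetric] by (rule wdg_cong) (use dG vs in auto)
 also have "wdg (theta w p) (\<lambda>us. cev (?G p) (rot w p # us)) vs = of_real ((norm (rot w p))\<^sup>2) * cev (?G p) vs"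
  using top by (simp add: qp wdg_scale_left bar_odd[OF th] wdg_minus_left del: of_real_power)
 also have "wdg (cev (beta w)) (cev (?G p)) vs = cev (beta w * ?G p) vs"
  by (simp add: cev_mult_even nicef_evn[OF nicef_beta])
 finally have d: "of_real s * ext_deriv (\<lambda>q. wdg (theta w q) (cev (?G q))) p vs =
   cev (sc (of_real s) * (beta w - sc (of_real \<tau> * of_real ((norm (rot w p))\<^sup>2))) * ?G p) vs"
  by (simp only: mult.assoc left_diff_distrib cev_sc_mult cev_simps)
 also have "\<dots> = cev (?G p - y p * ?G p) vs" by (simp add: y_def algebra_simps)
 also have "y p * ?G p = F p - F p * u p ^ (N + 1)"
  unfolding mult.left_commute[of _ "F p"] y_expand right_diff_distrib by simp
 also have "cev (?G p - (F p - F p * u p ^ (N + 1))) vs = cev (?G p) vs - cev (F p) vs"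
  using cev_mult_low_zero[of "2 * (N + 1)" "u p ^ (N + 1)" vs "F p"] u_low[of _ "N + 1"] vs by (simp del: power_Suc)
 finally show ?thesis .
qed

end

subsection \<open>Powers of a two-form on a frame\<close>

lemma power_contract:
 assumes b: "evn b"
 shows "cev (b ^ Suc n) (v # vs) = of_nat (Suc n) * wdg (\<lambda>us. cev b (v # us)) (cev (b ^ n)) vs"
proof (induction n arbitrary: vs)
 case 0
 then show ?case by (simp add: cev_one)
next
 case (Suc n)
 let ?i = "\<lambda>us. cev b (v # us)"
 have "(\<lambda>us. cev (b ^ Suc n) (v # us)) = (\<lambda>us. of_nat (Suc n) * wdg ?i (cev (b ^ n)) us)"
  using Suc by blast
 moreover have "cev (b ^ Suc (Suc n)) = wdg (cev b) (cev (b ^ Suc n))"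
  using cev_mult_even[OF b] by simp
 ultimately have "cev (b ^ Suc (Suc n)) (v # vs) =
   wdg ?i (cev (b ^ Suc n)) vs + of_nat (Suc n) * wdg (cev b) (wdg ?i (cev (b ^ n))) vs"
  by (simp only: wdg.simps bar_even[OF b] wdg_scale_right)
 also have "wdg (cev b) (wdg ?i (cev (b ^ n))) vs = wdg ?i (cev (b ^ Suc n)) vs"
  using cev_mult_even[OF b, of "b ^ n"] wdg_comm[OF b, of ?i]
  by (simp flip: wdg_assoc)
 finally show ?case by (simp add: algebra_simps)
qed

lemma wdg_one_form_zero:
 assumes "\<And>v. v \<in> set vs \<Longrightarrow> l v = 0" shows "wdg (one_form l) g vs = 0"
proof -
 have "wdg (one_form l) g vs = wdg (\<lambda>_. 0) g vs"
  by (rule wdg_cong) (use assms in \<open>auto simp: one_form_def split: list.splits\<close>)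
 then show ?thesis by simp
qed

text \<open>Contracting with \<open>e j\<close> leaves only the pairing with the partner
  \<open>e' j\<close>. Each such contraction lowers the exponent by one and brings it out as a
  factor, which accumulates to the factorial.\<close>

lemma power_frame:
 assumes b: "\<And>vs. length vs \<noteq> 2 \<Longrightarrow> cev b vs = 0" and js: "distinct js"
  and pair: "\<And>j. j \<in> set js \<Longrightarrow> cev b [e j, e' j] = c j"
  and orth: "\<And>j l. j \<in> set js \<Longrightarrow> l \<in> set js \<Longrightarrow> j \<noteq> l \<Longrightarrow> cev b [e j, e l] = 0 \<and> cev b [e j, e' l] = 0"
 shows "cev (b ^ length js) (concat (map (\<lambda>j. [e j, e' j]) js)) = fact (length js) * (\<Prod>j\<in>set js. c j)"
 using js pair orth
proof (induction js)
 case Nil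
 then show ?case by (simp add: cev_one unitc_def)
next
 case (Cons j js)
 let ?ws = "concat (map (\<lambda>j. [e j, e' j]) js)"
 have ev: "evn b" unfolding evenc_def by (metis b even_numeral)
 have i: "(\<lambda>us. cev b (e j # us)) = one_form (\<lambda>v. cev b [e j, v])"
  by (auto simp: fun_eq_iff one_form_def b split: list.splits)
 have z: "wdg (one_form (\<lambda>v. cev b [e j, v])) g ?ws = 0" for g
  by (rule wdg_one_form_zero) (use Cons.prems(1,3) in fastforce)
 have "cev (b ^ length (j # js)) (concat (map (\<lambda>j. [e j, e' j]) (j # js))) = of_nat (Suc (length js)) * (cev b [e j, e' j] * cev (b ^ length js) ?ws)"
  by (simp add: power_contract[OF ev] i wdg_one_form_Cons z del: wdg.simps power_Suc of_nat_Suc)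
 then show ?case using Cons by (simp add: algebra_simps)
qed

lemma wdg_top:
 assumes "\<And>us. length us < length vs \<Longrightarrow> g us = 0" shows "wdg f g vs = f [] * g vs"
proof -
 have "wdg (\<lambda>us. f us - f [] * unitc us) g vs = 0"
  by (rule wdg_low_zero2[of _ 1 "length vs"]) (use assms in \<open>auto simp: unitc_def\<close>)
 then show ?thesis by (simp add: wdg_diff_left wdg_scale_left)
qed

subsection \<open>The localisation formula\<close>

lemma bij_betw_Basis: "bij_betw (\<lambda>(j, c). axis j c) (UNIV \<times> {1, \<i>}) (Basis :: (complex ^ 'd::finite) set)"
 unfolding bij_betw_def
proof
 show "inj_on (\<lambda>(j::'d, c). axis j c) (UNIV \<times> {1, \<i>})"
  by (auto simp: inj_on_def axis_eq_axis)
 show "(\<lambda>(j, c). axis j c) ` (UNIV \<times> {1, \<i>}) = (Basis :: (complex ^ 'd) set)"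
  by (auto simp: Basis_vec_def Basis_complex_def)
qed

lemma sum_Basis: "(\<Sum>b\<in>Basis. f (b :: complex ^ 'd::finite)) = (\<Sum>j\<in>UNIV. f (axis j 1) + f (axis j \<i>))"
proof -
 have "(\<Sum>b\<in>Basis. f b) = (\<Sum>(j, c)\<in>UNIV \<times> {1, \<i>}. f (axis j c))"
  using sum.reindex_bij_betw[OF bij_betw_Basis, of f] by (simp add: case_prod_unfold)
 then show ?thesis by (simp add: sum.cartesian_product[symmetric])
qed

lemma prod_Basis: "(\<Prod>b\<in>Basis. f (b :: complex ^ 'd::finite)) = (\<Prod>j\<in>UNIV. f (axis j 1) * f (axis j \<i>))"
proof -
 have "(\<Prod>b\<in>Basis. f b) = (\<Prod>(j, c)\<in>UNIV \<times> {1, \<i>}. f (axis j c))"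
  using prod.reindex_bij_betw[OF bij_betw_Basis, of f] by (simp add: case_prod_unfold)
 then show ?thesis by (simp add: prod.cartesian_product[symmetric])
qed

text \<open>One more vector from the image of \<open>L\<close> makes the arguments dependent; this
  supplies the assumption \<open>top\<close> of the homotopy.\<close>

lemma tens_frame_Cons:
 fixes L :: "complex ^ 'd::finite \<Rightarrow> 'a::real_vector"
 assumes "tens f" "linear L" shows "f (L v # map L real_frame) = 0"
proof -
 have t: "tens (\<lambda>us. f (map L us))" by (rule tens_map[OF assms])
 have "f (map L (b # real_frame)) = 0" if "b \<in> Basis" for b
  by (rule tens_not_distinct[OF t]) (use that in \<open>simp add: real_frame_props\<close>)
 then show ?thesis using tens_expand[OF t, of v real_frame] by simp
qed

text \<open>Chart \<open>k\<close> is centred at a fixed point: in its coordinates V is the diagonal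
  linear field with weights \<open>lam k\<close>, and at the centre the metric is diagonal with
  coefficients \<open>cc\<close>. By \<open>center\<close> no other chart contains this centre, so
  each fixed point is counted once.\<close>

locale torus_atlas = hol_atlas X m \<phi> \<kappa> g
 for X :: "'N::finite cmatrix set" and m :: nat
  and \<phi> :: "nat \<Rightarrow> complex ^ 'd::finite \<Rightarrow> 'N cmatrix"
  and \<kappa> :: "nat \<Rightarrow> 'N cmatrix \<Rightarrow> complex ^ 'd"
  and g :: "nat \<Rightarrow> 'N cmatrix \<Rightarrow> real" +
 fixes w :: "'N \<Rightarrow> real" and lam :: "nat \<Rightarrow> 'd \<Rightarrow> real" and cc :: "'d \<Rightarrow> real"
 assumes proj: "p \<in> X \<Longrightarrow> p ** p = p"
  and lam: "k < m \<Longrightarrow> lam k j \<noteq> 0" and cc: "cc j > 0"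
  and rot_chart: "k < m \<Longrightarrow>
   rot w (\<phi> k z) = fder (\<phi> k) z (\<chi> j. \<i> * of_real (lam k j) * z $ j)"
  and rot_center: "k < m \<Longrightarrow> rot w (fder (\<phi> k) 0 h) =
   fder (\<phi> k) 0 (\<chi> j. \<i> * of_real (lam k j) * h $ j)"
  and metric: "k < m \<Longrightarrow> fder (\<phi> k) 0 h \<bullet> fder (\<phi> k) 0 h' =
   (\<Sum>j\<in>UNIV. cc j * Re (cnj (h $ j) * h' $ j))"
  and center: "k < m \<Longrightarrow> l < m \<Longrightarrow> k \<noteq> l \<Longrightarrow> g l (\<phi> k 0) \<le> 0"
begin

abbreviation D where "D k z \<equiv> fder (\<phi> k) z"

definition act :: "nat \<Rightarrow> complex ^ 'd \<Rightarrow> complex ^ 'd" where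
 "act k z = (\<chi> j. \<i> * of_real (lam k j) * z $ j)"

lemma has_D: "k < m \<Longrightarrow> (\<phi> k has_derivative D k z) (at z)"
 by (rule has_frechet[OF smooth_diff[OF smooth UNIV_I]])

lemma linear_D: "k < m \<Longrightarrow> linear (D k z)"
 using has_D has_derivative_linear by blast

lemma act_scale: "act k (r *\<^sub>R z) = r *\<^sub>R act k z"
 by (simp add: act_def vec_eq_iff scaleR_conv_of_real[where 'a = complex])

lemma D_tang:
 assumes k: "k < m" shows "D k z h \<in> tang (\<phi> k z)"
proof -
 have c: "((\<lambda>z. \<phi> k z $ a $ b) has_derivative (\<lambda>h. D k z h $ a $ b)) (at z)" for a b
  by (intro bounded_linear.has_derivative[OF bounded_linear_vec_nth] has_D k)
 have eq: "(\<lambda>z. \<Sum>c\<in>UNIV. \<phi> k z $ a $ c * \<phi> k z $ c $ b) = (\<lambda>z. \<phi> k z $ a $ b)" for a b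
 proof
  fix z
  show "(\<Sum>c\<in>UNIV. \<phi> k z $ a $ c * \<phi> k z $ c $ b) = \<phi> k z $ a $ b"
   using arg_cong[OF proj[OF in_X[OF k, of z]], of "\<lambda>x. x $ a $ b"] by (simp add: matrix_matrix_mult_def)
 qed
 have "(\<Sum>c\<in>UNIV. \<phi> k z $ a $ c * D k z h $ c $ b + D k z h $ a $ c * \<phi> k z $ c $ b) = D k z h $ a $ b" for a b
 proof -
  have "((\<lambda>z. \<Sum>c\<in>UNIV. \<phi> k z $ a $ c * \<phi> k z $ c $ b) has_derivative
    (\<lambda>h. \<Sum>c\<in>UNIV. \<phi> k z $ a $ c * D k z h $ c $ b + D k z h $ a $ c * \<phi> k z $ c $ b)) (at z)"
   by (intro has_derivative_sum has_derivative_mult c)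
  from has_derivative_unique[OF this[unfolded eq] c] show ?thesis by (rule fun_cong)
 qed
 then show ?thesis
  unfolding tang_def mem_Collect_eq vec_eq_iff vector_add_component matrix_matrix_mult_def vec_lambda_beta sum.distrib[symmetric]
  by blast
qed

lemma intg_expand:
 assumes F: "eqclosed w (of_real \<tau>) F" and \<tau>: "0 < \<tau>" and s: "0 \<le> s"
 shows "intg (\<lambda>p. cev (F p)) = intg (\<lambda>p. cev (F p * expand w CARD('d) \<tau> s p))"
proof -
 let ?G = "\<lambda>p. F p * expand w CARD('d) \<tau> s p"
 define \<eta> where "\<eta> p = wdg (theta w p) (cev (?G p))" for p
 have nF: "nicef F" using F by (simp add: eqclosed_def)
 have nG: "nicef ?G" by (intro nicef_mult nF nicef_expand \<tau> s)
 have \<eta>: "cform \<eta>" unfolding \<eta>_def[abs_def] by (intro cform_wdg cform_theta nicef_cform nG)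
 have "intg (\<lambda>p. cev (?G p)) = intg (\<lambda>p. cev (F p)) + of_real s * intg (ext_deriv \<eta>)"
 proof (rule intg_add)
  show "admissible (\<lambda>p. cev (F p))" "admissible (\<lambda>p. cev (?G p))"
   by (intro admissible_cform nicef_cform nF nG)+
  show "admissible (ext_deriv \<eta>)" by (rule admissible_ext_deriv[OF \<eta>])
  fix k :: nat and z :: "complex ^ 'd" assume k: "k < m"
  let ?p = "\<phi> k z" and ?vs = "map (D k z) real_frame"
  have "of_real s * ext_deriv (\<lambda>q. wdg (theta w q) (cev (F q * expand w CARD('d) \<tau> s q))) ?p ?vs =
   cev (F ?p * expand w CARD('d) \<tau> s ?p) ?vs - cev (F ?p) ?vs"
  proof (rule expand_homotopy[OF \<tau> s F proj[OF in_X[OF k]]])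
   show "set ?vs \<subseteq> tang ?p" using D_tang[OF k] by auto
   show "length ?vs = 2 * CARD('d)" by (simp add: real_frame_props)
   show "wdg (theta w ?p) (cev (?G ?p)) (rot w ?p # ?vs) = 0"
    unfolding rot_chart[OF k]
    by (rule tens_frame_Cons[OF cform_tens[OF \<eta>, unfolded \<eta>_def] linear_D[OF k]])
  qed
  then show "form_density (\<lambda>p. cev (?G p)) (\<phi> k) z =
    form_density (\<lambda>p. cev (F p)) (\<phi> k) z + of_real s * form_density (ext_deriv \<eta>) (\<phi> k) z"
   by (simp add: form_density_def \<eta>_def[abs_def])
 qed
 then show ?thesis by (simp add: stokes[OF \<eta>])
qed

text \<open>V is the image of the linear field under the derivative of the chart. The derivative is
  bounded below uniformly over the ball by compactness, and the linear field by the smallest squared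
  weight.\<close>

lemma moment_bound:
 assumes k: "k < m"
 obtains c where "0 < c" "\<And>z. z \<in> cball 0 R \<Longrightarrow> c * (norm z)\<^sup>2 \<le> (norm (rot w (\<phi> k z)))\<^sup>2"
proof (cases "R < 0")
 case True
 then show thesis by (intro that[of 1]) auto
next
 case False
 have cD: "continuous_on UNIV (\<lambda>z. D k z b)" for b by (rule smooth_continuous[OF smooth_frechet[OF smooth[OF k]]])
 have D: "D k z u = (\<Sum>b\<in>Basis. (u \<bullet> b) *\<^sub>R D k z b)" for z u
 proof -
  have "D k z u = D k z (\<Sum>b\<in>Basis. (u \<bullet> b) *\<^sub>R b)" by (simp add: euclidean_representation)
  also have "\<dots> = (\<Sum>b\<in>Basis. D k z ((u \<bullet> b) *\<^sub>R b))" by (rule linear_sum[OF linear_D[OF k]])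
  finally show ?thesis by (simp add: linear_scale[OF linear_D[OF k]])
 qed
 let ?S = "cball 0 R \<times> sphere 0 1 :: ((complex ^ 'd) \<times> (complex ^ 'd)) set"
 have cS: "compact ?S" by (intro compact_Times compact_cball compact_sphere)
 have ne: "?S \<noteq> {}"
  using False SOME_Basis[where 'a = "complex ^ 'd"] by (auto intro!: exI[of _ "SOME b. b \<in> Basis"])
 have cont: "continuous_on ?S (\<lambda>x. norm (D k (fst x) (snd x)))"
 proof -
  have "continuous_on ?S (\<lambda>x. norm (\<Sum>b\<in>Basis. (snd x \<bullet> b) *\<^sub>R D k (fst x) b))"
   by (intro continuous_intros continuous_on_compose2[OF cD continuous_on_fst[OF continuous_on_id] subset_UNIV])
  then show ?thesis unfolding D[symmetric] .
 qed
 obtain x where x: "x \<in> ?S" "\<forall>y\<in>?S. norm (D k (fst x) (snd x)) \<le> norm (D k (fst y) (snd y))"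
  using continuous_attains_inf[OF cS ne cont] by (rule bexE)
 define c0 where "c0 = norm (D k (fst x) (snd x))"
 have inj: "inj (D k z)" for z using param[OF k] by (simp add: holomorphic_parametrization_def)
 have "snd x \<noteq> 0" using x(1) by auto
 then have c0: "c0 > 0"
  using injD[OF inj, of "fst x" "snd x" 0] linear_0[OF linear_D[OF k]] by (auto simp: c0_def)
 have low: "c0 * norm u \<le> norm (D k z u)" if z: "z \<in> cball 0 R" for z u
 proof (cases "u = 0")
  case False
  have "c0 \<le> norm (D k z ((1 / norm u) *\<^sub>R u))"
   unfolding c0_def using bspec[OF x(2), of "(z, (1 / norm u) *\<^sub>R u)"] z False by simp
  then show ?thesis using False by (simp add: linear_scale[OF linear_D[OF k]] field_simps)
 qed simp
 define l0 where "l0 = Min (range (\<lambda>j. (lam k j)\<^sup>2))"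
 have l0: "0 < l0" "l0 \<le> (lam k j)\<^sup>2" for j
  using lam[OF k] by (auto simp: l0_def)
 have act: "l0 * (norm z)\<^sup>2 \<le> (norm (act k z))\<^sup>2" for z
 proof -
  have n2: "(norm u)\<^sup>2 = (\<Sum>j\<in>UNIV. (norm (u $ j))\<^sup>2)" for u :: "complex ^ 'd"
   by (simp add: norm_vec_def L2_set_def sum_nonneg)
  show ?thesis
   unfolding n2 sum_distrib_left
   by (rule sum_mono) (use l0 in \<open>simp add: act_def norm_mult power_mult_distrib mult_right_mono\<close>)
 qed
 show thesis
 proof (rule that[of "c0\<^sup>2 * l0"])
  show "0 < c0\<^sup>2 * l0" using c0 l0 by simp
  fix z :: "complex ^ 'd" assume z: "z \<in> cball 0 R"
  have "c0\<^sup>2 * l0 * (norm z)\<^sup>2 \<le> c0\<^sup>2 * (norm (act k z))\<^sup>2"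
   using act[of z] c0 by (simp add: mult.assoc)
  also have "\<dots> = (c0 * norm (act k z))\<^sup>2" by (simp add: power_mult_distrib)
  also have "\<dots> \<le> (norm (D k z (act k z)))\<^sup>2"
   using low[OF z] c0 by (intro power_mono) auto
  finally show "c0\<^sup>2 * l0 * (norm z)\<^sup>2 \<le> (norm (rot w (\<phi> k z)))\<^sup>2"
   by (simp add: rot_chart[OF k] act_def)
 qed
qed

text \<open>The action and the derivative are linear, so the outer factor cancels the scaling of the
  vector; what remains is the derivative at a point that tends to the centre.\<close>

lemma moment_blowup:
 assumes k: "k < m"
 shows "(\<lambda>n. (real (Suc n))\<^sup>2 * (norm (rot w (\<phi> k (u /\<^sub>R real (Suc n)))))\<^sup>2)
  \<longlonglongrightarrow> (\<Sum>j\<in>UNIV. cc j * (lam k j)\<^sup>2 * (norm (u $ j))\<^sup>2)"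
proof -
 have "(real (Suc n))\<^sup>2 * (norm (rot w (\<phi> k (u /\<^sub>R real (Suc n)))))\<^sup>2 = (norm (D k (u /\<^sub>R real (Suc n)) (act k u)))\<^sup>2" for n
  by (simp add: rot_chart[OF k, folded act_def] act_scale linear_scale[OF linear_D[OF k]] power_mult_distrib field_simps
    del: of_nat_Suc)
 moreover have "(\<lambda>n. u /\<^sub>R real (Suc n)) \<longlonglongrightarrow> 0"
  using tendsto_scaleR[OF LIMSEQ_inverse_real_of_nat tendsto_const[of u]] by simp
 then have "(\<lambda>n. D k (u /\<^sub>R real (Suc n)) (act k u)) \<longlonglongrightarrow> D k 0 (act k u)"
  by (rule continuous_on_tendsto_compose[OF smooth_continuous[OF smooth_frechet[OF smooth[OF k]], of UNIV]]) auto
 then have "(\<lambda>n. (norm (D k (u /\<^sub>R real (Suc n)) (act k u)))\<^sup>2) \<longlonglongrightarrow> (norm (D k 0 (act k u)))\<^sup>2"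
  by (intro tendsto_intros)
 moreover have "(norm (D k 0 (act k u)))\<^sup>2 = (\<Sum>j\<in>UNIV. cc j * (lam k j)\<^sup>2 * (norm (u $ j))\<^sup>2)"
  unfolding power2_norm_eq_inner metric[OF k]
  by (rule sum.cong) (simp_all add: act_def complex_mult_cnj cmod_def power2_eq_square inner_complex_def algebra_simps)
 ultimately show ?thesis by simp
qed

lemma beta_power_frame:
 assumes k: "k < m"
 shows "cev (beta w ^ CARD('d)) (map (D k 0) real_frame) = fact CARD('d) * (\<Prod>j\<in>UNIV. of_real (2 * cc j * lam k j))"
proof -
 define js :: "'d list" where "js = (SOME js. distinct js \<and> set js = UNIV)"
 have js: "distinct js \<and> set js = UNIV"
  unfolding js_def by (rule someI_ex) (metis finite_class.finite_UNIV finite_distinct_list)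
 have l: "length js = CARD('d)" using js distinct_card by metis
 have fr: "map (D k 0) real_frame = concat (map (\<lambda>j. [D k 0 (axis j 1), D k 0 (axis j \<i>)]) js)"
  by (simp add: real_frame_def js_def map_concat o_def)
 have b: "cev (beta w) [D k 0 h, D k 0 h'] = of_real (2 * (\<Sum>j\<in>UNIV. cc j * Re (cnj (\<i> * of_real (lam k j) * h $ j) * h' $ j)))" for h h'
  by (simp add: cev_beta rot_center[OF k] metric[OF k])
 have "cev (beta w ^ length js) (concat (map (\<lambda>j. [D k 0 (axis j 1), D k 0 (axis j \<i>)]) js)) =
   fact (length js) * (\<Prod>j\<in>set js. of_real (2 * cc j * lam k j))"
 proof (rule power_frame)
  show "cev (beta w) [D k 0 (axis j 1), D k 0 (axis j \<i>)] = of_real (2 * cc j * lam k j)" for j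
  proof -
   have "(\<Sum>l\<in>UNIV. cc l * Re (cnj (\<i> * of_real (lam k l) * axis j 1 $ l) * axis j \<i> $ l)) = (\<Sum>l\<in>UNIV. if l = j then cc j * lam k j else 0)"
    by (rule sum.cong) (auto simp: axis_def)
   then show ?thesis unfolding b by simp
  qed
  show "cev (beta w) [D k 0 (axis j 1), D k 0 (axis l 1)] = 0 \<and> cev (beta w) [D k 0 (axis j 1), D k 0 (axis l \<i>)] = 0"
   if "j \<noteq> l" for j l
  proof -
   have "(\<Sum>i\<in>UNIV. cc i * Re (cnj (\<i> * of_real (lam k i) * axis j 1 $ i) * axis l c $ i)) = (\<Sum>i\<in>(UNIV::'d set). 0)" for c
    by (rule sum.cong) (use that in \<open>auto simp: axis_def\<close>)
   then show ?thesis unfolding b by simp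
  qed
 qed (use js in \<open>auto simp: cev_beta\<close>)
 then show ?thesis using js by (simp add: fr l)
qed

text \<open>For each power of \<beta> in the truncated inverse, Laplace's method evaluates the limit
  s \<rightarrow> \<infinity> at the centres of the charts. Only the full power survives; since it
  is already of top degree, just the scalar part of F contributes.\<close>

theorem localisation:
 assumes F: "eqclosed w (of_real \<tau>) F" and \<tau>: "0 < \<tau>"
 shows "intg (\<lambda>p. cev (F p)) = (\<Sum>k<m. cev (F (\<phi> k 0)) [] * (\<Prod>j\<in>UNIV. of_real (2 * pi / (\<tau> * lam k j))))"
proof -
 let ?N = "CARD('d)"
 obtain R where R: "0 < R" "covering (\<lambda>k. k) m R" using radius by metis
 define A where "A k = piece (\<lambda>k. k) R k" for k
 define Q where "Q k z = \<tau> * (norm (rot w (\<phi> k z)))\<^sup>2" for k z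
 define Q2 where "Q2 k u = (\<Sum>j\<in>UNIV. \<tau> * cc j * (lam k j)\<^sup>2 * (norm (u $ j))\<^sup>2)" for k and u :: "complex ^ 'd"
 define a where "a j k = form_density (\<lambda>p. cev (F p * beta w ^ j)) (\<phi> k)" for j :: nat and k
 define s where "s n = (real (Suc n))\<^sup>2" for n
 have nF: "nicef F" using F by (simp add: eqclosed_def)
 have ac: "continuous_on UNIV (a j k)" if "k < m" for j k
  unfolding a_def by (intro continuous_density that admissible_cform nicef_cform nicef_mult nicef_power nicef_beta nF)
 have rc: "continuous_on UNIV (rot w)" by (rule linear_continuous_on[OF rot_linear[unfolded linear_conv_bounded_linear]])
 have Qc: "continuous_on UNIV (Q k)" if "k < m" for k
  unfolding Q_def by (intro continuous_intros continuous_on_compose2[OF rc] smooth_continuous[OF smooth[OF that]]) auto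
 have Ab: "A k \<in> sets borel" "A k \<subseteq> cball 0 R" if "k < m" for k
  unfolding A_def by (rule piece_props(1)[OF R(2) that]) (simp add: piece_def subset_iff)
 have sum: "intg (\<lambda>p. cev (F p)) = (\<Sum>k<m. \<Sum>j\<le>?N. LINT z:A k|lborel. of_real (s n ^ j / (1 + s n * Q k z) ^ (j + 1)) * a j k z)" for n
 proof -
  have s: "0 \<le> s n" by (simp add: s_def)
  have "intg (\<lambda>p. cev (F p)) = intg (\<lambda>p. cev (F p * expand w ?N \<tau> (s n) p))"
   by (rule intg_expand[OF F \<tau> s])
  also have "\<dots> = (\<Sum>k<m. LINT z:A k|lborel. form_density (\<lambda>p. cev (F p * expand w ?N \<tau> (s n) p)) (\<phi> k) z)"
   unfolding A_def
   by (rule intg_pieces[OF _ R(2)]) (intro admissible_cform nicef_cform nicef_mult nF nicef_expand \<tau> s)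
  also have "\<dots> = (\<Sum>k<m. \<Sum>j\<le>?N. LINT z:A k|lborel. of_real (s n ^ j / (1 + s n * Q k z) ^ (j + 1)) * a j k z)"
  proof (rule sum.cong[OF refl])
   fix k assume "k \<in> {..<m}"
   then have k: "k < m" by simp
   have "form_density (\<lambda>p. cev (F p * expand w ?N \<tau> (s n) p)) (\<phi> k) z =
     (\<Sum>j\<le>?N. of_real (s n ^ j / (1 + s n * Q k z) ^ (j + 1)) * a j k z)" for z
   proof -
    have "F p * expand w ?N \<tau> (s n) p = (\<Sum>j\<le>?N. sc (of_real (s n ^ j / (1 + s n * (\<tau> * (norm (rot w p))\<^sup>2)) ^ (j + 1))) * (F p * beta w ^ j))" for p
     unfolding expand_def sum_distrib_left by (rule sum.cong) (simp_all only: mult_ac)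
    then show ?thesis by (simp only: form_density_def cev_sum cev_sc_mult a_def Q_def)
   qed
   then have "(LINT z:A k|lborel. form_density (\<lambda>p. cev (F p * expand w ?N \<tau> (s n) p)) (\<phi> k) z) =
     (LINT z:A k|lborel. (\<Sum>j\<le>?N. of_real (s n ^ j / (1 + s n * Q k z) ^ (j + 1)) * a j k z))"
    by (simp only:)
   also have "\<dots> = (\<Sum>j\<le>?N. LINT z:A k|lborel. of_real (s n ^ j / (1 + s n * Q k z) ^ (j + 1)) * a j k z)"
   proof -
    have "set_integrable lborel (A k) (\<lambda>z. of_real (s n ^ j / (1 + s n * Q k z) ^ (j + 1)) * a j k z)" for j
    proof (rule density_integrable[OF _ Ab[OF k]])
     have "1 + s n * Q k z > 0" for z using \<tau> s by (simp add: Q_def add_pos_nonneg)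
     then have "(1 + s n * Q k z) ^ (j + 1) \<noteq> 0" for z by (metis less_irrefl power_not_zero)
     then show "continuous_on UNIV (\<lambda>z. of_real (s n ^ j / (1 + s n * Q k z) ^ (j + 1)) * a j k z)"
      by (intro continuous_intros Qc[OF k] ac[OF k]) auto
    qed
    then show ?thesis
     unfolding set_integrable_def set_lebesgue_integral_def scaleR_sum_right
     by (intro Bochner_Integration.integral_sum) auto
   qed
   finally show "(LINT z:A k|lborel. form_density (\<lambda>p. cev (F p * expand w ?N \<tau> (s n) p)) (\<phi> k) z) =
     (\<Sum>j\<le>?N. LINT z:A k|lborel. of_real (s n ^ j / (1 + s n * Q k z) ^ (j + 1)) * a j k z)" .
  qed
  finally show ?thesis .
 qed
 have N: "DIM(complex ^ 'd) = 2 * ?N" by simp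
 have lim: "(\<lambda>n. LINT z:A k|lborel. of_real (s n ^ j / (1 + s n * Q k z) ^ (j + 1)) * a j k z)
   \<longlonglongrightarrow> (if j = ?N then a j k 0 * of_real (LINT u|lborel. 1 / (1 + Q2 k u) ^ (?N + 1)) else 0)" if k: "k < m" and j: "j \<le> ?N" for k j
 proof -
  obtain c where c: "0 < c" "\<And>z. z \<in> cball 0 R \<Longrightarrow> c * (norm z)\<^sup>2 \<le> (norm (rot w (\<phi> k z)))\<^sup>2"
   using moment_bound[OF k] by metis
  \<comment> \<open>The centre lies outside the compact images of the earlier balls, so the piece of
    chart \<open>k\<close> contains a ball around it.\<close>
  have "\<exists>\<delta>>0. ball 0 \<delta> \<subseteq> A k"
  proof -
   define U where "U = (\<Inter>l<k. - (\<phi> l ` cball 0 R))"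
   have "open U" unfolding U_def
    using compact_imp_closed[OF compact_chart] k by (intro open_INT) (auto simp: open_Compl)
   moreover have "\<phi> k 0 \<in> U"
   proof -
    have "\<phi> k 0 \<notin> \<phi> l ` cball 0 R" if "l < k" for l
    proof
     assume "\<phi> k 0 \<in> \<phi> l ` cball 0 R"
     then obtain z where "\<phi> k 0 = \<phi> l z" by blast
     then have "g l (\<phi> k 0) > 0" using pos[of l z] that k by simp
     then show False using center[OF k, of l] that k by simp
    qed
    then show ?thesis by (auto simp: U_def)
   qed
   moreover have "continuous_on UNIV (\<phi> k)" by (rule smooth_continuous[OF smooth[OF k]])
   ultimately have "open (ball 0 R \<inter> \<phi> k -` U)" "0 \<in> ball 0 R \<inter> \<phi> k -` U"
    using R(1) open_vimage by (auto intro: open_Int)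
   then obtain \<delta> where "\<delta> > 0" "ball 0 \<delta> \<subseteq> ball 0 R \<inter> \<phi> k -` U" by (meson open_contains_ball)
   moreover have "ball 0 R \<inter> \<phi> k -` U \<subseteq> A k" by (auto simp: A_def piece_def U_def)
   ultimately show ?thesis by blast
  qed
  then obtain \<delta> where \<delta>: "0 < \<delta>" "ball 0 \<delta> \<subseteq> A k" by blast
  have t: "0 < \<tau> * c" using \<tau> c by simp
  have "\<tau> * c * (norm z)\<^sup>2 \<le> Q k z" if "z \<in> cball 0 R" for z
   using c(2)[OF that] \<tau> by (simp add: Q_def mult.assoc)
  moreover have "(\<lambda>n. (real (Suc n))\<^sup>2 * Q k (u /\<^sub>R real (Suc n))) \<longlonglongrightarrow> Q2 k u" for u
   using tendsto_mult[OF tendsto_const[of \<tau>] moment_blowup[OF k, of u]]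
   by (simp add: Q_def Q2_def sum_distrib_left mult_ac del: of_nat_Suc)
  ultimately have "(\<lambda>n. LINT z:A k|lborel. of_real ((real (Suc n))\<^sup>2 ^ j / (1 + (real (Suc n))\<^sup>2 * Q k z) ^ (j + 1)) * a j k z)
   \<longlonglongrightarrow> (if j = ?N then a j k 0 * of_real (LINT u|lborel. 1 / (1 + Q2 k u) ^ (?N + 1)) else 0)"
   by (intro laplace[OF N j Ab[OF k] \<delta> ac[OF k] Qc[OF k] t])
  then show ?thesis by (simp only: s_def)
 qed
 have "(\<lambda>n. \<Sum>k<m. \<Sum>j\<le>?N. LINT z:A k|lborel. of_real (s n ^ j / (1 + s n * Q k z) ^ (j + 1)) * a j k z)
   \<longlonglongrightarrow> (\<Sum>k<m. \<Sum>j\<le>?N. if j = ?N then a j k 0 * of_real (LINT u|lborel. 1 / (1 + Q2 k u) ^ (?N + 1)) else 0)"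
  by (intro tendsto_sum lim) auto
 \<comment> \<open>The integral does not depend on \<open>n\<close>, and therefore it equals the
   limit.\<close>
 then have "intg (\<lambda>p. cev (F p)) = (\<Sum>k<m. \<Sum>j\<le>?N. if j = ?N then a j k 0 * of_real (LINT u|lborel. 1 / (1 + Q2 k u) ^ (?N + 1)) else 0)"
  unfolding sum[symmetric] by (rule LIMSEQ_unique[OF tendsto_const])
 also have "\<dots> = (\<Sum>k<m. a ?N k 0 * of_real (LINT u|lborel. 1 / (1 + Q2 k u) ^ (?N + 1)))"
  by simp
 also have "\<dots> = (\<Sum>k<m. cev (F (\<phi> k 0)) [] * (\<Prod>j\<in>UNIV. of_real (2 * pi / (\<tau> * lam k j))))"
 proof (rule sum.cong[OF refl])
  fix k assume "k \<in> {..<m}"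
  then have k: "k < m" by simp
  define K where "K b = \<tau> * (\<Sum>j\<in>UNIV. cc j * (lam k j)\<^sup>2 * (norm (b $ j))\<^sup>2)" for b :: "complex ^ 'd"
  have K: "K (axis j c) = \<tau> * cc j * (lam k j)\<^sup>2 * (norm c)\<^sup>2" for j c
   by (simp add: K_def axis_def if_distrib[of norm] if_distrib[of "\<lambda>x. x\<^sup>2"] if_distrib[of "\<lambda>x. _ * x"] cong: if_cong)
  have Kpos: "K b > 0" if "b \<in> Basis" for b
  proof -
   have "b \<in> (\<lambda>(j, c). axis j c) ` (UNIV \<times> {1, \<i>})"
    unfolding bij_betw_imp_surj_on[OF bij_betw_Basis] by (rule that)
   then obtain j c where "b = axis j c" "c \<in> {1, \<i>}" by (elim imageE SigmaE) (simp only: prod.case)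
   then have "b = axis j c" "norm c = 1" by auto
   then show ?thesis using lam[OF k] cc \<tau> by (simp add: K)
  qed
  have Q2: "Q2 k u = (\<Sum>b\<in>Basis. K b * (u \<bullet> b)\<^sup>2)" for u
   by (simp add: sum_Basis K Q2_def inner_axis cmod_power2 distrib_left)
  have "(LINT u|lborel. 1 / (1 + Q2 k u) ^ (?N + 1)) = pi ^ ?N / (fact ?N * (\<Prod>b\<in>Basis. sqrt (K b)))"
   unfolding Q2 by (rule integral_rational(2)[OF Kpos N])
  also have "(\<Prod>b\<in>Basis. sqrt (K b)) = (\<Prod>j\<in>UNIV. \<tau> * cc j * (lam k j)\<^sup>2)"
  proof -
   have "0 \<le> \<tau> * cc j * (lam k j)\<^sup>2" for j using \<tau> less_imp_le[OF cc] by simp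
   then show ?thesis by (simp add: prod_Basis K)
  qed
  finally have L: "(LINT u|lborel. 1 / (1 + Q2 k u) ^ (?N + 1)) = pi ^ ?N / (fact ?N * (\<Prod>j\<in>UNIV. \<tau> * cc j * (lam k j)\<^sup>2))" .
  have ev: "evn (beta w ^ ?N)" by (intro evn_power nicef_evn[OF nicef_beta])
  have "a ?N k 0 = cev (F (\<phi> k 0)) [] * cev (beta w ^ ?N) (map (D k 0) real_frame)"
   unfolding a_def form_density_def cev_mult_even2[OF ev]
   by (rule wdg_top, rule cev_power_low_zero[OF nicef_evn[OF nicef_beta]]) (auto simp: cev_beta real_frame_props)
  then have a: "a ?N k 0 = cev (F (\<phi> k 0)) [] * (fact ?N * (\<Prod>j\<in>UNIV. of_real (2 * cc j * lam k j)))"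
   by (simp only: beta_power_frame[OF k])
  \<comment> \<open>The factorial and the metric coefficients \<open>cc\<close> cancel between the
    top power of \<beta> and the rational integral; of each weight one inverse power remains, with
    its sign.\<close>
  have "fact ?N * (\<Prod>j\<in>UNIV. 2 * cc j * lam k j) * (pi ^ ?N / (fact ?N * (\<Prod>j\<in>UNIV. \<tau> * cc j * (lam k j)\<^sup>2))) =
    (\<Prod>j\<in>UNIV. 2 * cc j * lam k j * (pi / (\<tau> * cc j * (lam k j)\<^sup>2)))"
   by (simp only: prod.distrib[of "\<lambda>j. 2 * cc j * lam k j" "\<lambda>j. pi / (\<tau> * cc j * (lam k j)\<^sup>2)"] prod_dividef prod_constant) simp
  also have "\<dots> = (\<Prod>j\<in>UNIV. 2 * pi / (\<tau> * lam k j))"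
   using lam[OF k] cc \<tau> by (intro prod.cong refl) (simp add: power2_eq_square less_imp_neq[symmetric] less_imp_neq[OF cc, symmetric])
  finally have "of_real (fact ?N * (\<Prod>j\<in>UNIV. 2 * cc j * lam k j) * (pi ^ ?N / (fact ?N * (\<Prod>j\<in>UNIV. \<tau> * cc j * (lam k j)\<^sup>2)))) =
    complex_of_real (\<Prod>j\<in>UNIV. 2 * pi / (\<tau> * lam k j))" by (rule arg_cong)
  then show "a ?N k 0 * of_real (LINT u|lborel. 1 / (1 + Q2 k u) ^ (?N + 1)) =
    cev (F (\<phi> k 0)) [] * (\<Prod>j\<in>UNIV. of_real (2 * pi / (\<tau> * lam k j)))"
   unfolding a L of_real_mult[of "fact ?N * _"] of_real_mult[of "fact ?N"] of_real_prod[symmetric] of_real_fact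
   by (simp only: mult.assoc)
 qed
 finally show ?thesis .
qed

text \<open>The parameter is the first component of the argument of \<open>F\<close>. The densities
  are continuous on the compact product of [0, 1] with a coordinate ball, which supplies a constant
  majorant.\<close>

lemma intg_continuous:
 fixes F :: "real \<times> 'N cmatrix \<Rightarrow> 'N cmatrix cochain"
 assumes F: "nicef F"
 shows "(\<lambda>n. intg (\<lambda>p. cev (F (1 / real (Suc n), p)))) \<longlonglongrightarrow> intg (\<lambda>p. cev (F (0, p)))"
proof -
 obtain R where R: "0 < R" "covering (\<lambda>k. k) m R" using radius by metis
 define A where "A k = piece (\<lambda>k. k) R k" for k
 define f where "f k x = cev (F (fst x, \<phi> k (snd x))) (map (D k (snd x)) real_frame)" for k and x :: "real \<times> (complex ^ 'd)"
 have Fc: "continuous_on UNIV (\<lambda>x. cev (F x) vs)" for vs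
  by (rule algf_continuous[OF nicef_algf[OF F]])
 have adm: "admissible (\<lambda>p. cev (F (r, p)))" for r
  unfolding admissible_def
  by (intro conjI allI nicef_tens[OF F] continuous_on_compose2[OF Fc] continuous_intros) auto
 have fc: "continuous_on UNIV (f k)" if k: "k < m" for k
 proof -
  have "continuous_on UNIV (\<lambda>x. cev (F (fst x, \<phi> k (snd x))) (map (\<lambda>w. w x) (map (\<lambda>h x. D k (snd x) h) real_frame)))"
  proof (rule tens_continuous)
   show "continuous_on UNIV (\<lambda>x. cev (F (fst x, \<phi> k (snd x))) vs)" for vs
    by (intro continuous_on_compose2[OF Fc] continuous_intros continuous_on_compose2[OF smooth_continuous[OF smooth[OF k]]]) auto
   fix v assume "v \<in> set (map (\<lambda>h (x :: real \<times> (complex ^ 'd)). D k (snd x) h) real_frame)"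
   then obtain h where "v = (\<lambda>x. D k (snd x) h)" by auto
   then show "continuous_on UNIV v"
    using continuous_on_compose2[OF smooth_continuous[OF smooth_frechet[OF smooth[OF k]], of UNIV h] continuous_on_snd[OF continuous_on_id]]
    by auto
  qed (rule nicef_tens[OF F])
  then show ?thesis by (simp add: f_def[abs_def] o_def)
 qed
 have Ab: "A k \<in> sets borel" "A k \<subseteq> cball 0 R" if "k < m" for k
  unfolding A_def by (rule piece_props(1)[OF R(2) that]) (simp add: piece_def subset_iff)
 have I: "intg (\<lambda>p. cev (F (r, p))) = (\<Sum>k<m. LINT z:A k|lborel. f k (r, z))" for r
  unfolding intg_pieces[OF adm R(2)] by (simp add: A_def f_def form_density_def[abs_def])
 have "(\<lambda>n. LINT z:A k|lborel. f k (1 / real (Suc n), z)) \<longlonglongrightarrow> (LINT z:A k|lborel. f k (0, z))" if k: "k < m" for k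
 proof -
  have "compact (f k ` ({0..1} \<times> cball 0 R))"
   by (intro compact_continuous_image continuous_on_subset[OF fc[OF k]] compact_Times) auto
  from compact_imp_bounded[OF this] obtain M where M': "\<forall>y\<in>f k ` ({0..1} \<times> cball 0 R). norm y \<le> M"
   unfolding bounded_iff by (rule exE)
  have M: "norm (f k (r, z)) \<le> M" if "r \<in> {0..1}" "z \<in> cball 0 R" for r z
   by (rule bspec[OF M' imageI[OF SigmaI[OF that]]])
  have fz: "continuous_on UNIV (\<lambda>z. f k (r, z))" for r
   by (rule continuous_on_compose2[OF fc[OF k]]) (auto intro!: continuous_intros)
  have mz: "(\<lambda>z. indicator (A k) z *\<^sub>R f k (r, z)) \<in> borel_measurable lborel" for r
   using Ab(1)[OF k] borel_measurable_continuous_onI[OF fz[of r]] by simp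
  show ?thesis
   unfolding set_lebesgue_integral_def
  proof (rule integral_dominated_convergence[where w = "\<lambda>z. indicator (A k) z *\<^sub>R M"])
   have "set_integrable lborel (A k) (\<lambda>_. complex_of_real M)"
    by (rule density_integrable[OF _ Ab[OF k]]) auto
   then have "set_integrable lborel (A k) (\<lambda>_. Re (of_real M))"
    unfolding set_integrable_complex_iff by (rule conjunct1)
   then show "integrable lborel (\<lambda>z. indicator (A k) z *\<^sub>R M)" by (simp add: set_integrable_def)
   show "AE z in lborel. (\<lambda>n. indicator (A k) z *\<^sub>R f k (1 / real (Suc n), z)) \<longlonglongrightarrow> indicator (A k) z *\<^sub>R f k (0, z)"
   proof (rule AE_I2, rule tendsto_scaleR[OF tendsto_const])
    fix z :: "complex ^ 'd"
    have "(\<lambda>n. (1 / real (Suc n), z)) \<longlonglongrightarrow> (0, z)"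
     using LIMSEQ_inverse_real_of_nat by (intro tendsto_Pair tendsto_const) (simp add: inverse_eq_divide)
    then show "(\<lambda>n. f k (1 / real (Suc n), z)) \<longlonglongrightarrow> f k (0, z)"
     by (rule continuous_on_tendsto_compose[OF fc[OF k]]) auto
   qed
   show "AE z in lborel. norm (indicator (A k) z *\<^sub>R f k (1 / real (Suc n), z)) \<le> indicator (A k) z *\<^sub>R M" for n
   proof (rule AE_I2)
    fix z :: "complex ^ 'd"
    have "1 / real (Suc n) \<in> {0..1}" by simp
    from M[OF this, of z] show "norm (indicator (A k) z *\<^sub>R f k (1 / real (Suc n), z)) \<le> indicator (A k) z *\<^sub>R M"
     using Ab(2)[OF k] by (cases "z \<in> A k") (auto simp del: of_nat_Suc)
   qed
  qed (rule mz)+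
 qed
 then have "(\<lambda>n. \<Sum>k<m. LINT z:A k|lborel. f k (1 / real (Suc n), z)) \<longlonglongrightarrow> (\<Sum>k<m. LINT z:A k|lborel. f k (0, z))"
  by (intro tendsto_sum) auto
 then show ?thesis by (simp only: I)
qed

end

no_notation fps_nth (infixl "$" 75)

section \<open>Charts of Grassmannians\<close>

subsection \<open>Adjoints and inverses of matrices\<close>

definition adj :: "complex ^ 'n ^ 'm \<Rightarrow> complex ^ 'm ^ 'n" where
 "adj A = (\<chi> i j. cnj (A $ j $ i))"

lemma adj_nth [simp]: "adj A $ i $ j = cnj (A $ j $ i)"
 by (simp add: adj_def)

lemma adj_adj [simp]: "adj (adj A) = A"
 by (simp add: vec_eq_iff)

lemma adj_mult: "adj (A ** B) = adj B ** adj A"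
 by (simp add: vec_eq_iff matrix_matrix_mult_def cnj_sum mult.commute)

lemma adj_mat: "adj (mat 1) = mat 1"
proof -
 have "cnj (if j = i then 1 else 0) = (if i = j then 1 else 0)" for i j :: 'a by simp
 then show ?thesis unfolding vec_eq_iff adj_nth mat_def vec_lambda_beta by blast
qed

lemma adj_simps: "adj (A + B) = adj A + adj B" "adj (A - B) = adj A - adj B"
 "adj (msc c A) = msc (cnj c) (adj A)" "adj 0 = 0" "adj (mat 1) = mat 1"
 unfolding adj_mat by (simp_all add: vec_eq_iff)

lemma hermitian_adj: "hermitian p \<longleftrightarrow> adj p = p"
 unfolding hermitian_def vec_eq_iff adj_nth by metis

text \<open>Cramer's rule presents the entries of the inverse as quotients of determinants, which
  keeps the charts within the class \<open>algf\<close>.\<close>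

definition cramer_inv :: "'a::field ^ 'n ^ 'n \<Rightarrow> 'a ^ 'n ^ 'n" where
 "cramer_inv A = (\<chi> i k. det (\<chi> a b. if b = i then axis k 1 $ a else A $ a $ b) / det A)"

lemma cramer_inv:
 fixes A :: "'a::field ^ 'n ^ 'n"
 assumes "det A \<noteq> 0" shows "A ** cramer_inv A = mat 1" "cramer_inv A ** A = mat 1"
proof -
 have "(A ** cramer_inv A) $ i $ k = mat 1 $ i $ k" for i k
 proof -
  have "A *v (\<chi> i. cramer_inv A $ i $ k) = axis k 1"
   unfolding cramer[OF assms] by (simp add: cramer_inv_def vec_eq_iff)
  from arg_cong[OF this, of "\<lambda>x. x $ i"] show ?thesis
   by (simp add: matrix_vector_mult_def matrix_matrix_mult_def mat_def axis_def)
 qed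
 then show "A ** cramer_inv A = mat 1" by (simp add: vec_eq_iff)
 then show "cramer_inv A ** A = mat 1" by (simp add: matrix_left_right_inverse)
qed

lemma algf_det:
 fixes A :: "'a::euclidean_space \<Rightarrow> complex ^ 'n::finite ^ 'n"
 shows "(\<And>i j. algf (\<lambda>x. A x $ i $ j)) \<Longrightarrow> algf (\<lambda>x. det (A x))"
 unfolding det_def by (intro algf_sum algf_mult algf_const algf_prod)

lemma algf_cramer_inv:
 fixes A :: "'a::euclidean_space \<Rightarrow> complex ^ 'n::finite ^ 'n"
 assumes A: "\<And>i j. algf (\<lambda>x. A x $ i $ j)" and nz: "\<And>x. det (A x) \<noteq> 0"
 shows "algf (\<lambda>x. cramer_inv (A x) $ i $ j)"
proof -
 have "algf (\<lambda>x. det (\<chi> a b. if b = i then axis j 1 $ a else A x $ a $ b) * inverse (det (A x)))"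
 proof (intro algf_mult algf_inverse nz algf_det A)
  show "algf (\<lambda>x. (\<chi> a b. if b = i then axis j 1 $ a else A x $ a $ b) $ a $ b)" for a b
   by (cases "b = i") (simp_all add: algf_const A)
 qed
 then show ?thesis by (simp add: cramer_inv_def divide_inverse)
qed

lemma algf_matmult:
 fixes A :: "'a::euclidean_space \<Rightarrow> complex ^ 'n::finite ^ 'm::finite" and B :: "'a \<Rightarrow> complex ^ 'k::finite ^ 'n"
 assumes "\<And>i j. algf (\<lambda>x. A x $ i $ j)" "\<And>i j. algf (\<lambda>x. B x $ i $ j)"
 shows "algf (\<lambda>x. (A x ** B x) $ i $ j)"
 unfolding matrix_matrix_mult_def using assms by (simp add: algf_sum algf_mult)

lemma has_derivative_matmult:
 fixes A :: "'a::real_normed_vector \<Rightarrow> complex ^ 'n::finite ^ 'm::finite" and B :: "'a \<Rightarrow> complex ^ 'k::finite ^ 'n"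
 assumes "(A has_derivative A') (at x)" "(B has_derivative B') (at x)"
 shows "((\<lambda>x. A x ** B x) has_derivative (\<lambda>h. A x ** B' h + A' h ** B x)) (at x)"
proof (intro has_derivative_vec)
 fix i j
 have c: "((\<lambda>x. A x $ i $ j) has_derivative (\<lambda>h. A' h $ i $ j)) (at x)" "((\<lambda>x. B x $ i' $ j') has_derivative (\<lambda>h. B' h $ i' $ j')) (at x)" for i j i' j'
  by (intro bounded_linear.has_derivative[OF bounded_linear_vec_nth] assms)+
 have "((\<lambda>x. \<Sum>k\<in>UNIV. A x $ i $ k * B x $ k $ j) has_derivative (\<lambda>h. \<Sum>k\<in>UNIV. A x $ i $ k * B' h $ k $ j + A' h $ i $ k * B x $ k $ j)) (at x)"
  by (intro has_derivative_sum has_derivative_mult c)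
 then show "((\<lambda>x. (A x ** B x) $ i $ j) has_derivative (\<lambda>h. (A x ** B' h + A' h ** B x) $ i $ j)) (at x)"
  by (simp add: matrix_matrix_mult_def sum.distrib)
qed

lemma linear_adj: "linear (adj :: complex ^ 'n::finite ^ 'm::finite \<Rightarrow> _)"
 by (rule linearI) (auto simp: vec_eq_iff scaleR_conv_of_real[where 'a = complex])

text \<open>The sum is the squared norm of \<open>A *v x\<close>.\<close>

lemma adj_mult_self':
 assumes "(\<Sum>i\<in>UNIV. cnj (x $ i) * ((adj A ** A) *v x) $ i) = 0" shows "A *v x = 0"
proof -
 have "(\<Sum>a\<in>UNIV. cnj ((A *v x) $ a) * ((A *v x) $ a)) = (\<Sum>i\<in>UNIV. cnj (x $ i) * ((adj A ** A) *v x) $ i)"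
 proof -
  have "(\<Sum>a\<in>UNIV. cnj ((A *v x) $ a) * ((A *v x) $ a)) = (\<Sum>a\<in>UNIV. \<Sum>i\<in>UNIV. cnj (x $ i) * (cnj (A $ a $ i) * ((A *v x) $ a)))"
  proof (rule sum.cong[OF refl])
   fix a
   have "cnj ((A *v x) $ a) = (\<Sum>i\<in>UNIV. cnj (x $ i) * cnj (A $ a $ i))"
    by (simp add: matrix_vector_mult_def cnj_sum mult.commute)
   then show "cnj ((A *v x) $ a) * ((A *v x) $ a) = (\<Sum>i\<in>UNIV. cnj (x $ i) * (cnj (A $ a $ i) * ((A *v x) $ a)))"
    by (simp only: sum_distrib_right mult.assoc)
  qed
  also have "\<dots> = (\<Sum>i\<in>UNIV. cnj (x $ i) * (\<Sum>a\<in>UNIV. cnj (A $ a $ i) * ((A *v x) $ a)))"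
   by (subst sum.swap) (simp add: sum_distrib_left)
  finally show ?thesis by (simp add: matrix_vector_mul_assoc[symmetric] matrix_vector_mult_def[of "adj A"])
 qed
 then have "(\<Sum>a\<in>UNIV. cnj ((A *v x) $ a) * ((A *v x) $ a)) = 0" by (simp add: assms)
 then have "complex_of_real (\<Sum>a\<in>UNIV. (norm ((A *v x) $ a))\<^sup>2) = 0"
  by (simp add: complex_norm_square mult.commute del: of_real_power)
 then have "(\<Sum>a\<in>UNIV. (norm ((A *v x) $ a))\<^sup>2) = 0" by (simp only: of_real_eq_0_iff)
 then have "\<forall>a\<in>UNIV. (norm ((A *v x) $ a))\<^sup>2 = 0"
  by (subst (asm) sum_nonneg_eq_0_iff) auto
 then show ?thesis by (simp add: vec_eq_iff)
qed

lemma adj_mult_self: "(adj A ** A) *v x = 0 \<Longrightarrow> A *v x = 0"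
 by (rule adj_mult_self') simp

lemma subspace_range: "vec.subspace (range ((*v) (A :: complex ^ 'n ^ 'm)))"
 by (rule vec.subspace_image[OF vec.subspace_UNIV])

lemma dim_image_kernel:
 fixes A :: "complex ^ 'n ^ 'm"
 assumes W: "vec.subspace W" and zero: "\<And>v. v \<in> W \<Longrightarrow> A *v v = 0 \<Longrightarrow> v = 0"
 shows "vec.dim ((*v) A ` W) = vec.dim W"
proof (rule vec.dim_image_eq[OF matrix_vector_mul_linear_gen inj_onI])
 fix v v' assume v: "v \<in> vec.span W" "v' \<in> vec.span W" and eq: "A *v v = A *v v'"
 then have "v - v' \<in> W" using vec.subspace_diff[OF W] vec.span_eq_iff[THEN iffD2, OF W] by simp
 then have "v - v' = 0" by (rule zero) (use eq in \<open>simp add: matrix_vector_mult_diff_distrib\<close>)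
 then show "v = v'" by simp
qed

subsection \<open>Graphs of matrices\<close>

text \<open>
 The bijection \<open>\<tau>\<close> selects the coordinates \<open>\<tau> a = Inl i\<close> over which a subspace is the graph of
 the matrix \<open>M\<close>; the columns of \<open>frame \<tau> M\<close> are a basis of this subspace.
\<close>

definition blocks :: "('N \<Rightarrow> 'n + 'n) \<Rightarrow> complex ^ 'n ^ 'n \<Rightarrow> complex ^ 'n ^ 'n \<Rightarrow> complex ^ 'n ^ 'N" where
 "blocks \<tau> A M = (\<chi> a j. case \<tau> a of Inl i \<Rightarrow> A $ i $ j | Inr i \<Rightarrow> M $ i $ j)"

definition frame :: "('N \<Rightarrow> 'n + 'n) \<Rightarrow> complex ^ 'n ^ 'n \<Rightarrow> complex ^ 'n::finite ^ 'N" where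
 "frame \<tau> M = blocks \<tau> (mat 1) M"

definition gram :: "complex ^ 'n ^ 'n \<Rightarrow> complex ^ 'n::finite ^ 'n" where
 "gram M = mat 1 + adj M ** M"

text \<open>With S the frame and \<open>gram M\<close> the product of the adjoint of S with S, this
  is the usual formula for the orthogonal projection onto the column space of S.\<close>

definition graph :: "('N::finite \<Rightarrow> 'n + 'n) \<Rightarrow> complex ^ 'n ^ 'n::finite \<Rightarrow> 'N cmatrix" where
 "graph \<tau> M = frame \<tau> M ** cramer_inv (gram M) ** adj (frame \<tau> M)"

definition coordp :: "'N set \<Rightarrow> 'N::finite cmatrix" where
 "coordp I = (\<chi> a b. if a = b \<and> a \<in> I then 1 else 0)"

lemma coordp_mult: "(coordp I *v v) $ a = (if a \<in> I then v $ a else 0)"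
 by (cases "a \<in> I") (simp_all add: coordp_def matrix_vector_mult_def if_distrib[of "\<lambda>x. x * _"] cong: if_cong)

lemma sum_bij_Plus:
 fixes \<tau> :: "'N::finite \<Rightarrow> 'n::finite + 'n"
 assumes "bij \<tau>" shows "(\<Sum>a\<in>UNIV. f (\<tau> a)) = (\<Sum>i\<in>UNIV. f (Inl i)) + (\<Sum>i\<in>UNIV. f (Inr i))"
proof -
 have "(\<Sum>a\<in>UNIV. f (\<tau> a)) = (\<Sum>b\<in>UNIV. f b)"
  using sum.reindex_bij_betw[OF assms, of f] .
 also have "\<dots> = (\<Sum>i\<in>UNIV. f (Inl i)) + (\<Sum>i\<in>UNIV. f (Inr i))"
  unfolding UNIV_Plus_UNIV[symmetric] by (subst sum.Plus) auto
 finally show ?thesis .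
qed

lemma blocks_mult: "blocks \<tau> A M ** B = blocks \<tau> (A ** B) (M ** B)"
 by (auto simp: blocks_def matrix_matrix_mult_def vec_eq_iff split: sum.splits)

lemma blocks_simps: "blocks \<tau> A M + blocks \<tau> A' M' = blocks \<tau> (A + A') (M + M')"
 "blocks \<tau> A M - blocks \<tau> A' M' = blocks \<tau> (A - A') (M - M')" "msc c (blocks \<tau> A M) = blocks \<tau> (msc c A) (msc c M)"
 by (auto simp: blocks_def vec_eq_iff split: sum.splits)

lemma blocks_eq:
 assumes "bij \<tau>" shows "blocks \<tau> A M = blocks \<tau> A' M' \<longleftrightarrow> A = A' \<and> M = M'"
proof
 assume eq: "blocks \<tau> A M = blocks \<tau> A' M'"
 have "blocks \<tau> A M $ inv \<tau> (Inl i) $ j = A $ i $ j" "blocks \<tau> A M $ inv \<tau> (Inr i) $ j = M $ i $ j" for A M i j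
  using assms by (simp_all add: blocks_def surj_f_inv_f bij_is_surj)
 then show "A = A' \<and> M = M'" using eq by (metis (no_types, lifting) vec_eq_iff)
qed simp

lemma adj_blocks:
 fixes \<tau> :: "'N::finite \<Rightarrow> 'n::finite + 'n"
 assumes "bij \<tau>" shows "adj (blocks \<tau> A M) ** blocks \<tau> A' M' = adj A ** A' + adj M ** M'"
proof -
 define F where "F B N b k = (case b of Inl l \<Rightarrow> B $ l $ k | Inr l \<Rightarrow> N $ l $ k)" for B N :: "complex ^ 'n ^ 'n" and b k
 have "(\<Sum>a\<in>UNIV. cnj (F A M (\<tau> a) i) * F A' M' (\<tau> a) j) =
   (\<Sum>k\<in>UNIV. cnj (A $ k $ i) * A' $ k $ j) + (\<Sum>k\<in>UNIV. cnj (M $ k $ i) * M' $ k $ j)" for i j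
  using sum_bij_Plus[OF assms, of "\<lambda>b. cnj (F A M b i) * F A' M' b j"] by (simp add: F_def)
 then show ?thesis by (simp add: vec_eq_iff blocks_def matrix_matrix_mult_def F_def)
qed

context
 fixes \<tau> :: "'N::finite \<Rightarrow> 'n::finite + 'n"
 assumes \<tau>: "bij \<tau>"
begin

lemma adj_frame: "adj (frame \<tau> M) ** frame \<tau> M = gram M"
 by (simp add: frame_def gram_def adj_blocks[OF \<tau>] adj_simps)

lemma frame_kernel: "frame \<tau> M *v x = 0 \<Longrightarrow> x = 0"
proof -
 assume "frame \<tau> M *v x = 0"
 then have "(frame \<tau> M *v x) $ inv \<tau> (Inl i) = 0" for i by simp
 then show "x = 0"
  using \<tau> by (simp add: frame_def blocks_def matrix_vector_mult_def surj_f_inv_f bij_is_surj mat_def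
    if_distrib[of "\<lambda>x. x * _"] vec_eq_iff cong: if_cong)
qed

lemma det_gram: "det (gram (M :: complex ^ 'n ^ 'n)) \<noteq> 0"
proof -
 have "x = 0" if "gram M *v x = 0" for x
  by (rule frame_kernel[of M], rule adj_mult_self, unfold adj_frame, rule that)
 then have "\<exists>B. B ** gram M = mat 1" unfolding matrix_left_invertible_ker by blast
 then have "invertible (gram M)" by (simp add: invertible_left_inverse)
 then show ?thesis by (simp add: invertible_det_nz)
qed

lemma gram_inv: "gram (M :: complex ^ 'n ^ 'n) ** cramer_inv (gram M) = mat 1" "cramer_inv (gram (M :: complex ^ 'n ^ 'n)) ** gram M = mat 1"
 by (rule cramer_inv[OF det_gram])+

lemma graph_frame: "graph \<tau> M ** frame \<tau> M = frame \<tau> M"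
 by (simp add: graph_def matrix_mul_assoc[symmetric] adj_frame gram_inv)

lemma adj_gram_inv: "adj (cramer_inv (gram (M :: complex ^ 'n ^ 'n))) = cramer_inv (gram M)"
proof -
 have "adj (gram M) = gram M" by (simp add: gram_def adj_simps adj_mult)
 then have "adj (cramer_inv (gram M)) ** gram M = mat 1"
  using arg_cong[OF gram_inv(1)[of M], of adj] by (simp add: adj_mult adj_simps)
 then show ?thesis using gram_inv(1)[of M] by (metis matrix_mul_assoc matrix_mul_lid matrix_mul_rid)
qed

lemma adj_graph: "adj (graph \<tau> M) = graph \<tau> M"
 by (simp add: graph_def adj_mult adj_gram_inv matrix_mul_assoc)

lemma graph_idem: "graph \<tau> M ** graph \<tau> M = graph \<tau> M"
proof -
 have "graph \<tau> M ** graph \<tau> M = graph \<tau> M ** frame \<tau> M ** cramer_inv (gram M) ** adj (frame \<tau> M)"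
  unfolding graph_def[of \<tau> M] by (simp only: matrix_mul_assoc)
 then show ?thesis by (simp add: graph_frame) (simp add: graph_def)
qed

lemma frame_zero: "frame \<tau> 0 $ a $ j = (if \<tau> a = Inl j then 1 else 0)"
 by (cases "\<tau> a") (simp_all add: frame_def blocks_def mat_def)

lemma graph_zero: "graph \<tau> 0 = coordp {a. \<exists>i. \<tau> a = Inl i}"
proof -
 have "gram 0 = (mat 1 :: complex ^ 'n ^ 'n)" by (simp add: gram_def)
 then have "cramer_inv (gram 0) = (mat 1 :: complex ^ 'n ^ 'n)" using gram_inv(2)[of 0] by (simp add: matrix_mul_rid)
 then have G: "graph \<tau> 0 = frame \<tau> 0 ** adj (frame \<tau> 0)" by (simp add: graph_def)
 have "graph \<tau> 0 $ a $ b = coordp {a. \<exists>i. \<tau> a = Inl i} $ a $ b" for a b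
 proof (cases "\<tau> a")
  case (Inl i)
  have "graph \<tau> 0 $ a $ b = (\<Sum>j\<in>UNIV. if j = i then (if \<tau> b = Inl i then 1 else 0) else 0)"
   unfolding G matrix_matrix_mult_def vec_lambda_beta adj_nth frame_zero by (rule sum.cong) (auto simp: Inl)
  then show ?thesis using inj_eq[OF bij_is_inj[OF \<tau>], of b a] Inl by (auto simp: coordp_def)
 qed (auto simp: G matrix_matrix_mult_def frame_zero coordp_def)
 then show ?thesis by (simp add: vec_eq_iff)
qed

lemma range_graph: "range ((*v) (graph \<tau> M)) = range ((*v) (frame \<tau> M))"
proof -
 have "graph \<tau> M *v x = frame \<tau> M *v (cramer_inv (gram M) *v (adj (frame \<tau> M) *v x))" for x
  by (simp only: graph_def matrix_vector_mul_assoc matrix_mul_assoc)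
 moreover have "frame \<tau> M *v x = graph \<tau> M *v (frame \<tau> M *v x)" for x
  by (simp only: matrix_vector_mul_assoc graph_frame)
 ultimately show ?thesis by (auto simp: image_iff)
qed

lemma dim_graph: "vec.dim (range ((*v) (graph \<tau> M))) = CARD('n)"
proof -
 have "vec.dim (range ((*v) (frame \<tau> M))) = vec.dim (UNIV :: (complex ^ 'n) set)"
  by (rule dim_image_kernel[OF vec.subspace_UNIV frame_kernel])
 then show ?thesis by (simp only: range_graph vec_dim_card)
qed

text \<open>The range of \<open>p\<close> contains the column space of the frame and has the same
  dimension. Two Hermitian projections with the same range absorb each other from both sides and are
  equal.\<close>

lemma projection_eq_graph:
 assumes p: "p ** p = p" "hermitian p" "vec.dim (range ((*v) p)) = CARD('n)" and pS: "p ** frame \<tau> M = frame \<tau> M"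
 shows "p = graph \<tau> M"
proof -
 have pG: "p ** graph \<tau> M = graph \<tau> M"
  using pS unfolding graph_def by (simp add: matrix_mul_assoc)
 have "range ((*v) (graph \<tau> M)) \<subseteq> range ((*v) p)"
 proof
  fix v assume "v \<in> range ((*v) (graph \<tau> M))"
  then obtain x where "v = graph \<tau> M *v x" by auto
  then have "v = p *v v" by (simp add: matrix_vector_mul_assoc pG)
  then show "v \<in> range ((*v) p)" by (metis rangeI)
 qed
 then have eq: "range ((*v) (graph \<tau> M)) = range ((*v) p)"
  by (intro vec.subspace_dim_equal vec.subspace_image vec.subspace_UNIV)
   (simp_all add: p(3) dim_graph)
 have "graph \<tau> M ** p = p"
 proof -
  have "graph \<tau> M *v (p *v x) = p *v x" for x
  proof -
   have "p *v x \<in> range ((*v) (graph \<tau> M))" unfolding eq by simp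
   then obtain y where "p *v x = graph \<tau> M *v y" by auto
   then show ?thesis by (simp add: matrix_vector_mul_assoc graph_idem)
  qed
  then show ?thesis by (simp add: matrix_eq matrix_vector_mul_assoc)
 qed
 from arg_cong[OF this, of adj] have "p ** graph \<tau> M = p"
  using p(2) by (simp add: adj_mult adj_graph hermitian_adj)
 then show ?thesis using pG by simp
qed

lemma tangent_zero:
 assumes "X \<in> tang (graph \<tau> M)" "adj X = X" "X ** frame \<tau> M = 0" shows "X = 0"
proof -
 have "X ** graph \<tau> M = 0" using assms(3) unfolding graph_def by (simp add: matrix_mul_assoc)
 moreover from arg_cong[OF this, of adj] have "graph \<tau> M ** X = 0" by (simp add: adj_mult adj_graph assms(2) adj_simps)
 ultimately show ?thesis using assms(1) by (simp add: tang_def)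
qed

text \<open>A Hermitian tangent vector is determined by its values on the subspace, as it equals p
  \<xi> + \<xi> p. Identities between derivatives of charts are therefore checked after
  multiplication with the frame alone.\<close>

lemma tangent_eqI:
 assumes "X \<in> tang (graph \<tau> M)" "adj X = X" "Y \<in> tang (graph \<tau> M)" "adj Y = Y" "X ** frame \<tau> M = Y ** frame \<tau> M"
 shows "X = Y"
proof -
 have "X - Y \<in> tang (graph \<tau> M)"
  using assms(1,3) by (simp add: tang_def matrix_diff_ldistrib matrix_diff_rdistrib algebra_simps)
 then have "X - Y = 0"
  by (rule tangent_zero) (simp_all add: adj_simps assms matrix_diff_rdistrib)
 then show ?thesis by simp
qed

subsection \<open>Derivatives of graphs\<close>

context
 fixes L :: "complex ^ 'd::finite \<Rightarrow> complex ^ 'n ^ 'n"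
 assumes L: "linear L"
begin

lemma smooth_graph: "smooth_on UNIV (\<lambda>z. graph \<tau> (L z))"
proof (rule smooth_on_matrixI, intro allI)
 fix a b
 have l: "algf (\<lambda>z. L z $ i $ j)" for i j by (rule algf_nth_compose[OF L])
 have l': "algf (\<lambda>z. adj (L z) $ i $ j)" for i j
  by (rule algf_nth_compose) (use linear_compose[OF L linear_adj] in \<open>simp add: o_def\<close>)
 have "algf (\<lambda>z. gram (L z) $ i $ j)" for i j
  unfolding gram_def vector_add_component by (intro algf_add algf_const algf_matmult l l')
 moreover have f: "algf (\<lambda>z. frame \<tau> (L z) $ i $ j)" for i j
  by (cases "\<tau> i") (simp_all add: frame_def blocks_def algf_const l)
 moreover have "algf (\<lambda>z. adj (frame \<tau> (L z)) $ i $ j)" for i j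
  by (cases "\<tau> j") (simp_all add: frame_def blocks_def algf_const l' l'[of i, simplified])
 ultimately show "algf (\<lambda>z. graph \<tau> (L z) $ a $ b)"
  unfolding graph_def by (intro algf_matmult algf_cramer_inv det_gram)
qed

lemma has_derivative_graph:
 "((\<lambda>z. graph \<tau> (L z)) has_derivative fder (\<lambda>z. graph \<tau> (L z)) z) (at z)"
 by (rule has_frechet[OF smooth_diff[OF smooth_graph UNIV_I]])

text \<open>For the projection P and its frame S, these come from differentiating P S = S, the
  self-adjointness of P, and P P = P.\<close>

lemma D_graph:
 defines "D \<equiv> \<lambda>z. fder (\<lambda>z. graph \<tau> (L z)) z"
 shows "D z h ** frame \<tau> (L z) = (mat 1 - graph \<tau> (L z)) ** blocks \<tau> 0 (L h)"
  "adj (D z h) = D z h" "D z h \<in> tang (graph \<tau> (L z))"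
proof -
 have d: "((\<lambda>z. graph \<tau> (L z)) has_derivative D z) (at z)"
  unfolding D_def by (rule has_derivative_graph)
 have "linear (\<lambda>h. blocks \<tau> 0 (L h))"
  by (rule linearI) (auto simp: blocks_def vec_eq_iff linear_add[OF L] linear_scale[OF L] split: sum.splits)
 then have "((\<lambda>z. frame \<tau> 0 + blocks \<tau> 0 (L z)) has_derivative (\<lambda>h. 0 + blocks \<tau> 0 (L h))) (at z)"
  by (intro has_derivative_add has_derivative_const linear_imp_has_derivative)
 then have f: "((\<lambda>z. frame \<tau> (L z)) has_derivative (\<lambda>h. blocks \<tau> 0 (L h))) (at z)"
  by (simp add: frame_def blocks_simps)
 from has_derivative_unique[OF has_derivative_matmult[OF d f, unfolded graph_frame] f, THEN fun_cong, of h]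
 show "D z h ** frame \<tau> (L z) = (mat 1 - graph \<tau> (L z)) ** blocks \<tau> 0 (L h)"
  by (simp add: matrix_diff_rdistrib algebra_simps)
 have "((\<lambda>z. adj (graph \<tau> (L z))) has_derivative (\<lambda>h. adj (D z h))) (at z)"
  using bounded_linear.has_derivative[OF _ d, of adj] linear_adj by (simp add: linear_conv_bounded_linear)
 from has_derivative_unique[OF this[unfolded adj_graph] d, THEN fun_cong, of h] show "adj (D z h) = D z h" .
 from has_derivative_unique[OF has_derivative_matmult[OF d d, unfolded graph_idem] d, THEN fun_cong, of h]
 show "D z h \<in> tang (graph \<tau> (L z))" by (simp add: tang_def)
qed

lemma graph_kills: "(mat 1 - graph \<tau> M) ** frame \<tau> M = 0"
 by (simp add: matrix_diff_rdistrib graph_frame)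

text \<open>If the derivative vanishes on \<open>h\<close>, the columns of
  \<open>blocks \<tau> 0 (L h)\<close> lie in the graph. Their base block is zero, and a vector of a
  graph with zero base coordinates is zero.\<close>

lemma inj_D_graph:
 assumes "inj L" shows "inj (fder (\<lambda>z. graph \<tau> (L z)) z)"
proof -
 have lin: "linear (fder (\<lambda>z. graph \<tau> (L z)) z)"
  using has_derivative_graph has_derivative_linear by blast
 have "h = 0" if "fder (\<lambda>z. graph \<tau> (L z)) z h = 0" for h
 proof -
  have "graph \<tau> (L z) ** blocks \<tau> 0 (L h) = blocks \<tau> 0 (L h)"
   using D_graph(1)[of z h] that by (simp add: matrix_diff_rdistrib)
  then have "frame \<tau> (L z) ** (cramer_inv (gram (L z)) ** adj (frame \<tau> (L z)) ** blocks \<tau> 0 (L h)) = blocks \<tau> 0 (L h)"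
   by (simp add: graph_def matrix_mul_assoc)
  then have "blocks \<tau> C (L z ** C) = blocks \<tau> 0 (L h)" if "C = cramer_inv (gram (L z)) ** adj (frame \<tau> (L z)) ** blocks \<tau> 0 (L h)" for C
   using that by (simp add: frame_def blocks_mult)
  then have "L h = 0" unfolding blocks_eq[OF \<tau>] by (metis matrix_zero_r)
  then show ?thesis using assms linear_0[OF L] by (metis injD)
 qed
 then show ?thesis using linear_injective_0[OF lin] by blast
qed

lemma D_graph_cstruct:
 assumes Li: "\<And>h. L (\<i> *s h) = msc \<i> (L h)"
 shows "fder (\<lambda>z. graph \<tau> (L z)) z (\<i> *s h) =
  cstruct (graph \<tau> (L z)) (fder (\<lambda>z. graph \<tau> (L z)) z h)"
proof (rule tangent_eqI[where M = "L z"])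
 let ?G = "graph \<tau> (L z)" and ?D = "fder (\<lambda>z. graph \<tau> (L z)) z"
 have c: "cstruct ?G \<xi> = msc \<i> (\<xi> ** ?G - ?G ** \<xi>)" for \<xi> by (simp add: cstruct_def vec_eq_iff)
 have GG: "?G ** (?G ** A) = ?G ** A" for A :: "complex ^ 'k ^ 'N" by (simp add: matrix_mul_assoc graph_idem)
 show "cstruct ?G (?D h) \<in> tang ?G"
  by (simp add: tang_def c msc_simps matrix_diff_ldistrib matrix_diff_rdistrib GG graph_idem flip: matrix_mul_assoc)
 show "adj (cstruct ?G (?D h)) = cstruct ?G (?D h)"
  by (simp add: c adj_simps adj_mult adj_graph D_graph(2)) (simp add: vec_eq_iff algebra_simps)
 have "?G ** (?D h ** frame \<tau> (L z)) = 0"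
  unfolding D_graph(1) by (simp add: matrix_diff_ldistrib matrix_diff_rdistrib matrix_mul_assoc graph_idem)
 then have "cstruct ?G (?D h) ** frame \<tau> (L z) = msc \<i> (?D h ** frame \<tau> (L z))"
  by (simp add: c msc_simps matrix_diff_rdistrib graph_frame flip: matrix_mul_assoc)
 moreover have "blocks \<tau> 0 (msc \<i> (L h)) = msc \<i> (blocks \<tau> 0 (L h))"
  by (simp add: vec_eq_iff blocks_def split: sum.splits)
 ultimately show "?D (\<i> *s h) ** frame \<tau> (L z) = cstruct ?G (?D h) ** frame \<tau> (L z)"
  by (simp add: D_graph(1) Li msc_simps)
qed (rule D_graph)+

text \<open>The torus scales each entry of the slope matrix by the quotient of the characters of its
  target and source coordinates, so the chart linearises the action.\<close>

lemma rot_graph: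
 assumes W: "\<And>i j. L (A z) $ i $ j = \<i> * of_real (w (inv \<tau> (Inr i)) - w (inv \<tau> (Inl j))) * L z $ i $ j"
 shows "rot w (graph \<tau> (L z)) = fder (\<lambda>z. graph \<tau> (L z)) z (A z)"
proof (rule tangent_eqI[where M = "L z"])
 let ?G = "graph \<tau> (L z)" and ?D = "fder (\<lambda>z. graph \<tau> (L z)) z" and ?S = "frame \<tau> (L z)"
 show "rot w ?G \<in> tang ?G" by (rule rot_tang[OF graph_idem])
 have "adj (weight w) = weight w" by (auto simp: vec_eq_iff weight_def)
 then show "adj (rot w ?G) = rot w ?G"
  by (simp add: rot_def adj_simps adj_mult adj_graph) (simp add: vec_eq_iff algebra_simps)
 \<comment> \<open>Subtracting \<open>?S ** W1\<close> changes the columns only within the subspace.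
   It cancels the base block of \<open>weight w ** ?S\<close>; what remains is the change of the
   slope matrix.\<close>
 define W1 where "W1 = (weight (\<lambda>i. w (inv \<tau> (Inl i))) :: 'n cmatrix)"
 have i: "inv \<tau> (Inl i) = a \<longleftrightarrow> \<tau> a = Inl i" "inv \<tau> (Inr i) = a \<longleftrightarrow> \<tau> a = Inr i" for i a
  using \<tau> by (metis bij_inv_eq_iff)+
 have wS: "msc \<i> (weight w ** ?S - ?S ** W1) = blocks \<tau> 0 (L (A z))"
 proof -
  have "(weight w ** ?S) $ a $ j = of_real (w a) * ?S $ a $ j" "(?S ** W1) $ a $ j = ?S $ a $ j * of_real (w (inv \<tau> (Inl j)))" for a j
   by (simp_all add: matrix_matrix_mult_def weight_def W1_def if_distrib[of "\<lambda>x. x * _"] if_distrib[of "\<lambda>x. _ * x"] cong: if_cong)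
  then have e: "msc \<i> (weight w ** ?S - ?S ** W1) $ a $ j = \<i> * of_real (w a - w (inv \<tau> (Inl j))) * ?S $ a $ j" for a j
   by (simp add: algebra_simps)
  have "\<i> * of_real (w a - w (inv \<tau> (Inl j))) * ?S $ a $ j = blocks \<tau> 0 (L (A z)) $ a $ j" for a j
  proof (cases "\<tau> a")
   case (Inl b)
   then have "inv \<tau> (Inl b) = a" by (simp add: i)
   then show ?thesis using Inl by (auto simp: frame_def blocks_def mat_def)
  next
   case (Inr b)
   then have "inv \<tau> (Inr b) = a" by (simp add: i)
   then show ?thesis using Inr W[of b j] by (simp add: frame_def blocks_def)
  qed
  then show ?thesis using e by (simp add: vec_eq_iff)
 qed
 have "rot w ?G ** ?S = msc \<i> ((mat 1 - ?G) ** (weight w ** ?S))"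
  by (simp add: rot_def msc_simps matrix_diff_rdistrib graph_frame flip: matrix_mul_assoc)
 also have "(mat 1 - ?G) ** (weight w ** ?S) = (mat 1 - ?G) ** (weight w ** ?S - ?S ** W1)"
  by (simp add: matrix_diff_ldistrib[of "mat 1 - ?G"] matrix_mul_assoc graph_kills)
 also have "msc \<i> \<dots> = (mat 1 - ?G) ** blocks \<tau> 0 (L (A z))"
  unfolding wS[symmetric] by (simp add: msc_simps)
 finally show "rot w ?G ** ?S = ?D (A z) ** ?S" by (simp add: D_graph(1))
qed (rule D_graph)+

lemma D_graph_center:
 "fder (\<lambda>z. graph \<tau> (L z)) 0 h $ a $ b =
  (case (\<tau> a, \<tau> b) of (Inr i, Inl j) \<Rightarrow> L h $ i $ j | (Inl i, Inr j) \<Rightarrow> cnj (L h $ j $ i) | _ \<Rightarrow> 0)"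
proof -
 let ?D = "fder (\<lambda>z. graph \<tau> (L z)) 0 h" and ?S = "frame \<tau> (L 0)"
 define e where "e a = (case \<tau> a of Inl i \<Rightarrow> 1 | _ \<Rightarrow> (0::complex))" for a
 have \<tau>_eq: "\<tau> a = \<tau> b \<longleftrightarrow> a = b" for a b by (rule inj_eq[OF bij_is_inj[OF \<tau>]])
 have G_nth: "graph \<tau> (L 0) $ a $ b = (if a = b then e a else 0)" for a b
  by (auto simp: linear_0[OF L] graph_zero coordp_def e_def split: sum.splits)
 have "(graph \<tau> (L 0) ** ?D) $ a $ b = e a * ?D $ a $ b" "(?D ** graph \<tau> (L 0)) $ a $ b = ?D $ a $ b * e b" for a b
  by (simp_all add: matrix_matrix_mult_def G_nth if_distrib[of "\<lambda>x. x * _"] if_distrib[of "\<lambda>x. _ * x"] cong: if_cong)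
 then have t: "?D $ a $ b = e a * ?D $ a $ b + ?D $ a $ b * e b" for a b
  using arg_cong[OF D_graph(3)[of 0 h, unfolded tang_def mem_Collect_eq], of "\<lambda>x. x $ a $ b"] by simp
 have low: "?D $ a $ b = L h $ i $ j" if "\<tau> a = Inr i" "\<tau> b = Inl j" for a b i j
 proof -
  have "(?D ** ?S) $ a $ j = ?D $ a $ b"
  proof -
   have "?S $ c $ j = (if c = b then 1 else 0)" for c
    using that \<tau>_eq[of c b] by (simp add: linear_0[OF L] frame_zero)
   then show ?thesis by (simp add: matrix_matrix_mult_def if_distrib[of "\<lambda>x. _ * x"] cong: if_cong)
  qed
  moreover have "((mat 1 - graph \<tau> (L 0)) ** blocks \<tau> 0 (L h)) $ a $ j = L h $ i $ j"
  proof -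
   have "(mat 1 - graph \<tau> (L 0)) $ a $ c = (if a = c then 1 else 0)" for c
    using that by (auto simp: G_nth mat_def e_def)
   then show ?thesis using that by (simp add: matrix_matrix_mult_def blocks_def if_distrib[of "\<lambda>x. x * _"] cong: if_cong)
  qed
  ultimately show ?thesis by (simp add: D_graph(1))
 qed
 show ?thesis
 proof (cases "\<tau> a"; cases "\<tau> b")
  fix i j assume ab: "\<tau> a = Inl i" "\<tau> b = Inr j"
  have "?D $ a $ b = cnj (?D $ b $ a)" using arg_cong[OF D_graph(2)[of 0 h], of "\<lambda>x. x $ a $ b"] by simp
  then show ?thesis using low[of b j a i] ab by simp
 qed (use t[of a b] low[of a _ b] in \<open>auto simp: e_def\<close>)
qed

end

end

subsection \<open>Inverting the charts\<close>

definition corner :: "('N \<Rightarrow> 'n + 'n) \<Rightarrow> 'N::finite cmatrix \<Rightarrow> complex ^ 'n ^ 'n" where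
 "corner \<tau> p = (\<chi> i j. p $ inv \<tau> (Inl i) $ inv \<tau> (Inl j))"

text \<open>For the graph of M the corner block is the inverse of the Gram matrix, and the block
  below it is M times this inverse; the quotient returns M.\<close>

definition slope :: "('N \<Rightarrow> 'n + 'n) \<Rightarrow> 'N::finite cmatrix \<Rightarrow> complex ^ 'n ^ 'n::finite" where
 "slope \<tau> p = (\<chi> i j. p $ inv \<tau> (Inr i) $ inv \<tau> (Inl j)) ** cramer_inv (corner \<tau> p)"

context
 fixes \<tau> :: "'N::finite \<Rightarrow> 'n::finite + 'n"
 assumes \<tau>: "bij \<tau>"
begin

lemma inv_eq: "\<tau> (inv \<tau> b) = b" "inv \<tau> (\<tau> a) = a"
 using \<tau> by (simp_all add: surj_f_inv_f bij_is_surj inv_f_f bij_is_inj)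

lemma range_inv: "range (\<lambda>i. inv \<tau> (Inl i)) = {a. \<exists>i. \<tau> a = Inl i}"
 "range (\<lambda>i. inv \<tau> (Inr i)) = - {a. \<exists>i. \<tau> a = Inl i}"
 and inj_inv: "inj (\<lambda>i. inv \<tau> (Inl i))" "inj (\<lambda>i. inv \<tau> (Inr i))"
proof -
 have i: "a = inv \<tau> b \<longleftrightarrow> \<tau> a = b" for a b using inv_eq by auto
 show "range (\<lambda>i. inv \<tau> (Inl i)) = {a. \<exists>i. \<tau> a = Inl i}" by (auto simp: image_iff i inv_eq)
 show "range (\<lambda>i. inv \<tau> (Inr i)) = - {a. \<exists>i. \<tau> a = Inl i}"
  by (auto simp: image_iff i inv_eq) (metis sum.exhaust)
 show "inj (\<lambda>i. inv \<tau> (Inl i))" "inj (\<lambda>i. inv \<tau> (Inr i))" by (auto simp: inj_def i inv_eq)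
qed

lemma graph_nth:
 "graph \<tau> M $ a $ inv \<tau> (Inl j) = blocks \<tau> (cramer_inv (gram M)) (M ** cramer_inv (gram M)) $ a $ j"
proof -
 have "graph \<tau> M $ a $ inv \<tau> (Inl j) = (\<Sum>k\<in>UNIV. blocks \<tau> (cramer_inv (gram M)) (M ** cramer_inv (gram M)) $ a $ k * cnj (mat 1 $ j $ k))"
  by (simp add: graph_def frame_def blocks_mult matrix_matrix_mult_def[of _ "adj _"]) (simp add: blocks_def inv_eq)
 also have "\<dots> = (\<Sum>k\<in>UNIV. if j = k then blocks \<tau> (cramer_inv (gram M)) (M ** cramer_inv (gram M)) $ a $ j else 0)"
  by (rule sum.cong) (auto simp: mat_def)
 finally show ?thesis by simp
qed

lemma corner_graph: "corner \<tau> (graph \<tau> M) = cramer_inv (gram M)"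
 by (simp add: corner_def graph_nth vec_eq_iff) (simp add: blocks_def inv_eq)

lemma det_corner_graph: "det (corner \<tau> (graph \<tau> M)) \<noteq> 0"
 using arg_cong[OF gram_inv(1)[OF \<tau>, of M], of det] by (auto simp: corner_graph det_mul)

lemma slope_graph: "slope \<tau> (graph \<tau> M) = M"
proof -
 have "(\<chi> i j. graph \<tau> M $ inv \<tau> (Inr i) $ inv \<tau> (Inl j)) = M ** cramer_inv (gram M)"
  by (simp add: graph_nth vec_eq_iff) (simp add: blocks_def inv_eq)
 then show ?thesis
  using cramer_inv(1)[OF det_corner_graph[of M]] by (simp add: slope_def corner_graph flip: matrix_mul_assoc)
qed

lemma frame_slope:
 assumes "p ** p = p" "det (corner \<tau> p) \<noteq> 0"
 shows "p ** frame \<tau> (slope \<tau> p) = frame \<tau> (slope \<tau> p)"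
proof -
 define P where "P = (\<chi> a j. p $ a $ inv \<tau> (Inl j))"
 have "P = blocks \<tau> (corner \<tau> p) (\<chi> i j. p $ inv \<tau> (Inr i) $ inv \<tau> (Inl j))"
  using inv_eq(2) by (auto simp: P_def blocks_def corner_def vec_eq_iff split: sum.splits) metis+
 then have f: "P ** cramer_inv (corner \<tau> p) = frame \<tau> (slope \<tau> p)"
  by (simp add: blocks_mult frame_def slope_def cramer_inv[OF assms(2)])
 have "(p ** P) $ a $ j = (p ** p) $ a $ inv \<tau> (Inl j)" for a j
  by (simp add: matrix_matrix_mult_def P_def)
 then have "p ** P = P" by (simp add: assms(1) vec_eq_iff) (simp add: P_def)
 then show ?thesis by (simp add: f[symmetric] matrix_mul_assoc)
qed

text \<open>The corner compresses \<open>p\<close> to the selected coordinates. A kernel vector y,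
  extended by zero to x, satisfies p x = 0. By dimension the selected coordinates map the range of
  \<open>p\<close> onto everything, so y consists of the selected coordinates of some p u; then
  |y|^2 is the product of p u with x, that is, of u with p x, hence zero.\<close>

lemma det_corner_nonzero:
 assumes p: "hermitian p" "p ** p = p" "vec.dim (range ((*v) p)) = CARD('n)"
  and nz: "\<And>v. v \<in> range ((*v) p) \<Longrightarrow> (\<And>i. v $ inv \<tau> (Inl i) = 0) \<Longrightarrow> v = 0"
 shows "det (corner \<tau> p) \<noteq> 0"
proof -
 have adj: "adj p = p" using p(1) by (simp add: hermitian_adj)
 define \<pi> :: "complex ^ 'N ^ 'n" where "\<pi> = (\<chi> i a. if a = inv \<tau> (Inl i) then 1 else 0)"
 have \<pi>: "(\<pi> *v v) $ i = v $ inv \<tau> (Inl i)" for v i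
  by (simp add: \<pi>_def matrix_vector_mult_def if_distrib[of "\<lambda>x. x * _"] cong: if_cong)
 have "vec.dim ((*v) \<pi> ` range ((*v) p)) = CARD('n)"
  unfolding p(3)[symmetric]
 proof (rule dim_image_kernel[OF subspace_range nz])
  fix v i assume "\<pi> *v v = 0"
  then show "v $ inv \<tau> (Inl i) = 0" by (simp flip: \<pi>)
 qed
 moreover have "vec.subspace ((*v) \<pi> ` range ((*v) p))" by (rule vec.subspace_image[OF subspace_range])
 ultimately have onto: "(*v) \<pi> ` range ((*v) p) = UNIV"
  by (intro vec.subspace_dim_equal vec.subspace_UNIV) (simp_all only: vec_dim_card order_refl subset_UNIV)
 have "y = 0" if y: "corner \<tau> p *v y = 0" for y
 proof -
  define x where "x = (\<chi> a. case \<tau> a of Inl i \<Rightarrow> y $ i | Inr i \<Rightarrow> 0)"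
  have x: "(\<Sum>a\<in>UNIV. f a * x $ a) = (\<Sum>i\<in>UNIV. f (inv \<tau> (Inl i)) * y $ i)" for f
   using sum_bij_Plus[OF \<tau>, of "\<lambda>b. f (inv \<tau> b) * (case b of Inl i \<Rightarrow> y $ i | Inr i \<Rightarrow> 0)"]
   by (simp add: x_def inv_eq)
  have "(p *v x) $ inv \<tau> (Inl i) = (corner \<tau> p *v y) $ i" for i
   by (simp add: matrix_vector_mult_def x corner_def)
  then have px: "p *v x = 0" using y by (intro nz) auto
  have "y \<in> (*v) \<pi> ` range ((*v) p)" unfolding onto ..
  then obtain u where u: "y = \<pi> *v (p *v u)" by auto
  have "(\<Sum>i\<in>UNIV. cnj (y $ i) * y $ i) = (\<Sum>a\<in>UNIV. cnj ((p *v u) $ a) * x $ a)"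
   by (simp add: x u \<pi>)
  also have "\<dots> = (\<Sum>a\<in>UNIV. \<Sum>b\<in>UNIV. cnj (u $ b) * (p $ b $ a * x $ a))"
  proof (rule sum.cong[OF refl])
   fix a
   have "cnj (p $ a $ b) = p $ b $ a" for b using arg_cong[OF adj, of "\<lambda>q. q $ b $ a"] by simp
   then show "cnj ((p *v u) $ a) * x $ a = (\<Sum>b\<in>UNIV. cnj (u $ b) * (p $ b $ a * x $ a))"
    by (simp add: matrix_vector_mult_def cnj_sum sum_distrib_left mult_ac)
  qed
  also have "\<dots> = (\<Sum>b\<in>UNIV. cnj (u $ b) * (p *v x) $ b)"
   by (subst sum.swap) (simp add: matrix_vector_mult_def sum_distrib_left)
  finally have "(\<Sum>i\<in>UNIV. cnj (y $ i) * ((adj (mat 1) ** mat 1) *v y) $ i) = 0"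
   by (simp add: px adj_simps)
  from adj_mult_self'[OF this] show ?thesis by simp
 qed
 then have "\<exists>B. B ** corner \<tau> p = mat 1" unfolding matrix_left_invertible_ker by blast
 then have "invertible (corner \<tau> p)" by (simp add: invertible_left_inverse)
 then show ?thesis by (simp add: invertible_det_nz)
qed

end

subsection \<open>Compactness of spaces of projections\<close>

text \<open>A diagonal entry of a Hermitian projection is the sum of the squared moduli in its
  row.\<close>

lemma projection_entry_le:
 fixes p :: "'N::finite cmatrix"
 assumes p: "p ** p = p" "hermitian p" shows "norm (p $ a $ b) \<le> 1"
proof -
 have c: "p $ b $ a = cnj (p $ a $ b)" for a b using p(2) unfolding hermitian_def by blast
 have e: "p $ i $ i = of_real (\<Sum>b\<in>UNIV. (norm (p $ i $ b))\<^sup>2)" for i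
 proof -
  have "p $ i $ i = (\<Sum>b\<in>UNIV. p $ i $ b * p $ b $ i)"
   using arg_cong[OF p(1), of "\<lambda>x. x $ i $ i"] by (simp add: matrix_matrix_mult_def)
  also have "\<dots> = (\<Sum>b\<in>UNIV. p $ i $ b * cnj (p $ i $ b))"
   by (subst c[of _ i]) (rule refl)
  also have "\<dots> = of_real (\<Sum>b\<in>UNIV. (norm (p $ i $ b))\<^sup>2)"
   by (simp only: of_real_sum complex_norm_square)
  finally show ?thesis .
 qed
 have "(norm (p $ a $ b))\<^sup>2 \<le> norm (p $ a $ a)" for b
 proof -
  have "(norm (p $ a $ b))\<^sup>2 \<le> (\<Sum>b\<in>UNIV. (norm (p $ a $ b))\<^sup>2)" by (rule member_le_sum) auto
  also have "\<dots> = norm (p $ a $ a)" by (subst e) (simp add: sum_nonneg del: of_real_sum)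
  finally show ?thesis .
 qed
 from this[of a] this[of b] have "(norm (p $ a $ a))\<^sup>2 \<le> norm (p $ a $ a)" "(norm (p $ a $ b))\<^sup>2 \<le> norm (p $ a $ a)" .
 then have "norm (p $ a $ a) \<le> 1" by (cases "norm (p $ a $ a) = 0") (auto simp: power2_eq_square)
 then have "(norm (p $ a $ b))\<^sup>2 \<le> 1\<^sup>2" using \<open>(norm (p $ a $ b))\<^sup>2 \<le> norm (p $ a $ a)\<close> by simp
 then show ?thesis by (rule power2_le_imp_le) simp
qed

text \<open>If \<open>q\<close> annihilated a nonzero v in the range of \<open>p\<close>, then v =
  (p - q) v, which at a coordinate of maximal modulus contradicts the smallness of p - q. So
  \<open>q\<close> is injective on the range of \<open>p\<close>. By symmetry, the rank is locally
  constant among projections.\<close>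

lemma dim_range_le:
 fixes p q :: "'N::finite cmatrix"
 assumes p: "p ** p = p" and d: "\<And>a b. norm (p $ a $ b - q $ a $ b) * CARD('N) < 1"
 shows "vec.dim (range ((*v) p)) \<le> vec.dim (range ((*v) q))"
proof -
 have zero: "v = 0" if v: "v \<in> range ((*v) p)" and q: "q *v v = 0" for v
 proof (rule ccontr)
  assume "v \<noteq> 0"
  have "finite (range (\<lambda>b. norm (v $ b)))" "range (\<lambda>b. norm (v $ b)) \<noteq> {}" by auto
  then have "Max (range (\<lambda>b. norm (v $ b))) \<in> range (\<lambda>b. norm (v $ b))" by (rule Max_in)
  then obtain a where a: "Max (range (\<lambda>b. norm (v $ b))) = norm (v $ a)" by (rule imageE)
  have le: "norm (v $ b) \<le> norm (v $ a)" for b unfolding a[symmetric] by (rule Max_ge) auto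
  have "norm (v $ a) > 0" 
  proof -
   obtain b where "v $ b \<noteq> 0" using \<open>v \<noteq> 0\<close> by (auto simp: vec_eq_iff)
   then have "0 < norm (v $ b)" by simp
   then show ?thesis using le[of b] by linarith
  qed
  have "p *v v = v" using v p by (auto simp: matrix_vector_mul_assoc)
  then have "v = (p - q) *v v" using q by (simp add: matrix_vector_mult_diff_rdistrib)
  then have "v $ a = (\<Sum>b\<in>UNIV. (p $ a $ b - q $ a $ b) * v $ b)"
   by (metis (no_types, lifting) matrix_vector_mult_def sum.cong vec_lambda_beta vector_minus_component)
  then have "norm (v $ a) \<le> (\<Sum>b\<in>UNIV. norm (p $ a $ b - q $ a $ b) * norm (v $ b))"
   by (simp add: norm_mult[symmetric] norm_sum)
  also have "\<dots> < (\<Sum>b\<in>(UNIV::'N set). norm (v $ a) / CARD('N))"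
  proof (rule sum_strict_mono)
   fix b
   have "norm (p $ a $ b - q $ a $ b) * norm (v $ b) \<le> norm (p $ a $ b - q $ a $ b) * norm (v $ a)"
    by (intro mult_left_mono le) auto
   also have "\<dots> < norm (v $ a) / CARD('N)"
    using mult_strict_right_mono[OF d[of a b] \<open>norm (v $ a) > 0\<close>] by (simp add: field_simps)
   finally show "norm (p $ a $ b - q $ a $ b) * norm (v $ b) < norm (v $ a) / CARD('N)" .
  qed auto
  finally show False by simp
 qed
 have "vec.dim (range ((*v) p)) = vec.dim ((*v) q ` range ((*v) p))"
  by (rule dim_image_kernel[OF subspace_range zero, symmetric])
 also have "\<dots> \<le> vec.dim (range ((*v) q))" by (rule vec.dim_subset) auto
 finally show ?thesis .
qed

lemma entry_continuous: "continuous_on S (\<lambda>p :: 'N::finite cmatrix. p $ a $ b)"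
 by (intro continuous_intros)

text \<open>Entries of Hermitian projections are bounded, and the rank survives limits because
  nearby projections have the same rank.\<close>

lemma compact_projections:
 fixes Y :: "'N::finite cmatrix set"
 assumes Y: "closed Y"
 shows "compact {p. p ** p = p \<and> hermitian p \<and> vec.dim (range ((*v) p)) = c \<and> p \<in> Y}" (is "compact ?X")
 unfolding compact_eq_bounded_closed
proof
 have "norm p \<le> (\<Sum>a\<in>(UNIV::'N set). \<Sum>b\<in>(UNIV::'N set). 1)" if "p \<in> ?X" for p
 proof -
  have "norm p \<le> (\<Sum>a\<in>UNIV. norm (p $ a))" unfolding norm_vec_def[of p] by (rule L2_set_le_sum) simp
  also have "\<dots> \<le> (\<Sum>a\<in>UNIV. \<Sum>b\<in>UNIV. norm (p $ a $ b))"
   by (rule sum_mono, unfold norm_vec_def[of "p $ _"], rule L2_set_le_sum) simp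
  also have "\<dots> \<le> (\<Sum>a\<in>(UNIV::'N set). \<Sum>b\<in>(UNIV::'N set). 1)"
   by (intro sum_mono projection_entry_le) (use that in auto)
  finally show ?thesis .
 qed
 then show "bounded ?X" unfolding bounded_iff by blast
 have "closed {p :: 'N cmatrix. \<forall>a b. (p ** p) $ a $ b = p $ a $ b}"
  by (intro closed_Collect_all closed_Collect_eq entry_continuous) 
   (simp add: matrix_matrix_mult_def, intro continuous_intros)
 moreover have "closed {p :: 'N cmatrix. \<forall>i j. p $ i $ j = cnj (p $ j $ i)}"
  by (intro closed_Collect_all closed_Collect_eq continuous_intros)
 ultimately have cl: "closed ({p :: 'N cmatrix. \<forall>a b. (p ** p) $ a $ b = p $ a $ b} \<inter> {p. \<forall>i j. p $ i $ j = cnj (p $ j $ i)} \<inter> Y)"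
  by (intro closed_Int Y)
 have alt: "p \<in> ?X \<longleftrightarrow> p \<in> {p :: 'N cmatrix. \<forall>a b. (p ** p) $ a $ b = p $ a $ b} \<inter> {p. \<forall>i j. p $ i $ j = cnj (p $ j $ i)} \<inter> Y
   \<and> vec.dim (range ((*v) p)) = c" for p
  by (auto simp: vec_eq_iff hermitian_def)
 show "closed ?X"
  unfolding closed_sequential_limits
 proof (intro allI impI, elim conjE)
  fix f p assume f: "\<forall>n. f n \<in> ?X" and lim: "f \<longlonglongrightarrow> p"
  have p: "p \<in> {p :: 'N cmatrix. \<forall>a b. (p ** p) $ a $ b = p $ a $ b} \<inter> {p. \<forall>i j. p $ i $ j = cnj (p $ j $ i)} \<inter> Y"
   by (rule closed_sequentially[OF cl _ lim]) (use f alt in blast)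
  have "\<exists>n. norm (f n - p) < 1 / CARD('N)"
   using LIMSEQ_D[OF lim, of "1 / CARD('N)"] by auto
  then obtain n where n: "norm (f n - p) < 1 / CARD('N)" by blast
  have d: "norm (f n $ a $ b - p $ a $ b) * CARD('N) < 1" for a b
  proof -
   have "norm ((f n - p) $ a $ b) \<le> norm (f n - p)"
    by (rule order_trans[OF Finite_Cartesian_Product.norm_nth_le Finite_Cartesian_Product.norm_nth_le])
   then have "norm (f n $ a $ b - p $ a $ b) * CARD('N) \<le> norm (f n - p) * CARD('N)"
    by (intro mult_right_mono) simp_all
   also have "\<dots> < 1" using n by (simp add: field_simps)
   finally show ?thesis .
  qed
  have fn: "f n ** f n = f n" "vec.dim (range ((*v) (f n))) = c" using spec[OF f, of n] by (simp_all only: mem_Collect_eq)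
  have "vec.dim (range ((*v) (f n))) \<le> vec.dim (range ((*v) p))"
   by (rule dim_range_le[OF fn(1) d])
  moreover have "vec.dim (range ((*v) p)) \<le> vec.dim (range ((*v) (f n)))"
  proof (rule dim_range_le)
   show "p ** p = p" using IntD1[OF IntD1[OF p]] unfolding mem_Collect_eq vec_eq_iff .
   show "norm (p $ a $ b - f n $ a $ b) * CARD('N) < 1" for a b
    using d[of a b] by (subst norm_minus_commute)
  qed
  ultimately have dp: "vec.dim (range ((*v) p)) = c" using fn(2) by linarith
  show "p \<in> ?X" by (rule alt[THEN iffD2, OF conjI[OF p dp]])
 qed
qed

subsection \<open>Atlases of Grassmannians\<close>

definition coords :: "('n \<Rightarrow> 'n \<Rightarrow> real) \<Rightarrow> ('n \<Rightarrow> 'n \<Rightarrow> 'd) \<Rightarrow> complex ^ 'd \<Rightarrow> complex ^ 'n ^ 'n" where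
 "coords \<epsilon> \<iota> z = (\<chi> i j. of_real (\<epsilon> i j) * z $ \<iota> i j)"

text \<open>Both Grassmannians are treated together. The slope matrix has the entry \<epsilon> i j
  times the coordinate of z numbered \<iota> i j. For ordinary subspaces \<iota> is the ordered
  pair; for Lagrangian ones it is the unordered pair, which encodes the symmetry of the slope matrix
  up to signs. The assumption \<open>distinct\<close> says that the centres are different coordinate
  subspaces.\<close>

locale grass_atlas =
 fixes X Y :: "'N::finite cmatrix set" and m :: nat and \<tau> :: "nat \<Rightarrow> 'N \<Rightarrow> 'n::finite + 'n"
  and \<epsilon> :: "nat \<Rightarrow> 'n \<Rightarrow> 'n \<Rightarrow> real" and \<iota> :: "'n \<Rightarrow> 'n \<Rightarrow> 'd::finite"
  and w :: "'N \<Rightarrow> real" and lam :: "nat \<Rightarrow> 'd \<Rightarrow> real"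
 assumes X: "X = {p. p ** p = p \<and> hermitian p \<and> vec.dim (range ((*v) p)) = CARD('n) \<and> p \<in> Y}"
  and closed_Y: "closed Y"
  and bij: "k < m \<Longrightarrow> bij (\<tau> k)"
  and eps: "\<epsilon> k i j * \<epsilon> k i j = 1"
  and surj: "\<exists>i j. \<iota> i j = d"
  and in_Y: "k < m \<Longrightarrow> graph (\<tau> k) (coords (\<epsilon> k) \<iota> z) \<in> Y"
  and compat: "k < m \<Longrightarrow> p \<in> X \<Longrightarrow> p ** frame (\<tau> k) M = frame (\<tau> k) M \<Longrightarrow> \<exists>z. M = coords (\<epsilon> k) \<iota> z"
  and cover': "p \<in> X \<Longrightarrow> \<exists>k<m. det (corner (\<tau> k) p) \<noteq> 0"
  and distinct: "k < m \<Longrightarrow> l < m \<Longrightarrow> k \<noteq> l \<Longrightarrow> \<exists>i j. \<tau> k (inv (\<tau> l) (Inl i)) = Inr j"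
  and lamw: "k < m \<Longrightarrow> w (inv (\<tau> k) (Inr i)) - w (inv (\<tau> k) (Inl j)) = lam k (\<iota> i j)"
  and lam_nz: "k < m \<Longrightarrow> lam k d \<noteq> 0"
begin

definition chart :: "nat \<Rightarrow> complex ^ 'd \<Rightarrow> 'N cmatrix" where
 "chart k z = graph (\<tau> k) (coords (\<epsilon> k) \<iota> z)"

definition pick :: "'d \<Rightarrow> 'n \<times> 'n" where
 "pick d = (SOME x. \<iota> (fst x) (snd x) = d)"

definition cochart :: "nat \<Rightarrow> 'N cmatrix \<Rightarrow> complex ^ 'd" where
 "cochart k p = (\<chi> d. of_real (\<epsilon> k (fst (pick d)) (snd (pick d))) * slope (\<tau> k) p $ fst (pick d) $ snd (pick d))"

text \<open>On \<open>X\<close> it is positive exactly where the subspace is a graph over the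
  selected coordinates; the square makes it differentiable on all matrices.\<close>

definition weightfn :: "nat \<Rightarrow> 'N cmatrix \<Rightarrow> real" where
 "weightfn k p = (norm (det (corner (\<tau> k) p)))\<^sup>2"

lemma pick: "\<iota> (fst (pick d)) (snd (pick d)) = d"
proof -
 obtain i j where "\<iota> i j = d" using surj by blast
 then show ?thesis unfolding pick_def by (intro someI[of "\<lambda>x. \<iota> (fst x) (snd x) = d" "(i, j)"]) simp
qed

lemma coords_linear: "linear (coords (\<epsilon> k) \<iota>)"
 by (rule linearI) (simp_all add: coords_def vec_eq_iff algebra_simps scaleR_conv_of_real[where 'a = complex])

lemma eps': "complex_of_real (\<epsilon> k i j) * (of_real (\<epsilon> k i j) * x) = x"
 by (simp add: mult.assoc[symmetric] eps flip: of_real_mult)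

lemma coords_inj: "inj (coords (\<epsilon> k) \<iota>)"
proof (rule injI)
 fix z z' :: "complex ^ 'd" assume eq: "coords (\<epsilon> k) \<iota> z = coords (\<epsilon> k) \<iota> z'"
 have "z $ d = of_real (\<epsilon> k (fst (pick d)) (snd (pick d))) * coords (\<epsilon> k) \<iota> z $ fst (pick d) $ snd (pick d)" for z d
  by (simp add: coords_def eps' pick)
 then show "z = z'" using eq by (simp add: vec_eq_iff)
qed

lemma cochart_chart: "k < m \<Longrightarrow> cochart k (chart k z) = z"
 by (simp add: cochart_def chart_def slope_graph[OF bij] coords_def eps' pick vec_eq_iff)

lemma chart_cochart:
 assumes k: "k < m" and p: "p \<in> X" and c: "det (corner (\<tau> k) p) \<noteq> 0"
 shows "chart k (cochart k p) = p"
proof -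
 have pS: "p ** frame (\<tau> k) (slope (\<tau> k) p) = frame (\<tau> k) (slope (\<tau> k) p)"
  by (rule frame_slope[OF bij[OF k] _ c]) (use p X in auto)
 then obtain z where z: "slope (\<tau> k) p = coords (\<epsilon> k) \<iota> z" using compat[OF k p] by blast
 have "cochart k p = z"
  by (simp add: cochart_def z coords_def eps' pick vec_eq_iff)
 moreover have "p = graph (\<tau> k) (slope (\<tau> k) p)"
  by (rule projection_eq_graph[OF bij[OF k] _ _ _ pS]) (use p X in auto)
 ultimately show ?thesis by (simp add: chart_def flip: z)
qed

lemma chart_in_X: "k < m \<Longrightarrow> chart k z \<in> X"
 unfolding X chart_def
 by (simp add: graph_idem[OF bij] hermitian_adj adj_graph[OF bij] dim_graph[OF bij] in_Y)

lemma algf_det_corner: "algf (\<lambda>p. det (corner (\<tau> k) p))"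
 by (rule algf_det) (simp add: corner_def algf_nth_compose[OF linear_ident'])

lemma c1_weightfn: "c1 (weightfn k)"
proof -
 have c: "c1 (\<lambda>p. f (det (corner (\<tau> k) p)))" if "bounded_linear f" for f :: "complex \<Rightarrow> real"
 proof (rule c1I)
  show "((\<lambda>p. f (det (corner (\<tau> k) p))) has_derivative (\<lambda>v. f (fder (\<lambda>p. det (corner (\<tau> k) p)) x v))) (at x)" for x
   by (rule bounded_linear.has_derivative[OF that c1_has[OF c1_algf[OF algf_det_corner]]])
  show "continuous_on UNIV (\<lambda>x. f (fder (\<lambda>p. det (corner (\<tau> k) p)) x v))" for v
   by (rule bounded_linear.continuous_on[OF that c1_cont[OF c1_algf[OF algf_det_corner]]])
 qed
 have "weightfn k = (\<lambda>p. Re (det (corner (\<tau> k) p)) * Re (det (corner (\<tau> k) p)) + Im (det (corner (\<tau> k) p)) * Im (det (corner (\<tau> k) p)))"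
  unfolding power2_eq_square[symmetric] cmod_power2[symmetric] weightfn_def[abs_def] ..
 then show ?thesis
  by (simp only:) (intro c1_add c1_mult c bounded_linear_Re bounded_linear_Im)
qed

lemma cochart_differentiable:
 assumes "k < m" "weightfn k p > 0" shows "cochart k differentiable (at p)"
proof -
 have nz: "det (corner (\<tau> k) p) \<noteq> 0" using assms by (auto simp: weightfn_def)
 have diff: "(\<lambda>p. cochart k p $ d) differentiable (at p)" for d
 proof -
  let ?i = "fst (pick d)" and ?j = "snd (pick d)"
  define N where "N l p = det (\<chi> a b. if b = l then axis ?j 1 $ a else corner (\<tau> k) p $ a $ b)" for l p
  have aN: "algf (N l)" for l
   unfolding N_def
  proof (rule algf_det)
   show "algf (\<lambda>p. (\<chi> a b. if b = l then axis ?j 1 $ a else corner (\<tau> k) p $ a $ b) $ a $ b)" for a b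
    by (cases "b = l") (simp_all add: algf_const corner_def algf_nth_compose[OF linear_ident'])
  qed
  define f where "f p = of_real (\<epsilon> k ?i ?j) * (\<Sum>l\<in>UNIV. p $ inv (\<tau> k) (Inr ?i) $ inv (\<tau> k) (Inl l) * N l p)" for p
  have "algf f"
   unfolding f_def[abs_def] by (intro algf_mult algf_const algf_sum algf_nth_compose[OF linear_ident'] aN)
  then have "f differentiable (at p)" by (rule algf_differentiable)
  from has_derivative_divide'[OF has_frechet[OF this] has_frechet[OF algf_differentiable[OF algf_det_corner]] nz]
  have "(\<lambda>p. f p / det (corner (\<tau> k) p)) differentiable (at p)"
   unfolding differentiable_def by blast
  moreover have "(\<lambda>p. cochart k p $ d) = (\<lambda>p. f p / det (corner (\<tau> k) p))"
   by (simp add: cochart_def slope_def f_def cramer_inv_def matrix_matrix_mult_def N_def fun_eq_iff flip: sum_divide_distrib)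
  ultimately show ?thesis by simp
 qed
 have "(cochart k has_derivative (\<lambda>h. \<chi> d. fder (\<lambda>p. cochart k p $ d) p h)) (at p)"
  by (rule has_derivative_vec) (simp add: has_frechet[OF diff])
 then show ?thesis unfolding differentiable_def by blast
qed

lemma chart_D:
 assumes k: "k < m"
 shows "smooth_on UNIV (chart k)" "inj (fder (chart k) z)"
  "fder (chart k) z (\<i> *s h) = cstruct (chart k z) (fder (chart k) z h)"
  "rot w (chart k z) = fder (chart k) z (\<chi> j. \<i> * of_real (lam k j) * z $ j)"
  "fder (chart k) 0 h $ a $ b = (case (\<tau> k a, \<tau> k b) of
   (Inr i, Inl j) \<Rightarrow> of_real (\<epsilon> k i j) * h $ \<iota> i j | (Inl i, Inr j) \<Rightarrow> of_real (\<epsilon> k j i) * cnj (h $ \<iota> j i) | _ \<Rightarrow> 0)"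
proof -
 have Li: "coords (\<epsilon> k) \<iota> (\<i> *s h) = msc \<i> (coords (\<epsilon> k) \<iota> h)" for h
  by (simp add: coords_def vec_eq_iff)
 have W: "coords (\<epsilon> k) \<iota> (\<chi> j. \<i> * of_real (lam k j) * z $ j) $ i $ j =
   \<i> * of_real (w (inv (\<tau> k) (Inr i)) - w (inv (\<tau> k) (Inl j))) * coords (\<epsilon> k) \<iota> z $ i $ j" for i j z
  unfolding lamw[OF k] by (simp add: coords_def)
 note g = bij[OF k] coords_linear
 show "smooth_on UNIV (chart k)" "inj (fder (chart k) z)"
  "fder (chart k) z (\<i> *s h) = cstruct (chart k z) (fder (chart k) z h)"
  unfolding chart_def[abs_def]
  by (rule smooth_graph[OF g] inj_D_graph[OF g coords_inj] D_graph_cstruct[OF g Li])+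
 show "rot w (chart k z) = fder (chart k) z (\<chi> j. \<i> * of_real (lam k j) * z $ j)"
  unfolding chart_def[abs_def] by (rule rot_graph[OF g W])
 show "fder (chart k) 0 h $ a $ b = (case (\<tau> k a, \<tau> k b) of
   (Inr i, Inl j) \<Rightarrow> of_real (\<epsilon> k i j) * h $ \<iota> i j | (Inl i, Inr j) \<Rightarrow> of_real (\<epsilon> k j i) * cnj (h $ \<iota> j i) | _ \<Rightarrow> 0)"
  unfolding chart_def[abs_def] D_graph_center[OF g] by (simp add: coords_def split: sum.splits)
qed

text \<open>Some coordinate selected by chart \<open>l\<close> vanishes on the coordinate subspace
  of chart \<open>k\<close>, which produces a zero row.\<close>

lemma corner_chart_center:
 assumes "k < m" "l < m" "k \<noteq> l" shows "det (corner (\<tau> l) (chart k 0)) = 0"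
proof -
 obtain i j where ij: "\<tau> k (inv (\<tau> l) (Inl i)) = Inr j" using distinct[OF assms] by blast
 have "chart k 0 $ inv (\<tau> l) (Inl i) $ b = 0" for b
 proof -
  have "frame (\<tau> k) (coords (\<epsilon> k) \<iota> 0) $ inv (\<tau> l) (Inl i) $ c = 0" for c
   by (simp add: frame_def blocks_def ij coords_def)
  then show ?thesis by (simp add: chart_def graph_def matrix_matrix_mult_def)
 qed
 then have "row i (corner (\<tau> l) (chart k 0)) = 0" by (simp add: row_def corner_def vec_eq_iff)
 then show ?thesis by (rule det_zero_row(1))
qed

text \<open>Every slope entry occurs in the Hermitian matrix once as itself and once conjugated,
  which gives the factor 2. A coordinate is shared by as many entries as it has preimages under
  \<iota>.\<close>

lemma chart_metric:
 assumes k: "k < m"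
 shows "fder (chart k) 0 h \<bullet> fder (chart k) 0 h' =
  (\<Sum>d\<in>UNIV. 2 * real (card {x. \<iota> (fst x) (snd x) = d}) * Re (cnj (h $ d) * h' $ d))"
proof -
 let ?r = "\<lambda>d. Re (cnj (h $ d) * h' $ d)"
 have ee: "\<epsilon> k i j * (\<epsilon> k i j * x) = x" for i j x
  using eps[of k i j] by (simp add: mult.assoc[symmetric])
 have S: "(\<Sum>a\<in>UNIV. f a) = (\<Sum>i\<in>UNIV. f (inv (\<tau> k) (Inl i))) + (\<Sum>i\<in>UNIV. f (inv (\<tau> k) (Inr i)))" for f :: "'N \<Rightarrow> real"
  using sum_bij_Plus[OF bij[OF k], of "\<lambda>b. f (inv (\<tau> k) b)"] by (simp add: inv_eq[OF bij[OF k]])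
 have "fder (chart k) 0 h \<bullet> fder (chart k) 0 h' =
   (\<Sum>i\<in>UNIV. \<Sum>j\<in>UNIV. ?r (\<iota> j i)) + (\<Sum>i\<in>UNIV. \<Sum>j\<in>UNIV. ?r (\<iota> i j))"
  unfolding inner_vec_def S
  by (simp add: chart_D(5)[OF k] inv_eq[OF bij[OF k]] inner_complex_def ee algebra_simps)
 also have "\<dots> = 2 * (\<Sum>i\<in>UNIV. \<Sum>j\<in>UNIV. ?r (\<iota> i j))"
  by (subst sum.swap) simp
 also have "(\<Sum>i\<in>UNIV. \<Sum>j\<in>UNIV. ?r (\<iota> i j)) = (\<Sum>x\<in>UNIV. ?r (\<iota> (fst x) (snd x)))"
  by (simp add: sum.cartesian_product case_prod_unfold)
 also have "\<dots> = (\<Sum>d\<in>UNIV. \<Sum>x\<in>{x \<in> UNIV. \<iota> (fst x) (snd x) = d}. ?r (\<iota> (fst x) (snd x)))"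
  by (rule sum.group[symmetric]) auto
 also have "\<dots> = (\<Sum>d\<in>UNIV. real (card {x. \<iota> (fst x) (snd x) = d}) * ?r d)"
  by (rule sum.cong) simp_all
 finally show ?thesis by (simp add: sum_distrib_left mult.assoc)
qed

sublocale torus_atlas X m chart cochart weightfn w lam "\<lambda>d. 2 * real (card {x. \<iota> (fst x) (snd x) = d})"
proof
 fix k :: nat and z h h' :: "complex ^ 'd" and p :: "'N cmatrix"
 show "compact X" unfolding X by (rule compact_projections[OF closed_Y])
 show "\<exists>k<m. weightfn k p > 0" if "p \<in> X" using cover'[OF that] by (auto simp: weightfn_def)
 show "c1 (weightfn k)" by (rule c1_weightfn)
 show "p ** p = p" if "p \<in> X" using that X by simp
 show "2 * real (card {x. \<iota> (fst x) (snd x) = d}) > 0" for d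
 proof -
  have "{x. \<iota> (fst x) (snd x) = d} \<noteq> {}" using pick[of d] by blast
  then show ?thesis by (simp add: card_gt_0_iff)
 qed
 assume k: "k < m"
 show "holomorphic_parametrization X UNIV (chart k)"
  unfolding holomorphic_parametrization_def
  using chart_D(1-3)[OF k] chart_in_X[OF k] by (auto intro!: inj_onI) (metis cochart_chart[OF k])
 show "cochart k (chart k z) = z" by (rule cochart_chart[OF k])
 show "chart k (cochart k p) = p" if "p \<in> X" "weightfn k p > 0"
  by (rule chart_cochart[OF k that(1)]) (use that in \<open>auto simp: weightfn_def\<close>)
 show "weightfn k (chart k z) > 0"
  using det_corner_graph[OF bij[OF k]] by (simp add: weightfn_def chart_def)
 show "cochart k differentiable (at p)" if "weightfn k p > 0" by (rule cochart_differentiable[OF k that])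
 show "lam k d \<noteq> 0" for d by (rule lam_nz[OF k])
 show "rot w (chart k z) = fder (chart k) z (\<chi> j. \<i> * of_real (lam k j) * z $ j)"
  by (rule chart_D(4)[OF k])
 show "fder (chart k) 0 h \<bullet> fder (chart k) 0 h' =
  (\<Sum>d\<in>UNIV. 2 * real (card {x. \<iota> (fst x) (snd x) = d}) * Re (cnj (h $ d) * h' $ d))"
  by (rule chart_metric[OF k])
 show "weightfn l (chart k 0) \<le> 0" if "l < m" "k \<noteq> l" for l
  using corner_chart_center[OF k that] by (simp add: weightfn_def)
 show "rot w (fder (chart k) 0 h) =
   fder (chart k) 0 (\<chi> j. \<i> * of_real (lam k j) * h $ j)"
 proof -
  have "w a - w b = lam k (\<iota> i j)" if "\<tau> k a = Inr i" "\<tau> k b = Inl j" for a b i j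
   using lamw[OF k, of i j] that inv_eq(2)[OF bij[OF k]] by metis
  then have "complex_of_real (w a) - of_real (w b) = of_real (lam k (\<iota> i j))" if "\<tau> k a = Inr i" "\<tau> k b = Inl j" for a b i j
   using that by (metis of_real_diff)
  note wl = this
  have wl': "complex_of_real (w a) - of_real (w b) = - of_real (lam k (\<iota> i j))" if "\<tau> k b = Inr i" "\<tau> k a = Inl j" for a b i j
   using wl[OF that] by (simp add: algebra_simps)
  show ?thesis
   by (simp add: vec_eq_iff rot_nth chart_D(5)[OF k] split: sum.splits) (simp add: wl wl')
 qed
qed

end

subsection \<open>Coordinate subspaces\<close>

text \<open>\<open>J\<close> is a largest set of coordinates whose span meets \<open>U\<close> only
  in zero. Enlarging it by \<open>k\<close> creates a vector of \<open>U\<close> whose only nonzero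
  entry outside \<open>J\<close> is at \<open>k\<close>, and this vector is rescaled.\<close>

lemma coordinate_complement:
 fixes U :: "(complex ^ 'N::finite) set"
 assumes U: "vec.subspace U"
 obtains J where "\<And>x. x \<in> U \<Longrightarrow> (\<And>a. a \<notin> J \<Longrightarrow> x $ a = 0) \<Longrightarrow> x = 0"
  "\<And>k. \<exists>u\<in>U. \<forall>a. a \<notin> J \<longrightarrow> u $ a = axis k 1 $ a"
proof -
 define P where "P J \<longleftrightarrow> (\<forall>x\<in>U. (\<forall>a. a \<notin> J \<longrightarrow> x $ a = 0) \<longrightarrow> x = 0)" for J
 have "P {}" by (auto simp: P_def vec_eq_iff)
 moreover have "card J < Suc CARD('N)" for J :: "'N set" by (intro le_imp_less_Suc card_mono) auto
 ultimately have "\<exists>J. P J \<and> (\<forall>J'. P J' \<longrightarrow> card J' \<le> card J)"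
  by (intro ex_has_greatest_nat) auto
 then obtain J where J: "P J" "\<And>J'. P J' \<Longrightarrow> card J' \<le> card J" by blast
 have "\<exists>u\<in>U. \<forall>a. a \<notin> J \<longrightarrow> u $ a = axis k 1 $ a" for k
 proof (cases "k \<in> J")
  case True
  then show ?thesis using vec.subspace_0[OF U] by (intro bexI[of _ 0]) (auto simp: axis_def)
 next
  case False
  then have "card (insert k J) > card J" by simp
  then have "\<not> P (insert k J)" using J(2) by (meson not_le)
  then obtain x where x: "x \<in> U" "\<And>a. a \<notin> insert k J \<Longrightarrow> x $ a = 0" "x \<noteq> 0" unfolding P_def by blast
  have "x $ k \<noteq> 0" using J(1) x unfolding P_def by (metis insertE)
  then show ?thesis
   using x by (intro bexI[of _ "inverse (x $ k) *s x"] vec.subspace_scale[OF U]) (auto simp: axis_def)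
 qed
 then show thesis using that[of J] J(1) unfolding P_def by blast
qed

text \<open>The complement of \<open>J\<close> serves as \<open>I\<close>: dropping the coordinates
  in \<open>J\<close> maps the subspace isomorphically onto the span of the others, which fixes the
  cardinality.\<close>

lemma coordinate_transversal:
 fixes p :: "'N::finite cmatrix"
 obtains I where "card I = vec.dim (range ((*v) p))" "\<And>v. v \<in> range ((*v) p) \<Longrightarrow> (\<And>a. a \<in> I \<Longrightarrow> v $ a = 0) \<Longrightarrow> v = 0"
proof -
 let ?W = "range ((*v) p)"
 obtain J where J: "\<And>x. x \<in> ?W \<Longrightarrow> (\<And>a. a \<notin> J \<Longrightarrow> x $ a = 0) \<Longrightarrow> x = 0"
  "\<And>k. \<exists>u\<in>?W. \<forall>a. a \<notin> J \<longrightarrow> u $ a = axis k 1 $ a"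
  using coordinate_complement[OF subspace_range] by metis
 let ?C = "{x :: complex ^ 'N. \<forall>i. i \<notin> - J \<longrightarrow> x $ i = 0}"
 have "vec.dim ((*v) (coordp (- J)) ` ?W) = vec.dim ?W"
 proof (rule dim_image_kernel[OF subspace_range J(1)])
  fix v a assume "coordp (- J) *v v = 0" "a \<notin> J"
  from arg_cong[OF this(1), of "\<lambda>x. x $ a"] this(2) show "v $ a = 0" by (simp add: coordp_mult)
 qed
 also have "(*v) (coordp (- J)) ` ?W = ?C"
 proof
  show "(*v) (coordp (- J)) ` ?W \<subseteq> ?C" by (auto simp: coordp_mult)
  have s: "vec.subspace ((*v) (coordp (- J)) ` ?W)" by (rule vec.subspace_image[OF subspace_range])
  have ax: "axis k 1 \<in> (*v) (coordp (- J)) ` ?W" if k: "k \<notin> J" for k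
  proof -
   obtain u where u: "u \<in> ?W" "\<forall>a. a \<notin> J \<longrightarrow> u $ a = axis k 1 $ a" using J(2) by blast
   have "axis k 1 = coordp (- J) *v u" using u(2) k by (auto simp: vec_eq_iff coordp_mult axis_def)
   then show ?thesis using u(1) by blast
  qed
  show "?C \<subseteq> (*v) (coordp (- J)) ` ?W"
  proof
   fix x assume x: "x \<in> ?C"
   have "x = (\<Sum>k\<in>- J. x $ k *s axis k 1)"
   proof -
    have "(\<Sum>k\<in>- J. x $ k *s axis k 1) $ a = (\<Sum>k\<in>- J. if k = a then x $ k else 0)" for a
     unfolding sum_component by (rule sum.cong) (auto simp: axis_def)
    then show ?thesis using x by (auto simp: vec_eq_iff)
   qed
   also have "\<dots> \<in> (*v) (coordp (- J)) ` ?W"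
    by (intro vec.subspace_sum[OF s] vec.subspace_scale[OF s] ax) simp
   finally show "x \<in> (*v) (coordp (- J)) ` ?W" .
  qed
 qed
 finally have "card (- J) = vec.dim ?W" by (simp only: dim_substandard_cart)
 then show thesis by (rule that) (rule J(1); blast)
qed

subsection \<open>Weights\<close>

text \<open>Being distinct and positive, the frequencies make all differences of torus weights
  nonzero, and in the Lagrangian case all signed sums that occur, including the case i = j.\<close>

definition freq :: "'n::finite \<Rightarrow> real" where
 "freq = (SOME \<omega>. inj \<omega> \<and> (\<forall>i. 0 < \<omega> i))"

lemma freq: "inj (freq :: 'n::finite \<Rightarrow> real)" "0 < freq (i :: 'n)"
proof -
 obtain f :: "'n \<Rightarrow> nat" where "inj f"
  using finite_imp_inj_to_nat_seg[OF finite_class.finite_UNIV] by auto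
 then have "inj (\<lambda>i. real (Suc (f i))) \<and> (\<forall>i. 0 < real (Suc (f i)))" by (auto simp: inj_def)
 then have "inj (freq :: 'n \<Rightarrow> real) \<and> (\<forall>i. 0 < freq (i :: 'n))"
  unfolding freq_def by (rule someI[of "\<lambda>\<omega>. inj \<omega> \<and> (\<forall>i. 0 < \<omega> i)"])
 then show "inj (freq :: 'n \<Rightarrow> real)" "0 < freq i" by auto
qed

definition wt :: "'n::finite + 'n \<Rightarrow> real" where
 "wt a = (case a of Inl i \<Rightarrow> freq i | Inr i \<Rightarrow> - freq i)"

lemma wt_eq: "wt a = wt b \<longleftrightarrow> a = b"
proof -
 have "freq i \<noteq> - freq j" "- freq i \<noteq> freq j" for i j :: 'a
  using freq(2)[of i] freq(2)[of j] by linarith+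
 then show ?thesis
  by (cases a; cases b) (simp_all add: wt_def inj_eq[OF freq(1)])
qed

subsection \<open>The ordinary Grassmannian\<close>

lemma grassmannian_alt:
 "grassmannian = {p :: ('n::finite + 'n) cmatrix. p ** p = p \<and> hermitian p \<and> vec.dim (range ((*v) p)) = CARD('n) \<and> p \<in> UNIV}"
 by (auto simp: grassmannian_def projections_onto_def n_subspaces_def intro!: vec.subspace_image vec.subspace_UNIV)

definition nsets :: "('n::finite + 'n) set set" where
 "nsets = {I. card I = CARD('n)}"

definition gtau :: "('n::finite + 'n) set \<Rightarrow> 'n + 'n \<Rightarrow> 'n + 'n" where
 "gtau I = (SOME \<tau>. bij \<tau> \<and> {a. \<exists>i. \<tau> a = Inl i} = I)"

definition genum :: "nat \<Rightarrow> ('n::finite + 'n) set" where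
 "genum = (SOME e. bij_betw e {..<card (nsets :: ('n + 'n) set set)} nsets)"

lemma genum: "bij_betw genum {..<card (nsets :: ('n + 'n) set set)} (nsets :: ('n::finite + 'n) set set)"
proof -
 have "\<exists>e. bij_betw e {..<card (nsets :: ('n + 'n) set set)} (nsets :: ('n + 'n) set set)"
  using ex_bij_betw_nat_finite[of "nsets :: ('n + 'n) set set"] by (simp add: atLeast0LessThan)
 then show ?thesis unfolding genum_def by (rule someI_ex)
qed

lemma gtau:
 assumes "I \<in> nsets" shows "bij (gtau I)" "{a. \<exists>i. gtau I a = Inl i} = I"
proof -
 have c: "card I = card (range Inl :: ('a + 'a) set)" "card (- I) = card (range Inr :: ('a + 'a) set)"
 proof -
  have "card (UNIV :: ('a + 'a) set) = CARD('a) + CARD('a)" by (metis UNIV_Plus_UNIV card_Plus finite)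
  then show "card I = card (range Inl :: ('a + 'a) set)" "card (- I) = card (range Inr :: ('a + 'a) set)"
   using assms by (simp_all add: nsets_def card_image Compl_eq_Diff_UNIV card_Diff_subset)
 qed
 then obtain f g where f: "bij_betw f I (range (Inl :: 'a \<Rightarrow> 'a + 'a))" and g: "bij_betw g (- I) (range (Inr :: 'a \<Rightarrow> 'a + 'a))"
  by (meson finite_same_card_bij finite)
 let ?t = "\<lambda>a. if a \<in> I then f a else g a"
 have "bij_betw ?t (I \<union> - I) (range Inl \<union> range Inr)"
  by (rule bij_betw_disjoint_Un[OF f g]) auto
 moreover have "range Inl \<union> range Inr = (UNIV :: ('a + 'a) set)" by (rule UNIV_sum[symmetric])
 ultimately have "bij ?t" by simp
 moreover have "(\<exists>i. ?t a = Inl i) \<longleftrightarrow> a \<in> I" for a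
 proof (cases "a \<in> I")
  case True
  have "f a \<in> range Inl" by (rule bspec[OF bij_betwE[OF f] True])
  then show ?thesis using True by auto
 next
  case False
  have "g a \<in> range Inr" by (rule bspec[OF bij_betwE[OF g]]) (use False in simp)
  then show ?thesis using False by auto
 qed
 ultimately have "bij ?t \<and> {a. \<exists>i. ?t a = Inl i} = I" by auto
 then have "bij (gtau I) \<and> {a. \<exists>i. gtau I a = Inl i} = I" unfolding gtau_def by (rule someI[of "\<lambda>\<tau>. bij \<tau> \<and> {a. \<exists>i. \<tau> a = Inl i} = I"])
 then show "bij (gtau I)" "{a. \<exists>i. gtau I a = Inl i} = I" by auto
qed

text \<open>The torus weights on the tangent space Hom(W, W') at a coordinate subspace W with
  coordinate complement W'.\<close>

definition glam :: "('n::finite + 'n) set \<Rightarrow> 'n \<times> 'n \<Rightarrow> real" where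
 "glam I x = wt (inv (gtau I) (Inr (fst x))) - wt (inv (gtau I) (Inl (snd x)))"

lemma genum_nsets: "k < card (nsets :: ('n + 'n) set set) \<Longrightarrow> (genum k :: ('n::finite + 'n) set) \<in> nsets"
 using bij_betwE[OF genum[where 'n = 'n]] by simp

interpretation gr: grass_atlas "grassmannian :: ('n::finite + 'n) cmatrix set" UNIV "card (nsets :: ('n + 'n) set set)"
 "\<lambda>k. gtau (genum k)" "\<lambda>_ _ _. 1" Pair wt "\<lambda>k. glam (genum k)"
proof (unfold_locales)
 fix k l :: nat and p :: "('n + 'n) cmatrix" and M :: "complex ^ 'n ^ 'n" and d :: "'n \<times> 'n" and i j :: 'n
 show "grassmannian = {p :: ('n + 'n) cmatrix. p ** p = p \<and> hermitian p \<and> vec.dim (range ((*v) p)) = CARD('n) \<and> p \<in> UNIV}"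
  by (rule grassmannian_alt)
 show "\<exists>i j. (i, j) = d" by (metis surj_pair)
 show "\<exists>k<card (nsets :: ('n + 'n) set set). det (corner (gtau (genum k)) p) \<noteq> 0" if p: "p \<in> grassmannian"
 proof -
  obtain I where I: "card I = vec.dim (range ((*v) p))"
   "\<And>v. v \<in> range ((*v) p) \<Longrightarrow> (\<And>a. a \<in> I \<Longrightarrow> v $ a = 0) \<Longrightarrow> v = 0"
   using coordinate_transversal by metis
  have p': "hermitian p" "p ** p = p" "vec.dim (range ((*v) p)) = CARD('n)" using p unfolding grassmannian_alt by simp_all
  have In: "I \<in> nsets" using I(1) p'(3) by (simp add: nsets_def)
  then obtain k where k: "k < card (nsets :: ('n + 'n) set set)" "I = genum k"
   using bij_betw_imp_surj_on[OF genum[where 'n = 'n]] by (metis imageE lessThan_iff)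
  have "det (corner (gtau I) p) \<noteq> 0"
  proof (rule det_corner_nonzero[OF gtau(1)[OF In] p'])
   fix v assume v: "v \<in> range ((*v) p)" and z: "\<And>i. v $ inv (gtau I) (Inl i) = 0"
   have "v $ a = 0" if "a \<in> I" for a
   proof -
    have "a \<in> {a. \<exists>i. gtau I a = Inl i}" using that gtau(2)[OF In] by simp
    then obtain i where "gtau I a = Inl i" by blast
    then have "a = inv (gtau I) (Inl i)" using inv_eq(2)[OF gtau(1)[OF In]] by metis
    then show ?thesis using z by simp
   qed
   then show "v = 0" by (rule I(2)[OF v])
  qed
  then show ?thesis using k by auto
 qed
 assume k: "k < card (nsets :: ('n + 'n) set set)"
 note In = genum_nsets[OF k]
 show "bij (gtau (genum k :: ('n + 'n) set))" by (rule gtau(1)[OF In])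
 show "\<exists>z. M = coords (\<lambda>_ _. 1) Pair z"
  by (rule exI[of _ "\<chi> d. M $ fst d $ snd d"]) (simp add: coords_def vec_eq_iff)
 show "wt (inv (gtau (genum k)) (Inr i)) - wt (inv (gtau (genum k)) (Inl j)) = glam (genum k) (i, j)"
  by (simp add: glam_def)
 show "glam (genum k) d \<noteq> 0"
  using inv_eq(1)[OF gtau(1)[OF In]] by (simp add: glam_def wt_eq) (metis sum.distinct(1))
 show "\<exists>i j. gtau (genum k) (inv (gtau (genum l)) (Inl i)) = Inr (j :: 'n)"
  if l: "l < card (nsets :: ('n + 'n) set set)" "k \<noteq> l"
 proof -
  note Il = genum_nsets[OF l(1)]
  have "genum k \<noteq> (genum l :: ('n + 'n) set)"
   using inj_onD[OF bij_betw_imp_inj_on[OF genum[where 'n = 'n]], of k l] k l by auto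
  then have "\<not> (genum l :: ('n + 'n) set) \<subseteq> genum k"
   using card_subset_eq[of "genum k" "genum l :: ('n + 'n) set"] In Il by (auto simp: nsets_def)
  then obtain a :: "'n + 'n" where a: "a \<in> genum l" "a \<notin> genum k" by blast
  have "a \<in> {a. \<exists>i. gtau (genum l) a = Inl i}" "a \<notin> {a. \<exists>i. gtau (genum k) a = Inl i}"
   using a gtau(2)[OF Il] gtau(2)[OF In] by simp_all
  then obtain i where i: "gtau (genum l) a = Inl i" "\<nexists>i. gtau (genum k) a = Inl i" by blast
  then obtain j where "gtau (genum k) a = Inr j" by (metis sum.exhaust)
  moreover have "inv (gtau (genum l)) (Inl i) = a" using i inv_eq(2)[OF gtau(1)[OF Il], of a] by simp
  ultimately show ?thesis by metis
 qed
qed auto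

lemma gr_localisation:
 assumes F: "eqclosed wt (of_real \<tau>) F" and \<tau>: "0 < \<tau>"
 shows "gr.intg (\<lambda>p. cev (F p)) = (\<Sum>I\<in>(nsets :: ('n::finite + 'n) set set).
  cev (F (coordp I)) [] * (\<Prod>a\<in>- I. \<Prod>b\<in>I. of_real (2 * pi / (\<tau> * (wt a - wt b)))))"
proof -
 have "gr.intg (\<lambda>p. cev (F p)) = (\<Sum>k<card (nsets :: ('n + 'n) set set).
   cev (F (gr.chart k 0)) [] * (\<Prod>j\<in>(UNIV :: ('n \<times> 'n) set). of_real (2 * pi / (\<tau> * glam (genum k) j))))"
  by (rule gr.localisation[OF F \<tau>])
 also have "\<dots> = (\<Sum>k<card (nsets :: ('n + 'n) set set).
  cev (F (coordp (genum k))) [] * (\<Prod>a\<in>- (genum k :: ('n + 'n) set). \<Prod>b\<in>(genum k :: ('n + 'n) set). of_real (2 * pi / (\<tau> * (wt a - wt b)))))"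
 proof (rule sum.cong[OF refl])
  fix k assume "k \<in> {..<card (nsets :: ('n + 'n) set set)}"
  then have In: "(genum k :: ('n + 'n) set) \<in> nsets" by (intro genum_nsets) simp
  note b = gtau(1)[OF In]
  let ?I = "genum k :: ('n + 'n) set"
  have c: "gr.chart k 0 = coordp ?I"
   using graph_zero[OF b] gtau(2)[OF In] by (simp add: gr.chart_def linear_0[OF gr.coords_linear])
  have 1: "bij_betw (\<lambda>i. inv (gtau ?I) (Inl i)) UNIV ?I" and 2: "bij_betw (\<lambda>i. inv (gtau ?I) (Inr i)) UNIV (- ?I)"
   unfolding bij_betw_def range_inv[OF b] gtau(2)[OF In] by (simp_all add: inj_inv[OF b])
  have "(\<Prod>j\<in>UNIV. complex_of_real (2 * pi / (\<tau> * glam ?I j))) =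
    (\<Prod>i\<in>UNIV. \<Prod>j\<in>UNIV. of_real (2 * pi / (\<tau> * (wt (inv (gtau ?I) (Inr i)) - wt (inv (gtau ?I) (Inl j))))))"
   by (simp add: glam_def prod.cartesian_product case_prod_unfold)
  also have "\<dots> = (\<Prod>a\<in>- ?I. \<Prod>b\<in>?I. of_real (2 * pi / (\<tau> * (wt a - wt b))))"
   unfolding prod.reindex_bij_betw[OF 2, symmetric] prod.reindex_bij_betw[OF 1, symmetric] ..
  finally show "cev (F (gr.chart k 0)) [] * (\<Prod>j\<in>(UNIV :: ('n \<times> 'n) set). of_real (2 * pi / (\<tau> * glam ?I j))) =
   cev (F (coordp ?I)) [] * (\<Prod>a\<in>- ?I. \<Prod>b\<in>?I. of_real (2 * pi / (\<tau> * (wt a - wt b))))"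
   by (simp only: c)
 qed
 also have "\<dots> = (\<Sum>I\<in>(nsets :: ('n + 'n) set set).
  cev (F (coordp I)) [] * (\<Prod>a\<in>- I. \<Prod>b\<in>I. of_real (2 * pi / (\<tau> * (wt a - wt b)))))"
  by (rule sum.reindex_bij_betw[OF genum])
 finally show ?thesis .
qed

subsection \<open>The Lagrangian Grassmannian\<close>

lemma symplectic_expand:
 "symplectic (A *v x) (B *v y) = (\<Sum>a\<in>UNIV. \<Sum>b\<in>UNIV. x $ a * y $ b * symplectic (column a A) (column b B))"
proof -
 have "symplectic (A *v x) (B *v y) = (\<Sum>i\<in>UNIV. \<Sum>a\<in>UNIV. \<Sum>b\<in>UNIV. x $ a * y $ b * (A $ Inl i $ a * B $ Inr i $ b - A $ Inr i $ a * B $ Inl i $ b))"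
  unfolding symplectic_def
  by (rule sum.cong) (simp_all add: matrix_vector_mult_def sum_product sum_subtractf algebra_simps)
 also have "\<dots> = (\<Sum>a\<in>UNIV. \<Sum>b\<in>UNIV. \<Sum>i\<in>UNIV. x $ a * y $ b * (A $ Inl i $ a * B $ Inr i $ b - A $ Inr i $ a * B $ Inl i $ b))"
  by (subst sum.swap) (intro sum.cong refl sum.swap)
 finally show ?thesis by (simp add: symplectic_def column_def sum_distrib_left)
qed

text \<open>Stated through the columns, isotropy is a family of polynomial equations in the entries
  and thus visibly closed.\<close>

definition isotropic :: "('n::finite + 'n) cmatrix set" where
 "isotropic = {p. \<forall>a b. symplectic (column a p) (column b p) = 0}"

lemma isotropic_alt: "p \<in> isotropic \<longleftrightarrow> (\<forall>v\<in>range ((*v) p). \<forall>u\<in>range ((*v) p). symplectic v u = 0)"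
proof
 assume p: "p \<in> isotropic"
 then have "symplectic (p *v x) (p *v y) = 0" for x y by (simp add: symplectic_expand isotropic_def)
 then show "\<forall>v\<in>range ((*v) p). \<forall>u\<in>range ((*v) p). symplectic v u = 0" by auto
next
 have "column a p = p *v axis a 1" for a
  by (simp add: vec_eq_iff column_def matrix_vector_mult_def axis_def if_distrib[of "\<lambda>x. _ * x"] cong: if_cong)
 moreover assume "\<forall>v\<in>range ((*v) p). \<forall>u\<in>range ((*v) p). symplectic v u = 0"
 ultimately show "p \<in> isotropic" by (simp add: isotropic_def)
qed

lemma lagrangian_grassmannian_alt:
 "lagrangian_grassmannian = {p :: ('n::finite + 'n) cmatrix. p ** p = p \<and> hermitian p \<and> vec.dim (range ((*v) p)) = CARD('n) \<and> p \<in> isotropic}"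
 unfolding isotropic_alt
 by (auto simp: lagrangian_grassmannian_def lagrangian_subspaces_def projections_onto_def n_subspaces_def
   intro!: vec.subspace_image vec.subspace_UNIV)

text \<open>Exchanges the members of each symplectic pair with index in \<open>K\<close>. The
  selected coordinates span the coordinate Lagrangian subspace of \<open>K\<close>: the second
  member of the pair for indices in \<open>K\<close>, the first member otherwise.\<close>

definition ltau :: "'n set \<Rightarrow> 'n + 'n \<Rightarrow> 'n + 'n" where
 "ltau K a = (case a of Inl i \<Rightarrow> if i \<in> K then Inr i else Inl i | Inr i \<Rightarrow> if i \<in> K then Inl i else Inr i)"

lemma ltau_ltau [simp]: "ltau K (ltau K a) = a"
 by (auto simp: ltau_def split: sum.splits)

lemma bij_ltau: "bij (ltau K)" and inv_ltau: "inv (ltau K) = ltau K"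
proof -
 have c: "ltau K \<circ> ltau K = id" by (simp add: fun_eq_iff)
 show "bij (ltau K)" by (rule o_bij[OF c c])
 show "inv (ltau K) = ltau K" by (rule inv_unique_comp[OF c c])
qed

definition sg :: "'n set \<Rightarrow> 'n \<Rightarrow> real" where
 "sg K i = (if i \<in> K then -1 else 1)"

lemma sg_sq: "sg K i * sg K i = 1"
 by (simp add: sg_def)

lemma wt_ltau: "wt (ltau K (Inl i)) = sg K i * freq i" "wt (ltau K (Inr i)) = - sg K i * freq i"
 by (auto simp: wt_def ltau_def sg_def)

text \<open>The torus weights on the symmetric square of the dual of a coordinate Lagrangian
  subspace, which is the tangent space there. The expression is symmetric in i and j, so the choice
  of an ordered pair does not matter.\<close>

definition llam :: "'n::finite set \<Rightarrow> 'n uprod \<Rightarrow> real" where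
 "llam K u = (SOME r. \<exists>i j. u = Upair i j \<and> r = - (sg K i * freq i + sg K j * freq j))"

lemma llam: "llam K (Upair i j) = - (sg K i * freq i + sg K j * freq j)"
proof -
 have "\<exists>i' j'. Upair i j = Upair i' j' \<and> llam K (Upair i j) = - (sg K i' * freq i' + sg K j' * freq j')"
  unfolding llam_def by (rule someI_ex) blast
 then show ?thesis by auto
qed

definition lenum :: "nat \<Rightarrow> 'n::finite set" where
 "lenum = (SOME e. bij_betw e {..<card (UNIV :: 'n set set)} UNIV)"

lemma lenum: "bij_betw lenum {..<card (UNIV :: 'n set set)} (UNIV :: 'n::finite set set)"
proof -
 have "\<exists>e. bij_betw e {..<card (UNIV :: 'n set set)} (UNIV :: 'n set set)"
  using ex_bij_betw_nat_finite[OF finite_class.finite_UNIV[where 'a = "'n set"]] by (simp only: atLeast0LessThan)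
 then show ?thesis unfolding lenum_def by (rule someI_ex)
qed

text \<open>Exchanging a symplectic pair changes the sign of its term, so a graph is isotropic
  exactly if its slope matrix becomes symmetric after scaling row i by \<open>sg K i\<close>. This
  is the origin of the signs in the Lagrangian charts.\<close>

lemma symplectic_frame:
 fixes K :: "'n::finite set"
 shows "symplectic (frame (ltau K) M *v x) (frame (ltau K) M *v y) =
  (\<Sum>i\<in>UNIV. of_real (sg K i) * (x $ i * (M *v y) $ i - (M *v x) $ i * y $ i))"
proof -
 have b: "blocks \<tau> A M *v x = (\<chi> a. case \<tau> a of Inl i \<Rightarrow> (A *v x) $ i | Inr i \<Rightarrow> (M *v x) $ i)" for \<tau> :: "'n + 'n \<Rightarrow> 'n + 'n" and A x
  by (auto simp: blocks_def matrix_vector_mult_def vec_eq_iff split: sum.splits)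
 show ?thesis
  unfolding symplectic_def frame_def b by (rule sum.cong) (auto simp: ltau_def sg_def algebra_simps)
qed

interpretation lg: grass_atlas "lagrangian_grassmannian :: ('n::finite + 'n) cmatrix set" isotropic "card (UNIV :: 'n set set)"
 "\<lambda>k. ltau (lenum k)" "\<lambda>k i j. sg (lenum k) i" Upair wt "\<lambda>k. llam (lenum k)"
proof (unfold_locales)
 fix k l :: nat and p :: "('n + 'n) cmatrix" and M :: "complex ^ 'n ^ 'n" and d :: "'n uprod" and i j :: 'n
  and z :: "complex ^ 'n uprod"
 show "lagrangian_grassmannian = {p :: ('n + 'n) cmatrix. p ** p = p \<and> hermitian p \<and> vec.dim (range ((*v) p)) = CARD('n) \<and> p \<in> isotropic}"
  by (rule lagrangian_grassmannian_alt)
 show "closed (isotropic :: ('n + 'n) cmatrix set)"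
  unfolding isotropic_def symplectic_def column_def vec_lambda_beta
  by (intro closed_Collect_all closed_Collect_eq continuous_intros)
 show "bij (ltau (lenum k :: 'n set))" by (rule bij_ltau)
 show "sg (lenum k) i * sg (lenum k) i = 1" by (rule sg_sq)
 show "\<exists>i j. Upair i j = d" by (cases d) auto
 show "wt (inv (ltau (lenum k)) (Inr i)) - wt (inv (ltau (lenum k)) (Inl j)) = llam (lenum k) (Upair i j)"
  by (simp add: inv_ltau wt_ltau llam)
 show "llam (lenum k) d \<noteq> 0"
 proof (cases d)
  case (Upair i j)
  have "freq i = freq j \<Longrightarrow> i = j" using freq(1) by (auto dest: injD)
  then show ?thesis using freq(2)[of i] freq(2)[of j] unfolding Upair llam by (auto simp: sg_def)
 qed
 show "graph (ltau (lenum k)) (coords (\<lambda>i j. sg (lenum k) i) Upair z) \<in> isotropic"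
 proof -
  let ?K = "lenum k :: 'n set"
  define M where "M = coords (\<lambda>i j. sg ?K i) Upair z"
  have "symplectic (frame (ltau ?K) M *v x) (frame (ltau ?K) M *v y) = 0" for x y
  proof -
   have "symplectic (frame (ltau ?K) M *v x) (frame (ltau ?K) M *v y) =
     (\<Sum>i\<in>UNIV. \<Sum>j\<in>UNIV. z $ Upair i j * (x $ i * y $ j)) - (\<Sum>i\<in>UNIV. \<Sum>j\<in>UNIV. z $ Upair i j * (x $ j * y $ i))"
    unfolding symplectic_frame sum_subtractf[symmetric]
   proof (rule sum.cong[OF refl])
    fix i
    have e: "complex_of_real (sg ?K i) * (of_real (sg ?K i) * c) = c" for c
     by (simp add: mult.assoc[symmetric] sg_sq flip: of_real_mult)
    have Mi: "of_real (sg ?K i) * (M *v x) $ i = (\<Sum>j\<in>UNIV. z $ Upair i j * x $ j)" for x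
     by (simp add: matrix_vector_mult_def M_def coords_def sum_distrib_left mult.assoc e)
    have "of_real (sg ?K i) * (x $ i * (M *v y) $ i - (M *v x) $ i * y $ i) =
      x $ i * (of_real (sg ?K i) * (M *v y) $ i) - (of_real (sg ?K i) * (M *v x) $ i) * y $ i"
     by (simp add: algebra_simps)
    also have "\<dots> = (\<Sum>j\<in>UNIV. z $ Upair i j * (x $ i * y $ j) - z $ Upair i j * (x $ j * y $ i))"
     unfolding Mi by (simp add: sum_subtractf sum_distrib_left sum_distrib_right mult_ac)
    finally show "of_real (sg ?K i) * (x $ i * (M *v y) $ i - (M *v x) $ i * y $ i) =
      (\<Sum>j\<in>UNIV. z $ Upair i j * (x $ i * y $ j) - z $ Upair i j * (x $ j * y $ i))" .
   qed
   also have "(\<Sum>i\<in>UNIV. \<Sum>j\<in>UNIV. z $ Upair i j * (x $ j * y $ i)) = (\<Sum>i\<in>UNIV. \<Sum>j\<in>UNIV. z $ Upair i j * (x $ i * y $ j))"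
    by (subst sum.swap) (intro sum.cong refl, metis Upair_inject)
   finally show ?thesis by simp
  qed
  then show ?thesis unfolding isotropic_alt range_graph[OF bij_ltau] M_def by auto
 qed
 show "\<exists>z. M = coords (\<lambda>i j. sg (lenum k) i) Upair z"
  if p: "p \<in> lagrangian_grassmannian" and pS: "p ** frame (ltau (lenum k)) M = frame (ltau (lenum k)) M"
 proof -
  let ?K = "lenum k :: 'n set" and ?S = "frame (ltau (lenum k)) M"
  have M: "M $ i $ j = (M *v axis j 1) $ i" for i j
   by (simp add: matrix_vector_mult_def axis_def if_distrib[of "\<lambda>x. _ * x"] cong: if_cong)
  \<comment> \<open>Isotropy of the graph, tested on the columns \<open>i\<close> and
    \<open>j\<close> of the frame.\<close>
  have sym: "of_real (sg ?K i) * M $ i $ j = of_real (sg ?K j) * M $ j $ i" for i j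
  proof -
   have "?S *v x \<in> range ((*v) p)" for x
    using pS by (metis matrix_vector_mul_assoc rangeI)
   then have "symplectic (?S *v axis i 1) (?S *v axis j 1) = 0"
    using p unfolding lagrangian_grassmannian_alt isotropic_alt by blast
   then have "(\<Sum>l\<in>UNIV. of_real (sg ?K l) * (axis i 1 $ l * M $ l $ j) - of_real (sg ?K l) * (M $ l $ i * axis j 1 $ l)) = 0"
    unfolding symplectic_frame by (simp add: M right_diff_distrib)
   then have "(\<Sum>l\<in>UNIV. if l = i then of_real (sg ?K l) * M $ l $ j else 0) - (\<Sum>l\<in>UNIV. if l = j then of_real (sg ?K l) * M $ l $ i else 0) = 0"
    unfolding sum_subtractf[symmetric] by (simp add: axis_def if_distrib[of "\<lambda>x. _ * x"] if_distrib[of "\<lambda>x. x * _"] cong: if_cong)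
   then show ?thesis by simp
  qed
  define z where "z = (\<chi> u. SOME r. \<exists>i j. u = Upair i j \<and> r = of_real (sg ?K i) * M $ i $ j)"
  have "z $ Upair i j = of_real (sg ?K i) * M $ i $ j" for i j
  proof -
   have "\<exists>i' j'. Upair i j = Upair i' j' \<and> z $ Upair i j = of_real (sg ?K i') * M $ i' $ j'"
    unfolding z_def vec_lambda_beta by (rule someI_ex) blast
   then show ?thesis using sym by auto
  qed
  then have "M = coords (\<lambda>i j. sg ?K i) Upair z"
   by (simp add: coords_def vec_eq_iff mult.assoc[symmetric] sg_sq flip: of_real_mult)
  then show ?thesis by blast
 qed
 show "\<exists>k<card (UNIV :: 'n set set). det (corner (ltau (lenum k)) p) \<noteq> 0" if p: "p \<in> lagrangian_grassmannian"
 proof -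
  have p': "hermitian p" "p ** p = p" "vec.dim (range ((*v) p)) = CARD('n)" "p \<in> isotropic"
   using p unfolding lagrangian_grassmannian_alt by simp_all
  let ?W = "range ((*v) p)"
  note sub = subspace_range[of p]
  define emb :: "complex ^ 'n ^ ('n + 'n)" where "emb = (\<chi> a j. if a = Inl j then 1 else 0)"
  have emb: "(emb *v u) $ Inl i = u $ i" "(emb *v u) $ Inr i = 0" for u i
   by (simp_all add: emb_def matrix_vector_mult_def if_distrib[of "\<lambda>x. x * _"] cong: if_cong)
  \<comment> \<open>The intersection of the Lagrangian subspace with the first coordinate
    Lagrangian. The set \<open>J\<close> of coordinates complementary to it determines the
    chart.\<close>
  define U where "U = {u. emb *v u \<in> ?W}"
  have "vec.subspace U"
   unfolding U_def vec.subspace_def mem_Collect_eq matrix_vector_right_distrib vector_scalar_commute matrix_vector_mult_0_right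
   using vec.subspace_0[OF sub] vec.subspace_add[OF sub] vec.subspace_scale[OF sub] by blast
  then obtain J where J: "\<And>x. x \<in> U \<Longrightarrow> (\<And>a. a \<notin> J \<Longrightarrow> x $ a = 0) \<Longrightarrow> x = 0"
   "\<And>k. \<exists>u\<in>U. \<forall>a. a \<notin> J \<longrightarrow> u $ a = axis k 1 $ a"
   using coordinate_complement by metis
  obtain k where k: "k < card (UNIV :: 'n set set)" "J = lenum k"
   using bij_betw_imp_surj_on[OF lenum[where 'n = 'n]] by (metis UNIV_I imageE lessThan_iff)
  have "det (corner (ltau J) p) \<noteq> 0"
  proof (rule det_corner_nonzero[OF bij_ltau p'(1-3)])
   fix v assume v: "v \<in> ?W" and z: "\<And>i. v $ inv (ltau J) (Inl i) = 0"
   have v0: "v $ Inr i = 0" if "i \<in> J" for i using z[of i] that by (simp add: inv_ltau ltau_def)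
   have v1: "v $ Inl i = 0" if "i \<notin> J" for i using z[of i] that by (simp add: inv_ltau ltau_def)
   \<comment> \<open>For \<open>k\<close> outside \<open>J\<close>, pairing \<open>v\<close> with a
     vector of \<open>U\<close> that agrees with the \<open>k\<close>-th unit vector off
     \<open>J\<close> isolates this entry, and isotropy makes it zero. Thereafter \<open>v\<close>
     comes from a vector of \<open>U\<close> supported in \<open>J\<close>.\<close>
   have "v $ Inr k = 0" for k
   proof (cases "k \<in> J")
    case False
    obtain u where u: "u \<in> U" "\<And>a. a \<notin> J \<Longrightarrow> u $ a = axis k 1 $ a" using J(2) by blast
    have "symplectic (emb *v u) v = 0"
     using p'(4) u(1) v unfolding isotropic_alt U_def by blast
    then have "0 = symplectic (emb *v u) v" by simp
    also have "\<dots> = (\<Sum>i\<in>UNIV. u $ i * v $ Inr i)" by (simp add: symplectic_def emb)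
    also have "\<dots> = (\<Sum>i\<in>UNIV. if i = k then v $ Inr k else 0)"
    proof (rule sum.cong[OF refl])
     fix i show "u $ i * v $ Inr i = (if i = k then v $ Inr k else 0)"
      using v0[of i] u(2)[of i] False by (cases "i \<in> J") (auto simp: axis_def)
    qed
    finally show ?thesis by simp
   qed (rule v0)
   note vr = this
   define u where "u = (\<chi> i. v $ Inl i)"
   have "emb *v u = v"
   proof -
    have "(emb *v u) $ a = v $ a" for a by (cases a) (simp_all add: emb vr u_def)
    then show ?thesis by (simp add: vec_eq_iff)
   qed
   moreover from this have "u = 0" by (intro J(1)) (use v v1 in \<open>auto simp: U_def u_def\<close>)
   ultimately show "v = 0" by simp
  qed
  then show ?thesis using k by auto
 qed
 show "\<exists>i j. ltau (lenum k) (inv (ltau (lenum l)) (Inl i)) = Inr (j :: 'n)"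
  if k: "k < card (UNIV :: 'n set set)" "l < card (UNIV :: 'n set set)" "k \<noteq> l"
 proof -
  have "lenum k \<noteq> (lenum l :: 'n set)"
   using inj_onD[OF bij_betw_imp_inj_on[OF lenum[where 'n = 'n]], of k l] k by auto
  then obtain i :: 'n where "(i \<in> lenum k) \<noteq> (i \<in> lenum l)" by blast
  then have "ltau (lenum k) (inv (ltau (lenum l)) (Inl i)) = Inr i"
   by (auto simp: inv_ltau ltau_def)
  then show ?thesis by blast
 qed
qed

definition lset :: "'n set \<Rightarrow> ('n + 'n) set" where
 "lset K = {a. \<exists>i. ltau K a = Inl i}"

lemma lg_localisation:
 assumes F: "eqclosed wt (of_real \<tau>) F" and \<tau>: "0 < \<tau>"
 shows "lg.intg (\<lambda>p. cev (F p)) = (\<Sum>K\<in>(UNIV :: 'n::finite set set).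
  cev (F (coordp (lset K))) [] * (\<Prod>u\<in>(UNIV :: 'n uprod set). of_real (2 * pi / (\<tau> * llam K u))))"
proof -
 have "lg.intg (\<lambda>p. cev (F p)) = (\<Sum>k<card (UNIV :: 'n set set).
   cev (F (lg.chart k 0)) [] * (\<Prod>u\<in>(UNIV :: 'n uprod set). of_real (2 * pi / (\<tau> * llam (lenum k) u))))"
  by (rule lg.localisation[OF F \<tau>])
 also have "\<dots> = (\<Sum>k<card (UNIV :: 'n set set).
   cev (F (coordp (lset (lenum k)))) [] * (\<Prod>u\<in>(UNIV :: 'n uprod set). of_real (2 * pi / (\<tau> * llam (lenum k) u))))"
  by (simp add: lg.chart_def linear_0[OF lg.coords_linear] graph_zero[OF bij_ltau] lset_def)
 also have "\<dots> = (\<Sum>K\<in>(UNIV :: 'n set set). cev (F (coordp (lset K))) [] * (\<Prod>u\<in>(UNIV :: 'n uprod set). of_real (2 * pi / (\<tau> * llam K u))))"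
  by (rule sum.reindex_bij_betw[OF lenum])
 finally show ?thesis .
qed

section \<open>Evaluation at the fixed points\<close>

subsection \<open>Evaluation of polynomials\<close>

definition monom_eval :: "('v::finite \<Rightarrow> complex) \<Rightarrow> ('v \<Rightarrow>\<^sub>0 nat) \<Rightarrow> complex" where
 "monom_eval v m = (\<Prod>i\<in>UNIV. v i ^ Poly_Mapping.lookup m i)"

definition peval :: "('v::finite \<Rightarrow> complex) \<Rightarrow> 'v polynomial \<Rightarrow> complex" where
 "peval v P = (\<Sum>m\<in>Poly_Mapping.keys P. Poly_Mapping.lookup P m * monom_eval v m)"

lemma peval_superset:
 "finite A \<Longrightarrow> Poly_Mapping.keys P \<subseteq> A \<Longrightarrow> peval v P = (\<Sum>m\<in>A. Poly_Mapping.lookup P m * monom_eval v m)"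
 unfolding peval_def by (rule sum.mono_neutral_left) (auto simp: in_keys_iff)

lemma peval_add: "peval v (P + Q) = peval v P + peval v Q"
proof -
 let ?A = "Poly_Mapping.keys P \<union> Poly_Mapping.keys Q"
 have "peval v R = (\<Sum>m\<in>?A. Poly_Mapping.lookup R m * monom_eval v m)" if "Poly_Mapping.keys R \<subseteq> ?A" for R
  by (rule peval_superset) (use that in auto)
 then show ?thesis by (simp add: keys_add lookup_add sum.distrib algebra_simps)
qed

lemma peval_single: "peval v (Poly_Mapping.single m c) = c * monom_eval v m"
 by (simp add: peval_def)

lemma peval_zero: "peval v 0 = 0"
 by (simp add: peval_def)

lemma peval_sum: "peval v (sum f A) = (\<Sum>a\<in>A. peval v (f a))"
 by (induction A rule: infinite_finite_induct) (simp_all add: peval_add peval_zero)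

lemma monomial_expansion: "P = (\<Sum>m\<in>Poly_Mapping.keys P. Poly_Mapping.single m (Poly_Mapping.lookup P m))"
 by (rule poly_mapping_eqI)
  (simp add: lookup_sum lookup_single when_def in_keys_iff)

lemma monom_eval_add: "monom_eval v (m + m') = monom_eval v m * monom_eval v m'"
 by (simp add: monom_eval_def lookup_add power_add prod.distrib)

lemma peval_mult: "peval v (P * Q) = peval v P * peval v Q"
proof -
 have "P * Q = (\<Sum>m\<in>Poly_Mapping.keys P. \<Sum>m'\<in>Poly_Mapping.keys Q.
   Poly_Mapping.single (m + m') (Poly_Mapping.lookup P m * Poly_Mapping.lookup Q m'))"
  by (subst monomial_expansion[of P], subst monomial_expansion[of Q]) (simp add: sum_product mult_single)
 then have "peval v (P * Q) = (\<Sum>m\<in>Poly_Mapping.keys P. \<Sum>m'\<in>Poly_Mapping.keys Q.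
   Poly_Mapping.lookup P m * monom_eval v m * (Poly_Mapping.lookup Q m' * monom_eval v m'))"
  by (simp add: peval_sum peval_single monom_eval_add mult_ac)
 then show ?thesis by (simp add: peval_def sum_product)
qed

lemma peval_one: "peval v 1 = 1"
 using peval_single[of v 0 1] by (simp add: monom_eval_def)

lemma peval_const: "peval v (const c) = c"
 by (simp add: const_def peval_single monom_eval_def)

lemma peval_var: "peval v (var i) = v i"
proof -
 have "(\<Prod>j\<in>UNIV. v j ^ Poly_Mapping.lookup (Poly_Mapping.single i 1) j) = (\<Prod>j\<in>UNIV. if j = i then v i else 1)"
  by (rule prod.cong) (auto simp: lookup_single when_def)
 then show ?thesis by (simp add: var_def peval_single monom_eval_def)
qed

lemma peval_prod: "peval v (prod f A) = (\<Prod>a\<in>A. peval v (f a))"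
 by (induction A rule: infinite_finite_induct) (simp_all add: peval_mult peval_one)

lemma peval_power: "peval v (P ^ k) = peval v P ^ k"
 by (induction k) (simp_all add: peval_mult peval_one)

lemma peval_minus_one: "peval v (-1) = -1"
proof -
 have "peval v (-1) + peval v 1 = 0" by (simp flip: peval_add add: peval_zero)
 then show ?thesis by (simp add: peval_one eq_neg_iff_add_eq_0)
qed

lemma peval_elementary: "peval v (elementary k) = (\<Sum>I | card I = k. \<Prod>i\<in>I. v i)"
 by (simp add: elementary_def peval_sum peval_prod peval_var)

lemma peval_subst:
 "peval v (subst_polynomial Q e) = (\<Sum>m\<in>Poly_Mapping.keys Q. Poly_Mapping.lookup Q m *
  (\<Prod>k\<in>Poly_Mapping.keys m. peval v (e k) ^ Poly_Mapping.lookup m k))"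
 by (simp add: subst_polynomial_def peval_sum peval_mult peval_const peval_prod peval_power)

subsection \<open>Characteristic forms at coordinate subspaces\<close>

text \<open>At a coordinate projection the scalar part of the curvature matrix is diagonal, so only
  the identity permutation contributes to a minor. The normalisation \<i> / (2 \<pi>) turns - \<i> t
  w_a into the Chern root t w_a / (2 \<pi>).\<close>

lemma eqchern_coordp:
 fixes I :: "'N::finite set"
 shows "cev (eqchern w t k (coordp I)) [] = (\<Sum>J | J \<subseteq> I \<and> card J = k. \<Prod>a\<in>J. t * of_real (w a) / (2 * pi))"
proof -
 have pwp: "(coordp I ** (weight w ** coordp I)) $ a $ b = (if a = b \<and> a \<in> I then of_real (w a) else 0)" for a b
 proof -
  have "(weight w ** coordp I) $ c $ b = (if c = b \<and> b \<in> I then of_real (w b) else 0)" for c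
   by (auto simp: matrix_matrix_mult_def weight_def coordp_def if_distrib[of "\<lambda>x. x * _"] cong: if_cong)
  then show ?thesis
   by (cases "a \<in> I") (auto simp: matrix_matrix_mult_def coordp_def if_distrib[of "\<lambda>x. x * _"] cong: if_cong)
 qed
 have e: "cev (entry w t a b (coordp I)) [] = (if a = b \<and> a \<in> I then - \<i> * t * of_real (w a) else 0)" for a b
  by (auto simp: entry_def cev_sc pwp)
 have s: "(\<Sum>\<sigma> | \<sigma> permutes J. of_int (sign \<sigma>) * (\<Prod>a\<in>J. cev (entry w t a (\<sigma> a) (coordp I)) [])) =
   (if J \<subseteq> I then \<Prod>a\<in>J. - \<i> * t * of_real (w a) else 0)" for J :: "'N set"
 proof -
  have "(\<Sum>\<sigma> | \<sigma> permutes J. of_int (sign \<sigma>) * (\<Prod>a\<in>J. cev (entry w t a (\<sigma> a) (coordp I)) [])) =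
    (\<Sum>\<sigma>\<in>{id}. of_int (sign \<sigma>) * (\<Prod>a\<in>J. cev (entry w t a (\<sigma> a) (coordp I)) []))"
  proof (rule sum.mono_neutral_right)
   show "\<forall>\<sigma>\<in>{\<sigma>. \<sigma> permutes J} - {id}. of_int (sign \<sigma>) * (\<Prod>a\<in>J. cev (entry w t a (\<sigma> a) (coordp I)) []) = 0"
   proof
    fix \<sigma> assume \<sigma>: "\<sigma> \<in> {\<sigma>. \<sigma> permutes J} - {id}"
    then have "\<exists>a. \<sigma> a \<noteq> id a" by (auto simp: fun_eq_iff)
    then obtain a where a: "\<sigma> a \<noteq> a" by auto
    then have "a \<in> J" using \<sigma> by (auto simp: permutes_def)
    then have "(\<Prod>a\<in>J. cev (entry w t a (\<sigma> a) (coordp I)) []) = 0"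
     using a by (intro prod_zero) (auto simp: e intro!: bexI[of _ a])
    then show "of_int (sign \<sigma>) * (\<Prod>a\<in>J. cev (entry w t a (\<sigma> a) (coordp I)) []) = 0" by simp
   qed
  qed (auto simp: permutes_id)
  also have "\<dots> = (\<Prod>a\<in>J. if a \<in> I then - \<i> * t * of_real (w a) else 0)" by (simp add: sign_id e)
  also have "\<dots> = (if J \<subseteq> I then \<Prod>a\<in>J. - \<i> * t * of_real (w a) else 0)"
  proof (cases "J \<subseteq> I")
   case False
   then have "(\<Prod>a\<in>J. if a \<in> I then - \<i> * t * of_real (w a) else 0) = 0" by (intro prod_zero) auto
   then show ?thesis using False by simp
  qed (auto intro!: prod.cong)
  finally show ?thesis .
 qed
 have "cev (eqchern w t k (coordp I)) [] = (\<i> / (2 * of_real pi)) ^ k * (\<Sum>J | card J = k. if J \<subseteq> I then \<Prod>a\<in>J. - \<i> * t * of_real (w a) else 0)"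
  by (simp add: eqchern_def minors_def cev_sc cev_sum cev_prod_Nil cev_of_int_Nil s)
 also have "(\<Sum>J | card J = k. if J \<subseteq> I then \<Prod>a\<in>J. - \<i> * t * of_real (w a) else 0) = (\<Sum>J | J \<subseteq> I \<and> card J = k. \<Prod>a\<in>J. - \<i> * t * of_real (w a))"
  by (rule sum.mono_neutral_cong_right) auto
 also have "(\<i> / (2 * of_real pi)) ^ k * \<dots> = (\<Sum>J | J \<subseteq> I \<and> card J = k. \<Prod>a\<in>J. t * of_real (w a) / (2 * pi))"
  unfolding sum_distrib_left
 proof (rule sum.cong[OF refl])
  fix J assume "J \<in> {J. J \<subseteq> I \<and> card J = k}"
  then have "(\<i> / (2 * of_real pi)) ^ k * (\<Prod>a\<in>J. - \<i> * t * of_real (w a)) = (\<Prod>a\<in>J. \<i> / (2 * of_real pi) * (- \<i> * t * of_real (w a)))"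
   by (simp only: prod.distrib[of "\<lambda>_. \<i> / (2 * of_real pi)"] prod_constant) auto
  also have "\<dots> = (\<Prod>a\<in>J. t * of_real (w a) / (2 * pi))"
   by (rule prod.cong) (simp_all add: field_simps)
  finally show "(\<i> / (2 * of_real pi)) ^ k * (\<Prod>a\<in>J. - \<i> * t * of_real (w a)) = (\<Prod>a\<in>J. t * of_real (w a) / (2 * pi))" .
 qed
 finally show ?thesis .
qed

text \<open>The Chern roots are numbered by an arbitrary labelling \<open>b\<close> of the basis
  vectors; polynomials in the elementary symmetric ones do not see the choice.\<close>

lemma eqsubst_coordp:
 fixes b :: "'n::finite \<Rightarrow> 'N::finite"
 assumes b: "inj b"
 shows "cev (eqsubst w t Q (coordp (range b))) [] = peval (\<lambda>i. t * of_real (w (b i)) / (2 * pi)) (subst_polynomial Q elementary)"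
proof -
 have "cev (eqchern w t k (coordp (range b))) [] = peval (\<lambda>i. t * of_real (w (b i)) / (2 * pi)) (elementary k)" for k
 proof -
  have bij: "bij_betw ((`) b) {J. card J = k} {J. J \<subseteq> range b \<and> card J = k}"
   unfolding bij_betw_def
  proof
   show "inj_on ((`) b) {J. card J = k}" using b by (auto simp: inj_on_def inj_image_eq_iff)
   have "J \<in> (`) b ` {J. card J = k}" if "J \<subseteq> range b" "card J = k" for J
   proof -
    have "J = b ` (b -` J)" using that(1) by auto
    moreover from this have "card (b -` J) = k"
     using card_image[OF inj_on_subset[OF b subset_UNIV], of "b -` J"] that(2) by simp
    ultimately show ?thesis by blast
   qed
   then show "(`) b ` {J. card J = k} = {J. J \<subseteq> range b \<and> card J = k}"
    using card_image[OF inj_on_subset[OF b subset_UNIV]] by auto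
  qed
  have "(\<Sum>J | J \<subseteq> range b \<and> card J = k. \<Prod>a\<in>J. t * of_real (w a) / (2 * pi)) =
    (\<Sum>J | card J = k. \<Prod>a\<in>b ` J. t * of_real (w a) / (2 * pi))"
   by (rule sum.reindex_bij_betw[OF bij, symmetric])
  also have "\<dots> = (\<Sum>J | card J = k. \<Prod>i\<in>J. t * of_real (w (b i)) / (2 * pi))"
   by (rule sum.cong[OF refl]) (simp add: prod.reindex[OF inj_on_subset[OF b subset_UNIV]])
  finally show ?thesis by (simp add: eqchern_coordp peval_elementary)
 qed
 then show ?thesis
  by (simp add: eqsubst_def peval_subst cev_sum cev_sc cev_prod_Nil cev_power_Nil)
qed

subsection \<open>Comparison of the fixed point contributions\<close>

text \<open>An unordered pair of distinct elements comes from two ordered pairs, a diagonal one from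
  a single pair. This is the difference between the n^2 weights on G(n, 2n) and the n(n+1)/2 weights
  on LG(n).\<close>

lemma prod_pairs:
 fixes F :: "'n::finite uprod \<Rightarrow> complex"
 shows "(\<Prod>i\<in>UNIV. \<Prod>j\<in>UNIV. F (Upair i j)) = (\<Prod>u\<in>UNIV. F u) * (\<Prod>u | card (set_uprod u) = 2. F u)"
proof -
 have "(\<Prod>i\<in>UNIV. \<Prod>j\<in>UNIV. F (Upair i j)) = (\<Prod>x\<in>UNIV. F (Upair (fst x) (snd x)))"
  by (simp add: prod.cartesian_product case_prod_unfold)
 also have "\<dots> = (\<Prod>u\<in>UNIV. \<Prod>x\<in>{x \<in> UNIV. Upair (fst x) (snd x) = u}. F (Upair (fst x) (snd x)))"
  by (rule prod.group[symmetric]) auto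
 also have "\<dots> = (\<Prod>u\<in>UNIV. F u * (if card (set_uprod u) = 2 then F u else 1))"
 proof (rule prod.cong[OF refl])
  fix u :: "'n uprod"
  obtain i j where u: "u = Upair i j" by (cases u) auto
  have "{x \<in> UNIV. Upair (fst x) (snd x) = u} = {(i, j), (j, i)}" by (auto simp: u)
  then have "(\<Prod>x\<in>{x \<in> UNIV. Upair (fst x) (snd x) = u}. F (Upair (fst x) (snd x))) = (\<Prod>x\<in>{(i, j), (j, i)}. F u)"
   by (intro prod.cong) (auto simp: u intro!: arg_cong[of _ _ F])
  also have "\<dots> = F u * (if card (set_uprod u) = 2 then F u else 1)"
   by (cases "i = j") (auto simp: u)
  finally show "(\<Prod>x\<in>{x \<in> UNIV. Upair (fst x) (snd x) = u}. F (Upair (fst x) (snd x))) = F u * (if card (set_uprod u) = 2 then F u else 1)" .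
 qed
 also have "\<dots> = (\<Prod>u\<in>UNIV. F u) * (\<Prod>u | card (set_uprod u) = 2. F u)"
  by (simp add: prod.distrib prod.If_cases)
 finally show ?thesis .
qed

lemma bij_set_uprod: "bij_betw set_uprod {u :: 'n::finite uprod. card (set_uprod u) = 2} {S. card S = 2}"
 unfolding bij_betw_def
proof
 show "inj_on set_uprod {u :: 'n uprod. card (set_uprod u) = 2}"
 proof (rule inj_onI)
  fix u u' :: "'n uprod" assume "set_uprod u = set_uprod u'"
  then show "u = u'" by (cases u; cases u') (auto simp: doubleton_eq_iff)
 qed
 show "set_uprod ` {u :: 'n uprod. card (set_uprod u) = 2} = {S. card S = 2}"
 proof
  show "{S. card S = 2} \<subseteq> set_uprod ` {u :: 'n uprod. card (set_uprod u) = 2}"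
  proof
   fix S :: "'n set" assume "S \<in> {S. card S = 2}"
   then obtain i j where "S = {i, j}" "i \<noteq> j" by (auto simp: card_2_iff)
   then show "S \<in> set_uprod ` {u. card (set_uprod u) = 2}" by (intro image_eqI[of _ _ "Upair i j"]) auto
  qed
 qed auto
qed

text \<open>The polynomial that represents \<sigma>; its sign amounts to one factor -1 for each of
  the n(n-1)/2 pairs.\<close>

definition rho :: "('n::finite) polynomial" where
 "rho = (-1) ^ (CARD('n) * (CARD('n) - 1) div 2) * (\<Prod>I | card I = 2. \<Sum>i\<in>I. var i)"

lemma peval_rho: "peval v (rho :: 'n::finite polynomial) = (\<Prod>I | card I = 2. - (\<Sum>i\<in>I. v i))"
proof -
 have "card {I :: 'n set. card I = 2} = CARD('n) * (CARD('n) - 1) div 2"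
  using n_subsets[OF finite_class.finite_UNIV[where 'a = 'n], of 2] by (simp add: choose_two)
 moreover have "(\<Prod>I | card I = 2. - (\<Sum>i\<in>I. v i)) = (\<Prod>I | card I = 2. (-1) * (\<Sum>i\<in>I. v i))" by simp
 ultimately show ?thesis
  by (simp only: prod.distrib[of "\<lambda>_. - 1"] prod_constant rho_def peval_mult peval_power peval_minus_one peval_prod peval_sum peval_var)
qed

text \<open>The product over ordered pairs contains one surplus factor \<open>F u\<close> for every
  pair of distinct elements, and this is inverse to the corresponding factor of \<open>rho\<close>.
  The diagonal factors occur once on both sides.\<close>

lemma rho_times_weights:
 fixes x :: "'n::finite \<Rightarrow> complex" and F :: "'n uprod \<Rightarrow> complex"
 assumes F: "\<And>i j. F (Upair i j) * - (x i + x j) = 1"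
 shows "peval x rho * (\<Prod>i\<in>UNIV. \<Prod>j\<in>UNIV. F (Upair i j)) = (\<Prod>u\<in>UNIV. F u)"
proof -
 have "peval x rho = (\<Prod>u | card (set_uprod u) = 2. - (\<Sum>i\<in>set_uprod u. x i))"
  unfolding peval_rho by (rule prod.reindex_bij_betw[OF bij_set_uprod, symmetric])
 then have "peval x rho * (\<Prod>u | card (set_uprod u) = 2. F u) = (\<Prod>u | card (set_uprod u) = 2. - (\<Sum>i\<in>set_uprod u. x i) * F u)"
  by (simp only: prod.distrib)
 also have "\<dots> = 1"
 proof (rule prod.neutral, rule ballI)
  fix u :: "'n uprod" assume u: "u \<in> {u. card (set_uprod u) = 2}"
  obtain i j where ij: "u = Upair i j" by (cases u) auto
  then have "i \<noteq> j" using u by auto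
  then show "- (\<Sum>i\<in>set_uprod u. x i) * F u = 1" using F[of i j] by (simp add: ij mult.commute)
 qed
 finally have "peval x rho * (\<Prod>u | card (set_uprod u) = 2. F u) = 1" .
 then show ?thesis unfolding prod_pairs by (simp add: mult.left_commute)
qed

lemma lset_range: "lset K = range (\<lambda>i. ltau K (Inl i))"
 and Compl_lset: "- lset K = range (\<lambda>i. ltau K (Inr i))"
 and inj_ltau: "inj (\<lambda>i. ltau K (Inl i))" "inj (\<lambda>i. ltau K (Inr i))" for K :: "'n::finite set"
 using range_inv[OF bij_ltau[of K]] inj_inv[OF bij_ltau[of K]] by (simp_all add: inv_ltau lset_def)

lemma lset_nsets: "lset K \<in> nsets"
 by (simp add: lset_range nsets_def card_image inj_ltau)

lemma inj_lset: "inj lset"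
proof (rule injI)
 fix K K' :: "'a set" assume eq: "lset K = lset K'"
 have "i \<in> K \<longleftrightarrow> Inr i \<in> lset K" for i and K :: "'a set" by (auto simp: lset_def ltau_def)
 then show "K = K'" using eq by blast
qed

text \<open>If \<open>I\<close> contained no symplectic pair, forgetting the side of a coordinate
  would be injective on \<open>I\<close>, hence onto by cardinality, and \<open>I\<close> would
  select exactly one member of each pair.\<close>

lemma nsets_cases:
 assumes I: "(I :: ('n::finite + 'n) set) \<in> nsets" "I \<notin> range lset"
 obtains k where "Inl k \<in> I" "Inr k \<in> I"
proof (rule ccontr)
 assume "\<not> thesis"
 then have n: "Inl k \<notin> I \<or> Inr k \<notin> I" for k using that by blast
 define f where "f a = (case a of Inl k \<Rightarrow> k | Inr k \<Rightarrow> k)" for a :: "'n + 'n"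
 have inj: "inj_on f I"
 proof (rule inj_onI)
  fix a b assume "a \<in> I" "b \<in> I" "f a = f b"
  then show "a = b" using n by (cases a; cases b) (auto simp: f_def)
 qed
 have "card (f ` I) = CARD('n)" using card_image[OF inj] I(1) by (simp add: nsets_def)
 then have onto: "f ` I = UNIV" by (intro card_subset_eq) auto
 have one: "Inl k \<in> I \<longleftrightarrow> Inr k \<notin> I" for k
 proof -
  have "k \<in> f ` I" using onto by simp
  then obtain a where "a \<in> I" "f a = k" by auto
  then show ?thesis using n[of k] by (cases a) (auto simp: f_def)
 qed
 have "I = lset {k. Inr k \<in> I}"
 proof (rule set_eqI)
  fix a show "a \<in> I \<longleftrightarrow> a \<in> lset {k. Inr k \<in> I}"
   using one by (cases a) (auto simp: lset_def ltau_def)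
 qed
 then show False using I(2) by blast
qed

text \<open>\<open>Q1\<close> and \<open>Q2\<close> may be different polynomials in the e_i. At a
  fixed point both evaluate \<open>P\<close> at the Chern roots, so the sums are compared through
  values of \<open>P\<close>.\<close>

lemma fixed_point_sums:
 fixes P :: "'n::finite polynomial" and \<tau> :: real
 assumes \<tau>: "0 < \<tau>" and P: "P = subst_polynomial Q1 elementary" "P = subst_polynomial Q2 elementary"
  and R: "rho = (subst_polynomial Qr elementary :: 'n polynomial)"
 shows "(\<Sum>K\<in>(UNIV :: 'n set set). cev (eqsubst wt (of_real \<tau>) Q1 (coordp (lset K))) [] *
   (\<Prod>u\<in>UNIV. of_real (2 * pi / (\<tau> * llam K u)))) =
  (\<Sum>I\<in>(nsets :: ('n + 'n) set set). cev (eqsubst wt (of_real \<tau>) Q2 (coordp I) * eqsubst wt (of_real \<tau>) Qr (coordp I)) [] *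
   (\<Prod>a\<in>- I. \<Prod>b\<in>I. of_real (2 * pi / (\<tau> * (wt a - wt b)))))"
proof -
 let ?G = "\<lambda>I :: ('n + 'n) set. cev (eqsubst wt (of_real \<tau>) Q2 (coordp I) * eqsubst wt (of_real \<tau>) Qr (coordp I)) [] *
   (\<Prod>a\<in>- I. \<Prod>b\<in>I. of_real (2 * pi / (\<tau> * (wt a - wt b))))"
 define y where "y a = complex_of_real \<tau> * of_real (wt a) / (2 * pi)" for a :: "'n + 'n"
 have ev: "cev (eqsubst wt (of_real \<tau>) Q (coordp (range b))) [] = peval (\<lambda>i. y (b i)) (subst_polynomial Q elementary)"
  if "inj b" for b :: "'n \<Rightarrow> 'n + 'n" and Q
  unfolding y_def by (rule eqsubst_coordp[OF that])
 have zero: "?G I = 0" if I: "I \<in> nsets - range lset" for I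
 proof -
  obtain k where k: "Inl k \<in> I" "Inr k \<in> I" using nsets_cases I by blast
  have "card (UNIV :: 'n set) = card I" using I by (simp add: nsets_def)
  \<comment> \<open>A labelling of the Chern roots by the variables of \<open>P\<close>. Opposite
    weights sit at two labels \<open>i\<close> and \<open>j\<close>, and the factor of
    \<open>rho\<close> for this pair is zero.\<close>
  then obtain b :: "'n \<Rightarrow> 'n + 'n" where b: "bij_betw b UNIV I"
   using finite_same_card_bij[of "UNIV :: 'n set" I] by auto
  then have inj: "inj b" and rb: "range b = I" by (auto simp: bij_betw_def)
  obtain i j where ij: "b i = Inl k" "b j = Inr k" using k rb by (metis rangeE)
  have "i \<noteq> j" using ij by auto
  then have "{i, j} \<in> {S. card S = 2}" by simp
  moreover have "(\<Sum>i\<in>{i, j}. y (b i)) = 0"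
   using ij by (cases "i = j") (auto simp: y_def wt_def add_divide_distrib[symmetric])
  ultimately have "peval (\<lambda>i. y (b i)) (rho :: 'n polynomial) = 0"
   unfolding peval_rho by (intro prod_zero) force+
  then have "cev (eqsubst wt (of_real \<tau>) Qr (coordp I)) [] = 0"
   using ev[OF inj, of Qr] R by (simp add: rb)
  then show ?thesis by simp
 qed
 have "(\<Sum>I\<in>nsets. ?G I) = (\<Sum>I\<in>range lset. ?G I)"
  by (rule sum.mono_neutral_right) (use lset_nsets zero in auto)
 also have "\<dots> = (\<Sum>K\<in>UNIV. ?G (lset K))"
  by (simp add: sum.reindex[OF inj_lset])
 also have "\<dots> = (\<Sum>K\<in>(UNIV :: 'n set set). cev (eqsubst wt (of_real \<tau>) Q1 (coordp (lset K))) [] *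
   (\<Prod>u\<in>UNIV. of_real (2 * pi / (\<tau> * llam K u))))"
 proof (rule sum.cong[OF refl])
  fix K :: "'n set"
  define x where "x i = y (ltau K (Inl i))" for i
  define F where "F u = complex_of_real (2 * pi / (\<tau> * llam K u))" for u
  have nz: "sg K i * freq i + sg K j * freq j \<noteq> 0" for i j
  proof -
   have f: "0 < freq i" "0 < freq j" by (rule freq(2))+
   show ?thesis
   proof (cases "i = j")
    case False
    then have "freq i \<noteq> freq j" using inj_eq[OF freq(1), of i j] by simp
    then show ?thesis unfolding sg_def using f by (simp split: if_splits)
   qed (use f in \<open>simp add: sg_def\<close>)
  qed
  have F: "F (Upair i j) * - (x i + x j) = 1" for i j
  proof -
   have "x i + x j = of_real (\<tau> * (sg K i * freq i + sg K j * freq j) / (2 * pi))"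
    by (simp add: x_def y_def wt_ltau algebra_simps add_divide_distrib)
   then have "F (Upair i j) * - (x i + x j) =
     of_real (2 * pi / (\<tau> * - (sg K i * freq i + sg K j * freq j)) * - (\<tau> * (sg K i * freq i + sg K j * freq j) / (2 * pi)))"
    unfolding F_def llam by (simp only: of_real_mult of_real_minus)
   also have "2 * pi / (\<tau> * - (sg K i * freq i + sg K j * freq j)) * - (\<tau> * (sg K i * freq i + sg K j * freq j) / (2 * pi)) = 1"
   proof -
    have "2 * pi / (\<tau> * - c) * - (\<tau> * c / (2 * pi)) = 1" if "c \<noteq> 0" for c using \<tau> that by simp
    from this[OF nz[of i j]] show ?thesis .
   qed
   finally show ?thesis by simp
  qed
  have W: "(\<Prod>a\<in>- lset K. \<Prod>b\<in>lset K. of_real (2 * pi / (\<tau> * (wt a - wt b)))) = (\<Prod>i\<in>UNIV. \<Prod>j\<in>UNIV. F (Upair i j))"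
   unfolding Compl_lset unfolding lset_range
   by (simp add: prod.reindex[OF inj_ltau(1)] prod.reindex[OF inj_ltau(2)] wt_ltau F_def llam)
  have "?G (lset K) = peval x P * (peval x rho * (\<Prod>i\<in>UNIV. \<Prod>j\<in>UNIV. F (Upair i j)))"
   unfolding W unfolding lset_range cev_mult_Nil ev[OF inj_ltau(1)] P(2)[symmetric] R[symmetric] x_def[symmetric]
   by (simp only: mult.assoc)
  also have "\<dots> = cev (eqsubst wt (of_real \<tau>) Q1 (coordp (lset K))) [] * (\<Prod>u\<in>UNIV. F u)"
   unfolding rho_times_weights[where F = F and x = x, OF F] lset_range ev[OF inj_ltau(1)] P(1)[symmetric] x_def[symmetric] ..
  finally show "?G (lset K) = cev (eqsubst wt (of_real \<tau>) Q1 (coordp (lset K))) [] * (\<Prod>u\<in>UNIV. of_real (2 * pi / (\<tau> * llam K u)))"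
   unfolding F_def .
 qed
 finally show ?thesis ..
qed

section \<open>Integrals of cohomology classes\<close>

lemma cform_add: "cform f \<Longrightarrow> cform g \<Longrightarrow> cform (\<lambda>p us. f p us + g p us)"
 by (simp add: cform_def c1_add tens_add)

lemma cform_ext_deriv:
 assumes "smooth_form \<eta>" shows "cform (ext_deriv \<eta>)"
proof -
 have "c1 (\<lambda>p. fder (\<lambda>q. \<eta> q us) p v)" for us v
  by (rule c1_smooth[OF smooth_frechet]) (use assms in \<open>simp add: smooth_form_iff\<close>)
 then show ?thesis
  unfolding cform_def ext_deriv_def[abs_def]
  using tens_ext_deriv[OF cform_smooth[OF assms], unfolded ext_deriv_def[abs_def]]
  by (auto intro!: c1_sum c1_mult c1_const)
qed

lemma wedge_wdg: "wedge \<alpha> \<beta> p = wdg (\<alpha> p) (\<beta> p)"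
 by (rule ext) (rule wedge_eq_wdg)

lemma cohomologous_refl:
 fixes X :: "'a::real_normed_vector set"
 shows "cohomologous X \<omega> \<omega>"
proof -
 have "smooth_on UNIV (\<lambda>p :: 'a. 0 :: complex)"
  by (rule smooth_on.coinduct[of "\<lambda>f. f = (\<lambda>_. 0)"]) auto
 then have "smooth_form (\<lambda>(p :: 'a) us. 0)" by (simp add: smooth_form_iff tens_zero)
 then show ?thesis unfolding cohomologous_def by (intro exI[of _ "\<lambda>p us. 0"]) (simp add: ext_deriv_def)
qed

section \<open>Independence of representatives, and cup products\<close>

context hol_atlas
begin

lemma frame_tangent: "k < m \<Longrightarrow> set (map (fder (\<phi> k) z) vs) \<subseteq> tangent_space X (\<phi> k z)"
 using D_tangent by auto

lemma intg_cohomologous: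
 assumes "admissible \<omega>" "admissible \<omega>'" "cohomologous X \<omega> \<omega>'"
 shows "intg \<omega>' = intg \<omega>"
proof -
 obtain \<eta> where \<eta>: "smooth_form \<eta>"
  "\<And>p vs. p \<in> X \<Longrightarrow> set vs \<subseteq> tangent_space X p \<Longrightarrow> \<omega>' p vs = \<omega> p vs + ext_deriv \<eta> p vs"
  using assms(3) unfolding cohomologous_def by blast
 have c: "cform \<eta>" by (rule cform_smooth[OF \<eta>(1)])
 have "intg \<omega>' = intg \<omega> + 1 * intg (ext_deriv \<eta>)"
  by (rule intg_add[OF assms(1) admissible_ext_deriv[OF c] assms(2)])
   (simp add: form_density_def \<eta>(2)[OF in_X frame_tangent])
 then show ?thesis by (simp add: stokes[OF c])
qed

text \<open>For \<alpha> = \<psi> + d\<eta>1 and \<beta> = \<rho> + d\<eta>2 the products differ by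
  d(\<eta>1 \<rho> + \<psi> \<eta>2 + \<eta>1 d\<eta>2) along \<open>X\<close>. Closedness of \<psi>
  and \<rho> is asked on vectors coming from the charts, where it is available, and evenness of
  \<psi> avoids a sign.\<close>

lemma intg_wedge_cohomologous:
 assumes sm: "smooth_form \<psi>" "smooth_form \<rho>" "smooth_form \<alpha>" "smooth_form \<beta>"
  and coh: "cohomologous X \<psi> \<alpha>" "cohomologous X \<rho> \<beta>"
  and cl: "\<And>k z vs. k < m \<Longrightarrow> set vs \<subseteq> range (fder (\<phi> k) z) \<Longrightarrow> ext_deriv \<psi> (\<phi> k z) vs = 0"
   "\<And>k z vs. k < m \<Longrightarrow> set vs \<subseteq> range (fder (\<phi> k) z) \<Longrightarrow> ext_deriv \<rho> (\<phi> k z) vs = 0"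
  and ev: "\<And>p. evenc (\<psi> p)"
 shows "intg (wedge \<alpha> \<beta>) = intg (wedge \<psi> \<rho>)"
proof -
 obtain \<eta>1 where \<eta>1: "smooth_form \<eta>1"
  "\<And>p vs. p \<in> X \<Longrightarrow> set vs \<subseteq> tangent_space X p \<Longrightarrow> \<alpha> p vs = \<psi> p vs + ext_deriv \<eta>1 p vs"
  using coh(1) unfolding cohomologous_def by blast
 obtain \<eta>2 where \<eta>2: "smooth_form \<eta>2"
  "\<And>p vs. p \<in> X \<Longrightarrow> set vs \<subseteq> tangent_space X p \<Longrightarrow> \<beta> p vs = \<rho> p vs + ext_deriv \<eta>2 p vs"
  using coh(2) unfolding cohomologous_def by blast
 note c = cform_smooth[OF sm(1)] cform_smooth[OF sm(2)] cform_smooth[OF \<eta>1(1)] cform_smooth[OF \<eta>2(1)] cform_ext_deriv[OF \<eta>2(1)]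
 note f = cform_fdiff[OF c(1)] cform_fdiff[OF c(2)] cform_fdiff[OF c(3)] cform_fdiff[OF c(4)] cform_fdiff[OF c(5)]
 define z1 where "z1 p = wdg (\<eta>1 p) (\<rho> p)" for p
 define z2 where "z2 p = wdg (\<psi> p) (\<eta>2 p)" for p
 define z3 where "z3 p = wdg (\<eta>1 p) (ext_deriv \<eta>2 p)" for p
 have cz: "cform z1" "cform z2" "cform z3" unfolding z1_def[abs_def] z2_def[abs_def] z3_def[abs_def] by (intro cform_wdg c)+
 define \<zeta> where "\<zeta> p us = (z1 p us + z2 p us) + z3 p us" for p us
 have c\<zeta>: "cform \<zeta>" unfolding \<zeta>_def[abs_def] by (intro cform_add cz)
 have adm: "admissible (wedge \<alpha> \<beta>)" "admissible (wedge \<psi> \<rho>)"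
  unfolding wedge_wdg[abs_def] by (intro admissible_wdg admissible_cform cform_smooth sm)+
 have "intg (wedge \<alpha> \<beta>) = intg (wedge \<psi> \<rho>) + 1 * intg (ext_deriv \<zeta>)"
 proof (rule intg_add[OF adm(2) admissible_ext_deriv[OF c\<zeta>] adm(1)])
  fix k :: nat and z :: "complex ^ 'd" assume k: "k < m"
  let ?D = "fder (\<phi> k) z" and ?p = "\<phi> k z"
  let ?vs = "map ?D real_frame"
  have t: "set us \<subseteq> tangent_space X ?p" "set us \<subseteq> range ?D" if "set us \<subseteq> set ?vs" for us
   using that D_tangent[OF k] by auto
  have 1: "ext_deriv z1 ?p ?vs = wdg (ext_deriv \<eta>1 ?p) (\<rho> ?p) ?vs"
  proof -
   have "wdg (bar (\<eta>1 ?p)) (ext_deriv \<rho> ?p) ?vs = wdg (bar (\<eta>1 ?p)) (\<lambda>_. 0) ?vs"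
    by (rule wdg_cong) (use cl(2)[OF k] t in auto)
   then show ?thesis unfolding z1_def[abs_def] ext_deriv_wdg[OF f(3,2)] by simp
  qed
  have 2: "ext_deriv z2 ?p ?vs = wdg (\<psi> ?p) (ext_deriv \<eta>2 ?p) ?vs"
  proof -
   have "wdg (ext_deriv \<psi> ?p) (\<eta>2 ?p) ?vs = wdg (\<lambda>_. 0) (\<eta>2 ?p) ?vs"
    by (rule wdg_cong) (use cl(1)[OF k] t in auto)
   then show ?thesis unfolding z2_def[abs_def] ext_deriv_wdg[OF f(1,4)] by (simp add: bar_even[OF ev])
  qed
  have 3: "ext_deriv z3 ?p ?vs = wdg (ext_deriv \<eta>1 ?p) (ext_deriv \<eta>2 ?p) ?vs"
   unfolding z3_def[abs_def] ext_deriv_wdg[OF f(3,5)] by (simp add: ext_deriv_ext_deriv[OF \<eta>2(1), abs_def])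
  have "ext_deriv \<zeta> ?p ?vs = ext_deriv z1 ?p ?vs + ext_deriv z2 ?p ?vs + ext_deriv z3 ?p ?vs"
   unfolding \<zeta>_def[abs_def]
   by (simp add: ext_deriv_add[OF fdiff_add[OF cform_fdiff[OF cz(1)] cform_fdiff[OF cz(2)]] cform_fdiff[OF cz(3)]]
     ext_deriv_add[OF cform_fdiff[OF cz(1)] cform_fdiff[OF cz(2)]])
  moreover have "wdg (\<alpha> ?p) (\<beta> ?p) ?vs = wdg (\<lambda>us. \<psi> ?p us + ext_deriv \<eta>1 ?p us) (\<lambda>us. \<rho> ?p us + ext_deriv \<eta>2 ?p us) ?vs"
   by (rule wdg_cong) (use \<eta>1(2)[OF in_X[OF k]] \<eta>2(2)[OF in_X[OF k]] t in auto)
  ultimately show "form_density (wedge \<alpha> \<beta>) (\<phi> k) z = form_density (wedge \<psi> \<rho>) (\<phi> k) z + 1 * form_density (ext_deriv \<zeta>) (\<phi> k) z"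
   by (simp add: form_density_def wedge_wdg 1 2 3 wdg_add_left wdg_add_right)
 qed
 then show ?thesis by (simp add: stokes[OF c\<zeta>])
qed

text \<open>A representative is required for uniqueness: for an empty class every number would
  satisfy the defining condition.\<close>

lemma class_integral_eqI:
 assumes "\<omega> \<in> C" "\<And>\<omega>. \<omega> \<in> C \<Longrightarrow> smooth_form \<omega> \<and> intg \<omega> = I"
 shows "class_integral TYPE('d) X C = I"
proof -
 have adm: "admissible \<omega>" if "\<omega> \<in> C" for \<omega> using assms(2)[OF that] by (intro admissible_cform cform_smooth) simp
 show ?thesis
  unfolding class_integral_def
 proof (rule the_equality)
  show "\<forall>\<omega>\<in>C. has_form_integral TYPE('d) X \<omega> I"
   using intg_unique[OF adm] assms(2) by auto
  show "J = I" if "\<forall>\<omega>\<in>C. has_form_integral TYPE('d) X \<omega> J" for J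
   using that assms(1) intg_unique[OF adm[OF assms(1)]] assms(2)[OF assms(1)] by auto
 qed
qed

lemma class_integral_coh_class:
 assumes "smooth_form \<omega>" shows "class_integral TYPE('d) X (coh_class X \<omega>) = intg \<omega>"
proof (rule class_integral_eqI)
 show "\<omega> \<in> coh_class X \<omega>" using assms by (simp add: coh_class_def cohomologous_refl)
 show "smooth_form \<omega>' \<and> intg \<omega>' = intg \<omega>" if "\<omega>' \<in> coh_class X \<omega>" for \<omega>'
  using that intg_cohomologous[of \<omega> \<omega>'] assms
  by (auto simp: coh_class_def intro: admissible_cform cform_smooth)
qed

end

context torus_atlas
begin

lemma closed_chart:
 assumes F: "eqclosed w 0 F" and k: "k < m" and vs: "set vs \<subseteq> range (D k z)"
 shows "ext_deriv (\<lambda>p. cev (F p)) (\<phi> k z) vs = 0"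
proof -
 have "set vs \<subseteq> tang (\<phi> k z)" using vs D_tang[OF k] by blast
 moreover have "eqD w 0 F (\<phi> k z) = 0" using F proj[OF in_X[OF k]] by (simp add: eqclosed_def)
 ultimately show ?thesis using cev_eqD[of vs "\<phi> k z" w 0 F] by simp
qed

lemma class_integral_cup:
 assumes F: "eqclosed w 0 F" and G: "eqclosed w 0 G"
 shows "class_integral TYPE('d) X (cup X (coh_class X (\<lambda>p. cev (F p))) (coh_class X (\<lambda>p. cev (G p)))) =
  intg (\<lambda>p. cev (F p * G p))"
proof -
 let ?f = "\<lambda>p. cev (F p)" and ?g = "\<lambda>p. cev (G p)"
 have n: "nicef F" "nicef G" using F G by (simp_all add: eqclosed_def)
 have sm: "smooth_form ?f" "smooth_form ?g" by (intro nicef_smooth_form n)+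
 have w: "wedge ?f ?g = (\<lambda>p. cev (F p * G p))"
  by (rule ext) (simp add: wedge_wdg cev_mult_even nicef_evn[OF n(1)])
 have smw: "smooth_form (wedge ?f ?g)" unfolding w by (intro nicef_smooth_form nicef_mult n)
 show ?thesis
 proof (rule class_integral_eqI)
  show "wedge ?f ?g \<in> cup X (coh_class X ?f) (coh_class X ?g)"
   unfolding cup_def coh_class_def using sm smw cohomologous_refl by blast
  fix \<omega> assume "\<omega> \<in> cup X (coh_class X ?f) (coh_class X ?g)"
  then obtain \<alpha> \<beta> where \<omega>: "smooth_form \<omega>" "smooth_form \<alpha>" "cohomologous X ?f \<alpha>" "smooth_form \<beta>" "cohomologous X ?g \<beta>"
   "cohomologous X (wedge \<alpha> \<beta>) \<omega>"
   unfolding cup_def coh_class_def by blast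
  have "admissible (wedge \<alpha> \<beta>)"
   unfolding wedge_wdg[abs_def] by (intro admissible_wdg admissible_cform cform_smooth \<omega>)
  then have "intg \<omega> = intg (wedge \<alpha> \<beta>)"
   by (rule intg_cohomologous[OF _ admissible_cform[OF cform_smooth[OF \<omega>(1)]] \<omega>(6)])
  also have "\<dots> = intg (wedge ?f ?g)"
   by (rule intg_wedge_cohomologous[OF sm \<omega>(2,4,3,5)]) (auto intro: closed_chart F G nicef_evn[OF n(1)])
  finally show "smooth_form \<omega> \<and> intg \<omega> = intg (\<lambda>p. cev (F p * G p))" using \<omega>(1) w by simp
 qed
qed

end

text \<open>The fixed point sums have \<tau> in denominators, so equality is proved for \<tau> = 1,
  1/2, 1/3, ... and passes to \<tau> = 0 through the continuity of both integrals.\<close>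

lemma lg_gr_integrals:
 fixes P :: "'n::finite polynomial"
 assumes P: "P = subst_polynomial Q1 elementary" "P = subst_polynomial Q2 elementary"
  and R: "rho = (subst_polynomial Qr elementary :: 'n polynomial)"
 shows "lg.intg (\<lambda>p :: ('n + 'n) cmatrix. cev (eqsubst wt 0 Q1 p)) =
  gr.intg (\<lambda>p :: ('n + 'n) cmatrix. cev (eqsubst wt 0 Q2 p * eqsubst wt 0 Qr p))"
proof -
 have a: "algf (\<lambda>x :: real \<times> ('n + 'n) cmatrix. of_real (fst x))"
  by (rule algf_linear) (auto simp: linear_iff scaleR_conv_of_real[where 'a = complex])
 have l: "linear (snd :: real \<times> ('n + 'n) cmatrix \<Rightarrow> _)" by (rule linear_snd)
 have n: "nicef (\<lambda>x :: real \<times> ('n + 'n) cmatrix. eqsubst wt (of_real (fst x)) Q (snd x))" for Q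
  by (rule nicef_eqsubst_param[OF a l])
 have L: "(\<lambda>n. lg.intg (\<lambda>p :: ('n + 'n) cmatrix. cev (eqsubst wt (of_real (1 / real (Suc n))) Q1 p))) \<longlonglongrightarrow>
   lg.intg (\<lambda>p :: ('n + 'n) cmatrix. cev (eqsubst wt 0 Q1 p))"
  using lg.intg_continuous[OF n[of Q1]] by (simp only: fst_conv snd_conv of_real_0)
 have G: "(\<lambda>n. gr.intg (\<lambda>p :: ('n + 'n) cmatrix. cev (eqsubst wt (of_real (1 / real (Suc n))) Q2 p * eqsubst wt (of_real (1 / real (Suc n))) Qr p))) \<longlonglongrightarrow>
   gr.intg (\<lambda>p :: ('n + 'n) cmatrix. cev (eqsubst wt 0 Q2 p * eqsubst wt 0 Qr p))"
  using gr.intg_continuous[OF nicef_mult[OF n[of Q2] n[of Qr]]] by (simp only: fst_conv snd_conv of_real_0)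
 have "lg.intg (\<lambda>p :: ('n + 'n) cmatrix. cev (eqsubst wt (of_real \<tau>) Q1 p)) =
   gr.intg (\<lambda>p :: ('n + 'n) cmatrix. cev (eqsubst wt (of_real \<tau>) Q2 p * eqsubst wt (of_real \<tau>) Qr p))" if "0 < \<tau>" for \<tau>
  unfolding lg_localisation[OF eqclosed_eqsubst that] gr_localisation[OF eqclosed_mult[OF eqclosed_eqsubst eqclosed_eqsubst] that]
  by (rule fixed_point_sums[OF that P R])
 note eq = this
 have e: "(\<lambda>n. lg.intg (\<lambda>p :: ('n + 'n) cmatrix. cev (eqsubst wt (of_real (1 / real (Suc n))) Q1 p))) =
   (\<lambda>n. gr.intg (\<lambda>p :: ('n + 'n) cmatrix. cev (eqsubst wt (of_real (1 / real (Suc n))) Q2 p * eqsubst wt (of_real (1 / real (Suc n))) Qr p)))"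
  by (rule ext, rule eq) simp
 show ?thesis by (rule LIMSEQ_unique[OF L[unfolded e] G])
qed

theorem proposition1:
 fixes P :: "('n::finite) polynomial"
  and \<Phi> \<Psi> \<sigma> :: "('n + 'n) cmatrix form set"
  and F :: "nat \<Rightarrow> (complex ^ ('n + 'n)) set"
 assumes "symmetric_polynomial P"
  and "degree_le (CARD('n) * (CARD('n) + 1) div 2) P"
  and "represented_by lagrangian_grassmannian P \<Phi>"
  and "represented_by grassmannian P \<Psi>"
  and "complete_flag F"
  and "schubert_class TYPE('n uprod) F (staircase CARD('n)) \<sigma>"
  and "represented_by grassmannian
      ((-1) ^ (CARD('n) * (CARD('n) - 1) div 2) * (\<Prod>I | card I = 2. \<Sum>i\<in>I. var i)) \<sigma>"
 shows "class_integral TYPE('n uprod) lagrangian_grassmannian \<Phi> =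
     class_integral TYPE('n \<times> 'n) grassmannian (cup grassmannian \<Psi> \<sigma>)"
proof -
 let ?f = "\<lambda>Q p :: ('n + 'n) cmatrix. cev (eqsubst wt 0 Q p)"
 have c: "subst_form Q chern_form = ?f Q" for Q by (rule ext) (rule subst_form_chern)
 obtain Q1 where Q1: "P = subst_polynomial Q1 elementary" "\<Phi> = coh_class lagrangian_grassmannian (?f Q1)"
  using assms(3) unfolding represented_by_def c by blast
 obtain Q2 where Q2: "P = subst_polynomial Q2 elementary" "\<Psi> = coh_class grassmannian (?f Q2)"
  using assms(4) unfolding represented_by_def c by blast
 obtain Qr where Qr: "rho = (subst_polynomial Qr elementary :: 'n polynomial)" "\<sigma> = coh_class grassmannian (?f Qr)"
  using assms(7) unfolding represented_by_def c rho_def by blast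
 have "class_integral TYPE('n uprod) lagrangian_grassmannian \<Phi> = lg.intg (?f Q1)"
  unfolding Q1(2) by (rule lg.class_integral_coh_class[OF nicef_smooth_form[OF nicef_eqsubst]])
 also have "\<dots> = gr.intg (\<lambda>p :: ('n + 'n) cmatrix. cev (eqsubst wt 0 Q2 p * eqsubst wt 0 Qr p))"
  by (rule lg_gr_integrals[OF Q1(1) Q2(1) Qr(1)])
 also have "\<dots> = class_integral TYPE('n \<times> 'n) grassmannian (cup grassmannian \<Psi> \<sigma>)"
  unfolding Q2(2) Qr(2) by (rule gr.class_integral_cup[OF eqclosed_eqsubst eqclosed_eqsubst, symmetric])
 finally show ?thesis .
qed

end
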